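(* Let $(G',\mathfrak{X}')$ be a Shimura datum with a choice of PEL-datum $(B',*',V',\langle\ ,\ \rangle',h')$ for which $B'_{\mathbb{R}}$ only has factors of symplectic type. Then for any Shimura datum $(G,h)$ with a choice of PEL-datum, any morphism of Shimura data $f\colon(G',h')\to(G,h)$ is admissible.
   Context: **PEL-data.** A PEL-datum is a tuple $(B,*,V,\langle\ ,\ \rangle,h)$: $B$ a semisimple $\mathbb{Q}$-algebra with positive anti-involution $*$ ($\mathrm{tr}_{B_{\mathbb{R}}/\mathbb{R}}(bb^* )>0$ for $0\ne b\in B_{\mathbb{R}}$), $V$ a finite-dimensional $B$-module with a non-degenerate alternating $\mathbb{Q}$-valued pairing satisfying $\langle bu,v\rangle=\langle u,b^*v\rangle$, and $h\colon\mathbb{C}\to\mathrm{End}_{B_{\mathbb{R}}}(V_{\mathbb{R}})$ an $\mathbb{R}$-algebra homomorphism with $\langle h(z)u,v\rangle=\langle u,h(\bar z)v\rangle$ and $\langle u,h(i)u\rangle$ positive definite on $V_{\mathbb{R}}$. Its group $G$ over $\mathbb{Q}$ has $G(R)=\{g\in\mathrm{Aut}_{B_R}(V_R)\mid\exists\mu(g)\in R^\times:\langle gu,gv\rangle=\mu(g)\langle u,v\rangle\ \forall u,v\in V_R\}$, and $h$ induces $h\colon\mathbb{S}=\mathrm{Res}_{\mathbb{C}/\mathbb{R}}\mathbb{G}_m\to G_{\mathbb{R}}$. A Shimura datum $(G,h)$ (equivalently $(G,\mathfrak{X})$ with $\mathfrak{X}$ the conjugacy class of $h$) arising in this way is of PEL-type,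 the tuple is a PEL-datum for it, and $V\in\mathrm{Rep}(G)$ is its standard representation. Following Kottwitz, $G$ need not be connected. **Symplectic type.** $(B_{\mathbb{R}},* )$ only has factors of symplectic type if it is a product of factors isomorphic to $(\mathrm{M}_n(\mathbb{R}),A\mapsto A^t)$ for varying $n$. **Admissibility.** Let $f\colon(G',h')\to(G,h)$ be a morphism of PEL-type Shimura data (a homomorphism $G'\to G$ over $\mathbb{Q}$ carrying the conjugacy class of $h'$ into that of $h$), each with a chosen PEL-datum, with standard representations $V',V$. $f$ is admissible if $f^*V\cong e\cdot V'^{\oplus n}$ as $G'$-representations for some $n\in\mathbb{N}$ and some idempotent $e\in\mathrm{End}_{\mathrm{Rep}(G')}(V'^{\oplus n})$. *)

theory Defs
  imports
    "HOL-Algebra.Algebraic_Closure_Type"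
    "Jordan_Normal_Form.Matrix"
begin

section \<open>Algebras over the rationals and extension of scalars\<close>

abbreviation rat_ring :: "rat ring"
  where "rat_ring \<equiv> ring_of_type_algebra"

abbreviation real_ring :: "real ring"
  where "real_ring \<equiv> ring_of_type_algebra"

definition rat_algebra :: "'u ring \<Rightarrow> bool"
  where "rat_algebra R \<longleftrightarrow> cring R \<and> (\<exists>\<iota>. \<iota> \<in> Ring.ring_hom rat_ring R)"

text \<open>The structure map of a \<open>\<rat>\<close>-algebra is uniquely determined by the ring.\<close>

definition of_rat_alg :: "'u ring \<Rightarrow> rat \<Rightarrow> 'u"
  where "of_rat_alg R = (THE \<iota>. \<iota> \<in> Ring.ring_hom rat_ring R)"

definition real_algebra :: "'u ring \<Rightarrow> (real \<Rightarrow> 'u) \<Rightarrow> bool"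
  where "real_algebra A \<phi> \<longleftrightarrow> cring A \<and> \<phi> \<in> Ring.ring_hom real_ring A"

text \<open>
  A finite-dimensional \<open>\<rat>\<close>-vector space \<open>W\<close> comes with a basis \<open>I\<close>, and \<open>W \<otimes> R\<close> is taken to be
  the free \<open>R\<close>-module of functions \<open>I \<rightarrow> R\<close>. An \<open>R\<close>-linear map from the free module on \<open>J\<close> to the
  free module on \<open>I\<close> is identified with its matrix, with entry \<open>(i, j)\<close> in row \<open>i\<close> and column \<open>j\<close>.
  Vectors and matrices are extensional, so that each is represented exactly once.
\<close>

definition vecs :: "'u ring \<Rightarrow> 'i set \<Rightarrow> ('i \<Rightarrow> 'u) set"
  where "vecs R I = (I \<rightarrow>\<^sub>E carrier R)"

definition mats :: "'u ring \<Rightarrow> 'i set \<Rightarrow> 'j set \<Rightarrow> ('i \<times> 'j \<Rightarrow> 'u) set"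
  where "mats R I J = (I \<times> J \<rightarrow>\<^sub>E carrier R)"

definition mmul :: "'u ring \<Rightarrow> 'i set \<Rightarrow> 'j set \<Rightarrow> 'k set \<Rightarrow>
    ('i \<times> 'j \<Rightarrow> 'u) \<Rightarrow> ('j \<times> 'k \<Rightarrow> 'u) \<Rightarrow> ('i \<times> 'k \<Rightarrow> 'u)"
  where "mmul R I J K M N = (\<lambda>(i, k) \<in> I \<times> K. finsum R (\<lambda>j. M (i, j) \<otimes>\<^bsub>R\<^esub> N (j, k)) J)"

definition mone :: "'u ring \<Rightarrow> 'i set \<Rightarrow> ('i \<times> 'i \<Rightarrow> 'u)"
  where "mone R I = (\<lambda>(i, j) \<in> I \<times> I. if i = j then \<one>\<^bsub>R\<^esub> else \<zero>\<^bsub>R\<^esub>)"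

definition mapply :: "'u ring \<Rightarrow> 'i set \<Rightarrow> 'j set \<Rightarrow> ('i \<times> 'j \<Rightarrow> 'u) \<Rightarrow> ('j \<Rightarrow> 'u) \<Rightarrow> ('i \<Rightarrow> 'u)"
  where "mapply R I J M v = (\<lambda>i \<in> I. finsum R (\<lambda>j. M (i, j) \<otimes>\<^bsub>R\<^esub> v j) J)"

definition mbase :: "'i set \<Rightarrow> 'j set \<Rightarrow> ('u \<Rightarrow> 'w) \<Rightarrow> ('i \<times> 'j \<Rightarrow> 'u) \<Rightarrow> ('i \<times> 'j \<Rightarrow> 'w)"
  where "mbase I J \<phi> M = (\<lambda>p \<in> I \<times> J. \<phi> (M p))"

section \<open>PEL-data\<close>

text \<open>
  The unit of \<open>B\<close> is a separate component, and \<open>'b\<close> is only of class \<open>ring\<close>, so that the zero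
  algebra is not excluded. \<open>hh z\<close> is the matrix of \<open>h(z)\<close> on \<open>V \<otimes> \<real>\<close>.
\<close>

record ('b, 'v) pel =
  scaleB :: "rat \<Rightarrow> 'b \<Rightarrow> 'b"
  basisB :: "'b set"
  oneB :: "'b"
  star :: "'b \<Rightarrow> 'b"
  scaleV :: "rat \<Rightarrow> 'v \<Rightarrow> 'v"
  basisV :: "'v set"
  act :: "'b \<Rightarrow> 'v \<Rightarrow> 'v"
  pairing :: "'v \<Rightarrow> 'v \<Rightarrow> rat"
  hh :: "complex \<Rightarrow> 'v \<times> 'v \<Rightarrow> real"

definition coordB :: "('b::ring, 'v) pel \<Rightarrow> 'b \<Rightarrow> 'b \<Rightarrow> rat"
  where "coordB D = Modules.module.representation (scaleB D) (basisB D)"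

definition coordV :: "('b, 'v::ab_group_add) pel \<Rightarrow> 'v \<Rightarrow> 'v \<Rightarrow> rat"
  where "coordV D = Modules.module.representation (scaleV D) (basisV D)"

text \<open>The algebra \<open>B\<^sub>R = B \<otimes> R\<close> with carrier \<open>vecs R (basisB D)\<close>, and its action on \<open>V\<^sub>R\<close>.\<close>

definition BR_mult :: "'u ring \<Rightarrow> ('b::ring, 'v) pel \<Rightarrow> ('b \<Rightarrow> 'u) \<Rightarrow> ('b \<Rightarrow> 'u) \<Rightarrow> ('b \<Rightarrow> 'u)"
  where "BR_mult R D x y = (\<lambda>k \<in> basisB D.
    finsum R (\<lambda>(i, j). x i \<otimes>\<^bsub>R\<^esub> y j \<otimes>\<^bsub>R\<^esub> of_rat_alg R (coordB D (i * j) k)) (basisB D \<times> basisB D))"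

definition BR_one :: "'u ring \<Rightarrow> ('b::ring, 'v) pel \<Rightarrow> ('b \<Rightarrow> 'u)"
  where "BR_one R D = (\<lambda>k \<in> basisB D. of_rat_alg R (coordB D (oneB D) k))"

definition BR_star :: "'u ring \<Rightarrow> ('b::ring, 'v) pel \<Rightarrow> ('b \<Rightarrow> 'u) \<Rightarrow> ('b \<Rightarrow> 'u)"
  where "BR_star R D x = (\<lambda>k \<in> basisB D.
    finsum R (\<lambda>i. x i \<otimes>\<^bsub>R\<^esub> of_rat_alg R (coordB D (star D i) k)) (basisB D))"

definition BR_act :: "'u ring \<Rightarrow> ('b::ring, 'v::ab_group_add) pel \<Rightarrow> ('b \<Rightarrow> 'u) \<Rightarrow> ('v \<times> 'v \<Rightarrow> 'u)"
  where "BR_act R D x = (\<lambda>(i, j) \<in> basisV D \<times> basisV D.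
    finsum R (\<lambda>k. x k \<otimes>\<^bsub>R\<^esub> of_rat_alg R (coordV D (act D k j) i)) (basisB D))"

text \<open>Trace of left multiplication by \<open>x\<close> on \<open>B\<^sub>R\<close>.\<close>

definition BR_trace :: "'u ring \<Rightarrow> ('b::ring, 'v) pel \<Rightarrow> ('b \<Rightarrow> 'u) \<Rightarrow> 'u"
  where "BR_trace R D x = finsum R
    (\<lambda>k. BR_mult R D x (\<lambda>i \<in> basisB D. if i = k then \<one>\<^bsub>R\<^esub> else \<zero>\<^bsub>R\<^esub>) k) (basisB D)"

definition VR_pairing :: "'u ring \<Rightarrow> ('b, 'v) pel \<Rightarrow> ('v \<Rightarrow> 'u) \<Rightarrow> ('v \<Rightarrow> 'u) \<Rightarrow> 'u"
  where "VR_pairing R D u v = finsum R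
    (\<lambda>(i, j). u i \<otimes>\<^bsub>R\<^esub> v j \<otimes>\<^bsub>R\<^esub> of_rat_alg R (pairing D i j)) (basisV D \<times> basisV D)"

definition BR_End :: "'u ring \<Rightarrow> ('b::ring, 'v::ab_group_add) pel \<Rightarrow> ('v \<times> 'v \<Rightarrow> 'u) set"
  where "BR_End R D = {g \<in> mats R (basisV D) (basisV D). \<forall>x \<in> vecs R (basisB D).
    mmul R (basisV D) (basisV D) (basisV D) g (BR_act R D x) =
    mmul R (basisV D) (basisV D) (basisV D) (BR_act R D x) g}"

definition left_ideal :: "'b::ring set \<Rightarrow> bool"
  where "left_ideal L \<longleftrightarrow> 0 \<in> L \<and> (\<forall>x \<in> L. \<forall>y \<in> L. x - y \<in> L) \<and> (\<forall>b. \<forall>x \<in> L. b * x \<in> L)"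

text \<open>Semisimplicity of the regular left module: every submodule is a direct summand.\<close>

definition semisimple_ring :: "'b::ring itself \<Rightarrow> bool"
  where "semisimple_ring _ \<longleftrightarrow> (\<forall>L :: 'b set. left_ideal L \<longrightarrow>
    (\<exists>L'. left_ideal L' \<and> L \<inter> L' = {0} \<and> (\<forall>b. \<exists>x \<in> L. \<exists>y \<in> L'. b = x + y)))"

locale PEL_datum =
  fixes D :: "('b::ring, 'v::ab_group_add) pel"
  assumes B_fin_dim: "finite_dimensional_vector_space (scaleB D) (basisB D)"
    and B_algebra: "scaleB D q (a * b) = scaleB D q a * b" "scaleB D q (a * b) = a * scaleB D q b"
    and B_unit: "oneB D * a = a" "a * oneB D = a"
    and B_semisimple: "semisimple_ring TYPE('b)"
    and star_linear: "Vector_Spaces.linear (scaleB D) (scaleB D) (star D)"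
    and star_mult: "star D (a * b) = star D b * star D a"
    and star_star: "star D (star D a) = a"
    and star_positive: "\<And>x. x \<in> vecs real_ring (basisB D) \<Longrightarrow> x \<noteq> (\<lambda>k \<in> basisB D. 0) \<Longrightarrow>
      BR_trace real_ring D (BR_mult real_ring D x (BR_star real_ring D x)) > 0"
    and V_fin_dim: "finite_dimensional_vector_space (scaleV D) (basisV D)"
    and act_linear: "Vector_Spaces.linear (scaleV D) (scaleV D) (act D a)"
      "Vector_Spaces.linear (scaleB D) (scaleV D) (\<lambda>a. act D a v)"
    and act_mult: "act D (a * b) v = act D a (act D b v)"
    and act_unit: "act D (oneB D) v = v"
    and pairing_linear: "Vector_Spaces.linear (scaleV D) (*) (\<lambda>u. pairing D u v)"
      "Vector_Spaces.linear (scaleV D) (*) (\<lambda>v. pairing D u v)"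
    and pairing_alternating: "pairing D u u = 0"
    and pairing_nondegenerate: "(\<And>v. pairing D u v = 0) \<Longrightarrow> u = 0"
    and pairing_star: "pairing D (act D b u) v = pairing D u (act D (star D b) v)"
    and h_End: "hh D z \<in> BR_End real_ring D"
    and h_add: "hh D (z + w) = (\<lambda>p \<in> basisV D \<times> basisV D. hh D z p + hh D w p)"
    and h_scale: "hh D (complex_of_real r * z) = (\<lambda>p \<in> basisV D \<times> basisV D. r * hh D z p)"
    and h_mult: "hh D (z * w) =
      mmul real_ring (basisV D) (basisV D) (basisV D) (hh D z) (hh D w)"
    and h_unit: "hh D 1 = mone real_ring (basisV D)"
    and h_adjoint: "\<And>z x y. x \<in> vecs real_ring (basisV D) \<Longrightarrow> y \<in> vecs real_ring (basisV D) \<Longrightarrow>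
      VR_pairing real_ring D (mapply real_ring (basisV D) (basisV D) (hh D z) x) y =
      VR_pairing real_ring D x (mapply real_ring (basisV D) (basisV D) (hh D (cnj z)) y)"
    and h_positive: "\<And>x. x \<in> vecs real_ring (basisV D) \<Longrightarrow> x \<noteq> (\<lambda>i \<in> basisV D. 0) \<Longrightarrow>
      VR_pairing real_ring D x (mapply real_ring (basisV D) (basisV D) (hh D \<i>) x) > 0"

text \<open>
  \<open>B\<^sub>\<real>\<close> is isomorphic, as an \<open>\<real>\<close>-algebra with involution, to the product over \<open>t < r\<close> of the
  algebras of \<open>n t \<times> n t\<close> matrices with transposition. \<open>\<Phi> t\<close> is the component of the
  isomorphism at the factor \<open>t\<close>.
\<close>

definition symplectic_type :: "('b::ring, 'v) pel \<Rightarrow> bool"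
  where "symplectic_type D \<longleftrightarrow>
    (\<exists>(r::nat) (n :: nat \<Rightarrow> nat) (\<Phi> :: nat \<Rightarrow> ('b \<Rightarrow> real) \<Rightarrow> real mat).
      (\<forall>t < r. n t > 0) \<and>
      bij_betw (\<lambda>x. \<lambda>t \<in> {..<r}. \<Phi> t x) (vecs real_ring (basisB D))
        (\<Pi>\<^sub>E t \<in> {..<r}. carrier_mat (n t) (n t)) \<and>
      (\<forall>t < r. \<forall>x \<in> vecs real_ring (basisB D). \<forall>y \<in> vecs real_ring (basisB D).
        \<Phi> t (\<lambda>k \<in> basisB D. x k + y k) = \<Phi> t x + \<Phi> t y \<and>
        (\<forall>c. \<Phi> t (\<lambda>k \<in> basisB D. c * x k) = c \<cdot>\<^sub>m \<Phi> t x) \<and>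
        \<Phi> t (BR_mult real_ring D x y) = \<Phi> t x * \<Phi> t y \<and>
        \<Phi> t (BR_star real_ring D x) = transpose_mat (\<Phi> t x)) \<and>
      (\<forall>t < r. \<Phi> t (BR_one real_ring D) = 1\<^sub>m (n t)))"

section \<open>The group of a PEL-datum and morphisms of Shimura data\<close>

definition PEL_group :: "('b::ring, 'v::ab_group_add) pel \<Rightarrow> 'u ring \<Rightarrow> ('v \<times> 'v \<Rightarrow> 'u) monoid"
  where "PEL_group D R = \<lparr>
    carrier = {g \<in> BR_End R D.
      (\<exists>g' \<in> mats R (basisV D) (basisV D).
        mmul R (basisV D) (basisV D) (basisV D) g g' = mone R (basisV D) \<and>
        mmul R (basisV D) (basisV D) (basisV D) g' g = mone R (basisV D)) \<and>
      (\<exists>\<mu> \<in> Units R. \<forall>u \<in> vecs R (basisV D). \<forall>v \<in> vecs R (basisV D).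
        VR_pairing R D (mapply R (basisV D) (basisV D) g u) (mapply R (basisV D) (basisV D) g v) =
        \<mu> \<otimes>\<^bsub>R\<^esub> VR_pairing R D u v)},
    monoid.mult = mmul R (basisV D) (basisV D) (basisV D),
    one = mone R (basisV D) \<rparr>"

text \<open>
  A homomorphism over \<open>\<rat>\<close> of group schemes is a natural transformation of group functors on
  commutative \<open>\<rat>\<close>-algebras. The test algebras are those whose carrier consists of elements of the
  type \<open>complex\<close>, with arbitrary ring operations; only the cardinality of this type
  matters. Every finitely generated algebra over \<open>\<rat>\<close> or \<open>\<real>\<close> is isomorphic to such a ring, hence so
  are the coordinate rings of the groups \<open>PEL_group D\<close>, and by Yoneda's lemma no homomorphisms
  are gained or lost by the restriction to these test algebras.
\<close>

definition group_scheme_hom :: "('b1::ring, 'v1::ab_group_add) pel \<Rightarrow>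
    ('b2::ring, 'v2::ab_group_add) pel \<Rightarrow>
    (complex ring \<Rightarrow> ('v1 \<times> 'v1 \<Rightarrow> complex) \<Rightarrow> ('v2 \<times> 'v2 \<Rightarrow> complex)) \<Rightarrow> bool"
  where "group_scheme_hom D' D f \<longleftrightarrow>
    (\<forall>R. rat_algebra R \<longrightarrow> f R \<in> hom (PEL_group D' R) (PEL_group D R)) \<and>
    (\<forall>R S. \<forall>\<phi> \<in> Ring.ring_hom R S. rat_algebra R \<longrightarrow> rat_algebra S \<longrightarrow>
      (\<forall>g \<in> carrier (PEL_group D' R).
        f S (mbase (basisV D') (basisV D') \<phi> g) = mbase (basisV D) (basisV D) \<phi> (f R g)))"

text \<open>
  The points \<open>(A \<otimes>\<^sub>\<real> \<complex>)\<^sup>\<times>\<close> of the Deligne torus, \<open>(a, b)\<close> standing for \<open>a \<otimes> 1 + b \<otimes> \<i>\<close>.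
\<close>

definition deligne_torus :: "'u ring \<Rightarrow> ('u \<times> 'u) set"
  where "deligne_torus A = {(a, b). a \<in> carrier A \<and> b \<in> carrier A \<and>
    (\<exists>c \<in> carrier A. \<exists>d \<in> carrier A.
      a \<otimes>\<^bsub>A\<^esub> c \<ominus>\<^bsub>A\<^esub> b \<otimes>\<^bsub>A\<^esub> d = \<one>\<^bsub>A\<^esub> \<and> a \<otimes>\<^bsub>A\<^esub> d \<oplus>\<^bsub>A\<^esub> b \<otimes>\<^bsub>A\<^esub> c = \<zero>\<^bsub>A\<^esub>)}"

definition h_point :: "('b, 'v) pel \<Rightarrow> 'u ring \<Rightarrow> (real \<Rightarrow> 'u) \<Rightarrow> 'u \<times> 'u \<Rightarrow> ('v \<times> 'v \<Rightarrow> 'u)"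
  where "h_point D A \<phi> = (\<lambda>(a, b). \<lambda>p \<in> basisV D \<times> basisV D.
    a \<otimes>\<^bsub>A\<^esub> \<phi> (hh D 1 p) \<oplus>\<^bsub>A\<^esub> b \<otimes>\<^bsub>A\<^esub> \<phi> (hh D \<i> p))"

text \<open>The conjugate of \<open>h\<close> by \<open>g \<in> G(\<real>)\<close>, on points over an \<open>\<real>\<close>-algebra \<open>A\<close>.\<close>

definition h_conj :: "('b::ring, 'v::ab_group_add) pel \<Rightarrow> ('v \<times> 'v \<Rightarrow> real) \<Rightarrow>
    'u ring \<Rightarrow> (real \<Rightarrow> 'u) \<Rightarrow> 'u \<times> 'u \<Rightarrow> ('v \<times> 'v \<Rightarrow> 'u)"
  where "h_conj D g A \<phi> z =
    mbase (basisV D) (basisV D) \<phi> g \<otimes>\<^bsub>PEL_group D A\<^esub> h_point D A \<phi> z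
      \<otimes>\<^bsub>PEL_group D A\<^esub> inv\<^bsub>PEL_group D A\<^esub> (mbase (basisV D) (basisV D) \<phi> g)"

definition shimura_morphism :: "('b1::ring, 'v1::ab_group_add) pel \<Rightarrow>
    ('b2::ring, 'v2::ab_group_add) pel \<Rightarrow>
    (complex ring \<Rightarrow> ('v1 \<times> 'v1 \<Rightarrow> complex) \<Rightarrow> ('v2 \<times> 'v2 \<Rightarrow> complex)) \<Rightarrow> bool"
  where "shimura_morphism D' D f \<longleftrightarrow> group_scheme_hom D' D f \<and>
    (\<forall>g' \<in> carrier (PEL_group D' real_ring). \<exists>g \<in> carrier (PEL_group D real_ring).
      \<forall>A \<phi>. real_algebra A \<phi> \<longrightarrow>
        (\<forall>z \<in> deligne_torus A. f A (h_conj D' g' A \<phi> z) = h_conj D g A \<phi> z))"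

section \<open>Representations and admissibility\<close>

text \<open>
  A representation of the group of \<open>D\<close> on the \<open>\<rat>\<close>-vector space with basis \<open>I\<close> is given by maps
  \<open>\<rho> R\<close> from \<open>G(R)\<close> to \<open>I \<times> I\<close> matrices. The following are the morphisms of representations from
  \<open>\<rho>\<close> to \<open>\<sigma>\<close>.
\<close>

definition rep_hom :: "('b::ring, 'v::ab_group_add) pel \<Rightarrow>
    'i set \<Rightarrow> (complex ring \<Rightarrow> ('v \<times> 'v \<Rightarrow> complex) \<Rightarrow> ('i \<times> 'i \<Rightarrow> complex)) \<Rightarrow>
    'j set \<Rightarrow> (complex ring \<Rightarrow> ('v \<times> 'v \<Rightarrow> complex) \<Rightarrow> ('j \<times> 'j \<Rightarrow> complex)) \<Rightarrow>
    ('j \<times> 'i \<Rightarrow> rat) set"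
  where "rep_hom D I \<rho> J \<sigma> = {T \<in> mats rat_ring J I.
    \<forall>R. rat_algebra R \<longrightarrow> (\<forall>g \<in> carrier (PEL_group D R).
      mmul R J I I (mbase J I (of_rat_alg R) T) (\<rho> R g) =
      mmul R J J I (\<sigma> R g) (mbase J I (of_rat_alg R) T))}"

definition std_power_basis :: "('b, 'v) pel \<Rightarrow> nat \<Rightarrow> (nat \<times> 'v) set"
  where "std_power_basis D n = {..<n} \<times> basisV D"

definition std_power :: "('b, 'v) pel \<Rightarrow> nat \<Rightarrow> 'u ring \<Rightarrow>
    ('v \<times> 'v \<Rightarrow> 'u) \<Rightarrow> ((nat \<times> 'v) \<times> (nat \<times> 'v) \<Rightarrow> 'u)"
  where "std_power D n R g = (\<lambda>((k, i), (l, j)) \<in> std_power_basis D n \<times> std_power_basis D n.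
    if k = l then g (i, j) else \<zero>\<^bsub>R\<^esub>)"

text \<open>
  An isomorphism of \<open>f\<^sup>*V\<close> with the subrepresentation \<open>e \<cdot> V'\<^bsup>\<oplus>n\<^esup>\<close> is a morphism of representations
  \<open>T\<close> from \<open>f\<^sup>*V\<close> to \<open>V'\<^bsup>\<oplus>n\<^esup>\<close> that is bijective onto the image of \<open>e\<close>.
\<close>

definition admissible :: "('b1::ring, 'v1::ab_group_add) pel \<Rightarrow>
    ('b2::ring, 'v2::ab_group_add) pel \<Rightarrow>
    (complex ring \<Rightarrow> ('v1 \<times> 'v1 \<Rightarrow> complex) \<Rightarrow> ('v2 \<times> 'v2 \<Rightarrow> complex)) \<Rightarrow> bool"
  where "admissible D' D f \<longleftrightarrow>
    (\<exists>n. let I = basisV D; J = std_power_basis D' n in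
      \<exists>e \<in> rep_hom D' J (std_power D' n) J (std_power D' n).
        mmul rat_ring J J J e e = e \<and>
        (\<exists>T \<in> rep_hom D' I f J (std_power D' n).
          bij_betw (mapply rat_ring J I T) (vecs rat_ring I)
            (mapply rat_ring J J e ` vecs rat_ring J)))"

end

theory Submission
 imports Defs "HOL-Computational_Algebra.Polynomial" "HOL-Library.Function_Algebras"
begin

text \<open>
 Over \<open>\<complex>\<close> the group of a PEL-datum of symplectic type is a product of symplectic similitude groups,
 generated over every local ring by the image of \<open>h\<close> and by the transvections \<open>1 + N\<close> with \<open>N\<close> a
 symmetric block. The weights \<open>\<plusminus>\<i>\<close> of \<open>h(\<i>)\<close> on \<open>V\<close> force \<open>f(1 + s N) = 1 + s q(N)\<close>, as a comparison of
 coefficients over \<open>\<complex>[s]\<close> shows, and the Weyl element relation gives \<open>q(N) q(N\<^sup>-\<^sup>1) = 1\<close> on the weight space.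
 A linear map on symmetric matrices that is compatible with inversion is a sum of copies of the standard
 one, so it is intertwined with the standard representation by complex matrices. Applying
 \<open>\<rat>\<close>-linear functionals \<open>\<complex> \<rightarrow> \<rat>\<close> to their entries yields rational intertwiners.
\<close>

section \<open>Matrices over a commutative ring\<close>

text \<open>The group is accessible only through its points over test rings that may have zero
  divisors and nilpotents, so density and Lie algebra arguments are replaced by identities between
  points. Equivariance of a matrix is an equation in such a ring. It can be checked in local rings,
  because a nonzero element survives in some localization, and in a local ring row reduction has
  pivots. Localizations, \<open>\<complex>[s]\<close> and \<open>R \<otimes> \<complex>\<close> must
  themselves occur among the test rings, which is why each of them is shown to be no larger than
  \<open>complex\<close> and is copied there. Admissibility is obtained from finitely many
  intertwiners \<open>S k\<close> from \<open>V'\<close> to \<open>V\<close> and \<open>T k\<close>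
  from \<open>V\<close> to \<open>V'\<close> whose products \<open>S k T k\<close> add up to 1: the
  column \<open>T\<close> then embeds \<open>V\<close> into a power of \<open>V'\<close>, and
  \<open>T S\<close> is the idempotent. Equivariance is linear in the matrix, so it survives a
  functional on the entries. The relation between the products is not linear; it survives because
  the entries of \<open>S k\<close> are expanded in a basis of \<open>\<complex>\<close> over
  \<open>\<rat>\<close> while one fixed functional is applied to the matching multiples of
  \<open>T k\<close>.\<close>

lemma mats_memI:
 assumes "!!i j. i \<in> I ==> j \<in> J ==> M (i, j) \<in> carrier R"
  and "!!p. p \<notin> I \<times> J ==> M p = undefined"
 shows "M \<in> mats R I J"
 unfolding mats_def using assms by (intro PiE_I) auto

lemma mats_entry: "M \<in> mats R I J ==> i \<in> I ==> j \<in> J ==> M (i, j) \<in> carrier R"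
 unfolding mats_def by auto

lemma mats_eqI:
 assumes "M \<in> mats R I J" "N \<in> mats R I J" "!!i j. i \<in> I ==> j \<in> J ==> M (i, j) = N (i, j)"
 shows "M = N"
 using assms unfolding mats_def PiE_def extensional_def by (fastforce simp: fun_eq_iff)

lemma vecs_entry: "v \<in> vecs R I ==> i \<in> I ==> v i \<in> carrier R"
 unfolding vecs_def by auto

lemma vecs_eqI: "v \<in> vecs R I ==> w \<in> vecs R I ==> (!!i. i \<in> I ==> v i = w i) ==> v = w"
 unfolding vecs_def by (rule PiE_ext)

lemma vecs_memI: "(!!i. i \<in> I ==> v i \<in> carrier R) ==> (\<lambda>i \<in> I. v i) \<in> vecs R I"
 unfolding vecs_def by auto

definition mtr :: "'i set => 'j set => ('i \<times> 'j => 'u) => ('j \<times> 'i => 'u)"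
 where "mtr I J M = (\<lambda>(j, i) \<in> J \<times> I. M (i, j))"

definition madd :: "'u ring => 'i set => 'j set => ('i \<times> 'j => 'u) => ('i \<times> 'j => 'u) => ('i \<times> 'j => 'u)"
 where "madd R I J M N = (\<lambda>p \<in> I \<times> J. M p \<oplus>\<^bsub>R\<^esub> N p)"

definition msc :: "'u ring => 'i set => 'j set => 'u => ('i \<times> 'j => 'u) => ('i \<times> 'j => 'u)"
 where "msc R I J a M = (\<lambda>p \<in> I \<times> J. a \<otimes>\<^bsub>R\<^esub> M p)"

lemma mmul_entry: "i \<in> I ==> k \<in> K ==> mmul R I J K M N (i, k) = finsum R (\<lambda>j. M (i, j) \<otimes>\<^bsub>R\<^esub> N (j, k)) J"
 and mone_entry: "i \<in> I ==> i' \<in> I ==> mone R I (i, i') = (if i = i' then \<one>\<^bsub>R\<^esub> else \<zero>\<^bsub>R\<^esub>)"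
 and madd_entry: "i \<in> I ==> j \<in> J ==> madd R I J M' N' (i, j) = M' (i, j) \<oplus>\<^bsub>R\<^esub> N' (i, j)"
 and msc_entry: "i \<in> I ==> j \<in> J ==> msc R I J a M' (i, j) = a \<otimes>\<^bsub>R\<^esub> M' (i, j)"
 and mtr_entry: "i \<in> I ==> j \<in> J ==> mtr I J M' (j, i) = M' (i, j)"
 and mbase_entry: "i \<in> I ==> j \<in> J ==> mbase I J \<phi> M' (i, j) = \<phi> (M' (i, j))"
 unfolding mmul_def mone_def madd_def msc_def mtr_def mbase_def by auto

lemma mapply_entry: "i \<in> I ==> mapply R I J M v i = finsum R (\<lambda>j. M (i, j) \<otimes>\<^bsub>R\<^esub> v j) J"
 unfolding mapply_def by auto

lemmas mat_entry = mmul_entry mone_entry madd_entry msc_entry mtr_entry mbase_entry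

lemma mtr_mats [simp]: "M \<in> mats R I J ==> mtr I J M \<in> mats R J I"
 by (rule mats_memI) (auto simp: mtr_def mats_entry)

lemma mtr_mtr [simp]: "M \<in> mats R I J ==> mtr J I (mtr I J M) = M"
 by (rule mats_eqI[of _ R I J]) (auto simp: mtr_entry)

lemma mbase_mats: "\<phi> \<in> Ring.ring_hom R S ==> M \<in> mats R I J ==> mbase I J \<phi> M \<in> mats S I J"
 by (rule mats_memI) (auto simp: mbase_def mats_entry intro: ring_hom_closed)

lemma mbase_mbase: "mbase I J \<phi> (mbase I J \<psi> M) = mbase I J (\<phi> \<circ> \<psi>) M"
 unfolding mbase_def by auto

lemma mbase_cong:
 "M \<in> mats R I J ==> (!!x. x \<in> carrier R ==> \<phi> x = \<psi> x) ==> mbase I J \<phi> M = mbase I J \<psi> M"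
 unfolding mbase_def by (auto simp: mats_entry)

lemma mbase_id: "M \<in> mats R I J ==> (!!x. x \<in> carrier R ==> \<phi> x = x) ==> mbase I J \<phi> M = M"
 unfolding mbase_def mats_def by (auto simp: restrict_def fun_eq_iff PiE_def extensional_def Pi_def)

lemma mbase_mtr: "mbase J I \<phi> (mtr I J M) = mtr I J (mbase I J \<phi> M)"
 unfolding mbase_def mtr_def by auto

locale base_ring = cring R for R :: "'u ring" (structure)
begin

lemma finsum_swap:
 assumes "finite A" "finite B" "!!a b. a \<in> A ==> b \<in> B ==> f a b \<in> carrier R"
 shows "(\<Oplus>a\<in>A. \<Oplus>b\<in>B. f a b) = (\<Oplus>b\<in>B. \<Oplus>a\<in>A. f a b)"
 using assms(1,3)
proof (induction A rule: finite_induct)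
 case (insert x F)
 have "(\<Oplus>a\<in>insert x F. \<Oplus>b\<in>B. f a b) = (\<Oplus>b\<in>B. f x b) \<oplus> (\<Oplus>b\<in>B. \<Oplus>a\<in>F. f a b)"
  using insert by (subst finsum_insert) (auto intro!: finsum_closed)
 also have "\<dots> = (\<Oplus>b\<in>B. f x b \<oplus> (\<Oplus>a\<in>F. f a b))"
  using insert by (subst finsum_addf) (auto intro!: finsum_closed)
 also have "\<dots> = (\<Oplus>b\<in>B. \<Oplus>a\<in>insert x F. f a b)"
  using insert by (intro finsum_cong') (auto intro!: finsum_closed)
 finally show ?case .
qed (simp add: finsum_zero)

lemma finsum_delta:
 assumes "finite A" "a \<in> A" "x \<in> carrier R"
 shows "(\<Oplus>b\<in>A. if a = b then x else \<zero>) = x" "(\<Oplus>b\<in>A. if b = a then x else \<zero>) = x"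
 using finsum_singleton[of a A "\<lambda>_. x"] assms by (auto simp: eq_commute[of _ a])

lemma finsum_single:
 assumes "finite A" "a \<in> A" "!!b. b \<in> A ==> f b \<in> carrier R" "!!b. b \<in> A ==> b ~= a ==> f b = \<zero>"
 shows "(\<Oplus>b\<in>A. f b) = f a"
proof -
 have "(\<Oplus>b\<in>A. f b) = (\<Oplus>b\<in>A. if a = b then f a else \<zero>)"
  by (rule finsum_cong') (use assms in auto)
 then show ?thesis using assms by (simp add: finsum_delta)
qed

lemma mone_mats [simp]: "mone R I \<in> mats R I I"
 by (rule mats_memI) (auto simp: mone_def)

lemma mmul_mats [simp]:
 "M \<in> mats R I J ==> N \<in> mats R J K ==> mmul R I J K M N \<in> mats R I K"
 by (rule mats_memI) (auto simp: mmul_entry mats_entry mmul_def intro!: finsum_closed)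

lemma madd_mats [simp]: "M \<in> mats R I J ==> N \<in> mats R I J ==> madd R I J M N \<in> mats R I J"
 by (rule mats_memI) (auto simp: madd_def mats_entry)

lemma msc_mats [simp]: "a \<in> carrier R ==> M \<in> mats R I J ==> msc R I J a M \<in> mats R I J"
 by (rule mats_memI) (auto simp: msc_def mats_entry)

lemma mapply_vecs [simp]: "M \<in> mats R I J ==> v \<in> vecs R J ==> mapply R I J M v \<in> vecs R I"
 unfolding mapply_def by (rule vecs_memI) (auto simp: mats_entry vecs_entry intro!: finsum_closed)

lemma mmul_assoc:
 assumes "finite J" "finite K" "M \<in> mats R I J" "N \<in> mats R J K" "L \<in> mats R K H"
 shows "mmul R I K H (mmul R I J K M N) L = mmul R I J H M (mmul R J K H N L)"
proof (rule mats_eqI[of _ R])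
 fix i h assume ih: "i \<in> I" "h \<in> H"
 note c = mats_entry[OF assms(3)] mats_entry[OF assms(4)] mats_entry[OF assms(5)]
 have "mmul R I K H (mmul R I J K M N) L (i, h) = (\<Oplus>k\<in>K. (\<Oplus>j\<in>J. M (i, j) \<otimes> N (j, k)) \<otimes> L (k, h))"
  using ih by (simp add: mmul_entry cong: finsum_cong) (rule finsum_cong', auto simp: mmul_entry c ih intro!: finsum_closed)
 also have "\<dots> = (\<Oplus>k\<in>K. \<Oplus>j\<in>J. M (i, j) \<otimes> N (j, k) \<otimes> L (k, h))"
  using ih assms by (intro finsum_cong') (auto simp: c finsum_ldistr intro!: finsum_closed)
 also have "\<dots> = (\<Oplus>j\<in>J. \<Oplus>k\<in>K. M (i, j) \<otimes> N (j, k) \<otimes> L (k, h))"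
  using ih assms by (intro finsum_swap) (auto simp: c)
 also have "\<dots> = (\<Oplus>j\<in>J. M (i, j) \<otimes> (\<Oplus>k\<in>K. N (j, k) \<otimes> L (k, h)))"
  using ih assms by (intro finsum_cong') (auto simp: c finsum_rdistr m_assoc intro!: finsum_closed finsum_cong')
 also have "\<dots> = mmul R I J H M (mmul R J K H N L) (i, h)"
  using ih by (simp add: mmul_entry) (rule finsum_cong', auto simp: mmul_entry c ih intro!: finsum_closed)
 finally show "mmul R I K H (mmul R I J K M N) L (i, h) = mmul R I J H M (mmul R J K H N L) (i, h)" .
qed (use assms in auto)

lemma mmul_one_left [simp]: "finite I ==> M \<in> mats R I J ==> mmul R I I J (mone R I) M = M"
 by (rule mats_eqI[of _ R]) (auto simp: mmul_entry mone_entry mats_entry intro!: trans[OF finsum_single])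

lemma mmul_one_right [simp]: "finite J ==> M \<in> mats R I J ==> mmul R I J J M (mone R J) = M"
proof (rule mats_eqI[of _ R])
 fix i j assume "finite J" "M \<in> mats R I J" "i \<in> I" "j \<in> J"
 then show "mmul R I J J M (mone R J) (i, j) = M (i, j)"
  by (simp add: mmul_entry) (subst finsum_single[of _ j], auto simp: mone_entry mats_entry)
qed auto

lemma mmul_add_left:
 assumes "finite J" "M \<in> mats R I J" "M' \<in> mats R I J" "N \<in> mats R J K"
 shows "mmul R I J K (madd R I J M M') N = madd R I K (mmul R I J K M N) (mmul R I J K M' N)"
proof (rule mats_eqI[of _ R])
 fix i k assume ik: "i \<in> I" "k \<in> K"
 note c = mats_entry[OF assms(2)] mats_entry[OF assms(3)] mats_entry[OF assms(4)]
 have "(\<Oplus>j\<in>J. madd R I J M M' (i, j) \<otimes> N (j, k)) = (\<Oplus>j\<in>J. M (i, j) \<otimes> N (j, k) \<oplus> M' (i, j) \<otimes> N (j, k))"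
  using ik by (intro finsum_cong') (auto simp: c madd_entry l_distr)
 then show "mmul R I J K (madd R I J M M') N (i, k) = madd R I K (mmul R I J K M N) (mmul R I J K M' N) (i, k)"
  using ik by (simp add: mmul_entry madd_entry finsum_addf c)
qed (use assms in auto)

lemma mmul_add_right:
 assumes "finite J" "M \<in> mats R I J" "N' \<in> mats R J K" "N \<in> mats R J K"
 shows "mmul R I J K M (madd R J K N N') = madd R I K (mmul R I J K M N) (mmul R I J K M N')"
proof (rule mats_eqI[of _ R])
 fix i k assume ik: "i \<in> I" "k \<in> K"
 note c = mats_entry[OF assms(2)] mats_entry[OF assms(3)] mats_entry[OF assms(4)]
 have "(\<Oplus>j\<in>J. M (i, j) \<otimes> madd R J K N N' (j, k)) = (\<Oplus>j\<in>J. M (i, j) \<otimes> N (j, k) \<oplus> M (i, j) \<otimes> N' (j, k))"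
  using ik by (intro finsum_cong') (auto simp: c madd_entry r_distr)
 then show "mmul R I J K M (madd R J K N N') (i, k) = madd R I K (mmul R I J K M N) (mmul R I J K M N') (i, k)"
  using ik by (simp add: mmul_entry madd_entry finsum_addf c)
qed (use assms in auto)

lemma mmul_msc_left:
 assumes "finite J" "a \<in> carrier R" "M \<in> mats R I J" "N \<in> mats R J K"
 shows "mmul R I J K (msc R I J a M) N = msc R I K a (mmul R I J K M N)"
proof (rule mats_eqI[of _ R])
 fix i k assume ik: "i \<in> I" "k \<in> K"
 note c = mats_entry[OF assms(3)] mats_entry[OF assms(4)]
 show "mmul R I J K (msc R I J a M) N (i, k) = msc R I K a (mmul R I J K M N) (i, k)"
  using ik assms by (simp add: mmul_entry msc_entry)
   (subst finsum_rdistr, auto simp: c msc_entry m_assoc intro!: finsum_cong')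
qed (use assms in auto)

lemma mmul_msc_right:
 assumes "finite J" "a \<in> carrier R" "M \<in> mats R I J" "N \<in> mats R J K"
 shows "mmul R I J K M (msc R J K a N) = msc R I K a (mmul R I J K M N)"
proof (rule mats_eqI[of _ R])
 fix i k assume ik: "i \<in> I" "k \<in> K"
 note c = mats_entry[OF assms(3)] mats_entry[OF assms(4)]
 show "mmul R I J K M (msc R J K a N) (i, k) = msc R I K a (mmul R I J K M N) (i, k)"
  using ik assms by (simp add: mmul_entry msc_entry)
   (subst finsum_rdistr, auto simp: c msc_entry m_lcomm intro!: finsum_cong')
qed (use assms in auto)

lemma mtr_mmul:
 assumes "finite J" "M \<in> mats R I J" "N \<in> mats R J K"
 shows "mtr I K (mmul R I J K M N) = mmul R K J I (mtr J K N) (mtr I J M)"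
proof (rule mats_eqI[of _ R])
 fix k i assume ik: "i \<in> I" "k \<in> K"
 note c = mats_entry[OF assms(2)] mats_entry[OF assms(3)]
 show "mtr I K (mmul R I J K M N) (k, i) = mmul R K J I (mtr J K N) (mtr I J M) (k, i)"
  using ik assms by (simp add: mmul_entry mtr_entry) (auto simp: c mtr_entry m_comm intro!: finsum_cong')
qed (use assms in auto)

lemma mapply_mmul:
 assumes "finite J" "finite K" "M \<in> mats R I J" "N \<in> mats R J K" "v \<in> vecs R K"
 shows "mapply R I K (mmul R I J K M N) v = mapply R I J M (mapply R J K N v)"
proof (rule vecs_eqI[of _ R])
 fix i assume i: "i \<in> I"
 \<comment> \<open>A vector is turned into a matrix with one column, so that associativity of
   \<open>mmul\<close> applies.\<close>
 define V where "V = (\<lambda>(k, u) \<in> K \<times> {()}. v k)"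
 have V: "V \<in> mats R K {()}" by (rule mats_memI) (use assms(5) in \<open>auto simp: V_def vecs_entry\<close>)
 have app: "mapply R A B L w a = mmul R A B {()} L (\<lambda>(b, u) \<in> B \<times> {()}. w b) (a, ())"
  if "a \<in> A" "L \<in> mats R A B" "w \<in> vecs R B" for A and B :: "'x set" and L w and a :: 'y
  using that by (simp add: mapply_def mmul_entry) (rule finsum_cong', auto simp: mats_entry vecs_entry)
 have "mapply R I K (mmul R I J K M N) v i = mmul R I J {()} M (mmul R J K {()} N V) (i, ())"
  using i assms V by (subst app) (auto simp: V_def[symmetric] mmul_assoc)
 also have "mmul R J K {()} N V = (\<lambda>(b, u) \<in> J \<times> {()}. mapply R J K N v b)"
  using app[of _ J N K v] assms V unfolding V_def[symmetric]
  by (intro mats_eqI[of _ R J "{()}"])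
   (auto intro!: mats_memI simp: vecs_entry[OF mapply_vecs] mats_entry[OF mmul_mats] split: if_splits)
 also have "mmul R I J {()} M (\<lambda>(b, u) \<in> J \<times> {()}. mapply R J K N v b) (i, ()) = mapply R I J M (mapply R J K N v) i"
  using i assms by (subst app) auto
 finally show "mapply R I K (mmul R I J K M N) v i = mapply R I J M (mapply R J K N v) i" .
qed (use assms in auto)

lemma mapply_one: "finite I ==> v \<in> vecs R I ==> mapply R I I (mone R I) v = v"
 by (rule vecs_eqI[of _ R]) (auto simp: mapply_entry mone_entry vecs_entry intro!: trans[OF finsum_single])

end

locale base_ring_hom = ring_hom_cring R S h for R :: "'u ring" and S :: "'w ring" and h

sublocale base_ring_hom \<subseteq> RB: base_ring R
 by unfold_locales

sublocale base_ring_hom \<subseteq> SB: base_ring S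
 by unfold_locales

context base_ring_hom
begin

lemma mbase_closed [simp]: "M \<in> mats R I J ==> mbase I J h M \<in> mats S I J"
 using homh by (rule mbase_mats)

lemma mbase_mmul:
 assumes "finite J" "M \<in> mats R I J" "N \<in> mats R J K"
 shows "mbase I K h (mmul R I J K M N) = mmul S I J K (mbase I J h M) (mbase J K h N)"
proof (rule mats_eqI[of _ S])
 fix i k assume ik: "i \<in> I" "k \<in> K"
 note c = mats_entry[OF assms(2)] mats_entry[OF assms(3)]
 show "mbase I K h (mmul R I J K M N) (i, k) = mmul S I J K (mbase I J h M) (mbase J K h N) (i, k)"
  using ik assms by (simp add: mmul_entry mbase_entry) 
   (subst hom_finsum, auto simp: c mbase_entry intro!: S.finsum_cong')
qed (use assms homh in auto)

lemma mbase_mone: "mbase I I h (mone R I) = mone S I"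
 by (rule mats_eqI[of _ S I I]) (use homh in \<open>auto simp: mbase_entry mone_entry\<close>)

lemma mbase_madd:
 "M \<in> mats R I J ==> N \<in> mats R I J ==> mbase I J h (madd R I J M N) = madd S I J (mbase I J h M) (mbase I J h N)"
 by (rule mats_eqI[of _ S I J]) (use homh in \<open>auto simp: mbase_entry madd_entry mats_entry\<close>)

lemma mbase_msc:
 "M \<in> mats R I J ==> a \<in> carrier R ==> mbase I J h (msc R I J a M) = msc S I J (h a) (mbase I J h M)"
 by (rule mats_eqI[of _ S I J]) (use homh in \<open>auto simp: mbase_entry msc_entry mats_entry\<close>)

end

section \<open>Algebras over the rationals\<close>

lemma type_ring_simps [simp]:
 "carrier ring_of_type_algebra = UNIV"
 "monoid.mult ring_of_type_algebra = (*)"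
 "ring.add ring_of_type_algebra = (+)"
 "one ring_of_type_algebra = 1"
 "ring.zero ring_of_type_algebra = 0"
 unfolding ring_of_type_algebra_def by (auto simp: fun_eq_iff)

lemma base_ring_type: "base_ring (ring_of_type_algebra :: 'a::comm_ring_1 ring)"
 unfolding base_ring_def by (rule cring_from_type_algebra)

lemma finsum_type [simp]:
 "finsum (ring_of_type_algebra :: 'a::comm_ring_1 ring) f A = (if finite A then sum f A else 0)"
proof -
 interpret base_ring "ring_of_type_algebra :: 'a ring" by (rule base_ring_type)
 show ?thesis
 proof (cases "finite A")
  case True
  then show ?thesis by (induction A rule: finite_induct) auto
 qed (use finsum_infinite in auto)
qed

lemma type_ring_homI:
 "(!!x. h x \<in> carrier S) ==> (!!x y. h (x * y) = h x \<otimes>\<^bsub>S\<^esub> h y) ==> (!!x y. h (x + y) = h x \<oplus>\<^bsub>S\<^esub> h y)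
  ==> h 1 = \<one>\<^bsub>S\<^esub> ==> h \<in> Ring.ring_hom ring_of_type_algebra S"
 by (rule ring_hom_memI) auto

text \<open>Agreement on integers follows from additivity. It extends to quotients because a nonzero
  rational has an invertible image. This justifies the definite description in
  \<open>of_rat_alg\<close>.\<close>

lemma rat_hom_unique:
 assumes "cring R" "\<iota> \<in> Ring.ring_hom rat_ring R" "\<kappa> \<in> Ring.ring_hom rat_ring R"
 shows "\<iota> = \<kappa>"
proof -
 interpret R: cring R by fact
 interpret i: ring_hom_cring rat_ring R \<iota>
  using assms cring_from_type_algebra[where 'a=rat] by (auto simp: ring_hom_cring_def ring_hom_cring_axioms_def)
 interpret k: ring_hom_cring rat_ring R \<kappa>
  using assms cring_from_type_algebra[where 'a=rat] by (auto simp: ring_hom_cring_def ring_hom_cring_axioms_def)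
 have mult: "\<iota> (x * y) = \<iota> x \<otimes>\<^bsub>R\<^esub> \<iota> y" "\<kappa> (x * y) = \<kappa> x \<otimes>\<^bsub>R\<^esub> \<kappa> y" for x y
  using i.hom_mult[of x y] k.hom_mult[of x y] by auto
 have cl [simp]: "\<iota> x \<in> carrier R" "\<kappa> x \<in> carrier R" for x
  using i.hom_closed[of x] k.hom_closed[of x] by auto
 have add: "\<iota> (x + y) = \<iota> x \<oplus>\<^bsub>R\<^esub> \<iota> y" "\<kappa> (x + y) = \<kappa> x \<oplus>\<^bsub>R\<^esub> \<kappa> y" for x y
  using i.hom_add[of x y] k.hom_add[of x y] by auto
 have z: "\<iota> 0 = \<zero>\<^bsub>R\<^esub>" "\<kappa> 0 = \<zero>\<^bsub>R\<^esub>" "\<iota> 1 = \<one>\<^bsub>R\<^esub>" "\<kappa> 1 = \<one>\<^bsub>R\<^esub>"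
  using i.hom_zero k.hom_zero i.hom_one k.hom_one by auto
 have nat: "\<iota> (of_nat n) = \<kappa> (of_nat n)" for n
  by (induction n) (simp_all add: z add)
 have quot: "\<iota> x = \<kappa> x" if "\<iota> (x * y) = \<kappa> (x * y)" "\<iota> y = \<kappa> y" "y ~= 0" for x y
 proof -
  have "\<kappa> y \<otimes>\<^bsub>R\<^esub> \<kappa> (inverse y) = \<one>\<^bsub>R\<^esub>"
   using that(3) by (simp add: z flip: mult(2))
  then have "\<iota> x = (\<iota> x \<otimes>\<^bsub>R\<^esub> \<iota> y) \<otimes>\<^bsub>R\<^esub> \<kappa> (inverse y)"
   using that(2) by (simp add: R.m_assoc)
  also have "\<iota> x \<otimes>\<^bsub>R\<^esub> \<iota> y = \<kappa> (x * y)"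
   using that(1) by (simp add: mult(1))
  also have "\<kappa> (x * y) \<otimes>\<^bsub>R\<^esub> \<kappa> (inverse y) = \<kappa> x"
   unfolding mult(2)[symmetric] using that(3) by (simp add: mult.assoc)
  finally show ?thesis .
 qed
 have neg: "\<iota> (- x) = \<kappa> (- x)" if "\<iota> x = \<kappa> x" for x
 proof -
  have "\<iota> (-1) \<oplus>\<^bsub>R\<^esub> \<iota> 1 = \<zero>\<^bsub>R\<^esub>" "\<kappa> (-1) \<oplus>\<^bsub>R\<^esub> \<kappa> 1 = \<zero>\<^bsub>R\<^esub>"
   unfolding add[symmetric] by (simp_all add: z)
  then have "\<iota> (-1) = \<ominus>\<^bsub>R\<^esub> \<one>\<^bsub>R\<^esub>" "\<kappa> (-1) = \<ominus>\<^bsub>R\<^esub> \<one>\<^bsub>R\<^esub>"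
   using R.sum_zero_eq_neg by (auto simp: z)
  then show ?thesis using mult(1)[of "-1" x] mult(2)[of "-1" x] that by simp
 qed
 have int: "\<iota> (of_int n) = \<kappa> (of_int n)" for n
  using nat[of "nat n"] neg[OF nat[of "nat (- n)"]] by (cases "n \<ge> 0") auto
 show ?thesis
 proof
  fix q
  obtain a b where "quotient_of q = (a, b)" by (cases "quotient_of q")
  then have q: "b > 0" "q = of_int a / of_int b"
   using quotient_of_denom_pos quotient_of_div by blast+
  then have "q * of_int b = of_int a" by simp
  then show "\<iota> q = \<kappa> q" using quot[of q "of_int b"] int q by auto
 qed
qed

lemma of_rat_alg_eqI: "cring R ==> \<iota> \<in> Ring.ring_hom rat_ring R ==> of_rat_alg R = \<iota>"
 unfolding of_rat_alg_def using rat_hom_unique by blast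

lemma of_rat_alg_hom: "rat_algebra R ==> of_rat_alg R \<in> Ring.ring_hom rat_ring R"
 unfolding rat_algebra_def using of_rat_alg_eqI by metis

lemma rat_algebra_hom:
 assumes "rat_algebra R" "cring S" "\<phi> \<in> Ring.ring_hom R S"
 shows "rat_algebra S" "of_rat_alg S q = \<phi> (of_rat_alg R q)"
proof -
 have h: "\<phi> \<circ> of_rat_alg R \<in> Ring.ring_hom rat_ring S"
  using ring_hom_trans[OF of_rat_alg_hom[OF assms(1)] assms(3)] .
 then show "rat_algebra S" using assms unfolding rat_algebra_def by blast
 show "of_rat_alg S q = \<phi> (of_rat_alg R q)" using of_rat_alg_eqI[OF assms(2) h] by simp
qed

lemma of_rat_alg_type [simp]: "of_rat_alg (ring_of_type_algebra :: 'a::field_char_0 ring) = of_rat"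
 by (intro of_rat_alg_eqI cring_from_type_algebra type_ring_homI) (auto simp: of_rat_mult of_rat_add)

lemma rat_algebra_type: "rat_algebra (ring_of_type_algebra :: 'a::field_char_0 ring)"
 unfolding rat_algebra_def
 by (intro conjI exI[of _ of_rat] cring_from_type_algebra type_ring_homI) (auto simp: of_rat_mult of_rat_add)

locale rat_alg = base_ring R for R :: "'u ring" (structure) +
 assumes rat_algebra: "rat_algebra R"
begin

sublocale rat: base_ring_hom rat_ring R "of_rat_alg R"
 using of_rat_alg_hom[OF rat_algebra] cring_from_type_algebra[where 'a=rat] is_cring
 by (auto simp: base_ring_hom_def ring_hom_cring_def ring_hom_cring_axioms_def)

end

lemma rat_alg_iff: "rat_alg R \<longleftrightarrow> rat_algebra R"
 unfolding rat_alg_def rat_alg_axioms_def base_ring_def rat_algebra_def by auto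

lemma base_ring_homI: "cring R ==> cring S ==> \<phi> \<in> Ring.ring_hom R S ==> base_ring_hom R S \<phi>"
 by (auto simp: base_ring_hom_def ring_hom_cring_def ring_hom_cring_axioms_def)

lemma (in base_ring) finsum_Times:
 assumes "finite A" "finite B" "!!a b. a \<in> A ==> b \<in> B ==> f (a, b) \<in> carrier R"
 shows "(\<Oplus>p\<in>A \<times> B. f p) = (\<Oplus>a\<in>A. \<Oplus>b\<in>B. f (a, b))"
 using assms(1,3)
proof (induction A rule: finite_induct)
 case (insert x F)
 have "(\<Oplus>p\<in>insert x F \<times> B. f p) = (\<Oplus>p\<in>Pair x ` B \<union> F \<times> B. f p)"
  by (rule arg_cong2[where f="finsum R"]) auto
 also have "\<dots> = (\<Oplus>p\<in>Pair x ` B. f p) \<oplus> (\<Oplus>p\<in>F \<times> B. f p)"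
  using insert assms(2) by (intro finsum_Un_disjoint) auto
 also have "(\<Oplus>p\<in>Pair x ` B. f p) = (\<Oplus>b\<in>B. f (x, b))"
  using insert assms(2) by (intro finsum_reindex) (auto simp: inj_on_def)
 finally show ?case using insert assms(2) by (simp add: finsum_insert finsum_closed)
qed simp

section \<open>The group of a PEL-datum in terms of matrices\<close>

definition bmat :: "('b::ring, 'v::ab_group_add) pel => 'b => ('v \<times> 'v => rat)"
 where "bmat D b = (\<lambda>(i, j) \<in> basisV D \<times> basisV D. coordV D (act D b j) i)"

definition gram :: "('b, 'v) pel => ('v \<times> 'v => rat)"
 where "gram D = (\<lambda>(i, j) \<in> basisV D \<times> basisV D. pairing D i j)"

lemma bmat_mats [simp]: "bmat D b \<in> mats rat_ring (basisV D) (basisV D)"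
 by (rule mats_memI) (auto simp: bmat_def)

lemma gram_mats [simp]: "gram D \<in> mats rat_ring (basisV D) (basisV D)"
 by (rule mats_memI) (auto simp: gram_def)

lemma (in rat_alg) of_rat_alg_closed [simp]: "of_rat_alg R q \<in> carrier R"
 using rat.hom_closed[of q] by simp

definition colv :: "'i set => ('i => 'u) => ('i \<times> unit => 'u)"
 where "colv I v = (\<lambda>(i, u) \<in> I \<times> {()}. v i)"

lemma (in base_ring) colv_mats [simp]: "v \<in> vecs R I ==> colv I v \<in> mats R I {()}"
 by (rule mats_memI) (auto simp: colv_def vecs_entry)

lemma (in base_ring) colv_mapply:
 "M \<in> mats R I J ==> v \<in> vecs R J ==> colv I (mapply R I J M v) = mmul R I J {()} M (colv J v)"
 by (rule mats_eqI[of _ R I "{()}"])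
  (simp_all, simp add: colv_def mapply_entry mmul_entry, auto simp: mats_entry vecs_entry intro!: finsum_cong')

locale pel_alg = rat_alg R for R :: "'u ring" (structure) +
 fixes D :: "('b::ring, 'v::ab_group_add) pel"
 assumes finV: "finite (basisV D)" and finB: "finite (basisB D)"
begin

abbreviation "I \<equiv> basisV D"
abbreviation "ext M \<equiv> mbase I I (of_rat_alg R) M"
abbreviation mm (infixl "\<bullet>\<bullet>" 70) where "M \<bullet>\<bullet> N \<equiv> mmul R I I I M N"

lemma BR_act_entry:
 "i \<in> I ==> j \<in> I ==> BR_act R D x (i, j) = (\<Oplus>k\<in>basisB D. x k \<otimes> ext (bmat D k) (i, j))"
 unfolding BR_act_def by (simp add: mbase_entry bmat_def)

lemma BR_act_mats [simp]: "x \<in> vecs R (basisB D) ==> BR_act R D x \<in> mats R I I"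
 by (rule mats_memI) (auto simp: BR_act_def vecs_entry intro!: finsum_closed)

lemma BR_act_unit:
 assumes "k \<in> basisB D"
 shows "BR_act R D (\<lambda>i\<in>basisB D. if i = k then \<one> else \<zero>) = ext (bmat D k)"
proof (rule mats_eqI[of _ R I I])
 fix i j assume "i \<in> I" "j \<in> I"
 then show "BR_act R D (\<lambda>i\<in>basisB D. if i = k then \<one> else \<zero>) (i, j) = ext (bmat D k) (i, j)"
  using assms finB by (simp add: BR_act_entry) (subst finsum_single[of _ k], auto simp: mbase_entry)
qed (auto intro!: BR_act_mats vecs_memI)

text \<open>Both products are linear in \<open>x\<close>. This reduces commutation with the whole
  algebra to finitely many equations, one for each basis element, in
  \<open>BR_End_iff\<close>.\<close>

lemma mmul_BR_act:
 assumes "x \<in> vecs R (basisB D)" "g \<in> mats R I I" "i \<in> I" "j \<in> I"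
 shows "(g \<bullet>\<bullet> BR_act R D x) (i, j) = (\<Oplus>k\<in>basisB D. x k \<otimes> (g \<bullet>\<bullet> ext (bmat D k)) (i, j))" (is ?A)
  and "(BR_act R D x \<bullet>\<bullet> g) (i, j) = (\<Oplus>k\<in>basisB D. x k \<otimes> (ext (bmat D k) \<bullet>\<bullet> g) (i, j))" (is ?B)
proof -
 note c = mats_entry[OF assms(2)] vecs_entry[OF assms(1)]
 have e [simp]: "ext (bmat D k) (i, j) \<in> carrier R" if "i \<in> I" "j \<in> I" for i j k
  using that by (simp add: mbase_entry)
 have "(g \<bullet>\<bullet> BR_act R D x) (i, j) = (\<Oplus>l\<in>I. \<Oplus>k\<in>basisB D. x k \<otimes> (g (i, l) \<otimes> ext (bmat D k) (l, j)))"
  using assms finB by (simp add: mmul_entry)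
   (intro finsum_cong', auto simp: c BR_act_entry finsum_rdistr m_lcomm intro!: finsum_cong' finsum_closed)
 also have "\<dots> = (\<Oplus>k\<in>basisB D. \<Oplus>l\<in>I. x k \<otimes> (g (i, l) \<otimes> ext (bmat D k) (l, j)))"
  using assms finB finV by (intro finsum_swap) (auto simp: c)
 also have "\<dots> = (\<Oplus>k\<in>basisB D. x k \<otimes> (g \<bullet>\<bullet> ext (bmat D k)) (i, j))"
  using assms finV by (intro finsum_cong') (auto simp: c mmul_entry finsum_rdistr intro!: finsum_closed finsum_cong')
 finally show ?A .
 have "(BR_act R D x \<bullet>\<bullet> g) (i, j) = (\<Oplus>l\<in>I. \<Oplus>k\<in>basisB D. x k \<otimes> (ext (bmat D k) (i, l) \<otimes> g (l, j)))"
  using assms finB by (simp add: mmul_entry)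
   (intro finsum_cong', auto simp: c BR_act_entry finsum_ldistr m_assoc intro!: finsum_cong' finsum_closed)
 also have "\<dots> = (\<Oplus>k\<in>basisB D. \<Oplus>l\<in>I. x k \<otimes> (ext (bmat D k) (i, l) \<otimes> g (l, j)))"
  using assms finB finV by (intro finsum_swap) (auto simp: c)
 also have "\<dots> = (\<Oplus>k\<in>basisB D. x k \<otimes> (ext (bmat D k) \<bullet>\<bullet> g) (i, j))"
  using assms finV by (intro finsum_cong') (auto simp: c mmul_entry finsum_rdistr intro!: finsum_closed finsum_cong')
 finally show ?B .
qed

lemma BR_End_iff:
 "g \<in> BR_End R D \<longleftrightarrow> g \<in> mats R I I \<and> (\<forall>k\<in>basisB D. g \<bullet>\<bullet> ext (bmat D k) = ext (bmat D k) \<bullet>\<bullet> g)"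
proof (intro iffI conjI ballI)
 assume g: "g \<in> BR_End R D"
 then show "g \<in> mats R I I" unfolding BR_End_def by auto
 fix k assume "k \<in> basisB D"
 moreover have "(\<lambda>i\<in>basisB D. if i = k then \<one> else \<zero>) \<in> vecs R (basisB D)" by (rule vecs_memI) auto
 ultimately show "g \<bullet>\<bullet> ext (bmat D k) = ext (bmat D k) \<bullet>\<bullet> g"
  using g unfolding BR_End_def by (auto simp: BR_act_unit[symmetric])
next
 assume g: "g \<in> mats R I I \<and> (\<forall>k\<in>basisB D. g \<bullet>\<bullet> ext (bmat D k) = ext (bmat D k) \<bullet>\<bullet> g)"
 have "g \<bullet>\<bullet> BR_act R D x = BR_act R D x \<bullet>\<bullet> g" if "x \<in> vecs R (basisB D)" for x
  by (rule mats_eqI[of _ R I I]) (use g that in \<open>auto simp: mmul_BR_act vecs_entry mats_entry[OF mmul_mats] intro!: finsum_cong'\<close>)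
 then show "g \<in> BR_End R D" using g unfolding BR_End_def by auto
qed

lemma VR_pairing_mmul:
 assumes "u \<in> vecs R I" "v \<in> vecs R I"
 shows "VR_pairing R D u v =
  mmul R {()} I {()} (mtr I {()} (colv I u)) (mmul R I I {()} (ext (gram D)) (colv I v)) ((), ())"
proof -
 note c = vecs_entry[OF assms(1)] vecs_entry[OF assms(2)]
 have "VR_pairing R D u v = (\<Oplus>i\<in>I. \<Oplus>j\<in>I. u i \<otimes> v j \<otimes> of_rat_alg R (pairing D i j))"
  unfolding VR_pairing_def using finV by (subst finsum_Times) (auto simp: c)
 also have "\<dots> = (\<Oplus>i\<in>I. u i \<otimes> (\<Oplus>j\<in>I. ext (gram D) (i, j) \<otimes> v j))"
  using finV by (intro finsum_cong')
   (auto simp: c gram_def mbase_entry finsum_rdistr m_assoc m_comm[of "of_rat_alg R _" "v _"] intro!: finsum_cong' finsum_closed)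
 also have "\<dots> = mmul R {()} I {()} (mtr I {()} (colv I u)) (mmul R I I {()} (ext (gram D)) (colv I v)) ((), ())"
  by (simp add: mmul_entry)
   (auto simp: c mtr_entry mmul_entry colv_def mbase_entry intro!: finsum_cong' finsum_closed arg_cong2[where f="(\<otimes>)"])
 finally show ?thesis .
qed

text \<open>A bilinear form is determined by its values on unit vectors, so the condition on all
  pairs of vectors collapses to one equation between Gram matrices.\<close>

lemma preserve_iff:
 assumes g: "g \<in> mats R I I" and m: "\<mu> \<in> carrier R"
 shows "(\<forall>u \<in> vecs R I. \<forall>v \<in> vecs R I. VR_pairing R D (mapply R I I g u) (mapply R I I g v) = \<mu> \<otimes> VR_pairing R D u v)
  \<longleftrightarrow> mtr I I g \<bullet>\<bullet> (ext (gram D) \<bullet>\<bullet> g) = msc R I I \<mu> (ext (gram D))" (is "?L \<longleftrightarrow> ?A = ?B")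
proof -
 have e [simp]: "ext (gram D) \<in> mats R I I" by simp
 have form: "mmul R {()} I {()} (mtr I {()} (colv I u)) (mmul R I I {()} M (colv I v)) ((), ())
   = (\<Oplus>i\<in>I. u i \<otimes> (\<Oplus>j\<in>I. M (i, j) \<otimes> v j))"
  if "u \<in> vecs R I" "v \<in> vecs R I" "M \<in> mats R I I" for u v M
  using vecs_entry[OF that(1)] vecs_entry[OF that(2)] mats_entry[OF that(3)]
  by (simp add: mmul_entry)
   (auto simp: mtr_entry mmul_entry colv_def mbase_entry intro!: finsum_cong' finsum_closed arg_cong2[where f="(\<otimes>)"])
 have L: "VR_pairing R D (mapply R I I g u) (mapply R I I g v) =
  mmul R {()} I {()} (mtr I {()} (colv I u)) (mmul R I I {()} ?A (colv I v)) ((), ())"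
  if "u \<in> vecs R I" "v \<in> vecs R I" for u v
  using that g finV by (simp add: VR_pairing_mmul colv_mapply mtr_mmul mmul_assoc)
 have R: "\<mu> \<otimes> VR_pairing R D u v =
  mmul R {()} I {()} (mtr I {()} (colv I u)) (mmul R I I {()} ?B (colv I v)) ((), ())"
  if "u \<in> vecs R I" "v \<in> vecs R I" for u v
  using that m finV by (simp add: VR_pairing_mmul mmul_msc_left mmul_msc_right msc_entry)
 have AB: "?A \<in> mats R I I" "?B \<in> mats R I I" using g m by auto
 show ?thesis
 proof
  assume l: ?L
  show "?A = ?B"
  proof (rule mats_eqI[OF AB])
   fix i j assume ij: "i \<in> I" "j \<in> I"
   \<comment> \<open>Unit vectors: inserting \<open>?d i\<close> and \<open>?d j\<close> into a form
     picks out the entry \<open>(i, j)\<close> of its matrix.\<close>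
   let ?d = "\<lambda>k. \<lambda>l\<in>I. if l = k then \<one> else \<zero>"
   have d: "?d k \<in> vecs R I" for k by (rule vecs_memI) auto
   have D: "mmul R {()} I {()} (mtr I {()} (colv I (?d i))) (mmul R I I {()} M (colv I (?d j))) ((), ()) = M (i, j)"
    if M: "M \<in> mats R I I" for M
   proof -
    have "(\<Oplus>l\<in>I. M (k, l) \<otimes> ?d j l) = M (k, j)" if "k \<in> I" for k
     using finV ij mats_entry[OF M] that by (subst finsum_single[of _ j]) auto
    then have "(\<Oplus>k\<in>I. ?d i k \<otimes> (\<Oplus>l\<in>I. M (k, l) \<otimes> ?d j l)) = (\<Oplus>k\<in>I. ?d i k \<otimes> M (k, j))"
     using ij mats_entry[OF M] by (intro finsum_cong') auto
    also have "\<dots> = M (i, j)"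
     using finV ij mats_entry[OF M] by (subst finsum_single[of _ i]) auto
    finally show ?thesis using form[OF d[of i] d[of j] M] by simp
   qed
   show "?A (i, j) = ?B (i, j)"
    using l[rule_format, OF d[of i] d[of j]] unfolding L[OF d[of i] d[of j]] R[OF d[of i] d[of j]] D[OF AB(1)] D[OF AB(2)] .
  qed
 next
  assume "?A = ?B"
  then show ?L using L R by metis
 qed
qed

definition similitude :: "'u => ('v \<times> 'v => 'u) => bool"
 where "similitude \<mu> g \<longleftrightarrow> mtr I I g \<bullet>\<bullet> (ext (gram D) \<bullet>\<bullet> g) = msc R I I \<mu> (ext (gram D))"

lemma PEL_group_iff:
 "g \<in> carrier (PEL_group D R) \<longleftrightarrow> g \<in> mats R I I \<and>
  (\<forall>k\<in>basisB D. g \<bullet>\<bullet> ext (bmat D k) = ext (bmat D k) \<bullet>\<bullet> g) \<and>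
  (\<exists>g' \<in> mats R I I. g \<bullet>\<bullet> g' = mone R I \<and> g' \<bullet>\<bullet> g = mone R I) \<and> (\<exists>\<mu> \<in> Units R. similitude \<mu> g)"
proof (cases "g \<in> mats R I I")
 case True
 have "(\<exists>\<mu> \<in> Units R. \<forall>u \<in> vecs R I. \<forall>v \<in> vecs R I.
   VR_pairing R D (mapply R I I g u) (mapply R I I g v) = \<mu> \<otimes> VR_pairing R D u v) \<longleftrightarrow> (\<exists>\<mu> \<in> Units R. similitude \<mu> g)"
  unfolding similitude_def by (intro bex_cong refl preserve_iff True Units_closed)
 then show ?thesis using True unfolding PEL_group_def by (simp add: BR_End_iff)
qed (simp add: PEL_group_def BR_End_iff)

lemma PEL_group_mats: "g \<in> carrier (PEL_group D R) ==> g \<in> mats R I I"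
 unfolding PEL_group_iff by blast

lemma PEL_group_mult [simp]: "monoid.mult (PEL_group D R) g h = g \<bullet>\<bullet> h"
 and PEL_group_one [simp]: "one (PEL_group D R) = mone R I"
 unfolding PEL_group_def by auto

lemma similitude_mult:
 assumes "g \<in> mats R I I" "h \<in> mats R I I" "\<mu> \<in> carrier R" "\<nu> \<in> carrier R" "similitude \<mu> g" "similitude \<nu> h"
 shows "similitude (\<mu> \<otimes> \<nu>) (g \<bullet>\<bullet> h)"
proof -
 let ?P = "ext (gram D)"
 have P: "?P \<in> mats R I I" by simp
 have "mtr I I (g \<bullet>\<bullet> h) \<bullet>\<bullet> (?P \<bullet>\<bullet> (g \<bullet>\<bullet> h)) = mtr I I h \<bullet>\<bullet> ((mtr I I g \<bullet>\<bullet> (?P \<bullet>\<bullet> g)) \<bullet>\<bullet> h)"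
  using assms finV by (simp add: mtr_mmul mmul_assoc)
 also have "\<dots> = msc R I I \<mu> (msc R I I \<nu> ?P)"
  using assms finV unfolding similitude_def by (simp add: mmul_msc_left mmul_msc_right)
 also have "\<dots> = msc R I I (\<mu> \<otimes> \<nu>) ?P"
  by (rule mats_eqI[of _ R I I]) (use assms in \<open>auto simp: msc_entry mats_entry[OF P] m_assoc\<close>)
 finally show ?thesis unfolding similitude_def .
qed

lemma similitude_one: "similitude \<one> (mone R I)"
proof -
 have "mtr I I (mone R I) = mone R I"
  by (rule mats_eqI[of _ R I I]) (auto simp: mtr_entry mone_entry)
 then show ?thesis unfolding similitude_def using finV
  by simp (rule mats_eqI[of _ R I I], auto simp: msc_entry mats_entry[OF rat.mbase_closed[OF gram_mats]])
qed

text \<open>Multiplying the equation for \<open>g\<close> by the transpose of \<open>g'\<close> on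
  the left and by \<open>g'\<close> on the right writes the Gram matrix as \<open>\<mu>\<close>
  times its transform under \<open>g'\<close>.\<close>

lemma similitude_inverse:
 assumes "g \<in> mats R I I" "g' \<in> mats R I I" "g \<bullet>\<bullet> g' = mone R I" "\<mu> \<in> Units R" "similitude \<mu> g"
 shows "similitude (inv \<mu>) g'"
proof -
 let ?P = "ext (gram D)"
 have P: "?P \<in> mats R I I" by simp
 have t: "mtr I I g' \<bullet>\<bullet> mtr I I g = mone R I"
  using assms(1-3) finV by (subst mtr_mmul[symmetric]) (auto intro!: mats_eqI[of _ R I I] simp: mtr_entry mone_entry)
 have "?P = (mtr I I g' \<bullet>\<bullet> mtr I I g) \<bullet>\<bullet> (?P \<bullet>\<bullet> (g \<bullet>\<bullet> g'))"
  using assms finV t by simp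
 also have "\<dots> = mtr I I g' \<bullet>\<bullet> ((mtr I I g \<bullet>\<bullet> (?P \<bullet>\<bullet> g)) \<bullet>\<bullet> g')"
  using assms(1,2) finV by (simp add: mmul_assoc)
 also have "\<dots> = msc R I I \<mu> (mtr I I g' \<bullet>\<bullet> (?P \<bullet>\<bullet> g'))"
  using assms finV unfolding similitude_def by (simp add: mmul_msc_left mmul_msc_right Units_closed)
 finally have e: "?P = msc R I I \<mu> (mtr I I g' \<bullet>\<bullet> (?P \<bullet>\<bullet> g'))" .
 have M: "mtr I I g' \<bullet>\<bullet> (?P \<bullet>\<bullet> g') \<in> mats R I I" using assms by simp
 show ?thesis unfolding similitude_def
  by (subst (2) e, rule mats_eqI[of _ R I I])
   (use assms M in \<open>auto simp: msc_entry mats_entry[OF M] Units_closed Units_inv_closed m_assoc[symmetric] Units_l_inv\<close>)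
qed

lemma PEL_group: "group (PEL_group D R)"
proof (rule groupI)
 fix g h assume gh: "g \<in> carrier (PEL_group D R)" "h \<in> carrier (PEL_group D R)"
 then obtain g' h' \<mu> \<nu> where w: "g \<in> mats R I I" "h \<in> mats R I I" "g' \<in> mats R I I" "h' \<in> mats R I I"
  "g \<bullet>\<bullet> g' = mone R I" "g' \<bullet>\<bullet> g = mone R I" "h \<bullet>\<bullet> h' = mone R I" "h' \<bullet>\<bullet> h = mone R I"
  "\<mu> \<in> Units R" "\<nu> \<in> Units R" "similitude \<mu> g" "similitude \<nu> h"
  by (auto simp: PEL_group_iff)
 have "(g \<bullet>\<bullet> h) \<bullet>\<bullet> (h' \<bullet>\<bullet> g') = g \<bullet>\<bullet> ((h \<bullet>\<bullet> h') \<bullet>\<bullet> g')" "(h' \<bullet>\<bullet> g') \<bullet>\<bullet> (g \<bullet>\<bullet> h) = h' \<bullet>\<bullet> ((g' \<bullet>\<bullet> g) \<bullet>\<bullet> h)"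
  using w(1-4) finV by (simp_all add: mmul_assoc)
 then have 1: "(g \<bullet>\<bullet> h) \<bullet>\<bullet> (h' \<bullet>\<bullet> g') = mone R I" "(h' \<bullet>\<bullet> g') \<bullet>\<bullet> (g \<bullet>\<bullet> h) = mone R I" using w finV by simp_all
 have 2: "(g \<bullet>\<bullet> h) \<bullet>\<bullet> ext (bmat D k) = ext (bmat D k) \<bullet>\<bullet> (g \<bullet>\<bullet> h)" if k: "k \<in> basisB D" for k
 proof -
  have b: "ext (bmat D k) \<in> mats R I I" by simp
  have "(g \<bullet>\<bullet> h) \<bullet>\<bullet> ext (bmat D k) = g \<bullet>\<bullet> (ext (bmat D k) \<bullet>\<bullet> h)"
   using gh k w(1,2) b finV by (simp add: PEL_group_iff mmul_assoc)
  also have "\<dots> = (ext (bmat D k) \<bullet>\<bullet> g) \<bullet>\<bullet> h"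
   using gh k w(1,2) b finV by (subst mmul_assoc[symmetric]) (auto simp: PEL_group_iff)
  finally show ?thesis using w(1,2) b finV by (simp add: mmul_assoc)
 qed
 have "similitude (\<mu> \<otimes> \<nu>) (g \<bullet>\<bullet> h)" using w by (intro similitude_mult) auto
 then show "g \<otimes>\<^bsub>PEL_group D R\<^esub> h \<in> carrier (PEL_group D R)"
  using 1 2 w by (auto simp: PEL_group_iff intro!: bexI[of _ "h' \<bullet>\<bullet> g'"] bexI[of _ "\<mu> \<otimes> \<nu>"])
next
 have "mone R I \<bullet>\<bullet> ext (bmat D k) = ext (bmat D k) \<bullet>\<bullet> mone R I" for k using finV by simp
 then show "\<one>\<^bsub>PEL_group D R\<^esub> \<in> carrier (PEL_group D R)"
  using finV similitude_one by (auto simp: PEL_group_iff intro!: bexI[of _ "mone R I"])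
next
 fix g assume g: "g \<in> carrier (PEL_group D R)"
 then obtain g' \<mu> where w: "g \<in> mats R I I" "g' \<in> mats R I I"
  "g \<bullet>\<bullet> g' = mone R I" "g' \<bullet>\<bullet> g = mone R I" "\<mu> \<in> Units R" "similitude \<mu> g"
  by (auto simp: PEL_group_iff)
 have "g' \<bullet>\<bullet> ext (bmat D k) = ext (bmat D k) \<bullet>\<bullet> g'" if k: "k \<in> basisB D" for k
 proof -
  let ?b = "ext (bmat D k)"
  have b: "?b \<in> mats R I I" by simp
  have "g' \<bullet>\<bullet> ?b = g' \<bullet>\<bullet> (?b \<bullet>\<bullet> (g \<bullet>\<bullet> g'))" using w b finV by simp
  also have "\<dots> = g' \<bullet>\<bullet> ((?b \<bullet>\<bullet> g) \<bullet>\<bullet> g')" using w(1,2) b finV by (simp add: mmul_assoc)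
  also have "?b \<bullet>\<bullet> g = g \<bullet>\<bullet> ?b" using g k by (auto simp: PEL_group_iff)
  also have "g' \<bullet>\<bullet> (g \<bullet>\<bullet> ?b \<bullet>\<bullet> g') = (g' \<bullet>\<bullet> g) \<bullet>\<bullet> (?b \<bullet>\<bullet> g')" using w(1,2) b finV by (simp add: mmul_assoc)
  also have "\<dots> = ?b \<bullet>\<bullet> g'" using w b finV by simp
  finally show ?thesis .
 qed
 moreover have "similitude (inv \<mu>) g'" using w by (intro similitude_inverse)
 ultimately show "\<exists>h\<in>carrier (PEL_group D R). h \<otimes>\<^bsub>PEL_group D R\<^esub> g = \<one>\<^bsub>PEL_group D R\<^esub>"
  using w by (intro bexI[of _ g']) (auto simp: PEL_group_iff intro!: bexI[of _ g] bexI[of _ "inv \<mu>"])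
qed (auto simp: PEL_group_iff mmul_assoc finV)

lemma PEL_group_inv:
 assumes "g \<in> carrier (PEL_group D R)" "g' \<in> mats R I I" "g' \<bullet>\<bullet> g = mone R I"
 shows "inv\<^bsub>PEL_group D R\<^esub> g = g'"
proof -
 interpret G: group "PEL_group D R" by (rule PEL_group)
 let ?i = "inv\<^bsub>PEL_group D R\<^esub> g"
 have i: "?i \<in> carrier (PEL_group D R)" "g \<bullet>\<bullet> ?i = mone R I"
  using assms(1) G.inv_closed G.r_inv[of g] by auto
 have "?i = (g' \<bullet>\<bullet> g) \<bullet>\<bullet> ?i" using assms i finV PEL_group_mats[OF i(1)] by simp
 also have "\<dots> = g' \<bullet>\<bullet> (g \<bullet>\<bullet> ?i)"
  using PEL_group_mats[OF assms(1)] PEL_group_mats[OF i(1)] assms(2) finV by (intro mmul_assoc)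
 also have "\<dots> = g'" using assms i finV by simp
 finally show ?thesis .
qed

end

section \<open>Rings with carrier in the complex numbers\<close>

text \<open>At most the cardinality of \<open>complex\<close>: exactly the condition under which a
  ring has an isomorphic copy among the test rings of type \<open>complex ring\<close>.\<close>

definition small :: "'a set => bool"
 where "small A \<longleftrightarrow> (\<exists>\<iota> :: 'a => complex. inj_on \<iota> A)"

lemma small_complex [simp]: "small (A :: complex set)"
 unfolding small_def by (auto intro: exI[of _ id])

lemma small_image:
 assumes "small A" shows "small (g ` A)"
proof -
 obtain \<iota> :: "'a => complex" where "inj_on \<iota> A" using assms unfolding small_def by blast
 then have "inj_on (\<iota> \<circ> inv_into A g) (g ` A)"
  by (intro comp_inj_on inj_on_inv_into subset_refl) (erule inj_on_subset, blast intro: inv_into_into)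
 then show ?thesis unfolding small_def by blast
qed

lemma small_subset: "small B ==> A \<subseteq> B ==> small A"
 unfolding small_def using inj_on_subset by blast

lemma complex_pair_inj: "\<exists>p :: complex \<times> complex => complex. inj p"
proof -
 have "(card_of ((UNIV :: complex set) \<times> (UNIV :: complex set)), card_of (UNIV :: complex set)) \<in> ordLeq"
  using card_of_Times_same_infinite[of "UNIV :: complex set"] infinite_UNIV_char_0 ordIso_iff_ordLeq by blast
 then obtain p :: "complex \<times> complex => complex" where "inj_on p (UNIV \<times> UNIV)"
  unfolding card_of_ordLeq[symmetric] by blast
 then show ?thesis by auto
qed

lemma small_Times:
 assumes "small A" "small B" shows "small (A \<times> B)"
proof -
 obtain f :: "'a => complex" and g :: "'b => complex" where fg: "inj_on f A" "inj_on g B"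
  using assms unfolding small_def by blast
 obtain p :: "complex \<times> complex => complex" where "inj p" using complex_pair_inj by blast
 then have "inj_on (\<lambda>(a, b). p (f a, g b)) (A \<times> B)"
  using fg by (fastforce intro: inj_onI dest: injD inj_onD)
 then show ?thesis unfolding small_def by blast
qed

text \<open>An element is encoded by the first stage that contains it together with its code at that
  stage.\<close>

lemma small_UN_nat:
 assumes "!!n :: nat. small (K n)" shows "small (\<Union>n. K n)"
proof -
 obtain \<iota> :: "nat => 'a => complex" where i: "inj_on (\<iota> n) (K n)" for n
  using assms unfolding small_def by metis
 obtain p :: "complex \<times> complex => complex" where p: "inj p" using complex_pair_inj by blast
 let ?n = "\<lambda>x. LEAST n. x \<in> K n"
 have K: "x \<in> K (?n x)" if "x \<in> (\<Union>n. K n)" for x using that by (auto intro: LeastI)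
 have "inj_on (\<lambda>x. p (of_nat (?n x), \<iota> (?n x) x)) (\<Union>n. K n)"
 proof (rule inj_onI)
  fix x y assume xy: "x \<in> (\<Union>n. K n)" "y \<in> (\<Union>n. K n)"
   "p (of_nat (?n x), \<iota> (?n x) x) = p (of_nat (?n y), \<iota> (?n y) y)"
  then have e: "?n x = ?n y" "\<iota> (?n x) x = \<iota> (?n y) y" using injD[OF p xy(3)] by auto
  show "x = y"
   by (rule inj_onD[OF i[of "?n x"]]) (use e K[OF xy(1)] K[OF xy(2)] in \<open>simp_all only:\<close>)
 qed
 then show ?thesis unfolding small_def by blast
qed

text \<open>Transport of structure along the injection into \<open>complex\<close>. Every ring built
  below enters the domain of the functor \<open>f\<close> in this way.\<close>

lemma small_ring_iso:
 fixes A :: "'a ring"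
 assumes "cring A" "small (carrier A)"
 obtains A' :: "complex ring" and al be where "cring A'" "al \<in> Ring.ring_hom A A'" "be \<in> Ring.ring_hom A' A"
  "!!x. x \<in> carrier A ==> be (al x) = x" "!!x. x \<in> carrier A' ==> al (be x) = x"
proof -
 interpret A: cring A by fact
 obtain \<iota> :: "'a => complex" where i: "inj_on \<iota> (carrier A)" using assms(2) unfolding small_def by blast
 show thesis
 proof (rule that)
  have "image_ring \<iota> A \<lparr>zero := \<iota> \<zero>\<^bsub>A\<^esub>\<rparr> = image_ring \<iota> A"
   unfolding image_ring_zero[symmetric] by simp
  then show "cring (image_ring \<iota> A)"
   using A.ring_iso_imp_img_cring[OF inj_imp_image_ring_iso[OF i]] by simp
  show "\<iota> \<in> Ring.ring_hom A (image_ring \<iota> A)"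
   using inj_imp_image_ring_iso[OF i] unfolding ring_iso_def by blast
  show "inv_into (carrier A) \<iota> \<in> Ring.ring_hom (image_ring \<iota> A) A"
   using ring_iso_set_sym[OF A.ring_axioms inj_imp_image_ring_iso[OF i]] unfolding ring_iso_def by blast
 qed (use i in \<open>auto simp: image_ring_carrier f_inv_into_f\<close>)
qed

section \<open>Localization\<close>

locale localization = base_ring R for R :: "'u ring" (structure) +
 fixes S :: "'u set"
 assumes S_sub: "S \<subseteq> carrier R" and S_one: "\<one> \<in> S" and S_mult: "s \<in> S ==> t \<in> S ==> s \<otimes> t \<in> S"
begin

lemma S_cl [simp]: "s \<in> S ==> s \<in> carrier R" using S_sub by auto

text \<open>The equivalence class of the fraction \<open>r / s\<close>. The extra factor
  \<open>u\<close> is what makes the relation transitive in the presence of zero divisors.\<close>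

definition frac :: "'u => 'u => ('u \<times> 'u) set"
 where "frac r s = {(r', s'). r' \<in> carrier R \<and> s' \<in> S \<and> (\<exists>u\<in>S. u \<otimes> (r \<otimes> s') = u \<otimes> (r' \<otimes> s))}"

lemma frac_eq:
 assumes "r \<in> carrier R" "s \<in> S" "r' \<in> carrier R" "s' \<in> S"
 shows "frac r s = frac r' s' \<longleftrightarrow> (\<exists>u\<in>S. u \<otimes> (r \<otimes> s') = u \<otimes> (r' \<otimes> s))"
proof
 assume "frac r s = frac r' s'"
 moreover have "(r', s') \<in> frac r' s'" using assms S_one unfolding frac_def by auto
 ultimately have "(r', s') \<in> frac r s" by simp
 then show "\<exists>u\<in>S. u \<otimes> (r \<otimes> s') = u \<otimes> (r' \<otimes> s)" unfolding frac_def by auto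
next
 have sub: "frac r s \<subseteq> frac r' s'" if a: "r \<in> carrier R" "s \<in> S" "r' \<in> carrier R" "s' \<in> S"
  "u \<in> S" "u \<otimes> (r \<otimes> s') = u \<otimes> (r' \<otimes> s)" for r s r' s' u
 proof safe
  fix x t assume "(x, t) \<in> frac r s"
  then obtain v where v: "x \<in> carrier R" "t \<in> S" "v \<in> S" "v \<otimes> (r \<otimes> t) = v \<otimes> (x \<otimes> s)"
   unfolding frac_def by auto
  have "u \<otimes> v \<otimes> s \<otimes> (r' \<otimes> t) = (u \<otimes> (r' \<otimes> s)) \<otimes> (v \<otimes> t)" using a v by (simp add: m_ac)
  also have "\<dots> = (v \<otimes> (r \<otimes> t)) \<otimes> (u \<otimes> s')" using a(1-5) v(1-3) by (simp add: m_ac flip: a(6))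
  also have "\<dots> = u \<otimes> v \<otimes> s \<otimes> (x \<otimes> s')" using a(1-5) v(1-3) by (simp add: v(4) m_ac)
  finally show "(x, t) \<in> frac r' s'"
   using a v S_mult unfolding frac_def by blast
 qed
 assume "\<exists>u\<in>S. u \<otimes> (r \<otimes> s') = u \<otimes> (r' \<otimes> s)"
 then show "frac r s = frac r' s'" using sub assms by (metis subset_antisym)
qed

lemma frac_cancel: "r \<in> carrier R ==> s \<in> S ==> t \<in> S ==> frac (r \<otimes> t) (s \<otimes> t) = frac r s"
 using S_one by (subst frac_eq) (auto simp: S_mult m_ac intro!: bexI[of _ \<one>])

definition rep :: "('u \<times> 'u) set => 'u \<times> 'u" where "rep x = (SOME p. p \<in> x)"

text \<open>The operations are computed on chosen representatives; \<open>loc_mult\<close> and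
  \<open>loc_add\<close> show that the choice is immaterial.\<close>

definition loc :: "('u \<times> 'u) set ring"
 where "loc = \<lparr> carrier = {frac r s |r s. r \<in> carrier R \<and> s \<in> S},
  monoid.mult = (\<lambda>x y. frac (fst (rep x) \<otimes> fst (rep y)) (snd (rep x) \<otimes> snd (rep y))),
  one = frac \<one> \<one>, zero = frac \<zero> \<one>,
  add = (\<lambda>x y. frac (fst (rep x) \<otimes> snd (rep y) \<oplus> fst (rep y) \<otimes> snd (rep x)) (snd (rep x) \<otimes> snd (rep y))) \<rparr>"

lemma rep_frac:
 assumes "r \<in> carrier R" "s \<in> S"
 obtains r' s' u where "rep (frac r s) = (r', s')" "r' \<in> carrier R" "s' \<in> S" "u \<in> S" "u \<otimes> (r \<otimes> s') = u \<otimes> (r' \<otimes> s)"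
proof -
 have "(r, s) \<in> frac r s" using assms S_one unfolding frac_def by auto
 then have "rep (frac r s) \<in> frac r s" unfolding rep_def by (rule someI)
 then show thesis using that unfolding frac_def by auto
qed

lemma loc_mult:
 assumes "r \<in> carrier R" "s \<in> S" "x \<in> carrier R" "t \<in> S"
 shows "frac r s \<otimes>\<^bsub>loc\<^esub> frac x t = frac (r \<otimes> x) (s \<otimes> t)"
proof -
 obtain r' s' u where 1: "rep (frac r s) = (r', s')" "r' \<in> carrier R" "s' \<in> S" "u \<in> S" "u \<otimes> (r \<otimes> s') = u \<otimes> (r' \<otimes> s)"
  using rep_frac assms by metis
 obtain x' t' v where 2: "rep (frac x t) = (x', t')" "x' \<in> carrier R" "t' \<in> S" "v \<in> S" "v \<otimes> (x \<otimes> t') = v \<otimes> (x' \<otimes> t)"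
  using rep_frac assms by metis
 have "u \<otimes> v \<otimes> (r' \<otimes> x' \<otimes> (s \<otimes> t)) = (u \<otimes> (r' \<otimes> s)) \<otimes> (v \<otimes> (x' \<otimes> t))"
  using assms 1(2-4) 2(2-4) by (simp add: m_ac)
 also have "\<dots> = u \<otimes> v \<otimes> (r \<otimes> x \<otimes> (s' \<otimes> t'))"
  unfolding 1(5)[symmetric] 2(5)[symmetric] using assms 1(2-4) 2(2-4) by (simp add: m_ac)
 finally show ?thesis
  using assms 1 2 unfolding loc_def by (auto simp: frac_eq S_mult intro!: bexI[of _ "u \<otimes> v"])
qed

lemma loc_add:
 assumes "r \<in> carrier R" "s \<in> S" "x \<in> carrier R" "t \<in> S"
 shows "frac r s \<oplus>\<^bsub>loc\<^esub> frac x t = frac (r \<otimes> t \<oplus> x \<otimes> s) (s \<otimes> t)"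
proof -
 obtain r' s' u where 1: "rep (frac r s) = (r', s')" "r' \<in> carrier R" "s' \<in> S" "u \<in> S" "u \<otimes> (r \<otimes> s') = u \<otimes> (r' \<otimes> s)"
  using rep_frac assms by metis
 obtain x' t' v where 2: "rep (frac x t) = (x', t')" "x' \<in> carrier R" "t' \<in> S" "v \<in> S" "v \<otimes> (x \<otimes> t') = v \<otimes> (x' \<otimes> t)"
  using rep_frac assms by metis
 have "u \<otimes> v \<otimes> ((r' \<otimes> t' \<oplus> x' \<otimes> s') \<otimes> (s \<otimes> t)) = (u \<otimes> (r' \<otimes> s)) \<otimes> (v \<otimes> t' \<otimes> t) \<oplus> (v \<otimes> (x' \<otimes> t)) \<otimes> (u \<otimes> s' \<otimes> s)"
  using assms 1(2-4) 2(2-4) by (simp add: m_ac l_distr r_distr)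
 also have "\<dots> = u \<otimes> v \<otimes> ((r \<otimes> t \<oplus> x \<otimes> s) \<otimes> (s' \<otimes> t'))"
  unfolding 1(5)[symmetric] 2(5)[symmetric]
  using assms 1(2-4) 2(2-4) by (simp add: m_ac l_distr r_distr)
 finally show ?thesis
  using assms 1 2 unfolding loc_def by (auto simp: frac_eq S_mult intro!: bexI[of _ "u \<otimes> v"])
qed

lemma loc_carrier: "x \<in> carrier loc \<longleftrightarrow> (\<exists>r\<in>carrier R. \<exists>s\<in>S. x = frac r s)"
 unfolding loc_def by auto

lemma frac_closed [simp]: "r \<in> carrier R ==> s \<in> S ==> frac r s \<in> carrier loc"
 unfolding loc_def by auto

lemma loc_one: "\<one>\<^bsub>loc\<^esub> = frac \<one> \<one>" and loc_zero: "\<zero>\<^bsub>loc\<^esub> = frac \<zero> \<one>"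
 unfolding loc_def by auto

lemma cring_loc: "cring loc"
proof (rule cringI)
 show "abelian_group loc"
 proof (rule abelian_groupI)
  fix x y z assume "x \<in> carrier loc" "y \<in> carrier loc" "z \<in> carrier loc"
  then obtain r s r' s' r'' s'' where "x = frac r s" "y = frac r' s'" "z = frac r'' s''" "r \<in> carrier R" "s \<in> S"
   "r' \<in> carrier R" "s' \<in> S" "r'' \<in> carrier R" "s'' \<in> S" by (auto simp: loc_carrier)
  then show "x \<oplus>\<^bsub>loc\<^esub> y \<oplus>\<^bsub>loc\<^esub> z = x \<oplus>\<^bsub>loc\<^esub> (y \<oplus>\<^bsub>loc\<^esub> z)"
   by (simp add: loc_add S_mult l_distr r_distr m_ac a_ac)
 next
  fix x y assume "x \<in> carrier loc" "y \<in> carrier loc"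
  then obtain r s r' s' where w: "x = frac r s" "y = frac r' s'" "r \<in> carrier R" "s \<in> S"
   "r' \<in> carrier R" "s' \<in> S" by (auto simp: loc_carrier)
  then show "x \<oplus>\<^bsub>loc\<^esub> y = y \<oplus>\<^bsub>loc\<^esub> x" by (simp add: loc_add m_ac a_ac)
  show "x \<oplus>\<^bsub>loc\<^esub> y \<in> carrier loc" using w by (simp add: loc_add S_mult)
 next
  show "\<zero>\<^bsub>loc\<^esub> \<in> carrier loc" using S_one by (auto simp: loc_carrier loc_zero)
 next
  fix x assume "x \<in> carrier loc"
  then obtain r s where w: "x = frac r s" "r \<in> carrier R" "s \<in> S" by (auto simp: loc_carrier)
  then show "\<zero>\<^bsub>loc\<^esub> \<oplus>\<^bsub>loc\<^esub> x = x" using S_one by (simp add: loc_add loc_zero)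
  have "(\<ominus> r \<otimes> s \<oplus> r \<otimes> s) = \<zero>" using w by (simp add: l_minus l_neg)
  then have "frac (\<ominus> r) s \<oplus>\<^bsub>loc\<^esub> x = \<zero>\<^bsub>loc\<^esub>"
   using w S_one by (auto simp: loc_add loc_zero frac_eq S_mult intro!: bexI[of _ \<one>])
  then show "\<exists>y\<in>carrier loc. y \<oplus>\<^bsub>loc\<^esub> x = \<zero>\<^bsub>loc\<^esub>" using w by (intro bexI) (auto simp: loc_carrier)
 qed
 show "comm_monoid loc"
 proof (rule comm_monoidI)
  fix x y z assume "x \<in> carrier loc" "y \<in> carrier loc" "z \<in> carrier loc"
  then obtain r s r' s' r'' s'' where "x = frac r s" "y = frac r' s'" "z = frac r'' s''" "r \<in> carrier R" "s \<in> S"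
   "r' \<in> carrier R" "s' \<in> S" "r'' \<in> carrier R" "s'' \<in> S" by (auto simp: loc_carrier)
  then show "x \<otimes>\<^bsub>loc\<^esub> y \<otimes>\<^bsub>loc\<^esub> z = x \<otimes>\<^bsub>loc\<^esub> (y \<otimes>\<^bsub>loc\<^esub> z)"
   by (simp add: loc_mult S_mult m_ac)
 next
  fix x y assume "x \<in> carrier loc" "y \<in> carrier loc"
  then obtain r s r' s' where w: "x = frac r s" "y = frac r' s'" "r \<in> carrier R" "s \<in> S"
   "r' \<in> carrier R" "s' \<in> S" by (auto simp: loc_carrier)
  then show "x \<otimes>\<^bsub>loc\<^esub> y = y \<otimes>\<^bsub>loc\<^esub> x" by (simp add: loc_mult m_ac)
  show "x \<otimes>\<^bsub>loc\<^esub> y \<in> carrier loc" using w by (simp add: loc_mult S_mult)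
 next
  show "\<one>\<^bsub>loc\<^esub> \<in> carrier loc" using S_one by (auto simp: loc_carrier loc_one)
 next
  fix x assume "x \<in> carrier loc"
  then obtain r s where w: "x = frac r s" "r \<in> carrier R" "s \<in> S" by (auto simp: loc_carrier)
  then show "\<one>\<^bsub>loc\<^esub> \<otimes>\<^bsub>loc\<^esub> x = x" using S_one by (simp add: loc_mult loc_one)
 qed
 fix x y z assume "x \<in> carrier loc" "y \<in> carrier loc" "z \<in> carrier loc"
 then obtain r s r' s' r'' s'' where w: "x = frac r s" "y = frac r' s'" "z = frac r'' s''" "r \<in> carrier R" "s \<in> S"
  "r' \<in> carrier R" "s' \<in> S" "r'' \<in> carrier R" "s'' \<in> S" by (auto simp: loc_carrier)
 have "(r \<otimes> r'' \<otimes> (s' \<otimes> s'') \<oplus> r' \<otimes> r'' \<otimes> (s \<otimes> s'')) = (r \<otimes> s' \<oplus> r' \<otimes> s) \<otimes> r'' \<otimes> s''"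
  "s \<otimes> s'' \<otimes> (s' \<otimes> s'') = s \<otimes> s' \<otimes> s'' \<otimes> s''"
  using w by (simp_all add: l_distr r_distr m_ac)
 then show "(x \<oplus>\<^bsub>loc\<^esub> y) \<otimes>\<^bsub>loc\<^esub> z = x \<otimes>\<^bsub>loc\<^esub> z \<oplus>\<^bsub>loc\<^esub> y \<otimes>\<^bsub>loc\<^esub> z"
  using w by (simp add: loc_add loc_mult S_mult frac_cancel)
qed

lemma frac_hom: "(\<lambda>r. frac r \<one>) \<in> Ring.ring_hom R loc"
 by (rule ring_hom_memI) (use S_one in \<open>auto simp: loc_carrier loc_mult loc_add loc_one\<close>)

end

lemma (in cring) ideal_closureI:
 assumes "J \<subseteq> carrier R" "\<zero> \<in> J" "!!x y. x \<in> J ==> y \<in> J ==> x \<oplus> y \<in> J"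
  "!!r x. r \<in> carrier R ==> x \<in> J ==> r \<otimes> x \<in> J"
 shows "ideal J R"
proof (rule idealI)
 show "subgroup J (add_monoid R)"
 proof (rule add.subgroupI)
  fix x assume x: "x \<in> J"
  then have "\<ominus> x = (\<ominus> \<one>) \<otimes> x" using assms(1) l_minus[of \<one> x] by auto
  then show "\<ominus> x \<in> J" using assms(4)[of "\<ominus> \<one>" x] x by simp
 qed (use assms in auto)
 fix x r assume "x \<in> J" "r \<in> carrier R"
 then show "x \<otimes> r \<in> J" using assms(1) assms(4)[of r x] m_comm[of x r] by auto
qed (use assms in \<open>auto intro: ring_axioms\<close>)

text \<open>The localization is taken at a maximal ideal containing the annihilator of
  \<open>a\<close>. If \<open>a\<close> became zero there, some element outside that ideal would
  annihilate it. Locality is recorded as a proper ideal \<open>M\<close> all of whose non-members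
  are units.\<close>

lemma local_ring_extension:
 fixes A :: "complex ring"
 assumes "cring A" "a \<in> carrier A" "a ~= \<zero>\<^bsub>A\<^esub>"
 obtains L :: "complex ring" and be and M where "cring L" "be \<in> Ring.ring_hom A L" "be a ~= \<zero>\<^bsub>L\<^esub>"
  "ideal M L" "\<one>\<^bsub>L\<^esub> \<notin> M" "!!x. x \<in> carrier L ==> x \<notin> M ==> x \<in> Units L"
proof -
 interpret A: base_ring A using assms(1) by (simp add: base_ring_def)
 define Ann where "Ann = {r \<in> carrier A. r \<otimes>\<^bsub>A\<^esub> a = \<zero>\<^bsub>A\<^esub>}"
 have Ann: "ideal Ann A"
  by (rule A.ideal_closureI) (use assms(2) in \<open>auto simp: Ann_def A.l_distr A.m_assoc\<close>)
 \<comment> \<open>Proper ideals above the annihilator. A maximal member of this family is a maximal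
   ideal of \<open>A\<close>, since every larger ideal also contains the annihilator.\<close>
 define F where "F = {J. ideal J A \<and> Ann \<subseteq> J \<and> \<one>\<^bsub>A\<^esub> \<notin> J}"
 have "\<one>\<^bsub>A\<^esub> \<notin> Ann" using assms by (simp add: Ann_def)
 then have "F ~= {}" using Ann unfolding F_def by auto
 moreover have "\<Union>C \<in> F" if C: "C ~= {}" "subset.chain F C" for C
 proof -
  have id: "!!J. J \<in> C ==> ideal J A" using C(2) unfolding subset.chain_def F_def by auto
  have sub: "!!J. J \<in> C ==> additive_subgroup J A" using id unfolding ideal_def by auto
  have "ideal (\<Union>C) A"
  proof (rule A.ideal_closureI)
   fix x y assume "x \<in> \<Union>C" "y \<in> \<Union>C"
   then obtain J K where "J \<in> C" "x \<in> J" "K \<in> C" "y \<in> K" by blast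
   moreover have "J \<subseteq> K | K \<subseteq> J" using \<open>J \<in> C\<close> \<open>K \<in> C\<close> C(2) unfolding subset.chain_def by blast
   ultimately obtain J where "J \<in> C" "x \<in> J" "y \<in> J" by blast
   then show "x \<oplus>\<^bsub>A\<^esub> y \<in> \<Union>C" using additive_subgroup.a_closed[OF sub] by blast
  next
   fix x r assume "x \<in> \<Union>C" "r \<in> carrier A"
   then show "r \<otimes>\<^bsub>A\<^esub> x \<in> \<Union>C" using ideal.I_l_closed[OF id] by blast
  next
   show "\<zero>\<^bsub>A\<^esub> \<in> \<Union>C" using C(1) additive_subgroup.zero_closed[OF sub] by blast
   show "\<Union>C \<subseteq> carrier A" using additive_subgroup.a_subset[OF sub] by blast
  qed
  then show ?thesis using C unfolding subset.chain_def F_def by blast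
 qed
 ultimately obtain m where m: "m \<in> F" "\<forall>J. J \<in> F --> m \<subseteq> J --> J = m"
  using subset_Zorn_nonempty[of F] by blast
 interpret m: ideal m A using m(1) unfolding F_def by auto
 have "maximalideal m A"
 proof (rule maximalidealI)
  show "carrier A ~= m" using m(1) unfolding F_def by auto
  fix J assume J: "ideal J A" "m \<subseteq> J" "J \<subseteq> carrier A"
  show "J = m | J = carrier A"
  proof (cases "\<one>\<^bsub>A\<^esub> \<in> J")
   case True then show ?thesis using ideal.one_imp_carrier[OF J(1)] by auto
  next
   case False
   then have "J \<in> F" using J m(1) unfolding F_def by auto
   then show ?thesis using J m(2) by auto
  qed
 qed (rule m.ideal_axioms)
 then interpret m: primeideal m A by (rule A.maximalideal_prime)
 define S where "S = carrier A - m"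
 interpret loc: localization A S
 proof
  show "\<one>\<^bsub>A\<^esub> \<in> S" using m(1) unfolding S_def F_def by auto
 qed (use m.I_prime in \<open>auto simp: S_def\<close>)
 interpret C: cring loc.loc by (rule loc.cring_loc)
 \<comment> \<open>A fraction is determined by two elements of the type
   \<open>complex\<close>.\<close>
 have "small (carrier loc.loc)"
 proof (rule small_subset)
  show "small ((\<lambda>(r, s). loc.frac r s) ` (UNIV :: (complex \<times> complex) set))"
   unfolding UNIV_Times_UNIV[symmetric] by (intro small_image small_Times small_complex)
  show "carrier loc.loc \<subseteq> (\<lambda>(r, s). loc.frac r s) ` UNIV" by (auto simp: loc.loc_def)
 qed
 then obtain L :: "complex ring" and al be where L: "cring L" "al \<in> Ring.ring_hom loc.loc L" "be \<in> Ring.ring_hom L loc.loc"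
  "!!x. x \<in> carrier loc.loc ==> be (al x) = x" "!!x. x \<in> carrier L ==> al (be x) = x"
  using small_ring_iso[OF loc.cring_loc] by metis
 interpret a: ring_hom_cring loc.loc L al
  using L loc.cring_loc by (simp add: ring_hom_cring_def ring_hom_cring_axioms_def)
 interpret b: ring_hom_cring L loc.loc be
  using L loc.cring_loc by (simp add: ring_hom_cring_def ring_hom_cring_axioms_def)
 have zero: "loc.frac r s = \<zero>\<^bsub>loc.loc\<^esub> \<longleftrightarrow> (\<exists>u\<in>S. u \<otimes>\<^bsub>A\<^esub> r = \<zero>\<^bsub>A\<^esub>)" if "r \<in> carrier A" "s \<in> S" for r s
  using that loc.S_one by (simp add: loc.loc_zero loc.frac_eq)
 \<comment> \<open>The maximal ideal of the localization. By \<open>mem\<close>, membership can be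
   read off from the numerator of any representation.\<close>
 define N where "N = {loc.frac r s |r s. r \<in> m \<and> s \<in> S}"
 have mem: "loc.frac r s \<in> N \<longleftrightarrow> r \<in> m" if rs: "r \<in> carrier A" "s \<in> S" for r s
 proof
  assume "loc.frac r s \<in> N"
  then obtain r' s' where "loc.frac r s = loc.frac r' s'" "r' \<in> m" "s' \<in> S" unfolding N_def by auto
  then obtain u where "u \<in> S" "u \<otimes>\<^bsub>A\<^esub> (r \<otimes>\<^bsub>A\<^esub> s') = u \<otimes>\<^bsub>A\<^esub> (r' \<otimes>\<^bsub>A\<^esub> s)"
   using rs loc.frac_eq[of r s r' s'] m.Icarr by auto
  moreover have "u \<otimes>\<^bsub>A\<^esub> (r' \<otimes>\<^bsub>A\<^esub> s) \<in> m"
   using \<open>r' \<in> m\<close> \<open>u \<in> S\<close> rs by (simp add: m.I_l_closed m.I_r_closed)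
  ultimately show "r \<in> m" using m.I_prime rs \<open>s' \<in> S\<close> unfolding S_def by (metis A.m_closed DiffD1 DiffD2)
 qed (use rs in \<open>auto simp: N_def\<close>)
 have Nsub: "N \<subseteq> carrier loc.loc" unfolding N_def using m.Icarr by auto
 have Nadd: "x \<oplus>\<^bsub>loc.loc\<^esub> y \<in> N" if xy: "x \<in> N" "y \<in> N" for x y
 proof -
  obtain r s r' s' where w: "x = loc.frac r s" "y = loc.frac r' s'" "r \<in> m" "s \<in> S" "r' \<in> m" "s' \<in> S"
   using xy unfolding N_def by blast
  then have "r \<otimes>\<^bsub>A\<^esub> s' \<oplus>\<^bsub>A\<^esub> r' \<otimes>\<^bsub>A\<^esub> s \<in> m" by (intro m.a_closed m.I_r_closed) auto
  then show ?thesis using w m.Icarr unfolding N_def by (auto simp: loc.loc_add intro: loc.S_mult)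
 qed
 have Nmul: "y \<otimes>\<^bsub>loc.loc\<^esub> x \<in> N" if xy: "y \<in> carrier loc.loc" "x \<in> N" for x y
 proof -
  obtain r s r' s' where w: "x = loc.frac r s" "y = loc.frac r' s'" "r \<in> m" "s \<in> S" "r' \<in> carrier A" "s' \<in> S"
   using xy unfolding N_def loc.loc_carrier by blast
  then have "r' \<otimes>\<^bsub>A\<^esub> r \<in> m" by (intro m.I_l_closed) auto
  then show ?thesis using w m.Icarr unfolding N_def by (auto simp: loc.loc_mult intro: loc.S_mult)
 qed
 have N: "ideal N loc.loc"
 proof (rule C.ideal_closureI)
  show "\<zero>\<^bsub>loc.loc\<^esub> \<in> N" using loc.S_one mem[of "\<zero>\<^bsub>A\<^esub>" "\<one>\<^bsub>A\<^esub>"] by (simp add: loc.loc_zero)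
 qed (use Nmul Nsub Nadd in auto)
 show thesis
 proof (rule that[OF L(1)])
  show "al \<circ> (\<lambda>r. loc.frac r \<one>\<^bsub>A\<^esub>) \<in> Ring.ring_hom A L" using ring_hom_trans[OF loc.frac_hom L(2)] .
  have "u \<otimes>\<^bsub>A\<^esub> a ~= \<zero>\<^bsub>A\<^esub>" if "u \<in> S" for u
  proof -
   have "u \<notin> Ann" using that m(1) unfolding S_def F_def by auto
   then show ?thesis using that unfolding Ann_def S_def by auto
  qed
  then have "loc.frac a \<one>\<^bsub>A\<^esub> ~= \<zero>\<^bsub>loc.loc\<^esub>" using zero assms(2) loc.S_one by auto
  moreover have "loc.frac a \<one>\<^bsub>A\<^esub> \<in> carrier loc.loc" using assms(2) loc.S_one by (auto simp: loc.loc_carrier)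
  ultimately show "(al \<circ> (\<lambda>r. loc.frac r \<one>\<^bsub>A\<^esub>)) a ~= \<zero>\<^bsub>L\<^esub>" using L(4) b.hom_zero by (metis comp_apply)
  interpret N: ideal N loc.loc by (rule N)
  show "ideal {x \<in> carrier L. be x \<in> N} L"
   by (rule cring.ideal_closureI[OF L(1)]) (auto intro: N.a_closed N.I_l_closed N.zero_closed)
  show "\<one>\<^bsub>L\<^esub> \<notin> {x \<in> carrier L. be x \<in> N}"
   using mem[of "\<one>\<^bsub>A\<^esub>" "\<one>\<^bsub>A\<^esub>"] loc.S_one S_def unfolding loc.loc_one[symmetric] by auto
  fix x assume x: "x \<in> carrier L" "x \<notin> {x \<in> carrier L. be x \<in> N}"
  then obtain r s where rs: "be x = loc.frac r s" "r \<in> carrier A" "s \<in> S"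
   using b.hom_closed[of x] by (auto simp: loc.loc_carrier)
  then have "r \<in> S" using x mem by (auto simp: S_def)
  then have y: "loc.frac s r \<in> carrier loc.loc" "be x \<otimes>\<^bsub>loc.loc\<^esub> loc.frac s r = \<one>\<^bsub>loc.loc\<^esub>"
   using rs loc.S_one by (auto simp: loc.loc_mult loc.loc_one loc.frac_eq loc.S_mult A.m_comm)
  then have "x \<otimes>\<^bsub>L\<^esub> al (loc.frac s r) = \<one>\<^bsub>L\<^esub>"
   using x L(5)[of x] a.hom_mult[of "be x" "loc.frac s r"] by simp
  then show "x \<in> Units L"
   using x y(1) a.S.m_comm[of x "al (loc.frac s r)"] unfolding Units_def
   by (auto intro!: bexI[of _ "al (loc.frac s r)"])
 qed
qed

lemma small_singleton: "small {x}"
 unfolding small_def by (rule exI[of _ "\<lambda>_. 0"]) simp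

section \<open>Extension of scalars to the complex numbers\<close>

abbreviation CR :: "complex ring"
 where "CR \<equiv> ring_of_type_algebra"

text \<open>
 \<open>R \<otimes> \<complex>\<close> is realized as the ring of operators on the additive maps \<open>\<psi>: \<complex> \<rightarrow> R\<close> generated by the
 operators taking \<open>\<psi>\<close> to \<open>\<lambda>d. r \<psi>(c d)\<close>; evaluation at \<open>\<psi>\<close> and \<open>d = 1\<close> is the functional \<open>id \<otimes> \<psi>\<close>.
\<close>

text \<open>Marks applications, so that closure rules do not match arbitrary terms.\<close>

definition ap :: "('a => 'b) => 'a => 'b" where "ap f x = f x"

locale complexification = base_ring R for R :: "'u ring" (structure)
begin

definition maps :: "(complex => 'u) set"
 where "maps = {\<psi>. (\<forall>c. ap \<psi> c \<in> carrier R) \<and> (\<forall>c d. ap \<psi> (c + d) = ap \<psi> c \<oplus> ap \<psi> d)}"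

lemma maps_closed [simp]: "\<psi> \<in> maps ==> ap \<psi> c \<in> carrier R"
 and maps_add: "\<psi> \<in> maps ==> ap \<psi> (c + d) = ap \<psi> c \<oplus> ap \<psi> d"
 unfolding maps_def by auto

lemma mapsI: "(!!c. ap \<psi> c \<in> carrier R) ==> (!!c d. ap \<psi> (c + d) = ap \<psi> c \<oplus> ap \<psi> d) ==> \<psi> \<in> maps"
 unfolding maps_def by blast

definition mscale :: "'u => complex => (complex => 'u) => (complex => 'u)"
 where "mscale r c \<psi> = (\<lambda>d. r \<otimes> ap \<psi> (c * d))"

definition madd2 :: "(complex => 'u) => (complex => 'u) => (complex => 'u)"
 where "madd2 \<psi> \<psi>' = (\<lambda>d. ap \<psi> d \<oplus> ap \<psi>' d)"

definition mzero :: "complex => 'u" where "mzero = (\<lambda>d. \<zero>)"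

lemma ap_maps [simp]:
 "ap (mscale r c \<psi>) d = r \<otimes> ap \<psi> (c * d)" "ap (madd2 \<psi> \<psi>') d = ap \<psi> d \<oplus> ap \<psi>' d" "ap mzero d = \<zero>"
 unfolding mscale_def madd2_def mzero_def by (simp_all add: ap_def)

lemma maps_eqI: "(!!d. ap \<psi> d = ap \<psi>' d) ==> \<psi> = \<psi>'"
 unfolding ap_def by auto

lemma maps_sum [simp]: "\<psi> \<in> maps ==> \<psi>' \<in> maps ==> madd2 \<psi> \<psi>' \<in> maps"
 by (rule mapsI) (simp_all add: maps_add a_ac)

lemma maps_scale [simp]: "\<psi> \<in> maps ==> r \<in> carrier R ==> mscale r c \<psi> \<in> maps"
 by (rule mapsI) (simp_all add: maps_add r_distr distrib_left)

lemma zero_maps [simp]: "mzero \<in> maps"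
 by (rule mapsI) simp_all

definition opz :: "(complex => 'u) => (complex => 'u)"
 where "opz = (\<lambda>\<psi> \<in> maps. mzero)"

definition opu :: "'u => complex => (complex => 'u) => (complex => 'u)"
 where "opu r c = (\<lambda>\<psi> \<in> maps. mscale r c \<psi>)"

definition opadd :: "((complex => 'u) => (complex => 'u)) => ((complex => 'u) => (complex => 'u)) => (complex => 'u) => (complex => 'u)"
 where "opadd F G = (\<lambda>\<psi> \<in> maps. madd2 (ap F \<psi>) (ap G \<psi>))"

definition opmul :: "((complex => 'u) => (complex => 'u)) => ((complex => 'u) => (complex => 'u)) => (complex => 'u) => (complex => 'u)"
 where "opmul F G = (\<lambda>\<psi> \<in> maps. ap F (ap G \<psi>))"

definition opone :: "(complex => 'u) => (complex => 'u)"
 where "opone = (\<lambda>\<psi> \<in> maps. \<psi>)"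

lemma ap_ops [simp]:
 assumes "\<psi> \<in> maps"
 shows "ap opz \<psi> = mzero" "ap (opu r c) \<psi> = mscale r c \<psi>" "ap (opadd F G) \<psi> = madd2 (ap F \<psi>) (ap G \<psi>)"
  "ap (opmul F G) \<psi> = ap F (ap G \<psi>)" "ap opone \<psi> = \<psi>"
 using assms unfolding opz_def opu_def opadd_def opmul_def opone_def ap_def by auto

lemma op_ext [simp]: "opz \<in> extensional maps" "opadd F G \<in> extensional maps"
 "opu r c \<in> extensional maps" "opmul F G \<in> extensional maps" "opone \<in> extensional maps"
 unfolding opz_def opadd_def opu_def opmul_def opone_def by auto

text \<open>Finite sums of operators \<open>opu r c\<close>, which play the part of
  \<open>r \<otimes> c\<close>, generated one summand at a time so that closure and cardinality go
  by induction.\<close>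

inductive_set ops :: "((complex => 'u) => (complex => 'u)) set" where
 zero: "opz \<in> ops"
| cons: "F \<in> ops ==> r \<in> carrier R ==> opadd (opu r c) F \<in> ops"

declare ops.zero [simp]

lemma ops_maps [simp]: "F \<in> ops ==> \<psi> \<in> maps ==> ap F \<psi> \<in> maps"
 by (induction rule: ops.induct) auto

lemma ops_extensional: "F \<in> ops ==> F \<in> extensional maps"
 by (induction rule: ops.induct) auto

lemma op_eqI:
 assumes "F \<in> extensional maps" "G \<in> extensional maps" "!!\<psi> d. \<psi> \<in> maps ==> ap (ap F \<psi>) d = ap (ap G \<psi>) d"
 shows "F = G"
proof (rule extensionalityI[OF assms(1,2)])
 fix \<psi> assume "\<psi> \<in> maps"
 then have "ap F \<psi> = ap G \<psi>" using assms(3) by (intro maps_eqI)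
 then show "F \<psi> = G \<psi>" unfolding ap_def .
qed

lemma ops_add_arg: "F \<in> ops ==> \<psi> \<in> maps ==> \<psi>' \<in> maps ==> ap F (madd2 \<psi> \<psi>') = madd2 (ap F \<psi>) (ap F \<psi>')"
 by (induction rule: ops.induct) (auto simp: r_distr a_ac intro!: maps_eqI)

text \<open>Generators commute with each other, and hence with sums of generators. This is the
  source of commutativity in \<open>ops_commute\<close>.\<close>

lemma ops_scale_arg:
 "F \<in> ops ==> \<psi> \<in> maps ==> r \<in> carrier R ==> ap F (mscale r c \<psi>) = mscale r c (ap F \<psi>)"
 by (induction rule: ops.induct) (auto simp: r_distr m_ac mult.left_commute intro!: maps_eqI)

lemma opadd_closed [simp]: "F \<in> ops ==> G \<in> ops ==> opadd F G \<in> ops"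
proof (induction rule: ops.induct)
 case zero
 have "opadd opz G = G"
  using zero ops_extensional by (intro op_eqI) auto
 then show ?case using zero by simp
next
 case (cons F r c)
 have "opadd (opadd (opu r c) F) G = opadd (opu r c) (opadd F G)"
  using cons by (intro op_eqI) (auto simp: a_assoc)
 then show ?case using cons ops.cons by simp
qed

lemma opu_closed [simp]: "r \<in> carrier R ==> opu r c \<in> ops"
proof -
 assume r: "r \<in> carrier R"
 have "opu r c = opadd (opu r c) opz" using r by (intro op_eqI) auto
 also have "\<dots> \<in> ops" using r by (intro ops.cons ops.zero)
 finally show ?thesis .
qed

lemma opu_mul_closed: "F \<in> ops ==> r \<in> carrier R ==> opmul (opu r c) F \<in> ops"
proof (induction rule: ops.induct)
 case zero
 have "opmul (opu r c) opz = opz" using zero by (intro op_eqI) auto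
 then show ?case by simp
next
 case (cons F s e)
 have "opmul (opu r c) (opadd (opu s e) F) = opadd (opu (r \<otimes> s) (e * c)) (opmul (opu r c) F)"
  using cons by (intro op_eqI) (auto simp: r_distr m_assoc mult.assoc)
 then show ?case using cons ops.cons by simp
qed

lemma opmul_closed [simp]: "F \<in> ops ==> G \<in> ops ==> opmul F G \<in> ops"
proof (induction rule: ops.induct)
 case zero
 have "opmul opz G = opz" using zero by (intro op_eqI) auto
 then show ?case by simp
next
 case (cons F r c)
 have "opmul (opadd (opu r c) F) G = opadd (opmul (opu r c) G) (opmul F G)"
  using cons by (intro op_eqI) auto
 then show ?case using cons opu_mul_closed by simp
qed

lemma ops_commute: "F \<in> ops ==> G \<in> ops ==> \<psi> \<in> maps ==> ap F (ap G \<psi>) = ap G (ap F \<psi>)"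
proof (induction rule: ops.induct)
 case zero
 \<comment> \<open>Writing the zero map as a multiple of \<open>\<psi>\<close> lets
   \<open>ops_scale_arg\<close> show that \<open>G\<close> sends it to zero.\<close>
 have "mzero = mscale \<zero> 0 \<psi>" "ap G (mscale \<zero> 0 \<psi>) = mscale \<zero> 0 (ap G \<psi>)"
  using zero ops_scale_arg[of G \<psi> \<zero> 0] by (auto intro!: maps_eqI)
 moreover have "mscale \<zero> 0 (ap G \<psi>) = mzero" using zero by (auto intro!: maps_eqI)
 ultimately show ?case using zero by simp
next
 case (cons F r c)
 then show ?case by (simp add: ops_add_arg ops_scale_arg)
qed

definition cx :: "((complex => 'u) => (complex => 'u)) ring"
 where "cx = \<lparr> carrier = ops, monoid.mult = opmul, one = opone, zero = opz, add = opadd \<rparr>"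

lemma cx_simps [simp]: "carrier cx = ops" "monoid.mult cx = opmul" "one cx = opone" "ring.zero cx = opz" "ring.add cx = opadd"
 unfolding cx_def by auto

lemma opone_eq: "opone = opu \<one> 1"
 by (intro op_eqI) auto

lemma cring_cx: "cring cx"
proof (rule cringI)
 show "abelian_group cx"
 proof (rule abelian_groupI)
  fix F assume F: "F \<in> carrier cx"
  have "opadd (opmul (opu (\<ominus> \<one>) 1) F) F = opz"
   using F by (intro op_eqI) (auto simp: l_minus l_neg)
  moreover have "opmul (opu (\<ominus> \<one>) 1) F \<in> ops" using F by simp
  ultimately show "\<exists>G\<in>carrier cx. G \<oplus>\<^bsub>cx\<^esub> F = \<zero>\<^bsub>cx\<^esub>"
   by (intro bexI[of _ "opmul (opu (\<ominus> \<one>) 1) F"]) simp_all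
  show "\<zero>\<^bsub>cx\<^esub> \<oplus>\<^bsub>cx\<^esub> F = F"
   using F ops_extensional by (simp, intro op_eqI) auto
 qed (auto simp: a_ac intro!: op_eqI)
 show "comm_monoid cx"
 proof (rule comm_monoidI)
  fix F assume F: "F \<in> carrier cx"
  then show "\<one>\<^bsub>cx\<^esub> \<otimes>\<^bsub>cx\<^esub> F = F"
   using ops_extensional by (simp, intro op_eqI) auto
 next
  fix F G assume "F \<in> carrier cx" "G \<in> carrier cx"
  then show "F \<otimes>\<^bsub>cx\<^esub> G = G \<otimes>\<^bsub>cx\<^esub> F"
   by (simp, intro op_eqI) (auto simp: ops_commute[of F G])
 qed (auto simp: opone_eq intro!: op_eqI)
 fix F G H assume "F \<in> carrier cx" "G \<in> carrier cx" "H \<in> carrier cx"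
 then show "(F \<oplus>\<^bsub>cx\<^esub> G) \<otimes>\<^bsub>cx\<^esub> H = F \<otimes>\<^bsub>cx\<^esub> H \<oplus>\<^bsub>cx\<^esub> G \<otimes>\<^bsub>cx\<^esub> H"
  by (simp, intro op_eqI) auto
qed

lemma small_ops: "small (carrier R) ==> small ops"
proof -
 assume sm: "small (carrier R)"
 \<comment> \<open>\<open>K n\<close> consists of the sums of \<open>n\<close> generators.\<close>
 define K where "K = rec_nat {opz} (\<lambda>_ Y. (\<lambda>(r, c, F). opadd (opu r c) F) ` (carrier R \<times> UNIV \<times> Y))"
 have K0: "K 0 = {opz}" and KS: "K (Suc n) = (\<lambda>(r, c, F). opadd (opu r c) F) ` (carrier R \<times> UNIV \<times> K n)" for n
  unfolding K_def by simp_all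
 have sK: "small (K n)" for n
 proof (induction n)
  case 0
  show ?case unfolding K0 by (rule small_singleton)
 next
  case (Suc n)
  show ?case unfolding KS by (intro small_image small_Times sm small_complex Suc)
 qed
 have "F \<in> (\<Union>n. K n)" if "F \<in> ops" for F
  using that
 proof (induction rule: ops.induct)
  case zero
  show ?case using K0 by blast
 next
  case (cons F r c)
  then obtain n where "F \<in> K n" by blast
  then have "opadd (opu r c) F \<in> K (Suc n)"
   unfolding KS using cons(2) by (intro image_eqI[where x="(r, c, F)"]) simp_all
  then show ?case by blast
 qed
 then show ?thesis by (intro small_subset[OF small_UN_nat[of K, OF sK]] subsetI)
qed

lemma cx_hom: "(\<lambda>r. opu r 1) \<in> Ring.ring_hom R cx" "(\<lambda>c. opu \<one> c) \<in> Ring.ring_hom CR cx"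
proof -
 show "(\<lambda>r. opu r 1) \<in> Ring.ring_hom R cx"
  by (rule ring_hom_memI) (auto simp: opone_eq l_distr m_assoc intro!: op_eqI)
 show "(\<lambda>c. opu \<one> c) \<in> Ring.ring_hom CR cx"
  by (rule type_ring_homI) (auto simp: opone_eq maps_add distrib_right mult.assoc mult.left_commute intro!: op_eqI)
qed

end

text \<open>\<open>K\<close> is \<open>R \<otimes> \<complex>\<close> and \<open>\<theta>\<close> is
  the map \<open>id \<otimes> \<psi>\<close>. Additivity and the values on simple tensors are all
  that is required to convert a linear equation with complex coefficients over \<open>K\<close> into
  one with rational coefficients over \<open>R\<close>.\<close>

lemma complexification_exists:
 fixes R :: "complex ring" (structure)
 assumes "rat_algebra R"
 obtains K :: "complex ring" and al \<phi> where "cring K" "al \<in> Ring.ring_hom R K" "\<phi> \<in> Ring.ring_hom CR K"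
  "!!\<psi> :: complex => rat. (!!c d. \<psi> (c + d) = \<psi> c + \<psi> d) ==> \<exists>\<theta>. \<theta> \<in> carrier K \<rightarrow> carrier R \<and>
   (\<forall>x \<in> carrier K. \<forall>y \<in> carrier K. \<theta> (x \<oplus>\<^bsub>K\<^esub> y) = \<theta> x \<oplus>\<^bsub>R\<^esub> \<theta> y) \<and>
   (\<forall>r \<in> carrier R. \<forall>c. \<theta> (al r \<otimes>\<^bsub>K\<^esub> \<phi> c) = r \<otimes>\<^bsub>R\<^esub> of_rat_alg R (\<psi> c))"
proof -
 interpret rat_alg R using assms by (simp add: rat_alg_iff)
 interpret complexification R ..
 obtain K :: "complex ring" and al be where K: "cring K" "al \<in> Ring.ring_hom cx K" "be \<in> Ring.ring_hom K cx"
  "!!x. x \<in> carrier cx ==> be (al x) = x"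
  using small_ring_iso[OF cring_cx] small_ops[OF small_complex] by (metis cx_simps(1))
 interpret b: ring_hom_cring K cx be
  using K cring_cx by (simp add: ring_hom_cring_def ring_hom_cring_axioms_def)
 show thesis
 proof (rule that[OF K(1)])
  show "al \<circ> (\<lambda>r. opu r 1) \<in> Ring.ring_hom R K" "al \<circ> (\<lambda>c. opu \<one> c) \<in> Ring.ring_hom CR K"
   using cx_hom K(2) by (auto intro: ring_hom_trans)
  fix \<psi> :: "complex => rat" assume \<psi>: "!!c d. \<psi> (c + d) = \<psi> c + \<psi> d"
  define \<psi>' where "\<psi>' = (\<lambda>c. of_rat_alg R (\<psi> c))"
  have \<psi>': "\<psi>' \<in> maps" using rat.hom_add by (intro mapsI) (auto simp: \<psi>'_def \<psi> ap_def)
  define \<theta> where "\<theta> x = ap (ap (be x) \<psi>') 1" for x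
  have cl: "be x \<in> ops" if "x \<in> carrier K" for x using b.hom_closed[OF that] by simp
  have "\<theta> (al (opu r 1) \<otimes>\<^bsub>K\<^esub> al (opu \<one> c)) = r \<otimes> ap \<psi>' c" if r: "r \<in> carrier R" for r c
  proof -
   have "al (opu r 1) \<in> carrier K" "al (opu \<one> c) \<in> carrier K"
    using r by (auto intro!: ring_hom_closed[OF K(2)])
   then have "be (al (opu r 1) \<otimes>\<^bsub>K\<^esub> al (opu \<one> c)) = opmul (opu r 1) (opu \<one> c)"
    using r K(4)[of "opu r 1"] K(4)[of "opu \<one> c"] by simp
   then show ?thesis using r \<psi>' unfolding \<theta>_def by simp
  qed
  moreover have "\<theta> (x \<oplus>\<^bsub>K\<^esub> y) = \<theta> x \<oplus> \<theta> y" if "x \<in> carrier K" "y \<in> carrier K" for x y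
   using that \<psi>' by (simp add: \<theta>_def)
  moreover have "\<theta> x \<in> carrier R" if "x \<in> carrier K" for x
   using cl[OF that] \<psi>' by (simp add: \<theta>_def)
  moreover have "ap \<psi>' c = of_rat_alg R (\<psi> c)" for c by (simp add: \<psi>'_def ap_def)
  ultimately show "\<exists>\<theta>. \<theta> \<in> carrier K \<rightarrow> carrier R \<and>
   (\<forall>x \<in> carrier K. \<forall>y \<in> carrier K. \<theta> (x \<oplus>\<^bsub>K\<^esub> y) = \<theta> x \<oplus>\<^bsub>R\<^esub> \<theta> y) \<and>
   (\<forall>r \<in> carrier R. \<forall>c. \<theta> ((al \<circ> (\<lambda>r. opu r 1)) r \<otimes>\<^bsub>K\<^esub> (al \<circ> (\<lambda>c. opu \<one> c)) c) = r \<otimes>\<^bsub>R\<^esub> of_rat_alg R (\<psi> c))"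
   by (intro exI[of _ \<theta>]) auto
 qed
qed

section \<open>Polynomials over the complex numbers\<close>

abbreviation poly_ring :: "complex poly ring"
 where "poly_ring \<equiv> ring_of_type_algebra"

lemma small_poly: "small (carrier poly_ring)"
proof -
 \<comment> \<open>\<open>K n\<close> consists of the polynomials of degree less than
   \<open>n\<close>, including zero.\<close>
 define K where "K = rec_nat {0} (\<lambda>_ Y. (\<lambda>(c :: complex, p). pCons c p) ` (UNIV \<times> Y))"
 have K0: "K 0 = {0}" and KS: "K (Suc n) = (\<lambda>(c, p). pCons c p) ` (UNIV \<times> K n)" for n
  unfolding K_def by simp_all
 have sK: "small (K n)" for n
 proof (induction n)
  case 0
  show ?case unfolding K0 by (rule small_singleton)
 next
  case (Suc n)
  show ?case unfolding KS by (intro small_image small_Times small_complex Suc)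
 qed
 have "p \<in> (\<Union>n. K n)" for p
 proof (induction p rule: pCons_induct)
  case 0
  show ?case using K0 by blast
 next
  case (pCons c p)
  then obtain n where "p \<in> K n" by blast
  then have "pCons c p \<in> K (Suc n)"
   unfolding KS by (intro image_eqI[where x="(c, p)"]) simp_all
  then show ?case by blast
 qed
 then show ?thesis by (intro small_subset[OF small_UN_nat[of K, OF sK]] subsetI)
qed

text \<open>Horner evaluation at \<open>a\<close>, with the complex coefficients mapped into the
  target by \<open>\<phi>\<close>.\<close>

definition pev :: "'u ring => (complex => 'u) => 'u => complex poly => 'u"
 where "pev A \<phi> a p = fold_coeffs (\<lambda>c x. \<phi> c \<oplus>\<^bsub>A\<^esub> a \<otimes>\<^bsub>A\<^esub> x) p \<zero>\<^bsub>A\<^esub>"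

locale complex_algebra = base_ring A for A :: "'u ring" (structure) +
 fixes \<phi> :: "complex => 'u"
 assumes phi_hom: "\<phi> \<in> Ring.ring_hom CR A"
begin

sublocale cx: base_ring_hom CR A \<phi>
 using phi_hom cring_from_type_algebra[where 'a=complex] is_cring by (intro base_ring_homI)

lemma phi_simps [simp]: "\<phi> c \<in> carrier A" "\<phi> 0 = \<zero>" "\<phi> 1 = \<one>"
 using cx.hom_closed[of c] cx.hom_zero cx.hom_one by auto

lemma phi_add: "\<phi> (c + d) = \<phi> c \<oplus> \<phi> d" and phi_mult: "\<phi> (c * d) = \<phi> c \<otimes> \<phi> d"
 using cx.hom_add[of c d] cx.hom_mult[of c d] by auto

lemma rat_algebra: "rat_algebra A"
 using rat_algebra_hom(1)[OF rat_algebra_type is_cring phi_hom] .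

sublocale rat_alg A
 using rat_algebra by (simp add: rat_alg_iff)

lemma of_rat_alg_phi: "of_rat_alg A q = \<phi> (of_rat q)"
 using rat_algebra_hom(2)[OF rat_algebra_type is_cring phi_hom] by simp

lemma pev_pCons: "a \<in> carrier A ==> pev A \<phi> a (pCons c p) = \<phi> c \<oplus> a \<otimes> pev A \<phi> a p"
 unfolding pev_def by (cases "p = 0 \<and> c = 0") auto

lemma pev_0 [simp]: "pev A \<phi> a 0 = \<zero>"
 unfolding pev_def by simp

lemma pev_closed [simp]: "a \<in> carrier A ==> pev A \<phi> a p \<in> carrier A"
 by (induction p) (auto simp: pev_pCons)

lemma pev_add: "a \<in> carrier A ==> pev A \<phi> a (p + q) = pev A \<phi> a p \<oplus> pev A \<phi> a q"
 by (induction p q rule: poly_induct2) (auto simp: pev_pCons phi_add r_distr a_ac)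

lemma pev_smult: "a \<in> carrier A ==> pev A \<phi> a (smult c p) = \<phi> c \<otimes> pev A \<phi> a p"
 by (induction p) (auto simp: pev_pCons phi_mult r_distr m_ac)

lemma pev_mult: "a \<in> carrier A ==> pev A \<phi> a (p * q) = pev A \<phi> a p \<otimes> pev A \<phi> a q"
 by (induction p) (auto simp: pev_pCons pev_add pev_smult l_distr m_assoc)

lemma pev_const [simp]: "a \<in> carrier A ==> pev A \<phi> a [:c:] = \<phi> c"
 and pev_X [simp]: "a \<in> carrier A ==> pev A \<phi> a [:0, 1:] = a"
 by (auto simp: pev_pCons)

lemma pev_hom: "a \<in> carrier A ==> pev A \<phi> a \<in> Ring.ring_hom poly_ring A"
 by (rule type_ring_homI) (auto simp: pev_add pev_mult one_pCons)

end

section \<open>Matrix units from a representation of symmetric matrices\<close>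

text \<open>Inserting \<open>a * a\<close> for \<open>a\<close> and moving one factor across
  \<open>b\<close> twice changes the sign twice, so \<open>a\<close> and \<open>b\<close> also
  commute; then \<open>a * b\<close> equals its own negative.\<close>

lemma idem_anticommute:
 fixes a b :: "'e::real_algebra"
 assumes "a * a = a" "a * b + b * a = 0"
 shows "a * b = 0"
proof -
 have 1: "a * b = - (b * a)" using assms(2) by (simp add: eq_neg_iff_add_eq_0)
 have "a * b = a * (a * b)" using assms(1) by (simp flip: mult.assoc)
 also have "\<dots> = - ((a * b) * a)" by (subst 1) (simp add: mult.assoc)
 also have "\<dots> = b * (a * a)" by (subst 1) (simp add: mult.assoc)
 finally have "a * b = b * a" using assms(1) by simp
 then have "2 *\<^sub>R (a * b) = 0" using assms(2) by (simp add: scaleR_2)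
 then show ?thesis by simp
qed

text \<open>Here \<open>a\<close>, \<open>b\<close>, \<open>y\<close> model the matrices E11, E22
  and E12 + E21. The last three hypotheses say that the square of \<open>v v^t\<close> is
  \<open>|v|^2\<close> times itself for v = (1,1), (1,-1), (3,4), whose squared lengths are 2, 2,
  25. The first two separate the terms even and odd in \<open>y\<close>. They leave only the sum of
  the two anticommutators known; a vector whose coordinates differ in absolute value separates
  them.\<close>

lemma pair_relations:
 fixes a b y :: "'e::real_algebra"
 assumes ab: "a * a = a" "b * b = b" "a * b = 0" "b * a = 0"
  and 1: "(a + b + y) * (a + b + y) = 2 *\<^sub>R (a + b + y)"
  and 2: "(a + b - y) * (a + b - y) = 2 *\<^sub>R (a + b - y)"
  and 3: "(9 *\<^sub>R a + 16 *\<^sub>R b + 12 *\<^sub>R y) * (9 *\<^sub>R a + 16 *\<^sub>R b + 12 *\<^sub>R y) = 25 *\<^sub>R (9 *\<^sub>R a + 16 *\<^sub>R b + 12 *\<^sub>R y)"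
 shows "y * y = a + b" "a * y + y * a = y" "a * y = y * b" "b * y = y * a"
proof -
 define s t where st: "s = a * y + y * a" "t = b * y + y * b"
 \<comment> \<open>The even and odd parts in \<open>y\<close> of the defect in the first hypothesis;
   the second hypothesis says \<open>p - r = 0\<close>.\<close>
 define p r where pr: "p = y * y - (a + b)" "r = s + t - (y + y)"
 have "p + r = (a + b + y) * (a + b + y) - 2 *\<^sub>R (a + b + y)" "p - r = (a + b - y) * (a + b - y) - 2 *\<^sub>R (a + b - y)"
  unfolding pr st by (simp_all add: algebra_simps ab scaleR_2)
 then have "p + r = 0" "p - r = 0" unfolding 1 2 by simp_all
 then have "2 *\<^sub>R p = 0" "r = p" by (simp_all add: scaleR_2)
 then have "p = 0" "r = 0" by simp_all
 then have yy: "y * y = a + b" and s: "t = (y + y) - s" unfolding pr by (simp_all add: algebra_simps)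
 show "y * y = a + b" by (rule yy)
 have "(9 *\<^sub>R a + 16 *\<^sub>R b + 12 *\<^sub>R y) * (9 *\<^sub>R a + 16 *\<^sub>R b + 12 *\<^sub>R y) =
   81 *\<^sub>R a + 256 *\<^sub>R b + 144 *\<^sub>R (y * y) + 108 *\<^sub>R s + 192 *\<^sub>R t"
  unfolding st by (simp add: algebra_simps ab)
 then have e: "81 *\<^sub>R a + 256 *\<^sub>R b + 144 *\<^sub>R (a + b) + 108 *\<^sub>R s + 192 *\<^sub>R ((y + y) - s) = 225 *\<^sub>R a + 400 *\<^sub>R b + 300 *\<^sub>R y"
  using 3 unfolding yy s by (simp add: algebra_simps)
 \<comment> \<open>The scalars are split so that equal summands cancel; the remaining coefficient is
   84 = 192 - 108 = 384 - 300.\<close>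
 have "225 *\<^sub>R a = 81 *\<^sub>R a + 144 *\<^sub>R a" "400 *\<^sub>R b = 256 *\<^sub>R b + 144 *\<^sub>R b"
  "192 *\<^sub>R s = 108 *\<^sub>R s + 84 *\<^sub>R s" "192 *\<^sub>R (y + y) = 300 *\<^sub>R y + 84 *\<^sub>R y"
  using scaleR_add_left[of 81 144 a] scaleR_add_left[of 256 144 b] scaleR_add_left[of 108 84 s]
   scaleR_add_left[of 300 84 y] scaleR_add_left[of 192 192 y] by (simp_all add: scaleR_add_right)
 then have "84 *\<^sub>R y = 84 *\<^sub>R s"
  using e by (simp add: scaleR_add_right scaleR_right_diff_distrib algebra_simps)
 then have ys: "s = y" by simp
 then show ay: "a * y + y * a = y" unfolding st .
 have by': "b * y + y * b = y" using s ys unfolding st by simp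
 have "a * y = a * (b * y + y * b)" using by' by simp
 also have "\<dots> = a * y * b" using ab by (simp add: distrib_left flip: mult.assoc)
 also have "\<dots> = (a * y + y * a) * b" using ab by (simp add: distrib_right mult.assoc)
 finally show "a * y = y * b" using ay by simp
 have "b * y = b * (a * y + y * a)" using ay by simp
 also have "\<dots> = b * y * a" using ab by (simp add: distrib_left flip: mult.assoc)
 also have "\<dots> = (b * y + y * b) * a" using ab by (simp add: distrib_right mult.assoc)
 finally show "b * y = y * a" using by' by simp
qed

text \<open>Real symmetric block diagonal matrices, with blocks the fibres of \<open>bl\<close>.
  Entries off \<open>TH\<close> are required to vanish, so that equality of functions is equality of
  matrices.\<close>

definition bsym :: "'t set => ('t => 'k) => ('t => 't => real) => bool"
 where "bsym TH bl Y \<longleftrightarrow> (\<forall>\<theta> \<eta>. Y \<theta> \<eta> = Y \<eta> \<theta>) \<and> (\<forall>\<theta> \<eta>. Y \<theta> \<eta> ~= 0 --> \<theta> \<in> TH \<and> \<eta> \<in> TH \<and> bl \<theta> = bl \<eta>)"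

text \<open>For \<open>al = be\<close> this is twice the diagonal unit. With this convention every
  symmetric matrix is half the sum, over ordered pairs, of its entries times
  \<open>ymat\<close>.\<close>

definition ymat :: "'t => 't => 't => 't => real"
 where "ymat al be \<theta> \<eta> = of_bool (\<theta> = al \<and> \<eta> = be) + of_bool (\<theta> = be \<and> \<eta> = al)"

lemma ymat_commute: "ymat al be \<theta> \<eta> = ymat al be \<eta> \<theta>"
 unfolding ymat_def by (subst add.commute, rule arg_cong2[where f="(+)"]) (rule arg_cong[where f=of_bool], blast)+

lemma ymat_nonzero: "ymat al be \<theta> \<eta> ~= 0 ==> \<theta> = al \<and> \<eta> = be | \<theta> = be \<and> \<eta> = al"
proof (rule ccontr)
 assume a: "ymat al be \<theta> \<eta> ~= 0" "\<not> (\<theta> = al \<and> \<eta> = be | \<theta> = be \<and> \<eta> = al)"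
 then have "\<not> (\<theta> = al \<and> \<eta> = be)" "\<not> (\<theta> = be \<and> \<eta> = al)" by blast+
 then have "ymat al be \<theta> \<eta> = 0" unfolding ymat_def by (simp only: of_bool_eq)
 then show False using a by blast
qed

text \<open>The two families \<open>q True\<close> and \<open>q False\<close> are the derivatives of
  opposite transvections: \<open>q b\<close> maps the image of \<open>P (\<not> b)\<close> into that
  of \<open>P b\<close>, and inverse matrices give mutually inverse maps. The aim is to extract a
  full system of matrix units from this data.\<close>

locale symmetric_rep =
 fixes TH :: "'t set" and bl :: "'t => 'k" and q :: "bool => ('t => 't => real) => 'e::real_algebra" and P :: "bool => 'e"
 assumes fin: "finite TH"
  and q_add: "bsym TH bl Y ==> bsym TH bl Z ==> q b (\<lambda>\<theta> \<eta>. Y \<theta> \<eta> + Z \<theta> \<eta>) = q b Y + q b Z"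
  and q_scale: "bsym TH bl Y ==> q b (\<lambda>\<theta> \<eta>. c * Y \<theta> \<eta>) = c *\<^sub>R q b Y"
  and PP: "P b * P b = P b" "P b * P (\<not> b) = 0"
  and Pq: "bsym TH bl Y ==> P b * q b Y = q b Y" "bsym TH bl Y ==> q b Y * P (\<not> b) = q b Y"
  and q_inv: "bsym TH bl Y ==> bsym TH bl Z ==>
   (!!\<theta> \<zeta>. \<theta> \<in> TH ==> \<zeta> \<in> TH ==> (\<Sum>\<eta>\<in>TH. Y \<theta> \<eta> * Z \<eta> \<zeta>) = of_bool (\<theta> = \<zeta>)) ==> q b Y * q (\<not> b) Z = P b"
begin

abbreviation "bs \<equiv> bsym TH bl"

definition "idm \<theta> \<eta> = (of_bool (\<theta> = \<eta> \<and> \<theta> \<in> TH) :: real)"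
text \<open>\<open>U True\<close> and \<open>U False\<close> are inverse isomorphisms between the
  two corners (\<open>UT\<close>). Composition with them moves \<open>q True\<close> and
  \<open>q False\<close> into the corner of \<open>P True\<close>, where their values
  \<open>\<sigma>\<close> and \<open>\<tau>\<close> can be multiplied with each other.\<close>

definition "U b = q b idm"
definition "\<sigma> Y = q True Y * U False"
definition "\<tau> Y = U True * q False Y"

lemma bs_idm [simp]: "bs idm" unfolding bsym_def idm_def by auto

lemma bs_add [simp]: "bs Y ==> bs Z ==> bs (\<lambda>\<theta> \<eta>. Y \<theta> \<eta> + Z \<theta> \<eta>)"
 unfolding bsym_def by (metis add.left_neutral add.right_neutral)

lemma bs_scale [simp]: "bs Y ==> bs (\<lambda>\<theta> \<eta>. c * Y \<theta> \<eta>)"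
 unfolding bsym_def by (metis mult_zero_right)

lemma UU: "U b * U (\<not> b) = P b"
 unfolding U_def by (rule q_inv) (auto simp: idm_def fin if_distrib sum.If_cases cong: if_cong)

lemma UT: "U True * U False = P True" "U False * U True = P False"
 using UU[of True] UU[of False] by auto

lemma PU: "P b * U b = U b" "U b * P (\<not> b) = U b"
 unfolding U_def by (auto simp: Pq)

lemma sigma_add: "bs Y ==> bs Z ==> \<sigma> (\<lambda>\<theta> \<eta>. Y \<theta> \<eta> + Z \<theta> \<eta>) = \<sigma> Y + \<sigma> Z"
 and sigma_scale: "bs Y ==> \<sigma> (\<lambda>\<theta> \<eta>. c * Y \<theta> \<eta>) = c *\<^sub>R \<sigma> Y"
 and tau_add: "bs Y ==> bs Z ==> \<tau> (\<lambda>\<theta> \<eta>. Y \<theta> \<eta> + Z \<theta> \<eta>) = \<tau> Y + \<tau> Z"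
 and tau_scale: "bs Y ==> \<tau> (\<lambda>\<theta> \<eta>. c * Y \<theta> \<eta>) = c *\<^sub>R \<tau> Y"
 unfolding \<sigma>_def \<tau>_def by (simp_all add: q_add q_scale distrib_left distrib_right)

lemma sigma_idm: "\<sigma> idm = P True" and tau_idm: "\<tau> idm = P True"
 unfolding \<sigma>_def \<tau>_def U_def[symmetric] by (simp_all add: UT)

lemma P_sigma: "bs Y ==> P True * \<sigma> Y = \<sigma> Y" "bs Y ==> \<sigma> Y * P True = \<sigma> Y" "bs Y ==> P True * \<tau> Y = \<tau> Y"
 using Pq(1)[of Y True] PU[of False] PU(1)[of True] unfolding \<sigma>_def \<tau>_def
 by (simp_all add: mult.assoc[symmetric]) (simp add: mult.assoc)

lemma sigma_tau_inv:
 assumes "bs Y" "bs Z" "!!\<theta> \<zeta>. \<theta> \<in> TH ==> \<zeta> \<in> TH ==> (\<Sum>\<eta>\<in>TH. Y \<theta> \<eta> * Z \<eta> \<zeta>) = of_bool (\<theta> = \<zeta>)"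
 shows "\<sigma> Y * \<tau> Z = P True"
proof -
 have "\<sigma> Y * \<tau> Z = q True Y * (P False * q False Z)"
  unfolding \<sigma>_def \<tau>_def UT(2)[symmetric] by (simp add: mult.assoc)
 also have "\<dots> = P True" using q_inv[OF assms, of True] assms by (simp add: Pq(1))
 finally show ?thesis .
qed

text \<open>If \<open>Y\<close> is idempotent, \<open>1 + c Y\<close> and \<open>1 + d Y\<close> are
  inverse to each other as soon as \<open>c + d + c d = 0\<close>. Each such pair yields a linear
  relation between \<open>\<sigma> Y\<close>, \<open>\<tau> Y\<close> and their product, and two
  independent relations force all three to coincide.\<close>

lemma idempotent:
 assumes Y: "bs Y" and YY: "!!\<theta> \<zeta>. \<theta> \<in> TH ==> \<zeta> \<in> TH ==> (\<Sum>\<eta>\<in>TH. Y \<theta> \<eta> * Y \<eta> \<zeta>) = Y \<theta> \<zeta>"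
 shows "\<tau> Y = \<sigma> Y" "\<sigma> Y * \<sigma> Y = \<sigma> Y"
proof -
 have main: "(P True + c *\<^sub>R \<sigma> Y) * (P True + d *\<^sub>R \<tau> Y) = P True" if cd: "c + d + c * d = 0" for c d
 proof -
  let ?A = "\<lambda>\<theta> \<eta>. idm \<theta> \<eta> + c * Y \<theta> \<eta>" and ?B = "\<lambda>\<theta> \<eta>. idm \<theta> \<eta> + d * Y \<theta> \<eta>"
  have "\<sigma> ?A * \<tau> ?B = P True"
  proof (rule sigma_tau_inv)
   fix \<theta> \<zeta> assume t: "\<theta> \<in> TH" "\<zeta> \<in> TH"
   have i1: "(\<Sum>\<eta>\<in>TH. idm \<theta> \<eta> * Z \<eta> \<zeta>) = Z \<theta> \<zeta>" for Z :: "'t => 't => real"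
   proof -
    have "(\<Sum>\<eta>\<in>TH. idm \<theta> \<eta> * Z \<eta> \<zeta>) = (\<Sum>\<eta>\<in>TH. if \<eta> = \<theta> then Z \<theta> \<zeta> else 0)"
     by (rule sum.cong) (use t in \<open>auto simp: idm_def\<close>)
    then show ?thesis using t fin by simp
   qed
   have i2: "(\<Sum>\<eta>\<in>TH. Z \<theta> \<eta> * idm \<eta> \<zeta>) = Z \<theta> \<zeta>" for Z :: "'t => 't => real"
   proof -
    have "(\<Sum>\<eta>\<in>TH. Z \<theta> \<eta> * idm \<eta> \<zeta>) = (\<Sum>\<eta>\<in>TH. if \<eta> = \<zeta> then Z \<theta> \<zeta> else 0)"
     by (rule sum.cong) (auto simp: idm_def)
    then show ?thesis using t fin by simp
   qed
   have "(\<Sum>\<eta>\<in>TH. ?A \<theta> \<eta> * ?B \<eta> \<zeta>) = (\<Sum>\<eta>\<in>TH. idm \<theta> \<eta> * ?B \<eta> \<zeta>) + c * (\<Sum>\<eta>\<in>TH. Y \<theta> \<eta> * idm \<eta> \<zeta>) + c * d * (\<Sum>\<eta>\<in>TH. Y \<theta> \<eta> * Y \<eta> \<zeta>)"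
    by (simp add: sum_distrib_left sum.distrib[symmetric] algebra_simps)
   also have "\<dots> = idm \<theta> \<zeta> + (c + d + c * d) * Y \<theta> \<zeta>"
    unfolding i1[of ?B] i2 YY[OF t] by (simp add: algebra_simps)
   finally show "(\<Sum>\<eta>\<in>TH. ?A \<theta> \<eta> * ?B \<eta> \<zeta>) = of_bool (\<theta> = \<zeta>)" using t cd by (simp add: idm_def)
  qed (use Y in auto)
  then show ?thesis using Y by (simp add: sigma_add tau_add sigma_scale tau_scale sigma_idm tau_idm)
 qed
 have e: "c *\<^sub>R \<sigma> Y + d *\<^sub>R \<tau> Y + (c * d) *\<^sub>R (\<sigma> Y * \<tau> Y) = 0" if "c + d + c * d = 0" for c d
  using main[OF that] Y PP(1)[of True] by (simp add: distrib_left distrib_right P_sigma scaleR_add_right mult.commute add.assoc add.commute add.left_commute)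
 \<comment> \<open>The pairs (1, -1/2) and (2, -2/3) are two instances of
   \<open>d = - c / (1 + c)\<close>.\<close>
 have "2 *\<^sub>R (\<sigma> Y - (1/2) *\<^sub>R \<tau> Y - (1/2) *\<^sub>R (\<sigma> Y * \<tau> Y)) = 0" using e[of 1 "-(1/2)"] by simp
 then have 1: "2 *\<^sub>R \<sigma> Y = \<tau> Y + \<sigma> Y * \<tau> Y" by (simp add: scaleR_right_diff_distrib algebra_simps)
 have "(3/2) *\<^sub>R (2 *\<^sub>R \<sigma> Y - (2/3) *\<^sub>R \<tau> Y - (4/3) *\<^sub>R (\<sigma> Y * \<tau> Y)) = 0" using e[of 2 "-(2/3)"] by simp
 then have 2: "3 *\<^sub>R \<sigma> Y = \<tau> Y + 2 *\<^sub>R (\<sigma> Y * \<tau> Y)" by (simp add: scaleR_right_diff_distrib algebra_simps)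
 have "3 *\<^sub>R \<sigma> Y = 2 *\<^sub>R \<sigma> Y + \<sigma> Y" using scaleR_add_left[of 2 1 "\<sigma> Y"] by simp
 then have st: "\<sigma> Y * \<tau> Y = \<sigma> Y" using 2 unfolding 1 by (simp add: scaleR_2)
 then show "\<tau> Y = \<sigma> Y" using 1 by (simp add: scaleR_2)
 then show "\<sigma> Y * \<sigma> Y = \<sigma> Y" using st by simp
qed

text \<open>Vectors supported in a single block, so that \<open>outer v\<close> is block
  diagonal.\<close>

definition "bvec v \<longleftrightarrow> (\<forall>\<theta>. v \<theta> ~= (0::real) --> \<theta> \<in> TH) \<and> (\<forall>\<theta> \<eta>. v \<theta> ~= 0 --> v \<eta> ~= 0 --> bl \<theta> = bl \<eta>)"
definition "dot v w = (\<Sum>\<theta>\<in>TH. v \<theta> * w \<theta> :: real)"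
definition "outer v \<theta> \<eta> = (v \<theta> * v \<eta> :: real)"
definition "nn v = \<sigma> (outer v)"

lemma bs_outer [simp]: "bvec v ==> bs (outer v)"
 unfolding bvec_def bsym_def outer_def by auto

lemma outer_outer:
 "(\<Sum>\<eta>\<in>TH. outer v \<theta> \<eta> * outer w \<eta> \<zeta>) = v \<theta> * w \<zeta> * dot v w"
 unfolding outer_def dot_def by (simp add: sum_distrib_left algebra_simps)

text \<open>Dividing \<open>outer v\<close> by \<open>dot v v\<close> gives an idempotent matrix, to
  which \<open>idempotent\<close> applies.\<close>

lemma nn_square:
 assumes "bvec v" "dot v v = s" "s ~= 0"
 shows "nn v * nn v = s *\<^sub>R nn v" "\<tau> (outer v) = nn v"
proof -
 let ?Y = "\<lambda>\<theta> \<eta>. (1/s) * outer v \<theta> \<eta>"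
 have YY: "(\<Sum>\<eta>\<in>TH. ?Y \<theta> \<eta> * ?Y \<eta> \<zeta>) = ?Y \<theta> \<zeta>" for \<theta> \<zeta>
 proof -
  have "(\<Sum>\<eta>\<in>TH. ?Y \<theta> \<eta> * ?Y \<eta> \<zeta>) = (1/s) * (1/s) * (\<Sum>\<eta>\<in>TH. outer v \<theta> \<eta> * outer v \<eta> \<zeta>)"
   by (simp add: sum_distrib_left algebra_simps)
  then show ?thesis using assms unfolding outer_outer by (simp add: outer_def)
 qed
 have Y: "bs ?Y" by (intro bs_scale bs_outer assms)
 have n: "\<sigma> ?Y = (1/s) *\<^sub>R nn v" "\<tau> ?Y = (1/s) *\<^sub>R \<tau> (outer v)"
  using assms by (simp_all only: sigma_scale tau_scale bs_outer nn_def)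
 have "s *\<^sub>R \<tau> ?Y = s *\<^sub>R \<sigma> ?Y" using idempotent(1)[OF Y YY] by simp
 then show "\<tau> (outer v) = nn v" unfolding n using assms(3) by simp
 have "(s * s) *\<^sub>R (\<sigma> ?Y * \<sigma> ?Y) = (s * s) *\<^sub>R \<sigma> ?Y" using idempotent(2)[OF Y YY] by simp
 then show "nn v * nn v = s *\<^sub>R nn v" unfolding n using assms(3) by simp
qed

text \<open>The sum of the two orthogonal projections is again idempotent, hence so is the sum of
  their images. Two idempotents with idempotent sum anticommute, and \<open>idem_anticommute\<close>
  finishes.\<close>

lemma nn_orth:
 assumes "bvec v" "dot v v ~= 0" "bvec w" "dot w w ~= 0" "dot v w = 0"
 shows "nn v * nn w = 0"
proof -
 let ?s = "dot v v" and ?t = "dot w w"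
 let ?Y = "\<lambda>\<theta> \<eta>. (1/?s) * outer v \<theta> \<eta> + (1/?t) * outer w \<theta> \<eta>"
 have wv: "dot w v = 0" using assms(5) unfolding dot_def by (simp add: mult.commute)
 have YY: "(\<Sum>\<eta>\<in>TH. ?Y \<theta> \<eta> * ?Y \<eta> \<zeta>) = ?Y \<theta> \<zeta>" for \<theta> \<zeta>
 proof -
  have "(\<Sum>\<eta>\<in>TH. ?Y \<theta> \<eta> * ?Y \<eta> \<zeta>) =
    (1/?s) * (1/?s) * (\<Sum>\<eta>\<in>TH. outer v \<theta> \<eta> * outer v \<eta> \<zeta>) + (1/?t) * (1/?t) * (\<Sum>\<eta>\<in>TH. outer w \<theta> \<eta> * outer w \<eta> \<zeta>)
   + (1/?s) * (1/?t) * (\<Sum>\<eta>\<in>TH. outer v \<theta> \<eta> * outer w \<eta> \<zeta>) + (1/?s) * (1/?t) * (\<Sum>\<eta>\<in>TH. outer w \<theta> \<eta> * outer v \<eta> \<zeta>)"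
   by (simp only: sum_distrib_left sum.distrib[symmetric]) (intro sum.cong refl, simp add: algebra_simps)
  then show ?thesis using assms wv unfolding outer_outer by (simp add: outer_def)
 qed
 have n: "\<sigma> ?Y = (1/?s) *\<^sub>R nn v + (1/?t) *\<^sub>R nn w"
  using assms by (simp only: sigma_add sigma_scale bs_outer bs_scale nn_def)
 let ?a = "(1/?s) *\<^sub>R nn v" and ?b = "(1/?t) *\<^sub>R nn w"
 have Y: "bs ?Y" by (intro bs_add bs_scale bs_outer assms)
 have i: "?a * ?a = ?a" "?b * ?b = ?b" using nn_square(1) assms by simp_all
 have "(?a + ?b) * (?a + ?b) = ?a + ?b" using idempotent(2)[OF Y YY] unfolding n .
 moreover have "(?a + ?b) * (?a + ?b) = ?a * ?a + ?b * ?b + (?a * ?b + ?b * ?a)" by (simp only: distrib_left distrib_right add_ac)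
 ultimately have "?a * ?b + ?b * ?a = 0" unfolding i by simp
 then have "?a * ?b = 0" using i(1) by (rule idem_anticommute[rotated])
 then show ?thesis using assms by simp
qed

definition "e al = nn (\<lambda>\<theta>. of_bool (\<theta> = al))"
definition "y al be = \<sigma> (ymat al be)"

lemma bs_ymat [simp]: "al \<in> TH ==> be \<in> TH ==> bl al = bl be ==> bs (ymat al be)"
 unfolding bsym_def using ymat_commute[of al be] ymat_nonzero[of al be] by metis

lemma bvec_delta [simp]: "al \<in> TH ==> bvec (\<lambda>\<theta>. of_bool (\<theta> = al))"
 unfolding bvec_def by auto

lemma dot_delta: "al \<in> TH ==> dot (\<lambda>\<theta>. of_bool (\<theta> = al)) v = v al"
proof -
 assume "al \<in> TH"
 have "dot (\<lambda>\<theta>. of_bool (\<theta> = al)) v = (\<Sum>\<theta>\<in>TH. if \<theta> = al then v al else 0)"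
  unfolding dot_def by (rule sum.cong) auto
 then show ?thesis using \<open>al \<in> TH\<close> fin by simp
qed

text \<open>Up to three nonzero coordinates; the case of two is covered by
  \<open>v3 a al b be 0 be\<close>.\<close>

definition "v3 a al b be c \<gamma> = (\<lambda>\<theta>. a * of_bool (\<theta> = al) + b * of_bool (\<theta> = be) + c * of_bool (\<theta> = \<gamma>) :: real)"

lemma bvec_v3 [simp]:
 "al \<in> TH ==> be \<in> TH ==> \<gamma> \<in> TH ==> bl al = bl be ==> bl be = bl \<gamma> ==> bvec (v3 a al b be c \<gamma>)"
proof -
 assume a: "al \<in> TH" "be \<in> TH" "\<gamma> \<in> TH" "bl al = bl be" "bl be = bl \<gamma>"
 have "\<theta> = al | \<theta> = be | \<theta> = \<gamma>" if "v3 a al b be c \<gamma> \<theta> ~= 0" for \<theta>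
  using that unfolding v3_def by fastforce
 then show ?thesis using a unfolding bvec_def by metis
qed

lemma dot_v3: "al \<in> TH ==> be \<in> TH ==> \<gamma> \<in> TH ==> dot (v3 a al b be c \<gamma>) w = a * w al + b * w be + c * w \<gamma>"
 using dot_delta[of al w] dot_delta[of be w] dot_delta[of \<gamma> w]
 unfolding dot_def v3_def by (simp add: distrib_right sum.distrib mult.assoc flip: sum_distrib_left)

lemma nn_v3:
 assumes "al \<in> TH" "be \<in> TH" "\<gamma> \<in> TH" "bl al = bl be" "bl be = bl \<gamma>"
 shows "nn (v3 a al b be c \<gamma>) = (a * a) *\<^sub>R e al + (b * b) *\<^sub>R e be + (c * c) *\<^sub>R e \<gamma>
  + (a * b) *\<^sub>R y al be + (b * c) *\<^sub>R y be \<gamma> + (a * c) *\<^sub>R y al \<gamma>"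
proof -
 let ?d = "\<lambda>al. outer (\<lambda>\<theta>. of_bool (\<theta> = al))"
 have "outer (v3 a al b be c \<gamma>) = (\<lambda>\<theta> \<eta>. (a * a) * ?d al \<theta> \<eta> + (b * b) * ?d be \<theta> \<eta> + (c * c) * ?d \<gamma> \<theta> \<eta>
  + (a * b) * ymat al be \<theta> \<eta> + (b * c) * ymat be \<gamma> \<theta> \<eta> + (a * c) * ymat al \<gamma> \<theta> \<eta>)"
  unfolding outer_def v3_def ymat_def of_bool_conj by (intro ext) (simp add: algebra_simps)
 then show ?thesis
  using assms unfolding nn_def e_def y_def by (simp only: sigma_add sigma_scale bs_add bs_scale bs_outer bvec_delta bs_ymat)
qed

lemma y_commute: "y al be = y be al"
proof -
 have "ymat al be = ymat be al" unfolding ymat_def by (intro ext) simp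
 then show ?thesis unfolding y_def by simp
qed

lemma e_idem: "al \<in> TH ==> e al * e al = e al"
 unfolding e_def using nn_square(1)[of "\<lambda>\<theta>. of_bool (\<theta> = al)" 1] by (simp add: dot_delta)

lemma e_orth: "al \<in> TH ==> be \<in> TH ==> al ~= be ==> e al * e be = 0"
 unfolding e_def by (rule nn_orth) (auto simp: dot_delta)

lemma v3_square:
 assumes "al \<in> TH" "be \<in> TH" "bl al = bl be" "al ~= be" "a * a + b * b ~= 0"
 defines "w \<equiv> (a * a) *\<^sub>R e al + (b * b) *\<^sub>R e be + (a * b) *\<^sub>R y al be"
 shows "w * w = (a * a + b * b) *\<^sub>R w" "\<tau> (outer (v3 a al b be 0 be)) = w"
proof -
 have "dot (v3 a al b be 0 be) (v3 a al b be 0 be) = a * a + b * b"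
  using assms by (simp add: dot_v3) (simp add: v3_def)
 moreover have "nn (v3 a al b be 0 be) = w"
  unfolding w_def using assms(1-4) by (simp add: nn_v3)
 ultimately show "w * w = (a * a + b * b) *\<^sub>R w" "\<tau> (outer (v3 a al b be 0 be)) = w"
  using nn_square[of "v3 a al b be 0 be" "a * a + b * b"] assms by auto
qed

lemma y_relations:
 assumes "al \<in> TH" "be \<in> TH" "bl al = bl be" "al ~= be"
 shows "y al be * y al be = e al + e be" "e al * y al be + y al be * e al = y al be"
  "e al * y al be = y al be * e be" "e be * y al be = y al be * e al"
 using pair_relations[of "e al" "e be" "y al be"] e_idem[OF assms(1)] e_idem[OF assms(2)] e_orth[OF assms(1,2)]
  e_orth[OF assms(2,1)] v3_square(1)[OF assms, of 1 1] v3_square(1)[OF assms, of 1 "-1"] v3_square(1)[OF assms, of 3 4] assms(4)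
 by simp_all

text \<open>The vector with ones at \<open>al\<close> and \<open>be\<close> is orthogonal to the
  unit vector at \<open>\<gamma>\<close>, so \<open>nn_orth\<close> kills the product with
  \<open>e al + e be + y al be\<close>, of which only the last term is unknown.\<close>

lemma e_y_orth:
 assumes "al \<in> TH" "be \<in> TH" "bl al = bl be" "al ~= be" "\<gamma> \<in> TH" "\<gamma> ~= al" "\<gamma> ~= be"
 shows "e \<gamma> * y al be = 0" "y al be * e \<gamma> = 0"
proof -
 let ?w = "v3 1 al 1 be 0 be" and ?d = "\<lambda>\<theta>. of_bool (\<theta> = \<gamma>)"
 have n: "nn ?w = e al + e be + y al be" using assms by (simp add: nn_v3)
 have d: "dot ?d ?d ~= 0" "dot ?w ?w ~= 0" "dot ?d ?w = 0" "dot ?w ?d = 0"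
  using assms by (simp_all add: dot_v3 dot_delta) (simp_all add: v3_def)
 have "e \<gamma> * nn ?w = 0" "nn ?w * e \<gamma> = 0"
  unfolding e_def using assms d by (auto intro!: nn_orth)
 then show "e \<gamma> * y al be = 0" "y al be * e \<gamma> = 0"
  unfolding n using assms by (simp_all add: distrib_left distrib_right e_orth)
qed

text \<open>The one relation involving three indices. It comes from the vector (1,1,1), whose
  squared length is 3, by compressing the resulting quadratic relation between \<open>e al\<close>
  and \<open>e \<gamma>\<close>.\<close>

lemma y_triple:
 assumes "al \<in> TH" "be \<in> TH" "\<gamma> \<in> TH" "bl al = bl be" "bl be = bl \<gamma>" "al ~= be" "be ~= \<gamma>" "al ~= \<gamma>"
 shows "e al * y al be * y be \<gamma> = e al * y al \<gamma>"
proof -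
 define a b c x u z where v: "a = e al" "b = e be" "c = e \<gamma>" "x = y al be" "u = y be \<gamma>" "z = y al \<gamma>"
 let ?w = "v3 1 al 1 be 1 \<gamma>"
 have n: "nn ?w = a + b + c + x + u + z" using assms unfolding v by (simp add: nn_v3 add_ac)
 have "dot ?w ?w = 3" using assms by (simp add: dot_v3) (simp add: v3_def)
 then have sq: "(a + b + c + x + u + z) * (a + b + c + x + u + z) = 3 *\<^sub>R (a + b + c + x + u + z)"
  using nn_square(1)[of ?w 3] assms unfolding n by simp
 have i: "a * a = a" "b * b = b" "c * c = c" "a * b = 0" "b * a = 0" "a * c = 0" "c * a = 0" "b * c = 0" "c * b = 0"
  unfolding v using assms by (auto simp: e_idem e_orth)
 have xr: "a * x = x * b" "b * x = x * a" "c * x = 0" "x * c = 0"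
  unfolding v using assms y_relations[of al be] e_y_orth[of al be \<gamma>] by auto
 have ur: "b * u = u * c" "c * u = u * b" "a * u = 0" "u * a = 0"
  unfolding v using assms y_relations[of be \<gamma>] e_y_orth[of be \<gamma> al] by auto
 have zr: "a * z = z * c" "c * z = z * a" "b * z = 0" "z * b = 0"
  unfolding v using assms y_relations[of al \<gamma>] e_y_orth[of al \<gamma> be] by auto
 let ?S = "a + b + c + x + u + z"
 \<comment> \<open>Both sides of \<open>S S = 3 S\<close> are compressed between \<open>a\<close>
   and \<open>c\<close>; the left becomes \<open>a x u + 2 a z\<close>, the right
   \<open>3 a z\<close>.\<close>
 have "(a * ?S) * (?S * c) = a * (?S * ?S) * c" by (simp add: mult.assoc)
 also have "\<dots> = 3 *\<^sub>R (a * ?S * c)" unfolding sq by simp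
 also have "a * ?S = a + a * x + a * z" by (simp add: distrib_left i ur)
 also have "(a + a * x + a * z) * c = a * z"
  using xr zr i by (simp add: distrib_right mult.assoc)
 also have "?S * c = c + u * c + z * c" by (simp add: distrib_right i xr)
 also have "(a + a * x + a * z) * (c + u * c + z * c) = a * x * u + 2 *\<^sub>R (a * z)"
 proof -
  have "a * x * c = 0" "a * x * (z * c) = 0" "a * z * (u * c) = 0" "a * z * (z * c) = 0" "a * (u * c) = 0"
   "a * (z * c) = a * z" "a * z * c = a * z" "a * x * (u * c) = a * x * u"
  proof -
   show "a * x * c = 0" using xr i(8) by (simp add: mult.assoc)
   show "a * x * (z * c) = 0" using xr zr by (metis mult.assoc mult_zero_left mult_zero_right)
   show "a * z * (u * c) = 0" using zr ur by (metis mult.assoc mult_zero_left mult_zero_right)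
   show "a * z * (z * c) = 0" using zr i by (metis mult.assoc mult_zero_left mult_zero_right)
   show "a * (u * c) = 0" using ur by (metis mult.assoc mult_zero_left)
   show az: "a * (z * c) = a * z" using zr i by (metis mult.assoc)
   then show "a * z * c = a * z" by (simp add: mult.assoc)
   show "a * x * (u * c) = a * x * u" using xr ur i by (metis mult.assoc)
  qed
  then show ?thesis using i by (simp add: distrib_left distrib_right scaleR_2)
 qed
 finally have "a * x * u + 2 *\<^sub>R (a * z) = 3 *\<^sub>R (a * z)" .
 moreover have "3 *\<^sub>R (a * z) = a * z + 2 *\<^sub>R (a * z)" using scaleR_add_left[of 1 2 "a * z"] by simp
 ultimately show ?thesis unfolding v by simp
qed

text \<open>The matrix unit at \<open>(al, be)\<close>: left multiplication by \<open>e al\<close>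
  cuts the symmetric element \<open>y al be\<close> down to one of its two halves.\<close>

definition "E al be = (if al = be then e al else e al * y al be)"

lemma E_right: "al \<in> TH ==> be \<in> TH ==> bl al = bl be ==> al ~= be ==> E al be = y al be * e be"
 unfolding E_def using y_relations(3)[of al be] by simp

lemma E_e: "al \<in> TH ==> be \<in> TH ==> bl al = bl be ==> E al be * e be = E al be"
 and e_E: "al \<in> TH ==> e al * E al be = E al be"
proof -
 show "E al be * e be = E al be" if "al \<in> TH" "be \<in> TH" "bl al = bl be"
 proof (cases "al = be")
  case False
  then show ?thesis using that E_right[of al be] e_idem[of be] by (simp add: mult.assoc)
 qed (use that e_idem in \<open>simp add: E_def\<close>)
 show "al \<in> TH ==> e al * E al be = E al be"
  unfolding E_def by (auto simp: e_idem simp flip: mult.assoc)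
qed

text \<open>Among matching indices only two cases carry content: returning to the start uses
  \<open>y_relations(1)\<close>, three distinct indices use \<open>y_triple\<close>.\<close>

lemma E_mult:
 assumes "al \<in> TH" "be \<in> TH" "\<gamma> \<in> TH" "\<delta> \<in> TH" "bl al = bl be" "bl \<gamma> = bl \<delta>"
 shows "E al be * E \<gamma> \<delta> = (if be = \<gamma> then E al \<delta> else 0)"
proof (cases "be = \<gamma>")
 case False
 have "E al be * E \<gamma> \<delta> = (E al be * e be) * (e \<gamma> * E \<gamma> \<delta>)" using assms by (simp add: E_e e_E)
 also have "\<dots> = E al be * (e be * e \<gamma>) * E \<gamma> \<delta>" by (simp add: mult.assoc)
 finally show ?thesis using False assms by (simp add: e_orth)
next
 case eq: True
 consider "al = be" | "be = \<delta>" | "al ~= be" "be ~= \<delta>" "al = \<delta>" | "al ~= be" "be ~= \<delta>" "al ~= \<delta>" by blast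
 then show ?thesis
 proof cases
  case 1
  then show ?thesis using eq e_E[OF assms(3), of \<delta>] by (simp add: E_def)
 next
  case 2
  then show ?thesis using eq assms E_e[of al be] by (auto simp: E_def)
 next
  case 3
  have "E al be * E be al = (e al * y al be) * (y be al * e al)"
   using 3 assms eq E_right[of be al] by (simp add: E_def)
  also have "\<dots> = e al * (y al be * y al be) * e al" by (simp add: mult.assoc y_commute[of be al])
  also have "\<dots> = e al"
   using 3 assms by (simp add: y_relations(1) distrib_left e_idem e_orth)
  finally show ?thesis using 3 eq by (simp add: E_def)
 next
  case 4
  have "E al be * E be \<delta> = (e al * y al be * e be) * y be \<delta>"
   using 4 by (simp add: E_def mult.assoc)
  also have "e al * y al be * e be = e al * y al be"
   using E_e[of al be] 4 assms by (simp add: E_def)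
  also have "e al * y al be * y be \<delta> = e al * y al \<delta>"
   using y_triple[of al be \<delta>] assms eq 4 by simp
  finally show ?thesis using 4 eq by (simp add: E_def)
 qed
qed

text \<open>On the spanning matrices \<open>ymat\<close>, both \<open>\<sigma>\<close> and
  \<open>\<tau>\<close> are the restriction of the algebra map given by the units \<open>E\<close>.
  This identifies the representation with a sum of standard ones.\<close>

lemma sigma_ymat:
 assumes "al \<in> TH" "be \<in> TH" "bl al = bl be"
 shows "\<sigma> (ymat al be) = E al be + E be al" "\<tau> (ymat al be) = \<sigma> (ymat al be)"
proof -
 let ?d = "\<lambda>al. outer (\<lambda>\<theta>. of_bool (\<theta> = al))"
 have td: "\<tau> (?d \<gamma>) = e \<gamma>" if "\<gamma> \<in> TH" for \<gamma>
  unfolding e_def using nn_square(2)[of "\<lambda>\<theta>. of_bool (\<theta> = \<gamma>)" 1] that by (simp add: dot_delta)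
 have sd: "\<sigma> (?d \<gamma>) = e \<gamma>" for \<gamma> unfolding e_def nn_def ..
 have eq: "\<tau> (ymat al be) = E al be + E be al \<and> \<sigma> (ymat al be) = E al be + E be al"
 proof (cases "al = be")
  case True
  have "ymat al al = (\<lambda>\<theta> \<eta>. 2 * ?d al \<theta> \<eta>)"
   unfolding ymat_def outer_def by (intro ext) simp
  then show ?thesis using assms True by (simp add: tau_scale sigma_scale td sd E_def scaleR_2)
 next
  case False
  have "outer (v3 1 al 1 be 0 be) = (\<lambda>\<theta> \<eta>. (?d al \<theta> \<eta> + ?d be \<theta> \<eta>) + ymat al be \<theta> \<eta>)"
   unfolding outer_def v3_def ymat_def of_bool_conj by (intro ext) (simp add: algebra_simps)
  then have "\<tau> (outer (v3 1 al 1 be 0 be)) = e al + e be + \<tau> (ymat al be)"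
   using assms by (simp add: tau_add td)
  then have t: "\<tau> (ymat al be) = y al be" using v3_square(2)[OF assms False, of 1 1] by simp
  have "E al be + E be al = e al * y al be + e be * y al be"
   using False by (simp add: E_def y_commute)
  then show ?thesis using t y_relations(2,4)[OF assms False] unfolding y_def[symmetric] by simp
 qed
 then show "\<sigma> (ymat al be) = E al be + E be al" "\<tau> (ymat al be) = \<sigma> (ymat al be)" by auto
qed

lemma sum_e: "(\<Sum>al\<in>TH. e al) = P True"
proof -
 let ?d = "\<lambda>al. outer (\<lambda>\<theta>. of_bool (\<theta> = al))"
 have "\<sigma> (\<lambda>\<theta> \<eta>. \<Sum>al\<in>F. ?d al \<theta> \<eta>) = (\<Sum>al\<in>F. e al) \<and> bs (\<lambda>\<theta> \<eta>. \<Sum>al\<in>F. ?d al \<theta> \<eta>)"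
  if "finite F" "F \<subseteq> TH" for F
  using that
 proof (induction F rule: finite_induct)
  case empty
  have "bs (\<lambda>\<theta> \<eta>. 0 * idm \<theta> \<eta>)" "\<sigma> (\<lambda>\<theta> \<eta>. 0 * idm \<theta> \<eta>) = 0 *\<^sub>R \<sigma> idm"
   using bs_scale[OF bs_idm] sigma_scale[OF bs_idm] by blast+
  then show ?case by simp
 next
  case (insert al F)
  then show ?case by (simp add: sigma_add e_def nn_def)
 qed
 from this[OF fin subset_refl] have "\<sigma> (\<lambda>\<theta> \<eta>. \<Sum>al\<in>TH. ?d al \<theta> \<eta>) = (\<Sum>al\<in>TH. e al)" by simp
 moreover have "(\<lambda>\<theta> \<eta>. \<Sum>al\<in>TH. ?d al \<theta> \<eta>) = idm"
 proof (intro ext)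
  fix \<theta> \<eta>
  have "(\<Sum>al\<in>TH. ?d al \<theta> \<eta>) = (\<Sum>al\<in>TH. if al = \<theta> then of_bool (\<eta> = \<theta>) else 0)"
   unfolding outer_def by (rule sum.cong) auto
  then show "(\<Sum>al\<in>TH. ?d al \<theta> \<eta>) = idm \<theta> \<eta>" using fin by (auto simp: idm_def)
 qed
 ultimately show ?thesis by (simp add: sigma_idm)
qed

lemma P_E: "al \<in> TH ==> P True * E al be = E al be"
 and E_P: "al \<in> TH ==> be \<in> TH ==> bl al = bl be ==> E al be * P True = E al be"
proof -
 have Pe: "P True * e \<gamma> = e \<gamma>" "e \<gamma> * P True = e \<gamma>" if "\<gamma> \<in> TH" for \<gamma>
  unfolding e_def nn_def using that by (simp_all add: P_sigma)
 show "P True * E al be = E al be" if "al \<in> TH"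
  using Pe(1)[OF that] e_E[OF that, of be] by (metis mult.assoc)
 show "E al be * P True = E al be" if "al \<in> TH" "be \<in> TH" "bl al = bl be"
  using Pe(2)[OF that(2)] E_e[OF that] by (metis mult.assoc)
qed

end

section \<open>Columns and rows of matrix units as intertwiners\<close>

context symmetric_rep
begin

text \<open>\<open>xx \<theta>0\<close> is column \<open>\<theta>0\<close> of the matrix units,
  extended to the second corner by \<open>U False\<close>; \<open>yy\<close> below is the dual row.
  The division by the size of the block in \<open>yy\<close> compensates for the number of columns
  when all of them are summed in \<open>sum_bimodule_maps\<close>.\<close>

definition "xx \<theta>0 l = (if bl (fst l) = bl \<theta>0 then if snd l then E (fst l) \<theta>0 else U False * E (fst l) \<theta>0 else 0)"
definition "yy \<theta>0 l = (if bl (fst l) = bl \<theta>0 then (1 / real (card {\<eta> \<in> TH. bl \<eta> = bl \<theta>0})) *\<^sub>R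
 (if snd l then E \<theta>0 (fst l) else E \<theta>0 (fst l) * U True) else 0)"

lemma corner:
 "U True * P False = U True" "U False * P True = U False" "P True * U True = U True" "P False * U False = U False"
 "P True * P False = 0" "P False * P True = 0"
 using PU(2)[of True] PU(2)[of False] PU(1)[of True] PU(1)[of False] PP(2)[of True] PP(2)[of False] by simp_all

text \<open>Under left multiplication by \<open>q\<close>, the elements
  \<open>xx \<theta>0 l\<close> transform like the basis vectors of the standard representation, and
  under right multiplication the \<open>yy \<theta>0 l\<close> transform like the dual basis. The
  last three parts record the corners in which they lie.\<close>

lemma bimodule_maps:
 assumes t: "\<theta>0 \<in> TH" and ab: "al \<in> TH" "be \<in> TH" "bl al = bl be" and g: "\<gamma> \<in> TH"
 shows "q b (ymat al be) * xx \<theta>0 (\<gamma>, \<not> b) = (if \<gamma> = be then xx \<theta>0 (al, b) else 0) + (if \<gamma> = al then xx \<theta>0 (be, b) else 0)" (is ?A)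
  and "q b (ymat al be) * xx \<theta>0 (\<gamma>, b) = 0" (is ?B)
  and "yy \<theta>0 (\<gamma>, b) * q b (ymat al be) = (if \<gamma> = al then yy \<theta>0 (be, \<not> b) else 0) + (if \<gamma> = be then yy \<theta>0 (al, \<not> b) else 0)" (is ?C)
  and "yy \<theta>0 (\<gamma>, \<not> b) * q b (ymat al be) = 0" (is ?D)
  and "P b * xx \<theta>0 (\<gamma>, b) = xx \<theta>0 (\<gamma>, b)" (is ?E)
  and "yy \<theta>0 (\<gamma>, b) * P b = yy \<theta>0 (\<gamma>, b)" (is ?F)
  and "P True * yy \<theta>0 (\<gamma>, b) = yy \<theta>0 (\<gamma>, b)" (is ?G)
proof -
 let ?Y = "ymat al be" and ?m = "1 / real (card {\<eta> \<in> TH. bl \<eta> = bl \<theta>0})"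
 have Y: "bs ?Y" using ab by simp
 have s: "\<sigma> ?Y = E al be + E be al" and tau: "\<tau> ?Y = E al be + E be al" using sigma_ymat[OF ab] by auto
 have qP: "q True ?Y * P False = q True ?Y" "P True * q True ?Y = q True ?Y" "q False ?Y * P True = q False ?Y" "P False * q False ?Y = q False ?Y"
  using Pq(2)[OF Y, of True] Pq(1)[OF Y, of True] Pq(2)[OF Y, of False] Pq(1)[OF Y, of False] by simp_all
 \<comment> \<open>The passage to the corner of \<open>P True\<close> is undone:
   \<open>q True\<close> and \<open>q False\<close> are recovered from \<open>\<sigma>\<close> and
   \<open>\<tau>\<close>.\<close>
 have "\<sigma> ?Y * U True = q True ?Y * (U False * U True)" unfolding \<sigma>_def by (simp only: mult.assoc)
 then have qT: "q True ?Y = \<sigma> ?Y * U True" unfolding UT qP ..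
 have "U False * \<tau> ?Y = (U False * U True) * q False ?Y" unfolding \<tau>_def by (simp only: mult.assoc)
 then have qF: "q False ?Y = U False * \<tau> ?Y" unfolding UT qP ..
 have UE: "U True * E \<gamma> \<theta>0 = 0" if "bl \<gamma> = bl \<theta>0"
 proof -
  have "U True * E \<gamma> \<theta>0 = (U True * P False) * (P True * E \<gamma> \<theta>0)"
   unfolding corner P_E[OF g] ..
  also have "\<dots> = U True * (P False * P True) * E \<gamma> \<theta>0" by (simp only: mult.assoc)
  finally show ?thesis unfolding corner by simp
 qed
 have EU: "E \<theta>0 \<gamma> * U False = 0" if "bl \<gamma> = bl \<theta>0"
 proof -
  have "E \<theta>0 \<gamma> * U False = (E \<theta>0 \<gamma> * P True) * (P False * U False)"
   unfolding corner E_P[OF t g that[symmetric]] ..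
  also have "\<dots> = E \<theta>0 \<gamma> * (P True * P False) * U False" by (simp only: mult.assoc)
  finally show ?thesis unfolding corner by simp
 qed
 have qU: "q False ?Y * U False = 0" "U True * q True ?Y = 0"
 proof -
  have "q False ?Y * U False = (q False ?Y * P True) * (P False * U False)" unfolding corner qP ..
  also have "\<dots> = q False ?Y * (P True * P False) * U False" by (simp only: mult.assoc)
  finally show "q False ?Y * U False = 0" unfolding corner by simp
  have "U True * q True ?Y = (U True * P False) * (P True * q True ?Y)" unfolding corner qP ..
  also have "\<dots> = U True * (P False * P True) * q True ?Y" by (simp only: mult.assoc)
  finally show "U True * q True ?Y = 0" unfolding corner by simp
 qed
 have EE1: "(E al be + E be al) * E \<gamma> \<theta>0 = (if \<gamma> = be then E al \<theta>0 else 0) + (if \<gamma> = al then E be \<theta>0 else 0)" if "bl \<gamma> = bl \<theta>0"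
  using that ab g t by (auto simp: distrib_right E_mult)
 have EE2: "E \<theta>0 \<gamma> * (E al be + E be al) = (if \<gamma> = al then E \<theta>0 be else 0) + (if \<gamma> = be then E \<theta>0 al else 0)" if "bl \<gamma> = bl \<theta>0"
  using that ab g t by (auto simp: distrib_left E_mult)
 have P1: "P True * E \<gamma> \<theta>0 = E \<gamma> \<theta>0" "U True * (U False * E \<gamma> \<theta>0) = E \<gamma> \<theta>0"
  using P_E[OF g, of \<theta>0] UT(1) mult.assoc[of "U True" "U False" "E \<gamma> \<theta>0"] by simp_all
 have P2: "E \<theta>0 \<gamma> * U True * U False = E \<theta>0 \<gamma>" if "bl \<gamma> = bl \<theta>0"
  using E_P[OF t g] that UT(1) mult.assoc[of "E \<theta>0 \<gamma>" "U True" "U False"] by simp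
 have xr: "(if \<gamma> = be then xx \<theta>0 (al, c) else 0) = (if \<gamma> = be then if c then E al \<theta>0 else U False * E al \<theta>0 else 0)"
  "(if \<gamma> = al then xx \<theta>0 (be, c) else 0) = (if \<gamma> = al then if c then E be \<theta>0 else U False * E be \<theta>0 else 0)"
  "(if \<gamma> = al then yy \<theta>0 (be, c) else 0) = (if \<gamma> = al then ?m *\<^sub>R (if c then E \<theta>0 be else E \<theta>0 be * U True) else 0)"
  "(if \<gamma> = be then yy \<theta>0 (al, c) else 0) = (if \<gamma> = be then ?m *\<^sub>R (if c then E \<theta>0 al else E \<theta>0 al * U True) else 0)"
  if g': "bl \<gamma> = bl \<theta>0" for c
  by (rule if_cong; use g' ab(3) in \<open>simp add: xx_def yy_def\<close>)+
 have xg: "xx \<theta>0 (\<gamma>, c) = (if c then E \<gamma> \<theta>0 else U False * E \<gamma> \<theta>0)"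
  "yy \<theta>0 (\<gamma>, c) = ?m *\<^sub>R (if c then E \<theta>0 \<gamma> else E \<theta>0 \<gamma> * U True)" if g': "bl \<gamma> = bl \<theta>0" for c
  using g' by (simp_all add: xx_def yy_def)
 have x0: "(if \<gamma> = be then xx \<theta>0 (al, c) else 0) = 0" "(if \<gamma> = al then xx \<theta>0 (be, c) else 0) = 0" "xx \<theta>0 (\<gamma>, c) = 0"
  "(if \<gamma> = al then yy \<theta>0 (be, c) else 0) = 0" "(if \<gamma> = be then yy \<theta>0 (al, c) else 0) = 0" "yy \<theta>0 (\<gamma>, c) = 0"
  if g': "bl \<gamma> ~= bl \<theta>0" for c
  using g' ab(3) by (auto simp: xx_def yy_def)
 show ?A
 proof (cases "bl \<gamma> = bl \<theta>0")
  case True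
  have "q True ?Y * (U False * E \<gamma> \<theta>0) = (E al be + E be al) * E \<gamma> \<theta>0"
   unfolding qT s by (simp add: mult.assoc P1)
  moreover have "q False ?Y * E \<gamma> \<theta>0 = U False * ((E al be + E be al) * E \<gamma> \<theta>0)"
   unfolding qF tau by (simp only: mult.assoc)
  ultimately show ?thesis unfolding xr[OF True] xg[OF True] EE1[OF True]
   by (cases b; cases "\<gamma> = be"; cases "\<gamma> = al") (simp_all add: distrib_left)
 qed (simp add: x0)
 show ?B
 proof (cases "bl \<gamma> = bl \<theta>0")
  case True
  have "q True ?Y * E \<gamma> \<theta>0 = 0" unfolding qT using UE[OF True] by (simp add: mult.assoc)
  moreover have "q False ?Y * (U False * E \<gamma> \<theta>0) = 0"
   using mult.assoc[of "q False ?Y" "U False" "E \<gamma> \<theta>0"] qU by simp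
  ultimately show ?thesis unfolding xg[OF True] by (cases b) simp_all
 qed (simp add: x0)
 show ?C
 proof (cases "bl \<gamma> = bl \<theta>0")
  case True
  have "E \<theta>0 \<gamma> * q True ?Y = (E \<theta>0 \<gamma> * (E al be + E be al)) * U True"
   unfolding qT s by (simp only: mult.assoc)
  moreover have "(E \<theta>0 \<gamma> * U True) * q False ?Y = E \<theta>0 \<gamma> * U True * U False * (E al be + E be al)"
   unfolding qF tau by (simp only: mult.assoc)
  ultimately show ?thesis unfolding xr[OF True] xg[OF True] EE2[OF True] P2[OF True]
   by (cases b; cases "\<gamma> = be"; cases "\<gamma> = al") (simp_all add: distrib_right scaleR_add_right)
 qed (simp add: x0)
 show ?D
 proof (cases "bl \<gamma> = bl \<theta>0")
  case True
  have "E \<theta>0 \<gamma> * q False ?Y = 0"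
   unfolding qF using EU[OF True] mult.assoc[of "E \<theta>0 \<gamma>" "U False" "\<tau> ?Y"] by simp
  moreover have "(E \<theta>0 \<gamma> * U True) * q True ?Y = 0"
   using qU by (simp add: mult.assoc)
  ultimately show ?thesis unfolding xg[OF True] by (cases b) simp_all
 qed (simp add: x0)
 have "P False * (U False * E \<gamma> \<theta>0) = U False * E \<gamma> \<theta>0"
  using mult.assoc[of "P False" "U False" "E \<gamma> \<theta>0"] corner by simp
 then show ?E using P1(1) by (cases b) (simp_all add: xx_def)
 have "(E \<theta>0 \<gamma> * U True) * P False = E \<theta>0 \<gamma> * U True"
  using corner by (simp add: mult.assoc)
 then show ?F using E_P[OF t g] by (cases b) (simp_all add: yy_def)
 have "P True * (E \<theta>0 \<gamma> * U True) = E \<theta>0 \<gamma> * U True"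
  using mult.assoc[of "P True" "E \<theta>0 \<gamma>" "U True"] P_E[OF t] by simp
 then show ?G using P_E[OF t] by (cases b) (simp_all add: yy_def)
qed

text \<open>Each \<open>\<theta>0\<close> in the block of \<open>\<gamma>\<close> contributes
  \<open>E \<gamma> \<theta>0 * E \<theta>0 \<gamma> = e \<gamma>\<close> and its copy in the other
  corner, and the normalization of \<open>yy\<close> turns their number into 1. This becomes the
  identity \<open>\<Sum> S T = 1\<close>.\<close>

lemma sum_bimodule_maps:
 "(\<Sum>\<theta>0\<in>TH. \<Sum>l\<in>TH \<times> UNIV. xx \<theta>0 l * yy \<theta>0 l) = P True + P False"
proof -
 define B where "B \<gamma> = {\<eta> \<in> TH. bl \<eta> = bl \<gamma>}" for \<gamma>
 \<comment> \<open>The diagonal unit at \<open>\<gamma>\<close> together with its transport to the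
   corner of \<open>P False\<close>.\<close>
 define ef where "ef \<gamma> = e \<gamma> + U False * e \<gamma> * U True" for \<gamma>
 have inner: "xx \<theta>0 (\<gamma>, True) * yy \<theta>0 (\<gamma>, True) + xx \<theta>0 (\<gamma>, False) * yy \<theta>0 (\<gamma>, False)
   = (if \<theta>0 \<in> B \<gamma> then (1 / real (card (B \<gamma>))) *\<^sub>R ef \<gamma> else 0)"
  if t: "\<theta>0 \<in> TH" and g: "\<gamma> \<in> TH" for \<theta>0 \<gamma>
 proof (cases "bl \<gamma> = bl \<theta>0")
  case True
  have m: "{\<eta> \<in> TH. bl \<eta> = bl \<theta>0} = B \<gamma>" "\<theta>0 \<in> B \<gamma>" unfolding B_def using True t by auto
  have ee: "E \<gamma> \<theta>0 * E \<theta>0 \<gamma> = e \<gamma>" using E_mult[OF g t t g True True[symmetric]] by (simp add: E_def)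
  have "U False * E \<gamma> \<theta>0 * (E \<theta>0 \<gamma> * U True) = U False * (E \<gamma> \<theta>0 * E \<theta>0 \<gamma>) * U True"
   by (simp only: mult.assoc)
  then show ?thesis unfolding xx_def yy_def fst_conv snd_conv m(1) ef_def ee
   using True m(2) ee by (simp only: if_True if_False simp_thms mult_scaleR_right scaleR_add_right)
 next
  case False
  then have "\<theta>0 \<notin> B \<gamma>" unfolding B_def by auto
  then show ?thesis using False by (simp add: xx_def)
 qed
 have "(\<Sum>\<theta>0\<in>TH. \<Sum>l\<in>TH \<times> UNIV. xx \<theta>0 l * yy \<theta>0 l) =
   (\<Sum>\<theta>0\<in>TH. \<Sum>\<gamma>\<in>TH. \<Sum>b\<in>UNIV. xx \<theta>0 (\<gamma>, b) * yy \<theta>0 (\<gamma>, b))"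
  by (rule sum.cong[OF refl]) (simp only: sum.cartesian_product split_def prod.collapse)
 also have "\<dots> = (\<Sum>\<theta>0\<in>TH. \<Sum>\<gamma>\<in>TH. if \<theta>0 \<in> B \<gamma> then (1 / real (card (B \<gamma>))) *\<^sub>R ef \<gamma> else 0)"
 proof (intro sum.cong refl)
  fix \<theta>0 \<gamma> assume "\<theta>0 \<in> TH" "\<gamma> \<in> TH"
  from inner[OF this] show "(\<Sum>b\<in>UNIV. xx \<theta>0 (\<gamma>, b) * yy \<theta>0 (\<gamma>, b)) =
    (if \<theta>0 \<in> B \<gamma> then (1 / real (card (B \<gamma>))) *\<^sub>R ef \<gamma> else 0)"
   unfolding UNIV_bool by (simp only: sum.insert finite.intros empty_iff insert_iff sum.empty simp_thms add_0_right add_0_left not_False_eq_True add.commute)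
 qed
 also have "\<dots> = (\<Sum>\<gamma>\<in>TH. \<Sum>\<theta>0\<in>TH. if \<theta>0 \<in> B \<gamma> then (1 / real (card (B \<gamma>))) *\<^sub>R ef \<gamma> else 0)"
  by (rule sum.swap)
 also have "\<dots> = (\<Sum>\<gamma>\<in>TH. ef \<gamma>)"
 proof (rule sum.cong[OF refl])
  fix \<gamma> assume g: "\<gamma> \<in> TH"
  have B: "\<gamma> \<in> B \<gamma>" "finite (B \<gamma>)" "TH \<inter> B \<gamma> = B \<gamma>" unfolding B_def using g fin by auto
  have "(\<Sum>\<theta>0\<in>TH. if \<theta>0 \<in> B \<gamma> then (1 / real (card (B \<gamma>))) *\<^sub>R ef \<gamma> else 0) = (\<Sum>\<theta>0\<in>B \<gamma>. (1 / real (card (B \<gamma>))) *\<^sub>R ef \<gamma>)"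
   using sum.inter_restrict[OF fin, of "\<lambda>_. (1 / real (card (B \<gamma>))) *\<^sub>R ef \<gamma>" "B \<gamma>"] B(3) by simp
  also have "\<dots> = ef \<gamma>" using B by (auto simp: sum_constant_scaleR card_eq_0_iff)
  finally show "(\<Sum>\<theta>0\<in>TH. if \<theta>0 \<in> B \<gamma> then (1 / real (card (B \<gamma>))) *\<^sub>R ef \<gamma> else 0) = ef \<gamma>" .
 qed
 also have "\<dots> = P True + U False * P True * U True"
  unfolding ef_def by (simp only: sum.distrib sum_distrib_left[symmetric] sum_distrib_right[symmetric] sum_e)
 also have "U False * P True * U True = P False" unfolding corner UT ..
 finally show ?thesis .
qed

end

section \<open>The real vector space of a PEL-datum\<close>

lemma sum_pair: "(\<Sum>a\<in>A. \<Sum>b\<in>B. g a b) = (\<Sum>p\<in>A \<times> B. g (fst p) (snd p))"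
 by (simp only: sum.cartesian_product split_def)

context PEL_datum
begin

abbreviation "IV \<equiv> basisV D"
abbreviation "IB \<equiv> basisB D"

sublocale VS: finite_dimensional_vector_space "scaleV D" "basisV D" by (rule V_fin_dim)
sublocale BS: finite_dimensional_vector_space "scaleB D" "basisB D" by (rule B_fin_dim)

lemma fin_IV: "finite IV" and fin_IB: "finite IB"
 using VS.finite_Basis BS.finite_Basis by auto

lemma coordV_expand: "(\<Sum>i\<in>IV. scaleV D (coordV D v i) i) = v"
 unfolding coordV_def
 using VS.sum_representation_eq[OF VS.independent_Basis, of v IV] VS.span_Basis fin_IV by simp

lemma coordB_expand: "(\<Sum>i\<in>IB. scaleB D (coordB D b i) i) = b"
 unfolding coordB_def
 using BS.sum_representation_eq[OF BS.independent_Basis, of b IB] BS.span_Basis fin_IB by simp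

lemma coordV_basis: "i \<in> IV ==> coordV D i j = (if j = i then 1 else 0)"
 unfolding coordV_def using VS.representation_basis[OF VS.independent_Basis] by simp

lemma coordB_basis: "i \<in> IB ==> coordB D i j = (if j = i then 1 else 0)"
 unfolding coordB_def using BS.representation_basis[OF BS.independent_Basis] by simp

lemma coordV_lin: "coordV D (\<Sum>i\<in>K. scaleV D (c i) (w i)) j = (\<Sum>i\<in>K. c i * coordV D (w i) j)"
proof -
 have sp: "x \<in> VS.span IV" for x using VS.span_Basis by simp
 show ?thesis unfolding coordV_def
  by (simp add: VS.representation_sum[OF VS.independent_Basis sp] VS.representation_scale[OF VS.independent_Basis sp])
qed

lemma act_sum: "act D a (\<Sum>i\<in>K. scaleV D (c i) (w i)) = (\<Sum>i\<in>K. scaleV D (c i) (act D a (w i)))"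
proof -
 interpret l: Vector_Spaces.linear "scaleV D" "scaleV D" "act D a" by (rule act_linear(1))
 show ?thesis by (simp add: l.sum l.scale)
qed

lemma act_sum_left: "act D (\<Sum>i\<in>K. scaleB D (c i) (w i)) v = (\<Sum>i\<in>K. scaleV D (c i) (act D (w i) v))"
proof -
 interpret l: Vector_Spaces.linear "scaleB D" "scaleV D" "\<lambda>a. act D a v" by (rule act_linear(2))
 show ?thesis by (simp add: l.sum l.scale)
qed

lemma pairing_sum_left: "pairing D (\<Sum>i\<in>K. scaleV D (c i) (w i)) v = (\<Sum>i\<in>K. c i * pairing D (w i) v)"
proof -
 interpret l: Vector_Spaces.linear "scaleV D" "(*)" "\<lambda>u. pairing D u v" by (rule pairing_linear(1))
 show ?thesis by (simp add: l.sum l.scale)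
qed

lemma pairing_sum_right: "pairing D v (\<Sum>i\<in>K. scaleV D (c i) (w i)) = (\<Sum>i\<in>K. c i * pairing D v (w i))"
proof -
 interpret l: Vector_Spaces.linear "scaleV D" "(*)" "\<lambda>u. pairing D v u" by (rule pairing_linear(2))
 show ?thesis by (simp add: l.sum l.scale)
qed

lemma pairing_skew: "pairing D u v = - pairing D v u"
proof -
 interpret l: Vector_Spaces.linear "scaleV D" "(*)" "\<lambda>u. pairing D u w" for w by (rule pairing_linear(1))
 interpret r: Vector_Spaces.linear "scaleV D" "(*)" "\<lambda>v. pairing D w v" for w by (rule pairing_linear(2))
 have "pairing D (u + v) (u + v) = (pairing D u u + pairing D u v) + (pairing D v u + pairing D v v)"
  by (simp only: l.add r.add)
 then show ?thesis by (simp add: pairing_alternating)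
qed

definition "rb b i j = (of_rat (coordV D (act D b j) i) :: real)"
definition "rp i j = (of_rat (pairing D i j) :: real)"
definition "ra x i j = (\<Sum>k\<in>IB. x k * rb k i j)"
definition "op M u = (\<lambda>i. if i \<in> IV then (\<Sum>j\<in>IV. M i j * u j) else (0::real))"
definition "om u v = (\<Sum>i\<in>IV. \<Sum>j\<in>IV. u i * v j * rp i j)"
definition "J i j = hh D \<i> (i, j)"
text \<open>Vectors of \<open>V\<close> over the reals are modelled as total functions vanishing off
  the basis. In contrast to extensional functions these are closed under pointwise
  operations.\<close>

definition "supp u \<longleftrightarrow> (\<forall>i. i \<notin> IV --> u i = (0::real))"

lemma op_supp [simp]: "supp (op M u)"
 unfolding supp_def op_def by simp

lemma op_add: "op M (\<lambda>i. u i + v i) = (\<lambda>i. op M u i + op M v i)"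
 and op_scale: "op M (\<lambda>i. c * u i) = (\<lambda>i. c * op M u i)"
 and op_diff: "op M (\<lambda>i. u i - v i) = (\<lambda>i. op M u i - op M v i)"
 unfolding op_def by (auto simp: fun_eq_iff algebra_simps sum.distrib sum_subtractf sum_distrib_left)

lemma op_sum: "op M (\<lambda>i. \<Sum>a\<in>K. u a i) = (\<lambda>i. \<Sum>a\<in>K. op M (u a) i)"
proof
 fix i
 have "(\<Sum>j\<in>IV. M i j * (\<Sum>a\<in>K. u a j)) = (\<Sum>a\<in>K. \<Sum>j\<in>IV. M i j * u a j)"
  unfolding sum_distrib_left by (rule sum.swap)
 then show "op M (\<lambda>i. \<Sum>a\<in>K. u a i) i = (\<Sum>a\<in>K. op M (u a) i)" unfolding op_def by simp
qed

lemma om_add: "om (\<lambda>i. u i + v i) w = om u w + om v w" "om w (\<lambda>i. u i + v i) = om w u + om w v"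
 and om_scale: "om (\<lambda>i. c * u i) w = c * om u w" "om w (\<lambda>i. c * u i) = c * om w u"
 and om_diff: "om (\<lambda>i. u i - v i) w = om u w - om v w" "om w (\<lambda>i. u i - v i) = om w u - om w v"
 unfolding om_def by (simp_all add: algebra_simps sum.distrib sum_subtractf sum_distrib_left)

lemma om_minus: "om (\<lambda>i. - u i) w = - om u w" "om w (\<lambda>i. - u i) = - om w u"
 using om_scale(1)[of "-1" u w] om_scale(2)[of w "-1" u] by simp_all

lemma om_zero: "om (\<lambda>i. 0) w = 0" "om w (\<lambda>i. 0) = 0"
 unfolding om_def by simp_all

lemma om_sum: "om (\<lambda>i. \<Sum>a\<in>K. u a i) w = (\<Sum>a\<in>K. om (u a) w)"
proof (induction K rule: infinite_finite_induct)
 case (insert a K)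
 then show ?case by (simp add: om_add)
qed (simp_all add: om_zero)

lemma rp_skew: "rp i j = - rp j i"
 unfolding rp_def using pairing_skew[of i j] by (simp add: of_rat_minus)

lemma om_skew: "om u v = - om v u"
proof -
 have "om u v = (\<Sum>j\<in>IV. \<Sum>i\<in>IV. u i * v j * rp i j)" unfolding om_def by (rule sum.swap)
 also have "\<dots> = (\<Sum>j\<in>IV. \<Sum>i\<in>IV. - (v j * u i * rp j i))"
  by (intro sum.cong refl) (subst rp_skew, simp)
 finally show ?thesis unfolding om_def by (simp add: sum_negf)
qed

lemma om_self: "om u u = 0"
 using om_skew[of u u] by simp

lemma op_op: "op M (op N u) = op (\<lambda>i j. \<Sum>l\<in>IV. M i l * N l j) u"
proof
 fix i
 have "(\<Sum>l\<in>IV. M i l * op N u l) = (\<Sum>l\<in>IV. \<Sum>j\<in>IV. M i l * N l j * u j)"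
  unfolding op_def by (intro sum.cong refl) (simp add: sum_distrib_left mult.assoc)
 also have "\<dots> = (\<Sum>j\<in>IV. \<Sum>l\<in>IV. M i l * N l j * u j)" by (rule sum.swap)
 finally show "op M (op N u) i = op (\<lambda>i j. \<Sum>l\<in>IV. M i l * N l j) u i"
  unfolding op_def[of M] op_def[of "\<lambda>i j. \<Sum>l\<in>IV. M i l * N l j"] by (simp add: sum_distrib_right)
qed

lemma op_cong: "(!!i j. i \<in> IV ==> j \<in> IV ==> M i j = N i j) ==> op M u = op N u"
 unfolding op_def by (auto simp: fun_eq_iff intro!: sum.cong)

lemma op_one: "supp u ==> op (\<lambda>i j. c * (if i = j then 1 else 0)) u = (\<lambda>i. c * u i)"
proof
 fix i assume u: "supp u"
 have "(\<Sum>j\<in>IV. c * (if i = j then 1 else 0) * u j) = c * u i" if "i \<in> IV"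
 proof -
  have "(\<Sum>j\<in>IV. c * (if i = j then 1 else 0) * u j) = (\<Sum>j\<in>IV. if j = i then c * u i else 0)"
   by (rule sum.cong) auto
  then show ?thesis using that fin_IV by simp
 qed
 then show "op (\<lambda>i j. c * (if i = j then 1 else 0)) u i = c * u i"
  using u unfolding op_def supp_def by auto
qed

lemma om_op: "om (op M u) v = (\<Sum>i\<in>IV. \<Sum>j\<in>IV. u i * v j * (\<Sum>l\<in>IV. M l i * rp l j))"
 and om_op_right: "om u (op M v) = (\<Sum>i\<in>IV. \<Sum>j\<in>IV. u i * v j * (\<Sum>l\<in>IV. rp i l * M l j))"
proof -
 have "om (op M u) v = (\<Sum>l\<in>IV. \<Sum>j\<in>IV. \<Sum>i\<in>IV. u i * v j * (M l i * rp l j))"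
  unfolding om_def op_def by (intro sum.cong refl) (simp add: sum_distrib_right sum_distrib_left algebra_simps)
 also have "\<dots> = (\<Sum>j\<in>IV. \<Sum>l\<in>IV. \<Sum>i\<in>IV. u i * v j * (M l i * rp l j))" by (rule sum.swap)
 also have "\<dots> = (\<Sum>j\<in>IV. \<Sum>i\<in>IV. \<Sum>l\<in>IV. u i * v j * (M l i * rp l j))"
  by (rule sum.cong[OF refl]) (rule sum.swap)
 also have "\<dots> = (\<Sum>i\<in>IV. \<Sum>j\<in>IV. \<Sum>l\<in>IV. u i * v j * (M l i * rp l j))" by (rule sum.swap)
 finally show "om (op M u) v = (\<Sum>i\<in>IV. \<Sum>j\<in>IV. u i * v j * (\<Sum>l\<in>IV. M l i * rp l j))"
  by (simp add: sum_distrib_left)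
 have "om u (op M v) = (\<Sum>i\<in>IV. \<Sum>l\<in>IV. \<Sum>j\<in>IV. u i * v j * (rp i l * M l j))"
  unfolding om_def op_def by (intro sum.cong refl) (simp add: sum_distrib_right sum_distrib_left algebra_simps)
 also have "\<dots> = (\<Sum>i\<in>IV. \<Sum>j\<in>IV. \<Sum>l\<in>IV. u i * v j * (rp i l * M l j))"
  by (rule sum.cong[OF refl]) (rule sum.swap)
 finally show "om u (op M v) = (\<Sum>i\<in>IV. \<Sum>j\<in>IV. u i * v j * (\<Sum>l\<in>IV. rp i l * M l j))"
  by (simp add: sum_distrib_left)
qed

lemma rb_mult: "rb (a * b) i j = (\<Sum>l\<in>IV. rb a i l * rb b l j)"
proof -
 have "act D (a * b) j = (\<Sum>l\<in>IV. scaleV D (coordV D (act D b j) l) (act D a l))"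
  unfolding act_mult act_sum[symmetric] coordV_expand ..
 then show ?thesis unfolding rb_def by (simp add: coordV_lin of_rat_sum of_rat_mult mult.commute)
qed

lemma rb_expand: "rb a i j = (\<Sum>k\<in>IB. of_rat (coordB D a k) * rb k i j)"
proof -
 have "act D a j = (\<Sum>k\<in>IB. scaleV D (coordB D a k) (act D k j))"
  unfolding act_sum_left[symmetric] coordB_expand ..
 then show ?thesis unfolding rb_def by (simp add: coordV_lin of_rat_sum of_rat_mult)
qed

lemma rb_one: "j \<in> IV ==> rb (oneB D) i j = (if i = j then 1 else 0)"
 unfolding rb_def by (simp add: act_unit coordV_basis)

lemma rb_star: "(\<Sum>l\<in>IV. rb b l i * rp l j) = (\<Sum>l\<in>IV. rp i l * rb (star D b) l j)"
proof -
 have "(\<Sum>l\<in>IV. coordV D (act D b i) l * pairing D l j) = pairing D (act D b i) j"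
  unfolding pairing_sum_left[symmetric] coordV_expand ..
 also have "\<dots> = (\<Sum>l\<in>IV. coordV D (act D (star D b) j) l * pairing D i l)"
  unfolding pairing_star pairing_sum_right[symmetric] coordV_expand ..
 finally have "(of_rat (\<Sum>l\<in>IV. coordV D (act D b i) l * pairing D l j) :: real)
   = of_rat (\<Sum>l\<in>IV. coordV D (act D (star D b) j) l * pairing D i l)" by simp
 then show ?thesis unfolding rb_def rp_def by (simp add: of_rat_sum of_rat_mult mult.commute)
qed

lemma ra_mult: "(\<Sum>l\<in>IV. ra x i l * ra y l j) = ra (BR_mult real_ring D x y) i j"
proof -
 have "(\<Sum>l\<in>IV. ra x i l * ra y l j) = (\<Sum>l\<in>IV. \<Sum>b\<in>IB. \<Sum>c\<in>IB. x b * y c * (rb b i l * rb c l j))"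
  unfolding ra_def by (intro sum.cong refl) (simp add: sum_product algebra_simps)
 also have "\<dots> = (\<Sum>b\<in>IB. \<Sum>l\<in>IV. \<Sum>c\<in>IB. x b * y c * (rb b i l * rb c l j))" by (rule sum.swap)
 also have "\<dots> = (\<Sum>b\<in>IB. \<Sum>c\<in>IB. \<Sum>l\<in>IV. x b * y c * (rb b i l * rb c l j))"
  by (rule sum.cong[OF refl]) (rule sum.swap)
 also have "\<dots> = (\<Sum>b\<in>IB. \<Sum>c\<in>IB. x b * y c * rb (b * c) i j)"
  unfolding rb_mult by (simp add: sum_distrib_left)
 also have "\<dots> = (\<Sum>b\<in>IB. \<Sum>c\<in>IB. \<Sum>k\<in>IB. x b * y c * of_rat (coordB D (b * c) k) * rb k i j)"
  by (subst rb_expand) (simp add: sum_distrib_left mult.assoc)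
 also have "\<dots> = (\<Sum>p\<in>IB \<times> IB. \<Sum>k\<in>IB. x (fst p) * y (snd p) * of_rat (coordB D (fst p * snd p) k) * rb k i j)"
  by (rule sum_pair)
 also have "\<dots> = (\<Sum>k\<in>IB. \<Sum>p\<in>IB \<times> IB. x (fst p) * y (snd p) * of_rat (coordB D (fst p * snd p) k) * rb k i j)"
  by (rule sum.swap)
 also have "\<dots> = ra (BR_mult real_ring D x y) i j"
  unfolding ra_def BR_mult_def using fin_IB by (intro sum.cong refl) (simp add: sum_distrib_right split_def)
 finally show ?thesis .
qed

lemma ra_one: "j \<in> IV ==> ra (BR_one real_ring D) i j = (if i = j then 1 else 0)"
 using rb_expand[of "oneB D" i j] rb_one[of j i] unfolding ra_def BR_one_def by simp

lemma ra_star: "(\<Sum>l\<in>IV. ra x l i * rp l j) = (\<Sum>l\<in>IV. rp i l * ra (BR_star real_ring D x) l j)"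
proof -
 have "(\<Sum>l\<in>IV. ra x l i * rp l j) = (\<Sum>l\<in>IV. \<Sum>b\<in>IB. x b * (rb b l i * rp l j))"
  unfolding ra_def by (simp add: sum_distrib_right mult.assoc)
 also have "\<dots> = (\<Sum>b\<in>IB. \<Sum>l\<in>IV. x b * (rb b l i * rp l j))" by (rule sum.swap)
 also have "\<dots> = (\<Sum>b\<in>IB. \<Sum>l\<in>IV. x b * (rp i l * rb (star D b) l j))"
  unfolding sum_distrib_left[symmetric] rb_star ..
 also have "\<dots> = (\<Sum>l\<in>IV. \<Sum>b\<in>IB. x b * (rp i l * rb (star D b) l j))" by (rule sum.swap)
 also have "\<dots> = (\<Sum>l\<in>IV. rp i l * ra (BR_star real_ring D x) l j)"
 proof (rule sum.cong[OF refl])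
  fix l
  have "(\<Sum>b\<in>IB. x b * rb (star D b) l j) = (\<Sum>b\<in>IB. \<Sum>k\<in>IB. x b * of_rat (coordB D (star D b) k) * rb k l j)"
   by (subst rb_expand) (simp add: sum_distrib_left mult.assoc)
  also have "\<dots> = (\<Sum>k\<in>IB. \<Sum>b\<in>IB. x b * of_rat (coordB D (star D b) k) * rb k l j)" by (rule sum.swap)
  also have "\<dots> = ra (BR_star real_ring D x) l j"
   unfolding ra_def BR_star_def using fin_IB by (intro sum.cong refl) (simp add: sum_distrib_right)
  finally have e: "(\<Sum>b\<in>IB. x b * rb (star D b) l j) = ra (BR_star real_ring D x) l j" .
  have "(\<Sum>b\<in>IB. x b * (rp i l * rb (star D b) l j)) = rp i l * (\<Sum>b\<in>IB. x b * rb (star D b) l j)"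
   by (simp add: sum_distrib_left mult.left_commute)
  then show "(\<Sum>b\<in>IB. x b * (rp i l * rb (star D b) l j)) = rp i l * ra (BR_star real_ring D x) l j"
   unfolding e .
 qed
 finally show ?thesis .
qed

lemma op_ra_mult: "op (ra x) (op (ra y) u) = op (ra (BR_mult real_ring D x y)) u"
 unfolding op_op ra_mult ..

lemma om_ra: "om (op (ra x) u) v = om u (op (ra (BR_star real_ring D x)) v)"
 unfolding om_op om_op_right ra_star ..

lemma hi_entry: "i \<in> IV ==> j \<in> IV ==> hh D (- \<i>) (i, j) = - J i j"
 using h_scale[of "-1" "\<i>"] unfolding J_def by simp

lemma J_J: assumes "supp u" shows "op J (op J u) = (\<lambda>i. - u i)"
proof -
 have m1: "hh D (- 1) (i, j) = - 1 * (if i = j then 1 else 0)" if "i \<in> IV" "j \<in> IV" for i j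
  using h_scale[of "-1" "1"] that by (simp add: h_unit mone_entry)
 have sq: "hh D (\<i> * \<i>) (i, j) = (\<Sum>l\<in>IV. J i l * J l j)" if "i \<in> IV" "j \<in> IV" for i j
  unfolding h_mult J_def using that fin_IV by (simp add: mmul_entry)
 have "(\<Sum>l\<in>IV. J i l * J l j) = - 1 * (if i = j then 1 else 0)" if "i \<in> IV" "j \<in> IV" for i j
  using m1[OF that] sq[OF that] by simp
 then have "op J (op J u) = op (\<lambda>i j. - 1 * (if i = j then 1 else 0)) u"
  unfolding op_op by (rule op_cong)
 then show ?thesis using op_one[OF assms, of "-1"] by simp
qed

lemma VR_om: "VR_pairing real_ring D (\<lambda>i\<in>IV. u i) (\<lambda>i\<in>IV. v i) = om u v"
proof -
 have "VR_pairing real_ring D (\<lambda>i\<in>IV. u i) (\<lambda>i\<in>IV. v i) = (\<Sum>p\<in>IV \<times> IV. u (fst p) * v (snd p) * rp (fst p) (snd p))"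
  unfolding VR_pairing_def using fin_IV by (auto simp: split_def rp_def intro!: sum.cong)
 then show ?thesis unfolding om_def sum_pair .
qed

lemma mapply_hh: "mapply real_ring IV IV (hh D z) (\<lambda>i\<in>IV. u i) = (\<lambda>i\<in>IV. op (\<lambda>i j. hh D z (i, j)) u i)"
 unfolding mapply_def op_def using fin_IV by (intro restrict_ext) simp

lemma vec_memb: "(\<lambda>i\<in>IV. u i) \<in> vecs real_ring IV"
 by (rule vecs_memI) simp

text \<open>The adjoint of \<open>h(\<i>)\<close> is \<open>h\<close> of the conjugate, which is
  \<open>- h(\<i>)\<close>.\<close>

lemma om_J: "om (op J u) v = - om u (op J v)"
proof -
 have "om (op J u) v = om u (op (\<lambda>i j. hh D (- \<i>) (i, j)) v)"
  using h_adjoint[OF vec_memb vec_memb, of "\<i>" u v] unfolding mapply_hh VR_om J_def by simp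
 also have "op (\<lambda>i j. hh D (- \<i>) (i, j)) v = (\<lambda>i. - op J v i)"
  unfolding op_def using hi_entry by (auto simp: fun_eq_iff sum_negf[symmetric] intro!: sum.cong)
 finally show ?thesis unfolding om_minus .
qed

lemma om_pos: assumes "supp u" "u ~= (\<lambda>i. 0)" shows "om u (op J u) > 0"
proof -
 have "(\<lambda>i\<in>IV. u i) ~= (\<lambda>i\<in>IV. 0)"
 proof
  assume e: "(\<lambda>i\<in>IV. u i) = (\<lambda>i\<in>IV. 0)"
  have "u i = 0" for i
  proof (cases "i \<in> IV")
   case True
   then show ?thesis using fun_cong[OF e, of i] by simp
  qed (use assms(1) in \<open>simp add: supp_def\<close>)
  then show False using assms(2) by auto
 qed
 from h_positive[OF vec_memb this] show ?thesis unfolding mapply_hh VR_om J_def .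
qed

lemma J_ra: assumes "x \<in> vecs real_ring IB" shows "op J (op (ra x) u) = op (ra x) (op J u)"
 unfolding op_op
proof (rule op_cong)
 fix i j assume ij: "i \<in> IV" "j \<in> IV"
 have b: "BR_act real_ring D x (i, j) = ra x i j" if "i \<in> IV" "j \<in> IV" for i j
  unfolding BR_act_def ra_def rb_def using that fin_IB by simp
 have "mmul real_ring IV IV IV (hh D \<i>) (BR_act real_ring D x) (i, j) =
   mmul real_ring IV IV IV (BR_act real_ring D x) (hh D \<i>) (i, j)"
  using h_End[of "\<i>"] assms unfolding BR_End_def by auto
 then show "(\<Sum>l\<in>IV. J i l * ra x l j) = (\<Sum>l\<in>IV. ra x i l * J l j)"
  using ij fin_IV by (simp add: mmul_entry J_def b cong: sum.cong)
qed

lemma op_ra_one: "supp u ==> op (ra (BR_one real_ring D)) u = u"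
 using op_one[of u 1] op_cong[of "ra (BR_one real_ring D)" "\<lambda>i j. 1 * (if i = j then 1 else 0)" u] ra_one by simp

lemma BR_mult_closed: "BR_mult real_ring D x y \<in> vecs real_ring IB"
 unfolding BR_mult_def by (rule vecs_memI) simp

lemma BR_one_closed: "BR_one real_ring D \<in> vecs real_ring IB"
 unfolding BR_one_def by (rule vecs_memI) simp

lemma BR_star_closed: "BR_star real_ring D x \<in> vecs real_ring IB"
 unfolding BR_star_def by (rule vecs_memI) simp

section \<open>Adapted symplectic bases\<close>

text \<open>Orthonormal systems for the hermitian form composed of \<open>om u (op J v)\<close> and
  \<open>om u v\<close>; together with its image under \<open>J\<close> such a set is a symplectic
  basis of its real span.\<close>

definition "adapted W T \<longleftrightarrow> T \<subseteq> W \<and> (\<forall>a\<in>T. \<forall>b\<in>T. om a b = 0 \<and> om a (op J b) = (if a = b then 1 else 0))"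

lemma maximal_adapted:
 obtains T where "adapted W T" "!!T'. adapted W T' ==> T \<subseteq> T' ==> T' = T"
proof -
 define F where "F = {T. adapted W T}"
 have "{} \<in> F" unfolding F_def adapted_def by simp
 moreover have "\<Union>C \<in> F" if C: "C ~= {}" "subset.chain F C" for C
  unfolding F_def mem_Collect_eq adapted_def
 proof (intro conjI ballI)
  show "\<Union>C \<subseteq> W" using C(2) unfolding subset.chain_def F_def adapted_def by blast
  fix a b assume "a \<in> \<Union>C" "b \<in> \<Union>C"
  then obtain K L where KL: "a \<in> K" "b \<in> L" "K \<in> C" "L \<in> C" by blast
  then have "K \<subseteq> L | L \<subseteq> K" using C(2) unfolding subset.chain_def by blast
  then obtain M where M: "a \<in> M" "b \<in> M" "M \<in> C" using KL by blast
  then have "adapted W M" using C(2) unfolding subset.chain_def F_def by blast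
  then show "om a b = 0" "om a (op J b) = (if a = b then 1 else 0)" using M unfolding adapted_def by blast+
 qed
 ultimately obtain T where "T \<in> F" "\<forall>T'\<in>F. T \<subseteq> T' --> T' = T"
  using subset_Zorn_nonempty[of F] by blast
 then show thesis using that unfolding F_def by blast
qed

text \<open>Pairing a linear relation with \<open>op J v\<close> isolates the coefficient of
  \<open>v\<close>, so an adapted set is linearly independent.\<close>

lemma finite_adapted:
 assumes T: "adapted W T" and W: "!!a. a \<in> W ==> supp a"
 shows "finite T"
proof -
 interpret R: vector_space "\<lambda>(c::real) (f :: 'v => real) i. c * f i"
  by unfold_locales (auto simp: fun_eq_iff algebra_simps)
 let ?d = "\<lambda>k. (\<lambda>i. if i = k then 1 else 0) :: 'v => real"
 have fsum: "(\<Sum>a\<in>K. g a) = (\<lambda>i. \<Sum>a\<in>K. g a i)" for K :: "'z set" and g :: "'z => 'v => real"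
  by (induction K rule: infinite_finite_induct) (auto simp: fun_eq_iff)
 have "T \<subseteq> R.span (?d ` IV)"
 proof
  fix a assume "a \<in> T"
  then have a: "supp a" using T W unfolding adapted_def by blast
  have "a = (\<Sum>k\<in>IV. (\<lambda>i. a k * ?d k i))"
  proof
   fix i
   have "(\<Sum>k\<in>IV. a k * ?d k i) = (\<Sum>k\<in>IV. if k = i then a i else 0)" by (rule sum.cong) auto
   then show "a i = (\<Sum>k\<in>IV. (\<lambda>i. a k * ?d k i)) i" using a fin_IV unfolding fsum supp_def by simp
  qed
  also have "\<dots> \<in> R.span (?d ` IV)"
   by (intro R.span_sum R.span_scale R.span_base) simp
  finally show "a \<in> R.span (?d ` IV)" .
 qed
 moreover have "R.independent T"
 proof
  assume "R.dependent T"
  then obtain K u v where K: "finite K" "K \<subseteq> T" "(\<Sum>a\<in>K. (\<lambda>i. u a * a i)) = 0" "v \<in> K" "u v ~= 0"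
   unfolding R.dependent_explicit by blast
  have "0 = om (\<Sum>a\<in>K. (\<lambda>i. u a * a i)) (op J v)"
   unfolding K(3) using om_zero(1) by (simp add: zero_fun_def)
  also have "\<dots> = (\<Sum>a\<in>K. u a * om a (op J v))" unfolding fsum om_sum om_scale ..
  also have "\<dots> = (\<Sum>a\<in>K. if a = v then u v else 0)"
  proof (rule sum.cong[OF refl])
   fix a assume "a \<in> K"
   then have "om a (op J v) = (if a = v then 1 else 0)" using K(2,4) T unfolding adapted_def by blast
   then show "u a * om a (op J v) = (if a = v then u v else 0)" by simp
  qed
  also have "\<dots> = u v" using K(1,4) by simp
  finally show False using K(5) by simp
 qed
 ultimately show ?thesis using R.independent_span_bound[of "?d ` IV" T] fin_IV by blast
qed

end

text \<open>Indices of the complex basis of \<open>V'\<close>: \<open>k\<close> is the coordinate in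
  the standard module of the matrix factor \<open>bl a\<close>, \<open>a\<close> runs through an
  adapted basis of the multiplicity spaces, and the boolean selects the eigenvalue of
  \<open>h(\<i>)\<close>.\<close>

definition Xi :: "'t set => ('t => nat) => (nat => nat) => (nat \<times> 't \<times> bool) set"
 where "Xi TH bl n = (SIGMA k:UNIV. {a \<in> TH. k < n (bl a)} \<times> UNIV)"

lemma Xi_iff [simp]: "(k, a, b) \<in> Xi TH bl n \<longleftrightarrow> a \<in> TH \<and> k < n (bl a)"
 unfolding Xi_def by auto

lemma finite_Xi [simp]: "finite TH ==> finite (Xi TH bl n)"
proof -
 assume "finite TH"
 then have "finite (\<Union>a\<in>TH. (\<lambda>(k, b). (k, a, b)) ` ({..<n (bl a)} \<times> (UNIV :: bool set)))" by simp
 moreover have "Xi TH bl n \<subseteq> (\<Union>a\<in>TH. (\<lambda>(k, b). (k, a, b)) ` ({..<n (bl a)} \<times> (UNIV :: bool set)))"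
  unfolding Xi_def by force
 ultimately show ?thesis by (rule finite_subset[rotated])
qed

lemma sum_Xi:
 fixes g :: "nat \<times> 't \<times> bool => 'c::comm_monoid_add"
 assumes "finite TH"
 shows "(\<Sum>\<xi>\<in>Xi TH bl n. g \<xi>) = (\<Sum>a\<in>TH. \<Sum>k<n (bl a). g (k, a, True) + g (k, a, False))"
proof -
 let ?f = "\<lambda>(a, k, b). (k, a, b)"
 have "(\<Sum>\<xi>\<in>Xi TH bl n. g \<xi>) = (\<Sum>\<xi>\<in>?f ` (SIGMA a:TH. {..<n (bl a)} \<times> UNIV). g \<xi>)"
  by (rule sum.cong) (force simp: Xi_def)+
 also have "\<dots> = (\<Sum>\<xi>\<in>(SIGMA a:TH. {..<n (bl a)} \<times> UNIV). g (?f \<xi>))"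
  by (subst sum.reindex) (auto simp: inj_on_def)
 also have "\<dots> = (\<Sum>a\<in>TH. \<Sum>x\<in>{..<n (bl a)} \<times> UNIV. g (?f (a, x)))"
  by (subst sum.Sigma) (use assms in \<open>auto simp: split_def\<close>)
 also have "\<dots> = (\<Sum>a\<in>TH. \<Sum>k<n (bl a). \<Sum>b\<in>UNIV. g (k, a, b))"
  by (rule sum.cong[OF refl]) (simp only: sum_pair split_def fst_conv snd_conv)
 finally show ?thesis by (simp add: UNIV_bool add.commute)
qed

text \<open>The standard symplectic form of a plane whose two basis vectors are the eigenvectors of
  \<open>h(\<i>)\<close>; both eigenlines are isotropic.\<close>

definition Omega :: "bool => bool => complex"
 where "Omega b b' = (if b = b' then 0 else if b then 1 else -1)"

definition eps :: "bool => complex"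
 where "eps b = (if b then \<i> else - \<i>)"

section \<open>Matrix units of the real algebra and the multiplicity spaces\<close>

locale symplectic_pel = PEL_datum D for D :: "('b::ring, 'v::ab_group_add) pel" +
 fixes r :: nat and n :: "nat => nat" and \<Phi> :: "nat => ('b => real) => real mat"
 assumes n_pos: "t < r ==> n t > 0"
  and Phi_bij: "bij_betw (\<lambda>x. \<lambda>t \<in> {..<r}. \<Phi> t x) (vecs real_ring (basisB D)) (\<Pi>\<^sub>E t \<in> {..<r}. carrier_mat (n t) (n t))"
  and Phi_alg: "t < r ==> x \<in> vecs real_ring (basisB D) ==> y \<in> vecs real_ring (basisB D) ==>
    \<Phi> t (\<lambda>k \<in> basisB D. x k + y k) = \<Phi> t x + \<Phi> t y \<and>
    (\<forall>c. \<Phi> t (\<lambda>k \<in> basisB D. c * x k) = c \<cdot>\<^sub>m \<Phi> t x) \<and>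
    \<Phi> t (BR_mult real_ring D x y) = \<Phi> t x * \<Phi> t y \<and>
    \<Phi> t (BR_star real_ring D x) = transpose_mat (\<Phi> t x)"
  and Phi_one: "t < r ==> \<Phi> t (BR_one real_ring D) = 1\<^sub>m (n t)"
begin

abbreviation "VB \<equiv> vecs real_ring IB"

lemma Phi_carrier: "t < r ==> x \<in> VB ==> \<Phi> t x \<in> carrier_mat (n t) (n t)"
 using bij_betw_apply[OF Phi_bij, of x] by (auto simp: PiE_iff)

lemma Phi_eqI:
 assumes "x \<in> VB" "y \<in> VB" "!!t p q. t < r ==> p < n t ==> q < n t ==> \<Phi> t x $$ (p, q) = \<Phi> t y $$ (p, q)"
 shows "x = y"
proof -
 have "\<Phi> t x = \<Phi> t y" if "t < r" for t
  using Phi_carrier[OF that assms(1)] Phi_carrier[OF that assms(2)] assms(3)[OF that] by (intro eq_matI) auto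
 then have "(\<lambda>t \<in> {..<r}. \<Phi> t x) = (\<lambda>t \<in> {..<r}. \<Phi> t y)" by (intro restrict_ext) simp
 then show ?thesis using bij_betw_imp_inj_on[OF Phi_bij] assms(1,2) unfolding inj_on_def by blast
qed

lemma Phi_lin:
 assumes "t < r" "p < n t" "q < n t" "finite K" "!!a. a \<in> K ==> x a \<in> VB"
 shows "(\<lambda>b\<in>IB. \<Sum>a\<in>K. c a * x a b) \<in> VB \<and> \<Phi> t (\<lambda>b\<in>IB. \<Sum>a\<in>K. c a * x a b) $$ (p, q) = (\<Sum>a\<in>K. c a * \<Phi> t (x a) $$ (p, q))"
 using assms(4,5)
proof (induction K rule: finite_induct)
 case empty
 have z: "(\<lambda>b\<in>IB. 0) \<in> VB" by (rule vecs_memI) simp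
 have "(\<lambda>b\<in>IB. 0 * (\<lambda>b\<in>IB. 0::real) b) = (\<lambda>b\<in>IB. 0)" by auto
 then have e: "\<Phi> t (\<lambda>b\<in>IB. 0) = 0 \<cdot>\<^sub>m \<Phi> t (\<lambda>b\<in>IB. 0)"
  using Phi_alg[OF assms(1) z z] by metis
 have "(0 \<cdot>\<^sub>m \<Phi> t (\<lambda>b\<in>IB. 0)) $$ (p, q) = 0" using assms(2,3) Phi_carrier[OF assms(1) z] by simp
 then have "\<Phi> t (\<lambda>b\<in>IB. 0) $$ (p, q) = 0" unfolding e[symmetric] .
 then show ?case unfolding sum.empty by (intro conjI z)
next
 case (insert a K)
 let ?y = "\<lambda>b\<in>IB. \<Sum>a\<in>K. c a * x a b" and ?z = "\<lambda>b\<in>IB. c a * x a b"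
 have y: "?y \<in> VB" "\<Phi> t ?y $$ (p, q) = (\<Sum>a\<in>K. c a * \<Phi> t (x a) $$ (p, q))"
  using insert.IH insert.prems by blast+
 have xa: "x a \<in> VB" using insert.prems by blast
 have z: "?z \<in> VB" by (rule vecs_memI) simp
 have pz: "\<Phi> t ?z = c a \<cdot>\<^sub>m \<Phi> t (x a)" using Phi_alg[OF assms(1) xa xa] by blast
 have e: "(\<lambda>b\<in>IB. \<Sum>a\<in>insert a K. c a * x a b) = (\<lambda>b\<in>IB. ?z b + ?y b)"
  using insert(1,2) by (intro restrict_ext) simp
 have "\<Phi> t (\<lambda>b\<in>IB. ?z b + ?y b) = \<Phi> t ?z + \<Phi> t ?y" using Phi_alg[OF assms(1) z y(1)] by blast
 then have "\<Phi> t (\<lambda>b\<in>IB. ?z b + ?y b) $$ (p, q) = c a * \<Phi> t (x a) $$ (p, q) + \<Phi> t ?y $$ (p, q)"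
  unfolding pz using Phi_carrier[OF assms(1) y(1)] Phi_carrier[OF assms(1) xa] assms(2,3) by simp
 also have "\<dots> = (\<Sum>a\<in>insert a K. c a * \<Phi> t (x a) $$ (p, q))" unfolding y(2) using insert(1,2) by simp
 finally have 1: "\<Phi> t (\<lambda>b\<in>IB. ?z b + ?y b) $$ (p, q) = (\<Sum>a\<in>insert a K. c a * \<Phi> t (x a) $$ (p, q))" .
 have "(\<lambda>b\<in>IB. ?z b + ?y b) \<in> VB" by (rule vecs_memI) simp
 then show ?case unfolding e by (intro conjI 1)
qed

definition "um N k l = mat N N (\<lambda>(i, j). if i = k \<and> j = l then 1 else (0::real))"

text \<open>The matrix unit at \<open>(k, l)\<close> of factor \<open>t\<close>, pulled back to the
  real algebra; its image in all other factors is zero.\<close>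

definition "eb t k l = (SOME x. x \<in> VB \<and> (\<forall>s<r. \<Phi> s x = (if s = t then um (n t) k l else 0\<^sub>m (n s) (n s))))"

lemma eb: "eb t k l \<in> VB" "s < r ==> \<Phi> s (eb t k l) = (if s = t then um (n t) k l else 0\<^sub>m (n s) (n s))"
proof -
 let ?M = "\<lambda>s\<in>{..<r}. if s = t then um (n t) k l else 0\<^sub>m (n s) (n s)"
 have "?M \<in> (\<Pi>\<^sub>E t \<in> {..<r}. carrier_mat (n t) (n t))" by (auto simp: um_def)
 then obtain x where x: "x \<in> VB" "(\<lambda>t \<in> {..<r}. \<Phi> t x) = ?M"
  using bij_betw_imp_surj_on[OF Phi_bij] by (metis (no_types, lifting) imageE)
 have "\<Phi> s x = (if s = t then um (n t) k l else 0\<^sub>m (n s) (n s))" if "s < r" for s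
  using fun_cong[OF x(2), of s] that by simp
 then have "\<exists>x. x \<in> VB \<and> (\<forall>s<r. \<Phi> s x = (if s = t then um (n t) k l else 0\<^sub>m (n s) (n s)))" using x(1) by blast
 from someI_ex[OF this] show "eb t k l \<in> VB" "s < r ==> \<Phi> s (eb t k l) = (if s = t then um (n t) k l else 0\<^sub>m (n s) (n s))"
  unfolding eb_def by blast+
qed

lemma eb_entry: "s < r ==> p < n s ==> q < n s ==> \<Phi> s (eb t k l) $$ (p, q) = (if s = t \<and> p = k \<and> q = l then 1 else 0)"
 by (auto simp: eb um_def)

lemma VB_expand:
 assumes x: "x \<in> VB"
 shows "x = (\<lambda>b\<in>IB. \<Sum>\<xi>\<in>(SIGMA t:{..<r}. {..<n t} \<times> {..<n t}). \<Phi> (fst \<xi>) x $$ snd \<xi> * eb (fst \<xi>) (fst (snd \<xi>)) (snd (snd \<xi>)) b)"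
  (is "x = ?y")
proof (rule Phi_eqI[OF x])
 let ?S = "SIGMA t:{..<r}. {..<n t} \<times> {..<n t}"
 have S: "finite ?S" by simp
 show "?y \<in> VB" by (rule vecs_memI) simp
 fix t p q assume t: "t < r" "p < n t" "q < n t"
 have "\<Phi> t ?y $$ (p, q) = (\<Sum>\<xi>\<in>?S. \<Phi> (fst \<xi>) x $$ snd \<xi> * \<Phi> t (eb (fst \<xi>) (fst (snd \<xi>)) (snd (snd \<xi>))) $$ (p, q))"
  by (rule Phi_lin[OF t S, THEN conjunct2]) (rule eb(1))
 also have "\<dots> = (\<Sum>\<xi>\<in>?S. if \<xi> = (t, p, q) then \<Phi> t x $$ (p, q) else 0)"
  using t by (intro sum.cong) (auto simp: eb_entry)
 also have "\<dots> = \<Phi> t x $$ (p, q)" using S t by simp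
 finally show "\<Phi> t x $$ (p, q) = \<Phi> t ?y $$ (p, q)" by simp
qed

lemma eb_mult:
 assumes "t < r" "s < r" "k < n t" "l < n t" "p < n s" "q < n s"
 shows "BR_mult real_ring D (eb s p q) (eb t k l) = (if s = t \<and> q = k then eb t p l else (\<lambda>b\<in>IB. 0))"
proof (rule Phi_eqI)
 have z: "(\<lambda>b\<in>IB. 0) \<in> VB" by (rule vecs_memI) simp
 show "BR_mult real_ring D (eb s p q) (eb t k l) \<in> VB" by (rule BR_mult_closed)
 show "(if s = t \<and> q = k then eb t p l else (\<lambda>b\<in>IB. 0)) \<in> VB" using z eb(1) by simp
 fix u i j assume u: "u < r" "i < n u" "j < n u"
 have z0: "\<Phi> u (\<lambda>b\<in>IB. 0) $$ (i, j) = 0" using Phi_lin[OF u, of "{}" "\<lambda>_. eb t k l" "\<lambda>_. 0"] by simp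
 have "\<Phi> u (BR_mult real_ring D (eb s p q) (eb t k l)) $$ (i, j) = (\<Phi> u (eb s p q) * \<Phi> u (eb t k l)) $$ (i, j)"
  using Phi_alg[OF u(1) eb(1) eb(1)] by simp
 also have "\<dots> = (\<Sum>m<n u. \<Phi> u (eb s p q) $$ (i, m) * \<Phi> u (eb t k l) $$ (m, j))"
  using u Phi_carrier[OF u(1) eb(1), of s p q] Phi_carrier[OF u(1) eb(1), of t k l]
  by (simp add: scalar_prod_def lessThan_atLeast0)
 also have "\<dots> = (\<Sum>m<n u. if m = q then if u = s \<and> i = p \<and> u = t \<and> q = k \<and> j = l then 1 else 0 else 0)"
  using u by (intro sum.cong) (auto simp: eb_entry)
 also have "\<dots> = (if u = s \<and> i = p \<and> u = t \<and> q = k \<and> j = l then 1 else 0)"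
  using assms by auto
 also have "\<dots> = \<Phi> u (if s = t \<and> q = k then eb t p l else (\<lambda>b\<in>IB. 0)) $$ (i, j)"
  using u z0 by (auto simp: eb_entry)
 finally show "\<Phi> u (BR_mult real_ring D (eb s p q) (eb t k l)) $$ (i, j) =
  \<Phi> u (if s = t \<and> q = k then eb t p l else (\<lambda>b\<in>IB. 0)) $$ (i, j)" .
qed

lemma eb_star:
 assumes "t < r" "k < n t" "l < n t"
 shows "BR_star real_ring D (eb t k l) = eb t l k"
proof (rule Phi_eqI)
 show "BR_star real_ring D (eb t k l) \<in> VB" by (rule BR_star_closed)
 fix u i j assume u: "u < r" "i < n u" "j < n u"
 have "\<Phi> u (BR_star real_ring D (eb t k l)) = transpose_mat (\<Phi> u (eb t k l))"
  using Phi_alg[OF u(1) eb(1) eb(1)] by blast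
 then show "\<Phi> u (BR_star real_ring D (eb t k l)) $$ (i, j) = \<Phi> u (eb t l k) $$ (i, j)"
  using u Phi_carrier[OF u(1) eb(1), of t k l] by (auto simp: eb_entry)
qed (rule eb(1))

definition "E t k l = op (ra (eb t k l))"

lemma ra_lin: "(!!b. b \<in> IB ==> x b = (\<Sum>a\<in>K. c a * y a b)) ==> op (ra x) u i = (\<Sum>a\<in>K. c a * op (ra (y a)) u i)"
proof -
 assume x: "!!b. b \<in> IB ==> x b = (\<Sum>a\<in>K. c a * y a b)"
 have "ra x i j = (\<Sum>a\<in>K. c a * ra (y a) i j)" for i j
 proof -
  have "ra x i j = (\<Sum>b\<in>IB. \<Sum>a\<in>K. c a * (y a b * rb b i j))"
   unfolding ra_def using x by (intro sum.cong) (auto simp: sum_distrib_right mult.assoc)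
  also have "\<dots> = (\<Sum>a\<in>K. \<Sum>b\<in>IB. c a * (y a b * rb b i j))" by (rule sum.swap)
  finally show ?thesis unfolding ra_def by (simp add: sum_distrib_left)
 qed
 then have "(\<Sum>j\<in>IV. ra x i j * u j) = (\<Sum>j\<in>IV. \<Sum>a\<in>K. c a * (ra (y a) i j * u j))"
  by (simp add: sum_distrib_right mult.assoc)
 also have "\<dots> = (\<Sum>a\<in>K. \<Sum>j\<in>IV. c a * (ra (y a) i j * u j))" by (rule sum.swap)
 finally show ?thesis unfolding op_def by (simp add: sum_distrib_left)
qed

lemma E_E:
 assumes "t < r" "s < r" "k < n t" "l < n t" "p < n s" "q < n s"
 shows "E s p q (E t k l u) = (if s = t \<and> q = k then E t p l u else (\<lambda>i. 0))"
proof -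
 have "op (ra (\<lambda>b\<in>IB. 0)) u = (\<lambda>i. 0)"
  by (rule ext) (subst ra_lin[where K="{} :: nat set" and c="\<lambda>_. 0" and y="\<lambda>_ _. 0"], auto)
 then show ?thesis unfolding E_def op_ra_mult eb_mult[OF assms] by simp
qed

text \<open>The involution is transposition in each factor, so the adjoint of a matrix unit is the
  transposed one. This is where symplectic type is used.\<close>

lemma om_E: "t < r ==> k < n t ==> l < n t ==> om (E t k l u) v = om u (E t l k v)"
 unfolding E_def om_ra by (simp add: eb_star)

lemma J_E: "op J (E t k l u) = E t k l (op J u)"
 unfolding E_def by (rule J_ra[OF eb(1)])

lemma op_VB_expand:
 assumes "x \<in> VB"
 shows "op (ra x) u i = (\<Sum>t<r. \<Sum>k<n t. \<Sum>l<n t. \<Phi> t x $$ (k, l) * E t k l u i)"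
proof -
 let ?S = "SIGMA t:{..<r}. {..<n t} \<times> {..<n t}"
 have "op (ra x) u i = (\<Sum>\<xi>\<in>?S. \<Phi> (fst \<xi>) x $$ snd \<xi> * E (fst \<xi>) (fst (snd \<xi>)) (snd (snd \<xi>)) u i)"
  unfolding E_def
 proof (rule ra_lin)
  fix b assume "b \<in> IB"
  then show "x b = (\<Sum>\<xi>\<in>?S. \<Phi> (fst \<xi>) x $$ snd \<xi> * eb (fst \<xi>) (fst (snd \<xi>)) (snd (snd \<xi>)) b)"
   using fun_cong[OF VB_expand[OF assms], of b] by simp
 qed
 also have "\<dots> = (\<Sum>t<r. \<Sum>p\<in>{..<n t} \<times> {..<n t}. \<Phi> t x $$ p * E t (fst p) (snd p) u i)"
  by (subst sum.Sigma) (auto simp: split_def)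
 finally show ?thesis by (simp add: sum_pair)
qed

lemma E_one:
 assumes "supp u"
 shows "u i = (\<Sum>t<r. \<Sum>k<n t. E t k k u i)"
proof -
 have "u i = (\<Sum>t<r. \<Sum>k<n t. \<Sum>l<n t. \<Phi> t (BR_one real_ring D) $$ (k, l) * E t k l u i)"
  using op_ra_one[OF assms] op_VB_expand[OF BR_one_closed, of u i] by simp
 also have "\<dots> = (\<Sum>t<r. \<Sum>k<n t. \<Sum>l<n t. if l = k then E t k k u i else 0)"
  by (intro sum.cong refl) (auto simp: Phi_one)
 finally show ?thesis by simp
qed

text \<open>Morita reduction: the image of the idempotent \<open>E t 0 0\<close> is the multiplicity
  space of factor \<open>t\<close>. The idempotent is self-adjoint and commutes with
  \<open>J\<close>, so this space inherits the form, \<open>J\<close> and positivity.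
  \<open>WW\<close> is the union over all factors.\<close>

definition "WW = {a. \<exists>t<r. E t 0 0 a = a}"
definition "bl a = (SOME t. t < r \<and> E t 0 0 a = a)"

lemma bl: "a \<in> WW ==> bl a < r" "a \<in> WW ==> E (bl a) 0 0 a = a"
 unfolding WW_def bl_def by (metis (mono_tags, lifting) mem_Collect_eq someI_ex)+

lemma WW_supp: "a \<in> WW ==> supp a"
 using bl(2)[of a] unfolding E_def by (metis op_supp)

lemma E_other:
 assumes a: "a \<in> WW" "t < r" "k < n t" "l < n t"
 shows "E t k l a = (if t = bl a \<and> l = 0 then E (bl a) k 0 a else (\<lambda>i. 0))"
proof -
 have "E t k l a = E t k l (E (bl a) 0 0 a)" using bl[OF a(1)] by simp
 then show ?thesis using E_E[of "bl a" t 0 0 k l a] assms bl[OF a(1)] n_pos by auto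
qed

lemma E_zero: "E t k l (\<lambda>i. 0) = (\<lambda>i. 0)"
 unfolding E_def op_def by auto

context
 fixes T assumes T: "adapted WW T" "!!T'. adapted WW T' ==> T \<subseteq> T' ==> T' = T"
begin

lemma T_fin: "finite T" using finite_adapted[OF T(1) WW_supp] .

lemma T_WW: "a \<in> T ==> a \<in> WW" using T(1) unfolding adapted_def by blast

lemma T_om: "a \<in> T ==> b \<in> T ==> om a b = 0" "a \<in> T ==> b \<in> T ==> om a (op J b) = (if a = b then 1 else 0)"
 using T(1) unfolding adapted_def by blast+

lemma om_JJ: "supp b ==> om (op J a) (op J b) = om a b"
 unfolding om_J J_J om_minus by simp

text \<open>The orthogonal projection onto the real span of \<open>T\<close> and its image under
  \<open>J\<close>.\<close>

definition "pr u i = (\<Sum>a\<in>T. om u (op J a) * a i - om u a * op J a i)"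

lemma om_pr: "om (pr u) v = (\<Sum>a\<in>T. om u (op J a) * om a v - om u a * om (op J a) v)"
proof -
 have "pr u = (\<lambda>i. \<Sum>a\<in>T. om u (op J a) * a i - om u a * op J a i)" by (rule ext) (simp add: pr_def)
 then show ?thesis by (simp add: om_sum om_diff om_scale)
qed

lemma op_pr: "op M (pr u) = (\<lambda>i. \<Sum>a\<in>T. om u (op J a) * op M a i - om u a * op M (op J a) i)"
proof -
 have "pr u = (\<lambda>i. \<Sum>a\<in>T. om u (op J a) * a i - om u a * op J a i)" by (rule ext) (simp add: pr_def)
 then show ?thesis by (simp add: op_sum op_diff op_scale)
qed

text \<open>A Gram-Schmidt step: if \<open>u\<close> were not in the span, the normalized difference
  \<open>u - pr u\<close> would enlarge \<open>T\<close>, contrary to maximality.\<close>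

lemma complete:
 assumes u: "E t 0 0 u = u" "t < r"
 shows "pr u = u"
proof (rule ccontr)
 assume ne: "pr u ~= u"
 define y where "y = (\<lambda>i. u i - pr u i)"
 have su: "supp u" using u(1) unfolding E_def by (metis op_supp)
 have spr: "supp (pr u)"
  unfolding supp_def pr_def using T_WW WW_supp op_supp by (auto simp: supp_def intro!: sum.neutral)
 have sy: "supp y" using su spr unfolding y_def supp_def by simp
 have yne: "y ~= (\<lambda>i. 0)"
 proof
  assume "y = (\<lambda>i. 0)"
  then have "u i - pr u i = 0" for i using fun_cong[of y "\<lambda>i. 0" i] unfolding y_def by blast
  then have "pr u = u" by (intro ext) simp
  then show False using ne by blast
 qed
 have n0: "0 < n t" using n_pos u(2) by simp
 \<comment> \<open>The self-adjoint idempotent \<open>E t 0 0\<close> fixes \<open>u\<close> and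
   kills members of \<open>T\<close> belonging to other factors.\<close>
 have om_other: "om u a = 0 \<and> om u (op J a) = 0" if a: "a \<in> T" "bl a ~= t" for a
 proof -
  have "E t 0 0 a = (\<lambda>i. 0)" using E_other[OF T_WW[OF a(1)] u(2) n0 n0] a(2) by auto
  moreover have "E t 0 0 (op J a) = (\<lambda>i. 0)"
  proof -
   have "op J (\<lambda>i. 0) = (\<lambda>i. 0)" unfolding op_def by auto
   then show ?thesis unfolding J_E[symmetric] calculation .
  qed
  ultimately show ?thesis using om_E[OF u(2) n0 n0, of u a] om_E[OF u(2) n0 n0, of u "op J a"] u(1) om_zero(2)
   by simp
 qed
 have Epr: "E t 0 0 (pr u) = pr u"
 proof
  fix i
  have "E t 0 0 (pr u) i = (\<Sum>a\<in>T. om u (op J a) * E t 0 0 a i - om u a * E t 0 0 (op J a) i)"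
   unfolding E_def op_pr ..
  also have "\<dots> = (\<Sum>a\<in>T. om u (op J a) * a i - om u a * op J a i)"
  proof (rule sum.cong[OF refl])
   fix a assume a: "a \<in> T"
   show "om u (op J a) * E t 0 0 a i - om u a * E t 0 0 (op J a) i = om u (op J a) * a i - om u a * op J a i"
   proof (cases "bl a = t")
    case True
    then have "E t 0 0 a = a" using bl(2)[OF T_WW[OF a]] by simp
    then show ?thesis unfolding J_E[symmetric] by simp
   qed (use om_other[OF a] in simp)
  qed
  finally show "E t 0 0 (pr u) i = pr u i" unfolding pr_def .
 qed
 have Ey: "E t 0 0 y = y"
  unfolding y_def E_def op_diff unfolding E_def[symmetric] u(1) Epr ..
 have Js: "supp (op J a)" for a by simp
 have ypr: "om y b = 0 \<and> om y (op J b) = 0" if b: "b \<in> T" for b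
 proof -
  have s: "supp b" using WW_supp[OF T_WW[OF b]] .
  have "om (pr u) b = (\<Sum>a\<in>T. if a = b then om u b else 0)"
   unfolding om_pr using b T_om om_J by (intro sum.cong) auto
  moreover have "om (pr u) (op J b) = (\<Sum>a\<in>T. if a = b then om u (op J b) else 0)"
   unfolding om_pr using b T_om om_JJ[OF s] by (intro sum.cong) auto
  ultimately show ?thesis using b T_fin unfolding y_def om_diff by simp
 qed
 have pos: "om y (op J y) > 0" using om_pos[OF sy yne] .
 \<comment> \<open>Positivity of \<open>h(\<i>)\<close> makes the square root real and
   nonzero.\<close>
 define c where "c = 1 / sqrt (om y (op J y))"
 define z where "z = (\<lambda>i. c * y i)"
 have zz: "om z (op J z) = 1"
  using pos unfolding z_def op_scale om_scale c_def by (simp flip: mult.assoc)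
 have zb: "om z b = 0" "om z (op J b) = 0" "om b z = 0" "om b (op J z) = 0" if b: "b \<in> T" for b
 proof -
  show 1: "om z b = 0" and 2: "om z (op J b) = 0" unfolding z_def om_scale using ypr[OF b] by simp_all
  show "om b z = 0" using om_skew[of b z] 1 by simp
  show "om b (op J z) = 0" using om_J[of b z] om_skew[of "op J b" z] 2 by simp
 qed
 have "z \<in> WW"
  unfolding WW_def mem_Collect_eq using u(2) Ey unfolding z_def E_def op_scale by auto
 moreover have "z \<notin> T" using zb(2)[of z] zz by auto
 ultimately have "adapted WW (insert z T)"
  using T(1) zb zz om_self[of z] unfolding adapted_def by auto
 from T(2)[OF this] \<open>z \<notin> T\<close> show False by blast
qed

text \<open>The pure tensor of the \<open>k\<close>-th standard vector and \<open>a\<close> in the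
  isotypic component of the factor \<open>bl a\<close>.\<close>

definition "AA k a = E (bl a) k 0 a"

text \<open>The unit is the sum of the \<open>E t k k\<close>, each of which factors through
  \<open>E t 0 k\<close>; its values lie in a multiplicity space, where \<open>complete\<close>
  provides the expansion.\<close>

lemma AA_expand:
 assumes u: "supp u"
 shows "u i = (\<Sum>a\<in>T. \<Sum>k<n (bl a). om u (op J (AA k a)) * AA k a i - om u (AA k a) * op J (AA k a) i)"
proof -
 let ?g = "\<lambda>k a. om u (op J (AA k a)) * AA k a i - om u (AA k a) * op J (AA k a) i"
 have Et: "E t k k u i = (\<Sum>a\<in>T. if bl a = t then ?g k a else 0)" if t: "t < r" "k < n t" for t k
 proof -
  have n0: "0 < n t" using t by simp
  let ?w = "E t 0 k u"
  have "E t 0 0 ?w = ?w" using E_E[OF t(1) t(1) n0 t(2) n0 n0, of u] by simp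
  from complete[OF this t(1)] have w: "pr ?w = ?w" .
  have "E t k k u = E t k 0 ?w" using E_E[OF t(1) t(1) n0 t(2) t(2) n0, of u] by simp
  also have "\<dots> = E t k 0 (pr ?w)" unfolding w ..
  finally have "E t k k u i = (\<Sum>a\<in>T. om ?w (op J a) * E t k 0 a i - om ?w a * E t k 0 (op J a) i)"
   unfolding E_def op_pr by simp
  also have "\<dots> = (\<Sum>a\<in>T. if bl a = t then ?g k a else 0)"
  proof (rule sum.cong[OF refl])
   fix a assume a: "a \<in> T"
   show "om ?w (op J a) * E t k 0 a i - om ?w a * E t k 0 (op J a) i = (if bl a = t then ?g k a else 0)"
   proof (cases "bl a = t")
    case True
    then show ?thesis unfolding om_E[OF t(1) n0 t(2)] J_E[symmetric] AA_def by simp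
   next
    case False
    have "E t k 0 a = (\<lambda>i. 0)" using E_other[OF T_WW[OF a] t(1) t(2) n0] False by auto
    moreover have "op J (\<lambda>i. 0) = (\<lambda>i. 0)" unfolding op_def by auto
    ultimately show ?thesis unfolding J_E[symmetric] using False by simp
   qed
  qed
  finally show ?thesis .
 qed
 have "u i = (\<Sum>t<r. \<Sum>k<n t. \<Sum>a\<in>T. if bl a = t then ?g k a else 0)"
  using E_one[OF u, of i] Et by simp
 also have "\<dots> = (\<Sum>t<r. \<Sum>a\<in>T. \<Sum>k<n t. if bl a = t then ?g k a else 0)"
  by (rule sum.cong[OF refl]) (rule sum.swap)
 also have "\<dots> = (\<Sum>a\<in>T. \<Sum>t<r. \<Sum>k<n t. if bl a = t then ?g k a else 0)" by (rule sum.swap)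
 also have "\<dots> = (\<Sum>a\<in>T. \<Sum>t<r. if t = bl a then \<Sum>k<n (bl a). ?g k a else 0)"
  by (intro sum.cong refl) auto
 also have "\<dots> = (\<Sum>a\<in>T. \<Sum>k<n (bl a). ?g k a)"
  by (rule sum.cong[OF refl]) (use bl(1)[OF T_WW] in simp)
 finally show ?thesis .
qed

lemma AA_om:
 assumes a: "a \<in> T" "b \<in> T" "k < n (bl a)" "l < n (bl b)"
 shows "om (AA k a) (AA l b) = 0" "om (AA k a) (op J (AA l b)) = (if k = l \<and> a = b then 1 else 0)"
  "om (op J (AA k a)) (op J (AA l b)) = 0" "om (op J (AA k a)) (AA l b) = (if k = l \<and> a = b then -1 else 0)"
proof -
 note A = T_WW[OF a(1)] and B = T_WW[OF a(2)]
 have n0: "0 < n (bl a)" "0 < n (bl b)" using a by auto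
 have EE: "E (bl a) 0 k (AA l b) = (if bl a = bl b \<and> k = l then b else (\<lambda>i. 0))"
  unfolding AA_def using E_E[OF bl(1)[OF B] bl(1)[OF A] a(4) n0(2) n0(1) a(3), of b] bl(2)[OF B] by auto
 have 1: "om (AA k a) v = om a (E (bl a) 0 k v)" for v
  unfolding AA_def by (rule om_E[OF bl(1)[OF A] a(3) n0(1)])
 have J0: "op J (\<lambda>i. 0) = (\<lambda>i. 0)" unfolding op_def by auto
 show r1: "om (AA k a) (AA l b) = 0" unfolding 1 EE using T_om a om_zero by auto
 show r2: "om (AA k a) (op J (AA l b)) = (if k = l \<and> a = b then 1 else 0)"
  unfolding 1 J_E[symmetric] EE using T_om(2)[OF a(1,2)] om_zero(2) by (auto simp: J0)
 show "om (op J (AA k a)) (op J (AA l b)) = 0"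
  using om_JJ[of "AA l b" "AA k a"] r1 unfolding AA_def E_def by simp
 show "om (op J (AA k a)) (AA l b) = (if k = l \<and> a = b then -1 else 0)"
  unfolding om_J r2 by simp
qed

definition "cf b t k l = \<Phi> t (\<lambda>c\<in>IB. if c = b then 1 else 0) $$ (k, l)"

lemma unit_VB: "(\<lambda>c\<in>IB. if c = b then 1 else 0) \<in> VB"
 by (rule vecs_memI) simp

lemma rb_AA:
 assumes a: "a \<in> T" "l < n (bl a)" "b \<in> IB"
 shows "op (rb b) (AA l a) i = (\<Sum>k<n (bl a). cf b (bl a) k l * AA k a i)"
  and "op (rb b) (op J (AA l a)) i = (\<Sum>k<n (bl a). cf b (bl a) k l * op J (AA k a) i)"
proof -
 note A = T_WW[OF a(1)]
 let ?x = "\<lambda>c\<in>IB. if c = b then 1 else 0"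
 have "ra ?x = rb b"
 proof (intro ext)
  fix i j
  have "ra ?x i j = (\<Sum>k\<in>IB. if k = b then rb b i j else 0)" unfolding ra_def by (rule sum.cong) auto
  then show "ra ?x i j = rb b i j" using fin_IB a(3) by simp
 qed
 then have op_b: "op (rb b) u i = (\<Sum>t<r. \<Sum>k<n t. \<Sum>q<n t. cf b t k q * E t k q u i)" for u i
  using op_VB_expand[OF unit_VB[of b], of u i] unfolding cf_def by simp
 have EA: "E t k q (AA l a) = (if t = bl a \<and> q = l then AA k a else (\<lambda>i. 0))" if "t < r" "k < n t" "q < n t" for t k q
  unfolding AA_def using E_E[OF bl(1)[OF A] that(1) a(2) _ that(2,3), of 0 a] a(2) by auto
 have J0: "op J (\<lambda>i. 0) = (\<lambda>i. 0)" unfolding op_def by auto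
 have gen: "(\<Sum>t<r. \<Sum>k<n t. \<Sum>q<n t. cf b t k q * (if t = bl a \<and> q = l then h k else 0)) = (\<Sum>k<n (bl a). cf b (bl a) k l * h k)"
  for h :: "nat => real"
 proof -
  have "(\<Sum>k<n t. \<Sum>q<n t. cf b t k q * (if t = bl a \<and> q = l then h k else 0)) =
    (if t = bl a then \<Sum>k<n (bl a). cf b (bl a) k l * h k else 0)" for t
  proof (cases "t = bl a")
   case True
   have "(\<Sum>q<n t. cf b t k q * (if t = bl a \<and> q = l then h k else 0)) = (\<Sum>q<n t. if q = l then cf b (bl a) k l * h k else 0)" for k
    using True by (intro sum.cong) auto
   then show ?thesis using True a(2) by simp
  qed simp
  then show ?thesis using bl(1)[OF A] a(2) by simp
 qed
 have "op (rb b) (AA l a) i = (\<Sum>t<r. \<Sum>k<n t. \<Sum>q<n t. cf b t k q * (if t = bl a \<and> q = l then AA k a i else 0))"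
  unfolding op_b by (intro sum.cong refl) (auto simp: EA)
 then show "op (rb b) (AA l a) i = (\<Sum>k<n (bl a). cf b (bl a) k l * AA k a i)" unfolding gen .
 have "op (rb b) (op J (AA l a)) i = (\<Sum>t<r. \<Sum>k<n t. \<Sum>q<n t. cf b t k q * (if t = bl a \<and> q = l then op J (AA k a) i else 0))"
  unfolding op_b J_E[symmetric] by (intro sum.cong refl) (auto simp: EA J0)
 then show "op (rb b) (op J (AA l a)) i = (\<Sum>k<n (bl a). cf b (bl a) k l * op J (AA k a) i)" unfolding gen .
qed

text \<open>The matrix units are combinations of the rational basis of \<open>B'\<close> after
  extension of scalars. Commuting with that basis is therefore as strong as commuting with all
  matrix units.\<close>

lemma cf_units:
 assumes "t < r" "s < r" "p < n s" "q < n s"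
 shows "(\<Sum>b\<in>IB. eb t k l b * cf b s p q) = (if s = t \<and> p = k \<and> q = l then 1 else 0)"
proof -
 let ?x = "\<lambda>b. \<lambda>c\<in>IB. if c = b then (1::real) else 0"
 have "eb t k l = (\<lambda>c\<in>IB. \<Sum>b\<in>IB. eb t k l b * ?x b c)"
 proof (rule vecs_eqI[OF eb(1)])
  show "(\<lambda>c\<in>IB. \<Sum>b\<in>IB. eb t k l b * ?x b c) \<in> VB" by (rule vecs_memI) simp
  fix c assume c: "c \<in> IB"
  have "(\<Sum>b\<in>IB. eb t k l b * ?x b c) = (\<Sum>b\<in>IB. if b = c then eb t k l c else 0)"
   using c by (intro sum.cong) auto
  then show "eb t k l c = (\<lambda>c\<in>IB. \<Sum>b\<in>IB. eb t k l b * ?x b c) c" using c fin_IB by simp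
 qed
 then have "\<Phi> s (eb t k l) $$ (p, q) = (\<Sum>b\<in>IB. eb t k l b * \<Phi> s (?x b) $$ (p, q))"
  using Phi_lin[OF assms(2-4) fin_IB, of ?x "eb t k l"] unit_VB by metis
 then show ?thesis unfolding cf_def using eb_entry[OF assms(2-4)] by simp
qed

end

end

text \<open>An element of the algebra acts on the first index only, by its matrix in the relevant
  factor. In contrast \<open>epsm\<close> and \<open>omm\<close> below see only the multiplicity
  space.\<close>

definition stdm :: "(nat \<times> 't \<times> bool) set => ('t => nat) => (nat => nat => nat => real) => ((nat \<times> 't \<times> bool) \<times> (nat \<times> 't \<times> bool) => complex)"
 where "stdm \<Xi> bl c = (\<lambda>(\<xi>, \<eta>) \<in> \<Xi> \<times> \<Xi>. if snd \<xi> = snd \<eta> then of_real (c (bl (fst (snd \<xi>))) (fst \<xi>) (fst \<eta>)) else 0)"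

definition epsm :: "(nat \<times> 't \<times> bool) set => ((nat \<times> 't \<times> bool) \<times> (nat \<times> 't \<times> bool) => complex)"
 where "epsm \<Xi> = (\<lambda>(\<xi>, \<eta>) \<in> \<Xi> \<times> \<Xi>. if \<xi> = \<eta> then eps (snd (snd \<xi>)) else 0)"

definition omm :: "(nat \<times> 't \<times> bool) set => ((nat \<times> 't \<times> bool) \<times> (nat \<times> 't \<times> bool) => complex)"
 where "omm \<Xi> = (\<lambda>(\<xi>, \<eta>) \<in> \<Xi> \<times> \<Xi>. if fst \<xi> = fst \<eta> \<and> fst (snd \<xi>) = fst (snd \<eta>) then Omega (snd (snd \<xi>)) (snd (snd \<eta>)) else 0)"

text \<open>Over \<open>\<complex>\<close> the module becomes a sum of tensor products of standard
  modules with symplectic spaces on which \<open>h(\<i>)\<close> is diagonal. The columns of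
  \<open>Q\<close> are the new basis and \<open>P\<close> is the inverse of \<open>Q\<close>;
  \<open>units\<close> states that every matrix unit is a complex combination of the algebra
  basis.\<close>

locale normal_form =
 fixes D :: "('b::ring, 'v::ab_group_add) pel" and TH :: "'t set" and bl :: "'t => nat" and n :: "nat => nat"
  and cf :: "'b => nat => nat => nat => real"
  and Q :: "'v \<times> (nat \<times> 't \<times> bool) => complex" and P :: "(nat \<times> 't \<times> bool) \<times> 'v => complex"
 assumes finT: "finite TH" and finV: "finite (basisV D)" and finB: "finite (basisB D)"
  and n_pos: "a \<in> TH ==> 0 < n (bl a)"
  and Q_mats: "Q \<in> mats CR (basisV D) (Xi TH bl n)" and P_mats: "P \<in> mats CR (Xi TH bl n) (basisV D)"
  and QP: "mmul CR (basisV D) (Xi TH bl n) (basisV D) Q P = mone CR (basisV D)"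
  and PQ: "mmul CR (Xi TH bl n) (basisV D) (Xi TH bl n) P Q = mone CR (Xi TH bl n)"
  and bQ: "b \<in> basisB D ==> mmul CR (basisV D) (basisV D) (Xi TH bl n) (mbase (basisV D) (basisV D) of_rat (bmat D b)) Q =
   mmul CR (basisV D) (Xi TH bl n) (Xi TH bl n) Q (stdm (Xi TH bl n) bl (cf b))"
  and JQ: "mmul CR (basisV D) (basisV D) (Xi TH bl n) (mbase (basisV D) (basisV D) of_real (hh D \<i>)) Q =
   mmul CR (basisV D) (Xi TH bl n) (Xi TH bl n) Q (epsm (Xi TH bl n))"
  and gramQ: "mmul CR (Xi TH bl n) (basisV D) (Xi TH bl n) (mtr (basisV D) (Xi TH bl n) Q)
   (mmul CR (basisV D) (basisV D) (Xi TH bl n) (mbase (basisV D) (basisV D) of_rat (gram D)) Q) = omm (Xi TH bl n)"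
  and units: "a \<in> TH ==> k < n (bl a) ==> l < n (bl a) ==> \<exists>x :: 'b => complex. \<forall>a' \<in> TH. \<forall>p < n (bl a'). \<forall>q < n (bl a').
   (\<Sum>b\<in>basisB D. x b * of_real (cf b (bl a') p q)) = (if bl a' = bl a \<and> p = k \<and> q = l then 1 else 0)"

section \<open>The eigenbasis of \<open>h(\<i>)\<close> attached to an adapted basis\<close>

context symplectic_pel
begin

context
 fixes T assumes T: "adapted WW T" "!!T'. adapted WW T' ==> T \<subseteq> T' ==> T' = T"
begin

interpretation C: base_ring CR by (rule base_ring_type)

abbreviation "\<Xi> \<equiv> Xi T bl n"

text \<open>The basis vectors are \<open>A - \<i> J A\<close> for the eigenvalue \<open>\<i>\<close>
  and \<open>A / (2 \<i>) + J A / 2\<close> for \<open>- \<i>\<close>, scaled so that the first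
  pairs with the second to 1. The coefficients \<open>d1\<close>, \<open>d2\<close> give the
  coordinate functionals, which are pairings with the opposite eigenvector up to sign.\<close>

definition "c1 b = (if b then 1 else 1 / (2 * \<i>))"
definition "c2 b = (if b then - \<i> else 1 / 2)"
definition "d1 b = (if b then 1 / (2 * \<i>) else - 1)"
definition "d2 b = (if b then 1 / 2 else \<i>)"

definition "A \<xi> = AA (fst \<xi>) (fst (snd \<xi>))"
definition "\<delta> j = (\<lambda>i. if i = j then 1 else (0::real))"
definition "Qm = (\<lambda>(i, \<xi>) \<in> IV \<times> \<Xi>. c1 (snd (snd \<xi>)) * of_real (A \<xi> i) + c2 (snd (snd \<xi>)) * of_real (op J (A \<xi>) i))"
definition "Pm = (\<lambda>(\<xi>, j) \<in> \<Xi> \<times> IV. d1 (snd (snd \<xi>)) * of_real (om (\<delta> j) (A \<xi>)) + d2 (snd (snd \<xi>)) * of_real (om (\<delta> j) (op J (A \<xi>))))"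

lemma Qm_mats: "Qm \<in> mats CR IV \<Xi>" and Pm_mats: "Pm \<in> mats CR \<Xi> IV"
 by (rule mats_memI; simp add: Qm_def Pm_def)+

lemma fin\<Xi>: "finite \<Xi>" using finite_Xi[OF T_fin[OF T]] by simp

lemma om_delta: "supp u ==> (\<Sum>j\<in>IV. om (\<delta> j) v * u j) = om u v"
proof -
 have "om (\<delta> j) v * u j = (\<Sum>k\<in>IV. u j * v k * rp j k)" if "j \<in> IV" for j
 proof -
  have "om (\<delta> j) v = (\<Sum>i\<in>IV. if i = j then \<Sum>k\<in>IV. v k * rp j k else 0)"
   unfolding om_def \<delta>_def by (intro sum.cong) auto
  then show ?thesis using that fin_IV by (simp add: sum_distrib_right sum_distrib_left algebra_simps)
 qed
 then show "(\<Sum>j\<in>IV. om (\<delta> j) v * u j) = om u v" unfolding om_def by simp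
qed

lemma QPm: "mmul CR IV \<Xi> IV Qm Pm = mone CR IV"
proof (rule mats_eqI[of _ CR IV IV])
 fix i j assume ij: "i \<in> IV" "j \<in> IV"
 let ?x = "\<lambda>k a. om (\<delta> j) (AA k a)" and ?y = "\<lambda>k a. om (\<delta> j) (op J (AA k a))"
 have "mmul CR IV \<Xi> IV Qm Pm (i, j) = (\<Sum>\<xi>\<in>\<Xi>. Qm (i, \<xi>) * Pm (\<xi>, j))"
  using ij fin\<Xi> by (simp add: mmul_entry)
 also have "\<dots> = (\<Sum>a\<in>T. \<Sum>k<n (bl a). Qm (i, (k, a, True)) * Pm ((k, a, True), j) + Qm (i, (k, a, False)) * Pm ((k, a, False), j))"
  by (rule sum_Xi[OF T_fin[OF T]])
 also have "\<dots> = (\<Sum>a\<in>T. \<Sum>k<n (bl a). of_real (?y k a * AA k a i - ?x k a * op J (AA k a) i))"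
 proof (intro sum.cong refl)
  fix a k assume "a \<in> T" "k \<in> {..<n (bl a)}"
  then show "Qm (i, (k, a, True)) * Pm ((k, a, True), j) + Qm (i, (k, a, False)) * Pm ((k, a, False), j)
   = of_real (?y k a * AA k a i - ?x k a * op J (AA k a) i)"
   using ij by (simp add: Qm_def Pm_def A_def c1_def c2_def d1_def d2_def) (simp add: algebra_simps divide_simps)
 qed
 also have "\<dots> = of_real (\<Sum>a\<in>T. \<Sum>k<n (bl a). ?y k a * AA k a i - ?x k a * op J (AA k a) i)" by simp
 also have "\<dots> = of_real (\<delta> j i)"
 proof -
  have "supp (\<delta> j)" unfolding supp_def \<delta>_def using ij by auto
  from AA_expand[OF T this, of i] show ?thesis by simp
 qed
 finally show "mmul CR IV \<Xi> IV Qm Pm (i, j) = mone CR IV (i, j)"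
  using ij by (simp add: mone_entry \<delta>_def)
qed (use Qm_mats Pm_mats in auto)

lemma AA_supp: "supp (AA k a)" "supp (A \<xi>)"
 by (simp_all add: A_def AA_def[OF T] E_def)

lemma of_real_of_rat: "complex_of_real (of_rat q) = of_rat q"
proof -
 obtain a b where q: "q = of_int a / of_int b" by (metis Fract_of_int_quotient Rat_cases)
 show ?thesis unfolding q of_rat_divide of_rat_of_int_eq by simp
qed

lemma mbase_cx_mats: "mbase I J' \<phi> M \<in> mats CR I J'"
 by (rule mats_memI; simp add: mbase_def)+

lemma form_mats: "stdm \<Xi> bl c \<in> mats CR \<Xi> \<Xi>" "epsm \<Xi> \<in> mats CR \<Xi> \<Xi>" "omm \<Xi> \<in> mats CR \<Xi> \<Xi>"
 by (rule mats_memI; simp add: stdm_def epsm_def omm_def)+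

lemma PQm: "mmul CR \<Xi> IV \<Xi> Pm Qm = mone CR \<Xi>"
proof (rule mats_eqI[of _ CR \<Xi> \<Xi>])
 fix \<xi> \<eta> assume x: "\<xi> \<in> \<Xi>" "\<eta> \<in> \<Xi>"
 obtain k a b where xi: "\<xi> = (k, a, b)" by (cases \<xi>) auto
 obtain l c b' where eta: "\<eta> = (l, c, b')" by (cases \<eta>) auto
 have m: "a \<in> T" "k < n (bl a)" "c \<in> T" "l < n (bl c)" using x xi eta by auto
 note o = AA_om[OF T m(3) m(1) m(4) m(2)]
 have "mmul CR \<Xi> IV \<Xi> Pm Qm (\<xi>, \<eta>) = (\<Sum>j\<in>IV. Pm (\<xi>, j) * Qm (j, \<eta>))"
  using x fin_IV by (simp add: mmul_entry)
 also have "\<dots> = (\<Sum>j\<in>IV. d1 b * c1 b' * of_real (om (\<delta> j) (A \<xi>) * A \<eta> j) + d1 b * c2 b' * of_real (om (\<delta> j) (A \<xi>) * op J (A \<eta>) j)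
  + d2 b * c1 b' * of_real (om (\<delta> j) (op J (A \<xi>)) * A \<eta> j) + d2 b * c2 b' * of_real (om (\<delta> j) (op J (A \<xi>)) * op J (A \<eta>) j))"
  using x by (intro sum.cong refl) (simp add: Qm_def Pm_def xi eta algebra_simps)
 also have "\<dots> = d1 b * c1 b' * of_real (om (A \<eta>) (A \<xi>)) + d1 b * c2 b' * of_real (om (op J (A \<eta>)) (A \<xi>))
  + d2 b * c1 b' * of_real (om (A \<eta>) (op J (A \<xi>))) + d2 b * c2 b' * of_real (om (op J (A \<eta>)) (op J (A \<xi>)))"
  unfolding om_delta[OF AA_supp(2), symmetric] om_delta[OF op_supp, symmetric] of_real_sum
  by (simp only: sum.distrib sum_distrib_left)
 also have "\<dots> = (if \<xi> = \<eta> then 1 else 0)"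
  unfolding A_def xi eta fst_conv snd_conv by (auto simp: o d1_def d2_def c1_def c2_def divide_simps)
 finally show "mmul CR \<Xi> IV \<Xi> Pm Qm (\<xi>, \<eta>) = mone CR \<Xi> (\<xi>, \<eta>)"
  using x by (simp add: mone_entry)
qed (use Qm_mats Pm_mats in auto)

lemma sum_real_Qm:
 assumes "\<xi> \<in> \<Xi>" "i \<in> IV"
 shows "(\<Sum>j\<in>IV. of_real (M i j) * Qm (j, \<xi>)) = c1 (snd (snd \<xi>)) * of_real (op M (A \<xi>) i) + c2 (snd (snd \<xi>)) * of_real (op M (op J (A \<xi>)) i)"
proof -
 have "(\<Sum>j\<in>IV. of_real (M i j) * Qm (j, \<xi>)) =
  (\<Sum>j\<in>IV. c1 (snd (snd \<xi>)) * of_real (M i j * A \<xi> j) + c2 (snd (snd \<xi>)) * of_real (M i j * op J (A \<xi>) j))"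
  using assms by (intro sum.cong refl) (simp add: Qm_def split_def algebra_simps)
 also have "\<dots> = c1 (snd (snd \<xi>)) * of_real (\<Sum>j\<in>IV. M i j * A \<xi> j) + c2 (snd (snd \<xi>)) * of_real (\<Sum>j\<in>IV. M i j * op J (A \<xi>) j)"
  by (simp add: sum.distrib sum_distrib_left)
 finally show ?thesis using assms unfolding op_def[of M] by simp
qed

lemma bQm:
 assumes b: "b \<in> IB"
 shows "mmul CR IV IV \<Xi> (mbase IV IV of_rat (bmat D b)) Qm = mmul CR IV \<Xi> \<Xi> Qm (stdm \<Xi> bl (cf b))"
proof (rule mats_eqI[of _ CR IV \<Xi>])
 fix i \<xi> assume i: "i \<in> IV" "\<xi> \<in> \<Xi>"
 obtain l a b' where xi: "\<xi> = (l, a, b')" by (cases \<xi>) auto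
 have m: "a \<in> T" "l < n (bl a)" using i xi by auto
 have "mmul CR IV IV \<Xi> (mbase IV IV of_rat (bmat D b)) Qm (i, \<xi>) = (\<Sum>j\<in>IV. of_real (rb b i j) * Qm (j, \<xi>))"
  using i fin_IV by (simp add: mmul_entry) (auto intro!: sum.cong simp: mbase_entry bmat_def rb_def of_real_of_rat)
 also have "\<dots> = (\<Sum>k<n (bl a). of_real (cf b (bl a) k l) * Qm (i, (k, a, b')))"
 proof -
  have r: "op (rb b) (A \<xi>) i = (\<Sum>k<n (bl a). cf b (bl a) k l * AA k a i)"
   "op (rb b) (op J (A \<xi>)) i = (\<Sum>k<n (bl a). cf b (bl a) k l * op J (AA k a) i)"
   unfolding A_def xi using rb_AA[OF T m b, of i] by simp_all
  have "(\<Sum>k<n (bl a). of_real (cf b (bl a) k l) * Qm (i, (k, a, b'))) =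
   (\<Sum>k<n (bl a). c1 b' * of_real (cf b (bl a) k l * AA k a i) + c2 b' * of_real (cf b (bl a) k l * op J (AA k a) i))"
   using i m by (intro sum.cong refl) (simp add: Qm_def A_def algebra_simps)
  then show ?thesis unfolding sum_real_Qm[OF i(2,1)] r unfolding xi by (simp add: sum.distrib sum_distrib_left)
 qed
 also have "\<dots> = (\<Sum>c\<in>T. if c = a then \<Sum>k<n (bl a). of_real (cf b (bl a) k l) * Qm (i, (k, a, b')) else 0)"
  using m T_fin[OF T] by simp
 also have "\<dots> = (\<Sum>c\<in>T. \<Sum>k<n (bl c). Qm (i, (k, c, True)) * stdm \<Xi> bl (cf b) ((k, c, True), \<xi>) + Qm (i, (k, c, False)) * stdm \<Xi> bl (cf b) ((k, c, False), \<xi>))"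
  using m by (intro sum.cong refl) (auto simp: stdm_def xi intro!: sum.cong)
 also have "\<dots> = (\<Sum>\<eta>\<in>\<Xi>. Qm (i, \<eta>) * stdm \<Xi> bl (cf b) (\<eta>, \<xi>))"
  by (rule sum_Xi[OF T_fin[OF T], symmetric])
 finally show "mmul CR IV IV \<Xi> (mbase IV IV of_rat (bmat D b)) Qm (i, \<xi>) = mmul CR IV \<Xi> \<Xi> Qm (stdm \<Xi> bl (cf b)) (i, \<xi>)"
  using i fin\<Xi> by (simp add: mmul_entry)
qed (intro C.mmul_mats Qm_mats mbase_cx_mats form_mats; fail)+

lemma JQm: "mmul CR IV IV \<Xi> (mbase IV IV of_real (hh D \<i>)) Qm = mmul CR IV \<Xi> \<Xi> Qm (epsm \<Xi>)"
proof (rule mats_eqI[of _ CR IV \<Xi>])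
 fix i \<xi> assume i: "i \<in> IV" "\<xi> \<in> \<Xi>"
 obtain l a b' where xi: "\<xi> = (l, a, b')" by (cases \<xi>) auto
 have "mmul CR IV IV \<Xi> (mbase IV IV of_real (hh D \<i>)) Qm (i, \<xi>) = (\<Sum>j\<in>IV. of_real (J i j) * Qm (j, \<xi>))"
  using i fin_IV by (simp add: mmul_entry) (auto intro!: sum.cong simp: mbase_entry J_def)
 also have "\<dots> = c1 b' * of_real (op J (A \<xi>) i) - c2 b' * of_real (A \<xi> i)"
  unfolding sum_real_Qm[OF i(2,1)] J_J[OF AA_supp(2)] by (simp add: xi)
 also have "\<dots> = Qm (i, \<xi>) * eps b'"
  using i by (simp add: Qm_def xi c1_def c2_def eps_def divide_simps) (simp add: algebra_simps)
 also have "\<dots> = (\<Sum>\<eta>\<in>\<Xi>. if \<eta> = \<xi> then Qm (i, \<xi>) * eps b' else 0)"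
  using i fin\<Xi> by simp
 also have "\<dots> = (\<Sum>\<eta>\<in>\<Xi>. Qm (i, \<eta>) * epsm \<Xi> (\<eta>, \<xi>))"
  using i by (intro sum.cong refl) (auto simp: epsm_def xi)
 finally show "mmul CR IV IV \<Xi> (mbase IV IV of_real (hh D \<i>)) Qm (i, \<xi>) = mmul CR IV \<Xi> \<Xi> Qm (epsm \<Xi>) (i, \<xi>)"
  using i fin\<Xi> by (simp add: mmul_entry)
qed (intro C.mmul_mats Qm_mats mbase_cx_mats form_mats; fail)+

lemma gramQm:
 "mmul CR \<Xi> IV \<Xi> (mtr IV \<Xi> Qm) (mmul CR IV IV \<Xi> (mbase IV IV of_rat (gram D)) Qm) = omm \<Xi>"
proof (rule mats_eqI[of _ CR \<Xi> \<Xi>])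
 fix \<xi> \<eta> assume x: "\<xi> \<in> \<Xi>" "\<eta> \<in> \<Xi>"
 obtain k a b where xi: "\<xi> = (k, a, b)" by (cases \<xi>) auto
 obtain l c b' where eta: "\<eta> = (l, c, b')" by (cases \<eta>) auto
 have m: "a \<in> T" "k < n (bl a)" "c \<in> T" "l < n (bl c)" using x xi eta by auto
 note o = AA_om[OF T m(1) m(3) m(2) m(4)]
 have "mmul CR \<Xi> IV \<Xi> (mtr IV \<Xi> Qm) (mmul CR IV IV \<Xi> (mbase IV IV of_rat (gram D)) Qm) (\<xi>, \<eta>) =
  (\<Sum>i\<in>IV. Qm (i, \<xi>) * (\<Sum>j\<in>IV. of_real (rp i j) * Qm (j, \<eta>)))"
  using x fin_IV by (simp add: mmul_entry) (auto intro!: sum.cong arg_cong2[where f="(*)"] simp: mbase_entry mmul_entry mtr_entry gram_def rp_def of_real_of_rat)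
 also have "\<dots> = (\<Sum>i\<in>IV. \<Sum>j\<in>IV. c1 b * c1 b' * of_real (A \<xi> i * A \<eta> j * rp i j) + c1 b * c2 b' * of_real (A \<xi> i * op J (A \<eta>) j * rp i j)
  + c2 b * c1 b' * of_real (op J (A \<xi>) i * A \<eta> j * rp i j) + c2 b * c2 b' * of_real (op J (A \<xi>) i * op J (A \<eta>) j * rp i j))"
  using x by (auto simp: sum_distrib_left Qm_def xi eta algebra_simps intro!: sum.cong)
 also have "\<dots> = c1 b * c1 b' * of_real (om (A \<xi>) (A \<eta>)) + c1 b * c2 b' * of_real (om (A \<xi>) (op J (A \<eta>)))
  + c2 b * c1 b' * of_real (om (op J (A \<xi>)) (A \<eta>)) + c2 b * c2 b' * of_real (om (op J (A \<xi>)) (op J (A \<eta>)))"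
  unfolding om_def of_real_sum by (simp only: sum.distrib sum_distrib_left)
 also have "\<dots> = omm \<Xi> (\<xi>, \<eta>)"
  using x unfolding A_def xi eta fst_conv snd_conv by (auto simp: o omm_def Omega_def c1_def c2_def divide_simps)
 finally show "mmul CR \<Xi> IV \<Xi> (mtr IV \<Xi> Qm) (mmul CR IV IV \<Xi> (mbase IV IV of_rat (gram D)) Qm) (\<xi>, \<eta>) = omm \<Xi> (\<xi>, \<eta>)" .
qed (intro C.mmul_mats mtr_mats Qm_mats mbase_cx_mats form_mats; fail)+

lemma normal_form_Qm: "normal_form D T bl n cf Qm Pm"
proof
 fix a k l assume a: "a \<in> T" "k < n (bl a)" "l < n (bl a)"
 have "(\<Sum>b\<in>IB. complex_of_real (eb (bl a) k l b) * of_real (cf b (bl a') p q)) = (if bl a' = bl a \<and> p = k \<and> q = l then 1 else 0)"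
  if "a' \<in> T" "p < n (bl a')" "q < n (bl a')" for a' p q
 proof -
  have r: "(\<Sum>b\<in>IB. eb (bl a) k l b * cf b (bl a') p q) = (if bl a' = bl a \<and> p = k \<and> q = l then 1 else 0)"
   by (rule cf_units[OF T bl(1)[OF T_WW[OF T a(1)]] bl(1)[OF T_WW[OF T that(1)]] that(2,3)])
  have "complex_of_real (\<Sum>b\<in>IB. eb (bl a) k l b * cf b (bl a') p q) = (if bl a' = bl a \<and> p = k \<and> q = l then 1 else 0)"
   unfolding r by simp
  then show ?thesis by (simp only: of_real_sum of_real_mult)
 qed
 then show "\<exists>x :: 'b => complex. \<forall>a' \<in> T. \<forall>p < n (bl a'). \<forall>q < n (bl a').
   (\<Sum>b\<in>IB. x b * of_real (cf b (bl a') p q)) = (if bl a' = bl a \<and> p = k \<and> q = l then 1 else 0)"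
  by (intro exI[of _ "\<lambda>b. complex_of_real (eb (bl a) k l b)"]) blast
qed (use T_fin[OF T] fin_IV fin_IB n_pos bl(1)[OF T_WW[OF T]] Qm_mats Pm_mats QPm PQm bQm JQm gramQm in auto)

end

lemma normal_form_exists: "\<exists>(TH :: ('v => real) set) bl n cf Q P. normal_form D TH bl n cf Q P"
proof -
 obtain T where "adapted WW T" "!!T'. adapted WW T' ==> T \<subseteq> T' ==> T' = T"
  using maximal_adapted by metis
 then show ?thesis using normal_form_Qm by blast
qed

end

lemma symplectic_normal_form:
 fixes D :: "('b::ring, 'v::ab_group_add) pel"
 assumes "PEL_datum D" "symplectic_type D"
 obtains TH :: "('v => real) set" and bl n cf Q P where "normal_form D TH bl n cf Q P"
proof -
 obtain r n \<Phi> where "symplectic_pel D r n \<Phi>"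
  using assms unfolding symplectic_type_def symplectic_pel_def symplectic_pel_axioms_def by blast
 then show thesis using symplectic_pel.normal_form_exists that by blast
qed

section \<open>The group of a PEL-datum in normal form\<close>

locale base_change = base_ring R for R :: "'u ring" (structure) +
 fixes I :: "'i set" and K :: "'k set" and Q P
 assumes fin: "finite I" "finite K" and Q: "Q \<in> mats R I K" and P: "P \<in> mats R K I"
  and QP: "mmul R I K I Q P = mone R I" and PQ: "mmul R K I K P Q = mone R K"
begin

definition "cjm M = mmul R I K I Q (mmul R K K I M P)"

lemma cancel [simp]:
 "N \<in> mats R I L ==> mmul R I K L Q (mmul R K I L P N) = N"
 "N' \<in> mats R K L ==> mmul R K I L P (mmul R I K L Q N') = N'"
 using mmul_assoc[OF fin(2,1) Q P, of N L] mmul_assoc[OF fin(1,2) P Q, of N' L] QP PQ fin by simp_all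

lemma mats_QP [simp]: "Q \<in> mats R I K" "P \<in> mats R K I" "finite I" "finite K"
 using Q P fin by auto

lemma cjm_mats [simp]: "M \<in> mats R K K ==> cjm M \<in> mats R I I"
 unfolding cjm_def by simp

lemma cjm_mult: "M \<in> mats R K K ==> N \<in> mats R K K ==> mmul R I I I (cjm M) (cjm N) = cjm (mmul R K K K M N)"
 unfolding cjm_def by (simp add: mmul_assoc)

lemma cjm_one: "cjm (mone R K) = mone R I"
 unfolding cjm_def by (simp add: QP)

lemma cjm_inv: "M \<in> mats R K K ==> mmul R K I K P (mmul R I I K (cjm M) Q) = M"
 unfolding cjm_def by (simp add: mmul_assoc PQ)

lemma cjm_inj: "M \<in> mats R K K ==> N \<in> mats R K K ==> cjm M = cjm N \<longleftrightarrow> M = N"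
 by (metis cjm_inv)

lemma cjm_surj:
 assumes "g \<in> mats R I I"
 obtains M where "M \<in> mats R K K" "g = cjm M"
proof (rule that[of "mmul R K I K P (mmul R I I K g Q)"])
 show "g = cjm (mmul R K I K P (mmul R I I K g Q))"
  unfolding cjm_def using assms by (simp add: mmul_assoc QP)
qed (use assms in simp)

lemma cjm_intertwine:
 assumes "B \<in> mats R I I" "S \<in> mats R K K" "mmul R I I K B Q = mmul R I K K Q S"
 shows "B = cjm S"
proof -
 have "B = mmul R I K I (mmul R I I K B Q) P" using assms(1) by (simp add: mmul_assoc QP)
 then show ?thesis unfolding assms(3) cjm_def using assms by (simp add: mmul_assoc)
qed

lemma cjm_mtr: "M \<in> mats R K K ==> mtr I I (cjm M) = mmul R I K I (mtr K I P) (mmul R K K I (mtr K K M) (mtr I K Q))"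
 unfolding cjm_def by (simp add: mtr_mmul mmul_assoc)

lemma cjm_form:
 assumes G: "G \<in> mats R I I" "F \<in> mats R K K" "mmul R K I K (mtr I K Q) (mmul R I I K G Q) = F"
  and M: "M \<in> mats R K K"
 shows "mmul R I I I (mtr I I (cjm M)) (mmul R I I I G (cjm M)) =
  mmul R I K I (mtr K I P) (mmul R K K I (mmul R K K K (mtr K K M) (mmul R K K K F M)) P)"
proof -
 have "mmul R I I I (mtr I I (cjm M)) (mmul R I I I G (cjm M)) =
  mmul R I K I (mtr K I P) (mmul R K K I (mtr K K M) (mmul R K K I (mmul R K I K (mtr I K Q) (mmul R I I K G Q)) (mmul R K K I M P)))"
  unfolding cjm_mtr[OF M] unfolding cjm_def using M G(1) by (simp add: mmul_assoc)
 then show ?thesis unfolding G(3) using M G(2) by (simp add: mmul_assoc)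
qed

lemma form_cjm:
 assumes G: "G \<in> mats R I I" "F \<in> mats R K K" "mmul R K I K (mtr I K Q) (mmul R I I K G Q) = F"
 shows "G = mmul R I K I (mtr K I P) (mmul R K K I F P)"
proof -
 have t: "mtr I I (mone R I) = mone R I" "mtr K K (mone R K) = mone R K"
  by (rule mats_eqI[of _ R I I] mats_eqI[of _ R K K]; auto simp: mtr_entry mone_entry)+
 show ?thesis using cjm_form[OF G, of "mone R K"] G t by (simp add: cjm_one)
qed

lemma form_inj:
 assumes "M \<in> mats R K K" "N \<in> mats R K K"
  "mmul R I K I (mtr K I P) (mmul R K K I M P) = mmul R I K I (mtr K I P) (mmul R K K I N P)"
 shows "M = N"
proof -
 have t: "mmul R K I K (mtr I K Q) (mtr K I P) = mone R K"
 proof -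
  have "mtr K K (mone R K) = mone R K" by (rule mats_eqI[of _ R K K]) (auto simp: mtr_entry mone_entry)
  then show ?thesis using mtr_mmul[OF fin(1) P Q] PQ by simp
 qed
 have "M' = mmul R K I K (mtr I K Q) (mmul R I I K (mmul R I K I (mtr K I P) (mmul R K K I M' P)) Q)"
  if M': "M' \<in> mats R K K" for M'
 proof -
  have "mmul R K I K (mtr I K Q) (mmul R I I K (mmul R I K I (mtr K I P) (mmul R K K I M' P)) Q) =
   mmul R K K K (mmul R K I K (mtr I K Q) (mtr K I P)) M'" using M' by (simp add: mmul_assoc PQ)
  then show ?thesis unfolding t using M' by simp
 qed
 then show ?thesis using assms by metis
qed

end

locale symp_points = normal_form D TH bl n cf Q P + complex_algebra A \<phi>
 for D :: "('b::ring, 'v::ab_group_add) pel" and TH :: "'t set" and bl n cf Q P and A :: "'u ring" (structure) and \<phi>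
begin

sublocale pel_alg A D
 using finV finB by unfold_locales

notation mm (infixl "\<bullet>\<bullet>" 70)

abbreviation "\<Xi> \<equiv> Xi TH bl n"
abbreviation "\<Lambda> \<equiv> TH \<times> (UNIV :: bool set)"
abbreviation "QA \<equiv> mbase I \<Xi> \<phi> Q"
abbreviation "PA \<equiv> mbase \<Xi> I \<phi> P"

lemma fin\<Xi> [simp]: "finite \<Xi>" and fin\<Lambda> [simp]: "finite \<Lambda>" "finite I" using finT finV by auto

sublocale bc: base_change A I \<Xi> QA PA
proof
 show "mmul A I \<Xi> I QA PA = mone A I" "mmul A \<Xi> I \<Xi> PA QA = mone A \<Xi>"
  using cx.mbase_mmul[OF _ Q_mats P_mats] cx.mbase_mmul[OF _ P_mats Q_mats] QP PQ
  by (simp_all add: cx.mbase_mone)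
qed (use Q_mats P_mats in auto)

text \<open>A point commuting with the algebra has the form \<open>1 \<otimes> h\<close> with
  \<open>h\<close> block diagonal on the multiplicity spaces. \<open>st h\<close> is this extension
  to the indices \<open>\<Xi>\<close>, and \<open>iota h\<close> is its matrix in the original
  basis.\<close>

definition "blk h \<longleftrightarrow> h \<in> mats A \<Lambda> \<Lambda> \<and> (\<forall>l\<in>\<Lambda>. \<forall>m\<in>\<Lambda>. bl (fst l) ~= bl (fst m) --> h (l, m) = \<zero>)"
definition "st h = (\<lambda>(\<xi>, \<eta>) \<in> \<Xi> \<times> \<Xi>. if fst \<xi> = fst \<eta> then h (snd \<xi>, snd \<eta>) else \<zero>)"
definition "Om = (\<lambda>(l, m) \<in> \<Lambda> \<times> \<Lambda>. if fst l = fst m then \<phi> (Omega (snd l) (snd m)) else \<zero>)"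
definition "iota h = bc.cjm (st h)"

lemma blk_mats [simp]: "blk h ==> h \<in> mats A \<Lambda> \<Lambda>" unfolding blk_def by simp

lemma snd_Xi: "\<xi> \<in> \<Xi> ==> snd \<xi> \<in> \<Lambda>" unfolding Xi_def by auto

lemma Xi_zero: "l \<in> \<Lambda> ==> (0, l) \<in> \<Xi>" using n_pos by (cases l) auto

lemma Xi_blk: "(k, l) \<in> \<Xi> ==> m \<in> \<Lambda> ==> bl (fst l) = bl (fst m) ==> (k, m) \<in> \<Xi>"
 by (cases l; cases m) auto

lemma st_mats [simp]: "h \<in> mats A \<Lambda> \<Lambda> ==> st h \<in> mats A \<Xi> \<Xi>"
 by (rule mats_memI) (auto simp: st_def mats_entry snd_Xi)

lemma st_entry: "\<xi> \<in> \<Xi> ==> \<eta> \<in> \<Xi> ==> st h (\<xi>, \<eta>) = (if fst \<xi> = fst \<eta> then h (snd \<xi>, snd \<eta>) else \<zero>)"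
 unfolding st_def by simp

lemma st_inj:
 assumes "h \<in> mats A \<Lambda> \<Lambda>" "h' \<in> mats A \<Lambda> \<Lambda>" "st h = st h'"
 shows "h = h'"
proof (rule mats_eqI[of _ A \<Lambda> \<Lambda>])
 fix l m assume "l \<in> \<Lambda>" "m \<in> \<Lambda>"
 then show "h (l, m) = h' (l, m)"
  using fun_cong[OF assms(3), of "((0, l), (0, m))"] st_entry[OF Xi_zero Xi_zero, of l m] by simp
qed (use assms in auto)

text \<open>For fixed \<open>k\<close> the factors of size at most \<open>k\<close> are absent from
  \<open>\<Xi>\<close>; the second assumption on \<open>g\<close> fills these gaps with
  zeros.\<close>

lemma finsum_Xi:
 assumes "k = fst \<xi>" "!!l. l \<in> \<Lambda> ==> g l \<in> carrier A" "!!l. l \<in> \<Lambda> ==> (k, l) \<notin> \<Xi> ==> g l = \<zero>"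
 shows "(\<Oplus>\<eta>\<in>\<Xi>. if k = fst \<eta> then g (snd \<eta>) else \<zero>) = (\<Oplus>l\<in>\<Lambda>. g l)"
proof -
 let ?S = "{l \<in> \<Lambda>. (k, l) \<in> \<Xi>}"
 have "(\<Oplus>\<eta>\<in>\<Xi>. if k = fst \<eta> then g (snd \<eta>) else \<zero>) = (\<Oplus>\<eta>\<in>Pair k ` ?S. g (snd \<eta>))"
  by (rule add.finprod_mono_neutral_cong_right) (use assms snd_Xi in \<open>auto simp: image_iff\<close>)
 also have "\<dots> = (\<Oplus>l\<in>?S. g l)"
  by (subst finsum_reindex) (use assms in \<open>auto simp: inj_on_def\<close>)
 also have "\<dots> = (\<Oplus>l\<in>\<Lambda>. g l)"
  by (rule add.finprod_mono_neutral_cong_left) (use assms in auto)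
 finally show ?thesis .
qed

text \<open>Block diagonality of the left factor ensures that intermediate indices missing from
  \<open>\<Xi>\<close> contribute nothing, so \<open>st\<close> is multiplicative although the
  factors have different sizes.\<close>

lemma st_mmul:
 assumes h: "blk h" and h': "h' \<in> mats A \<Lambda> \<Lambda>"
 shows "st (mmul A \<Lambda> \<Lambda> \<Lambda> h h') = mmul A \<Xi> \<Xi> \<Xi> (st h) (st h')"
proof (rule mats_eqI[of _ A \<Xi> \<Xi>])
 fix \<xi> \<zeta> assume x: "\<xi> \<in> \<Xi>" "\<zeta> \<in> \<Xi>"
 note c = mats_entry[OF blk_mats[OF h]] mats_entry[OF h'] snd_Xi[OF x(1)] snd_Xi[OF x(2)]
 have "mmul A \<Xi> \<Xi> \<Xi> (st h) (st h') (\<xi>, \<zeta>) = (\<Oplus>\<eta>\<in>\<Xi>. if fst \<xi> = fst \<eta> then (if fst \<xi> = fst \<zeta> then h (snd \<xi>, snd \<eta>) \<otimes> h' (snd \<eta>, snd \<zeta>) else \<zero>) else \<zero>)"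
  using x by (simp add: mmul_entry) (rule finsum_cong', auto simp: st_entry c snd_Xi)
 also have "\<dots> = (\<Oplus>l\<in>\<Lambda>. if fst \<xi> = fst \<zeta> then h (snd \<xi>, l) \<otimes> h' (l, snd \<zeta>) else \<zero>)"
 proof (rule finsum_Xi[OF refl])
  fix l assume l: "l \<in> \<Lambda>"
  then show "(if fst \<xi> = fst \<zeta> then h (snd \<xi>, l) \<otimes> h' (l, snd \<zeta>) else \<zero>) \<in> carrier A" using c by auto
  assume "(fst \<xi>, l) \<notin> \<Xi>"
  then have "bl (fst (snd \<xi>)) ~= bl (fst l)" using Xi_blk[of "fst \<xi>" "snd \<xi>" l] x l by auto
  then show "(if fst \<xi> = fst \<zeta> then h (snd \<xi>, l) \<otimes> h' (l, snd \<zeta>) else \<zero>) = \<zero>"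
   using h l c unfolding blk_def by auto
 qed
 finally show "st (mmul A \<Lambda> \<Lambda> \<Lambda> h h') (\<xi>, \<zeta>) = mmul A \<Xi> \<Xi> \<Xi> (st h) (st h') (\<xi>, \<zeta>)"
  using x snd_Xi by (simp add: st_entry mmul_entry)
qed (use assms in auto)

lemma st_mone: "st (mone A \<Lambda>) = mone A \<Xi>"
 by (rule mats_eqI[of _ A \<Xi> \<Xi>]) (auto simp: st_entry mone_entry snd_Xi prod_eq_iff)

lemma st_mtr: "h \<in> mats A \<Lambda> \<Lambda> ==> st (mtr \<Lambda> \<Lambda> h) = mtr \<Xi> \<Xi> (st h)"
 by (rule mats_eqI[of _ A \<Xi> \<Xi>]) (auto simp: st_entry mtr_entry snd_Xi)

lemma Om_mats [simp]: "Om \<in> mats A \<Lambda> \<Lambda>"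
 by (rule mats_memI) (auto simp: Om_def)

lemma Om_blk: "blk Om"
 unfolding blk_def by (intro conjI ballI impI Om_mats) (auto simp: Om_def)

lemma mtr_blk: "blk h ==> blk (mtr \<Lambda> \<Lambda> h)"
 unfolding blk_def by (auto simp: mtr_entry)

lemma mone_blk: "blk (mone A \<Lambda>)" unfolding blk_def by (auto simp: mone_entry)

lemma mmul_blk: "blk h ==> blk h' ==> blk (mmul A \<Lambda> \<Lambda> \<Lambda> h h')"
 unfolding blk_def[of "mmul A \<Lambda> \<Lambda> \<Lambda> h h'"]
proof (intro conjI ballI impI)
 fix l m assume *: "blk h" "blk h'" "l \<in> \<Lambda>" "m \<in> \<Lambda>" "bl (fst l) ~= bl (fst m)"
 have "h (l, p) \<otimes> h' (p, m) = \<zero>" if "p \<in> \<Lambda>" for p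
 proof (cases "bl (fst l) = bl (fst p)")
  case True
  then have "h' (p, m) = \<zero>" using * that unfolding blk_def by auto
  then show ?thesis using mats_entry[OF blk_mats[OF *(1)] *(3) that] by simp
 next
  case False
  then have "h (l, p) = \<zero>" using * that unfolding blk_def by auto
  then show ?thesis using mats_entry[OF blk_mats[OF *(2)] that *(4)] by simp
 qed
 then show "mmul A \<Lambda> \<Lambda> \<Lambda> h h' (l, m) = \<zero>" using *(3,4) by (simp add: mmul_entry cong: finsum_cong) 
qed auto

lemma form_mats: "stdm \<Xi> bl c \<in> mats CR \<Xi> \<Xi>" "epsm \<Xi> \<in> mats CR \<Xi> \<Xi>" "omm \<Xi> \<in> mats CR \<Xi> \<Xi>"
 by (rule mats_memI; simp add: stdm_def epsm_def omm_def)+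

lemma st_Om: "mbase \<Xi> \<Xi> \<phi> (omm \<Xi>) = st Om"
proof (rule mats_eqI[of _ A \<Xi> \<Xi>])
 fix \<xi> \<eta> assume "\<xi> \<in> \<Xi>" "\<eta> \<in> \<Xi>"
 then show "mbase \<Xi> \<Xi> \<phi> (omm \<Xi>) (\<xi>, \<eta>) = st Om (\<xi>, \<eta>)"
  using snd_Xi by (auto simp: mbase_entry omm_def st_entry Om_def split_def)
qed (use form_mats(3) in auto)

lemma iota_mats [simp]: "h \<in> mats A \<Lambda> \<Lambda> ==> iota h \<in> mats A I I"
 unfolding iota_def by simp

lemma iota_mult: "blk h ==> h' \<in> mats A \<Lambda> \<Lambda> ==> iota (mmul A \<Lambda> \<Lambda> \<Lambda> h h') = iota h \<bullet>\<bullet> iota h'"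
 unfolding iota_def by (simp add: st_mmul bc.cjm_mult)

lemma iota_one: "iota (mone A \<Lambda>) = mone A I"
 unfolding iota_def st_mone bc.cjm_one ..

lemma iota_inj: "h \<in> mats A \<Lambda> \<Lambda> ==> h' \<in> mats A \<Lambda> \<Lambda> ==> iota h = iota h' \<longleftrightarrow> h = h'"
 unfolding iota_def using st_inj by (auto simp: bc.cjm_inj)

lemma ext_phi: "M \<in> mats rat_ring I I ==> ext M = mbase I I \<phi> (mbase I I of_rat M)"
 unfolding mbase_mbase by (rule mbase_cong) (auto simp: of_rat_alg_phi)

lemma mats_cx: "M \<in> mats CR I I' ==> mbase I I' \<phi> M \<in> mats A I I'"
 by simp

lemma cx_mats: "mbase J K \<psi> M \<in> mats CR J K"
 by (rule mats_memI; simp add: mbase_def)+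

lemma ext_gram: "mmul A \<Xi> I \<Xi> (mtr I \<Xi> QA) (mmul A I I \<Xi> (ext (gram D)) QA) = st Om"
proof -
 have "mmul A \<Xi> I \<Xi> (mtr I \<Xi> QA) (mmul A I I \<Xi> (ext (gram D)) QA) = mbase \<Xi> \<Xi> \<phi>
  (mmul CR \<Xi> I \<Xi> (mtr I \<Xi> Q) (mmul CR I I \<Xi> (mbase I I of_rat (gram D)) Q))"
  using Q_mats by (simp add: cx.mbase_mmul cx_mats mbase_mtr ext_phi)
 then show ?thesis unfolding gramQ st_Om .
qed

lemma ext_bmat: "b \<in> basisB D ==> ext (bmat D b) = bc.cjm (mbase \<Xi> \<Xi> \<phi> (stdm \<Xi> bl (cf b)))"
proof (rule bc.cjm_intertwine)
 assume b: "b \<in> basisB D"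
 have "mmul A I I \<Xi> (ext (bmat D b)) QA = mbase I \<Xi> \<phi> (mmul CR I I \<Xi> (mbase I I of_rat (bmat D b)) Q)"
  using Q_mats by (simp add: cx.mbase_mmul cx_mats ext_phi)
 then show "mmul A I I \<Xi> (ext (bmat D b)) QA = mmul A I \<Xi> \<Xi> QA (mbase \<Xi> \<Xi> \<phi> (stdm \<Xi> bl (cf b)))"
  unfolding bQ[OF b] using Q_mats by (simp add: cx.mbase_mmul form_mats)
qed (auto simp: form_mats)

end

section \<open>The centralizer of the algebra and the similitude condition\<close>

context symp_points
begin

lemma blk_zero: "blk h ==> l \<in> \<Lambda> ==> m \<in> \<Lambda> ==> bl (fst l) ~= bl (fst m) ==> h (l, m) = \<zero>"
 unfolding blk_def by auto

lemma phi_minus: "\<phi> (- c) = \<ominus> \<phi> c"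
 using minus_equality[of "\<phi> (- c)" "\<phi> c"] phi_add[of "- c" c] by simp

definition "form h = mmul A \<Lambda> \<Lambda> \<Lambda> (mtr \<Lambda> \<Lambda> h) (mmul A \<Lambda> \<Lambda> \<Lambda> Om h)"

lemma form_mult:
 assumes "h \<in> mats A \<Lambda> \<Lambda>" "h' \<in> mats A \<Lambda> \<Lambda>" "\<mu> \<in> carrier A" "\<nu> \<in> carrier A" "form h = msc A \<Lambda> \<Lambda> \<mu> Om" "form h' = msc A \<Lambda> \<Lambda> \<nu> Om"
 shows "form (mmul A \<Lambda> \<Lambda> \<Lambda> h h') = msc A \<Lambda> \<Lambda> (\<mu> \<otimes> \<nu>) Om"
proof -
 have "form (mmul A \<Lambda> \<Lambda> \<Lambda> h h') = mmul A \<Lambda> \<Lambda> \<Lambda> (mtr \<Lambda> \<Lambda> h') (mmul A \<Lambda> \<Lambda> \<Lambda> (form h) h')"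
  using assms(1-4) unfolding form_def by (simp add: mtr_mmul mmul_assoc)
 also have "\<dots> = msc A \<Lambda> \<Lambda> \<mu> (form h')"
  unfolding assms(5) unfolding form_def using assms(1-4) by (simp add: mmul_msc_left mmul_msc_right)
 also have "\<dots> = msc A \<Lambda> \<Lambda> (\<mu> \<otimes> \<nu>) Om"
  unfolding assms(6) by (rule mats_eqI[of _ A \<Lambda> \<Lambda>]) (use assms(3,4) in \<open>auto simp: msc_entry mats_entry[OF Om_mats] m_assoc\<close>)
 finally show ?thesis .
qed

lemma st_msc: "\<mu> \<in> carrier A ==> h \<in> mats A \<Lambda> \<Lambda> ==> st (msc A \<Lambda> \<Lambda> \<mu> h) = msc A \<Xi> \<Xi> \<mu> (st h)"
proof (rule mats_eqI[of _ A \<Xi> \<Xi>])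
 fix \<xi> \<eta> assume "\<mu> \<in> carrier A" "\<xi> \<in> \<Xi>" "\<eta> \<in> \<Xi>"
 then show "st (msc A \<Lambda> \<Lambda> \<mu> h) (\<xi>, \<eta>) = msc A \<Xi> \<Xi> \<mu> (st h) (\<xi>, \<eta>)"
  using snd_Xi by (simp add: st_entry msc_entry)
qed auto

lemma similitude_iota:
 assumes h: "blk h" and mu: "\<mu> \<in> carrier A"
 shows "similitude \<mu> (iota h) \<longleftrightarrow> form h = msc A \<Lambda> \<Lambda> \<mu> Om"
proof -
 let ?c = "\<lambda>M. mmul A I \<Xi> I (mtr \<Xi> I PA) (mmul A \<Xi> \<Xi> I M PA)"
 have G: "ext (gram D) \<in> mats A I I" by simp
 have hm: "h \<in> mats A \<Lambda> \<Lambda>" using h by simp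
 have sO: "st Om \<in> mats A \<Xi> \<Xi>" by simp
 have fm: "form h \<in> mats A \<Lambda> \<Lambda>" unfolding form_def using hm by simp
 have PA: "PA \<in> mats A \<Xi> I" by simp
 have "st (form h) = mmul A \<Xi> \<Xi> \<Xi> (mtr \<Xi> \<Xi> (st h)) (mmul A \<Xi> \<Xi> \<Xi> (st Om) (st h))"
  unfolding form_def using hm by (simp add: st_mmul[OF mtr_blk[OF h]] st_mmul[OF Om_blk] st_mtr)
 then have 1: "mtr I I (iota h) \<bullet>\<bullet> (ext (gram D) \<bullet>\<bullet> iota h) = ?c (st (form h))"
  unfolding iota_def using bc.cjm_form[OF G sO ext_gram st_mats[OF hm]] by simp
 have "msc A I I \<mu> (ext (gram D)) = ?c (st (msc A \<Lambda> \<Lambda> \<mu> Om))"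
  unfolding bc.form_cjm[OF G sO ext_gram] st_msc[OF mu Om_mats]
  using mu PA sO by (simp add: mmul_msc_left mmul_msc_right)
 then have "similitude \<mu> (iota h) \<longleftrightarrow> ?c (st (form h)) = ?c (st (msc A \<Lambda> \<Lambda> \<mu> Om))"
  unfolding similitude_def 1 by simp
 also have "\<dots> \<longleftrightarrow> form h = msc A \<Lambda> \<Lambda> \<mu> Om"
  using bc.form_inj[of "st (form h)" "st (msc A \<Lambda> \<Lambda> \<mu> Om)"] st_inj[of "form h" "msc A \<Lambda> \<Lambda> \<mu> Om"] fm mu by auto
 finally show ?thesis .
qed

abbreviation "stdA b \<equiv> mbase \<Xi> \<Xi> \<phi> (stdm \<Xi> bl (cf b))"

lemma stdA_mats [simp]: "stdA b \<in> mats A \<Xi> \<Xi>" by (simp add: form_mats)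

lemma stdA_entry: "\<xi> \<in> \<Xi> ==> \<eta> \<in> \<Xi> ==> stdA b (\<xi>, \<eta>) = \<phi> (if snd \<xi> = snd \<eta> then of_real (cf b (bl (fst (snd \<xi>))) (fst \<xi>) (fst \<eta>)) else 0)"
 by (simp add: mbase_entry stdm_def)

lemma finsum_at:
 assumes "!!\<eta>. \<eta> \<in> \<Xi> ==> f \<eta> \<in> carrier A" "!!\<eta>. \<eta> \<in> \<Xi> ==> \<eta> ~= \<eta>0 ==> f \<eta> = \<zero>" "\<eta>0 \<in> \<Xi>"
 shows "(\<Oplus>\<eta>\<in>\<Xi>. f \<eta>) = f \<eta>0"
 using finsum_single[OF fin\<Xi> assms(3), of f] assms by auto

text \<open>The algebra acts on the first index and \<open>h\<close> on the others, so each product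
  reduces to a single term, and block diagonality makes the algebra coefficients equal on both
  sides.\<close>

lemma std_commute:
 assumes h: "blk h"
 shows "mmul A \<Xi> \<Xi> \<Xi> (stdA b) (st h) = mmul A \<Xi> \<Xi> \<Xi> (st h) (stdA b)"
proof (rule mats_eqI[of _ A \<Xi> \<Xi>])
 fix \<xi> \<zeta> assume x: "\<xi> \<in> \<Xi>" "\<zeta> \<in> \<Xi>"
 note c = mats_entry[OF blk_mats[OF h]]
 have hc: "h (snd \<xi>, snd \<zeta>) \<in> carrier A" using c x snd_Xi by auto
 show "mmul A \<Xi> \<Xi> \<Xi> (stdA b) (st h) (\<xi>, \<zeta>) = mmul A \<Xi> \<Xi> \<Xi> (st h) (stdA b) (\<xi>, \<zeta>)"
 proof (cases "bl (fst (snd \<xi>)) = bl (fst (snd \<zeta>))")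
  case True
  have m: "(fst \<zeta>, snd \<xi>) \<in> \<Xi>" "(fst \<xi>, snd \<zeta>) \<in> \<Xi>"
   using Xi_blk[of "fst \<zeta>" "snd \<zeta>" "snd \<xi>"] Xi_blk[of "fst \<xi>" "snd \<xi>" "snd \<zeta>"] x True snd_Xi by auto
  have "(\<Oplus>\<eta>\<in>\<Xi>. stdA b (\<xi>, \<eta>) \<otimes> st h (\<eta>, \<zeta>)) = stdA b (\<xi>, (fst \<zeta>, snd \<xi>)) \<otimes> st h ((fst \<zeta>, snd \<xi>), \<zeta>)"
   by (rule finsum_at[OF _ _ m(1)]) (use x c snd_Xi in \<open>auto simp: stdA_entry st_entry prod_eq_iff\<close>)
  moreover have "(\<Oplus>\<eta>\<in>\<Xi>. st h (\<xi>, \<eta>) \<otimes> stdA b (\<eta>, \<zeta>)) = st h (\<xi>, (fst \<xi>, snd \<zeta>)) \<otimes> stdA b ((fst \<xi>, snd \<zeta>), \<zeta>)"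
   by (rule finsum_at[OF _ _ m(2)]) (use x c snd_Xi in \<open>auto simp: stdA_entry st_entry prod_eq_iff\<close>)
  ultimately show ?thesis using x m True hc by (simp add: mmul_entry stdA_entry st_entry m_comm)
 next
  case False
  have z: "h (l, m) = \<zero>" if "l \<in> \<Lambda>" "m \<in> \<Lambda>" "bl (fst l) ~= bl (fst m)" for l m using h that unfolding blk_def by auto
  have "stdA b (\<xi>, \<eta>) \<otimes> st h (\<eta>, \<zeta>) = \<zero>" "st h (\<xi>, \<eta>) \<otimes> stdA b (\<eta>, \<zeta>) = \<zero>" if "\<eta> \<in> \<Xi>" for \<eta>
  proof -
   have s: "snd \<xi> \<in> \<Lambda>" "snd \<zeta> \<in> \<Lambda>" "snd \<eta> \<in> \<Lambda>" using x that snd_Xi by auto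
   show "stdA b (\<xi>, \<eta>) \<otimes> st h (\<eta>, \<zeta>) = \<zero>" 
    using z[OF s(3,2)] c[OF s(3,2)] False x that by (auto simp: stdA_entry st_entry)
   show "st h (\<xi>, \<eta>) \<otimes> stdA b (\<eta>, \<zeta>) = \<zero>"
    using z[OF s(1,3)] c[OF s(1,3)] False x that by (auto simp: stdA_entry st_entry)
  qed
  then show ?thesis using x by (simp add: mmul_entry cong: finsum_cong)
 qed
qed (use h in auto)

lemma finsum_phi:
 assumes "finite B" "finite S" "!!\<eta>. \<eta> \<in> S ==> m \<eta> \<in> carrier A"
 shows "(\<Oplus>b\<in>B. \<phi> (x b) \<otimes> (\<Oplus>\<eta>\<in>S. m \<eta> \<otimes> \<phi> (s b \<eta>))) = (\<Oplus>\<eta>\<in>S. m \<eta> \<otimes> \<phi> (\<Sum>b\<in>B. x b * s b \<eta>))"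
proof -
 have "(\<Oplus>b\<in>B. \<phi> (x b) \<otimes> (\<Oplus>\<eta>\<in>S. m \<eta> \<otimes> \<phi> (s b \<eta>))) = (\<Oplus>b\<in>B. \<Oplus>\<eta>\<in>S. m \<eta> \<otimes> \<phi> (x b * s b \<eta>))"
  using assms by (intro finsum_cong') (auto simp: finsum_rdistr phi_mult m_lcomm intro!: finsum_closed finsum_cong')
 also have "\<dots> = (\<Oplus>\<eta>\<in>S. \<Oplus>b\<in>B. m \<eta> \<otimes> \<phi> (x b * s b \<eta>))"
  using assms by (intro finsum_swap) auto
 also have "\<dots> = (\<Oplus>\<eta>\<in>S. m \<eta> \<otimes> \<phi> (\<Sum>b\<in>B. x b * s b \<eta>))"
 proof (rule finsum_cong'[OF refl])
  fix \<eta> assume e: "\<eta> \<in> S"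
  have "(\<Oplus>b\<in>B. m \<eta> \<otimes> \<phi> (x b * s b \<eta>)) = m \<eta> \<otimes> (\<Oplus>b\<in>B. \<phi> (x b * s b \<eta>))"
   using assms e by (subst finsum_rdistr) auto
  also have "(\<Oplus>b\<in>B. \<phi> (x b * s b \<eta>)) = \<phi> (\<Sum>b\<in>B. x b * s b \<eta>)"
   using assms(1) by (induction B rule: finite_induct) (auto simp: phi_add)
  finally show "(\<Oplus>b\<in>B. m \<eta> \<otimes> \<phi> (x b * s b \<eta>)) = m \<eta> \<otimes> \<phi> (\<Sum>b\<in>B. x b * s b \<eta>)" .
 qed (use assms in auto)
 finally show ?thesis .
qed

text \<open>The double commutant computation. Commuting with the matrix unit from row
  \<open>k\<close> to column 0 forces the entries with first index \<open>k\<close> on both sides to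
  equal those with first index 0, and all entries with different first indices or in different
  blocks to vanish.\<close>

lemma commute_st:
 assumes M: "M \<in> mats A \<Xi> \<Xi>" and c: "!!b. b \<in> basisB D ==> mmul A \<Xi> \<Xi> \<Xi> M (stdA b) = mmul A \<Xi> \<Xi> \<Xi> (stdA b) M"
 obtains h where "blk h" "M = st h"
proof -
 define h where "h = (\<lambda>(l, m) \<in> \<Lambda> \<times> \<Lambda>. M ((0, l), (0, m)))"
 have hm: "h \<in> mats A \<Lambda> \<Lambda>"
  by (rule mats_memI) (auto simp: h_def intro!: mats_entry[OF M] n_pos)
 have key: "M (\<xi>, \<zeta>) = (if fst \<xi> = fst \<zeta> \<and> bl (fst (snd \<xi>)) = bl (fst (snd \<zeta>)) then h (snd \<xi>, snd \<zeta>) else \<zero>)"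
  if x: "\<xi> \<in> \<Xi>" "\<zeta> \<in> \<Xi>" for \<xi> \<zeta>
 proof -
  let ?a = "fst (snd \<zeta>)" and ?k = "fst \<zeta>" and ?z = "(0, snd \<zeta>)"
  have a: "?a \<in> TH" "?k < n (bl ?a)" "0 < n (bl ?a)" using x(2) n_pos by (cases \<zeta>, auto)+
  have z: "?z \<in> \<Xi>" "(0, snd \<xi>) \<in> \<Xi>" using x snd_Xi Xi_zero by blast+
  \<comment> \<open>The coefficients \<open>y\<close> express the matrix unit with row
    \<open>?k\<close> and column 0 in the factor of \<open>\<zeta>\<close>. Commutation is then
    evaluated at the entry \<open>(\<xi>, ?z)\<close>.\<close>
  obtain y :: "'b => complex" where y: "!!a' p q. a' \<in> TH ==> p < n (bl a') ==> q < n (bl a') ==>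
   (\<Sum>b\<in>basisB D. y b * of_real (cf b (bl a') p q)) = (if bl a' = bl ?a \<and> p = ?k \<and> q = 0 then 1 else 0)"
   using units[OF a(1) a(2) a(3)] by blast
  define s where "s b \<eta> \<zeta>' = (if snd \<eta> = snd \<zeta>' then complex_of_real (cf b (bl (fst (snd \<eta>))) (fst \<eta>) (fst \<zeta>')) else 0)"
   for b and \<eta> \<zeta>' :: "nat \<times> 't \<times> bool"
  have E: "(\<Sum>b\<in>basisB D. y b * s b \<eta> \<zeta>') = (if snd \<eta> = snd \<zeta>' \<and> bl (fst (snd \<eta>)) = bl ?a \<and> fst \<eta> = ?k \<and> fst \<zeta>' = 0 then 1 else 0)"
   if "\<eta> \<in> \<Xi>" "\<zeta>' \<in> \<Xi>" for \<eta> \<zeta>'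
  proof (cases "snd \<eta> = snd \<zeta>'")
   case True
   have "fst (snd \<eta>) \<in> TH" "fst \<eta> < n (bl (fst (snd \<eta>)))" "fst \<zeta>' < n (bl (fst (snd \<eta>)))"
    using that True by (cases \<eta>; cases \<zeta>'; auto)+
   from y[OF this] show ?thesis unfolding s_def using True by simp
  qed (simp add: s_def)
  have Mc: "M (p, q) \<in> carrier A" if "p \<in> \<Xi>" "q \<in> \<Xi>" for p q using mats_entry[OF M] that .
  have "(\<Oplus>\<eta>\<in>\<Xi>. M (\<xi>, \<eta>) \<otimes> \<phi> (s b \<eta> ?z)) = (\<Oplus>\<eta>\<in>\<Xi>. M (\<eta>, ?z) \<otimes> \<phi> (s b \<xi> \<eta>))" if b: "b \<in> basisB D" for b
  proof -
   have "(\<Oplus>\<eta>\<in>\<Xi>. M (\<xi>, \<eta>) \<otimes> \<phi> (s b \<eta> ?z)) = mmul A \<Xi> \<Xi> \<Xi> M (stdA b) (\<xi>, ?z)"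
    using x z by (simp only: mmul_entry) (rule finsum_cong', auto simp: stdA_entry s_def Mc)
   also have "\<dots> = (\<Oplus>\<eta>\<in>\<Xi>. M (\<eta>, ?z) \<otimes> \<phi> (s b \<xi> \<eta>))"
    unfolding c[OF b] using x z by (simp only: mmul_entry) (rule finsum_cong', auto simp: stdA_entry s_def Mc m_comm)
   finally show ?thesis .
  qed
  then have "(\<Oplus>b\<in>basisB D. \<phi> (y b) \<otimes> (\<Oplus>\<eta>\<in>\<Xi>. M (\<xi>, \<eta>) \<otimes> \<phi> (s b \<eta> ?z))) = (\<Oplus>b\<in>basisB D. \<phi> (y b) \<otimes> (\<Oplus>\<eta>\<in>\<Xi>. M (\<eta>, ?z) \<otimes> \<phi> (s b \<xi> \<eta>)))"
   using x z Mc by (intro finsum_cong') (auto intro!: finsum_closed)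
  then have "(\<Oplus>\<eta>\<in>\<Xi>. M (\<xi>, \<eta>) \<otimes> \<phi> (\<Sum>b\<in>basisB D. y b * s b \<eta> ?z)) = (\<Oplus>\<eta>\<in>\<Xi>. M (\<eta>, ?z) \<otimes> \<phi> (\<Sum>b\<in>basisB D. y b * s b \<xi> \<eta>))"
   using finsum_phi[OF finB fin\<Xi>, of "\<lambda>\<eta>. M (\<xi>, \<eta>)"] finsum_phi[OF finB fin\<Xi>, of "\<lambda>\<eta>. M (\<eta>, ?z)"] x z Mc by simp
  moreover have "(\<Oplus>\<eta>\<in>\<Xi>. M (\<xi>, \<eta>) \<otimes> \<phi> (\<Sum>b\<in>basisB D. y b * s b \<eta> ?z)) = M (\<xi>, \<zeta>) \<otimes> \<phi> (\<Sum>b\<in>basisB D. y b * s b \<zeta> ?z)"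
  proof (rule finsum_at[OF _ _ x(2)])
   fix \<eta> assume "\<eta> \<in> \<Xi>" "\<eta> ~= \<zeta>"
   moreover from this have "\<not> (snd \<eta> = snd \<zeta> \<and> fst \<eta> = fst \<zeta>)" by (auto simp: prod_eq_iff)
   ultimately show "M (\<xi>, \<eta>) \<otimes> \<phi> (\<Sum>b\<in>basisB D. y b * s b \<eta> ?z) = \<zero>" using E[of \<eta> ?z] z Mc x by auto
  qed (use Mc x in auto)
  moreover have "(\<Oplus>\<eta>\<in>\<Xi>. M (\<eta>, ?z) \<otimes> \<phi> (\<Sum>b\<in>basisB D. y b * s b \<xi> \<eta>)) = M ((0, snd \<xi>), ?z) \<otimes> \<phi> (\<Sum>b\<in>basisB D. y b * s b \<xi> (0, snd \<xi>))"
  proof (rule finsum_at[OF _ _ z(2)])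
   fix \<eta> assume "\<eta> \<in> \<Xi>" "\<eta> ~= (0, snd \<xi>)"
   moreover from this have "\<not> (snd \<xi> = snd \<eta> \<and> fst \<eta> = 0)" by (auto simp: prod_eq_iff)
   ultimately show "M (\<eta>, ?z) \<otimes> \<phi> (\<Sum>b\<in>basisB D. y b * s b \<xi> \<eta>) = \<zero>" using E[of \<xi> \<eta>] z Mc x by auto
  qed (use Mc z in auto)
  ultimately show ?thesis
   using E[OF x(2) z(1)] E[OF x(1) z(2)] Mc x z snd_Xi[OF x(1)] snd_Xi[OF x(2)]
   by (auto simp: h_def split_def split: if_splits)
 qed
 have "blk h"
  unfolding blk_def
 proof (intro conjI ballI impI hm)
  fix l m assume "l \<in> \<Lambda>" "m \<in> \<Lambda>" "bl (fst l) ~= bl (fst m)"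
  then show "h (l, m) = \<zero>" using key[OF Xi_zero Xi_zero, of l m] by (simp add: h_def split_def)
 qed
 moreover have "M = st h"
 proof (rule mats_eqI[of _ A \<Xi> \<Xi>])
  fix \<xi> \<zeta> assume x: "\<xi> \<in> \<Xi>" "\<zeta> \<in> \<Xi>"
  have "bl (fst (snd \<xi>)) ~= bl (fst (snd \<zeta>)) ==> h (snd \<xi>, snd \<zeta>) = \<zero>"
   using \<open>blk h\<close> snd_Xi[OF x(1)] snd_Xi[OF x(2)] by (rule blk_zero)
  then show "M (\<xi>, \<zeta>) = st h (\<xi>, \<zeta>)" using key[OF x] x by (simp add: st_entry)
 qed (use M hm in auto)
 ultimately show thesis by (rule that)
qed

lemma iota_group:
 assumes "blk h" "blk h'" "mmul A \<Lambda> \<Lambda> \<Lambda> h h' = mone A \<Lambda>" "mmul A \<Lambda> \<Lambda> \<Lambda> h' h = mone A \<Lambda>"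
  "\<mu> \<in> Units A" "form h = msc A \<Lambda> \<Lambda> \<mu> Om"
 shows "iota h \<in> carrier (PEL_group D A)"
 unfolding PEL_group_iff
proof (intro conjI ballI)
 show "iota h \<bullet>\<bullet> ext (bmat D k) = ext (bmat D k) \<bullet>\<bullet> iota h" if "k \<in> basisB D" for k
  unfolding ext_bmat[OF that] iota_def using assms(1) by (simp add: bc.cjm_mult std_commute)
 show "\<exists>g'\<in>mats A I I. iota h \<bullet>\<bullet> g' = mone A I \<and> g' \<bullet>\<bullet> iota h = mone A I"
  using assms by (intro bexI[of _ "iota h'"]) (auto simp flip: iota_mult simp: iota_one)
 show "\<exists>\<mu>\<in>Units A. similitude \<mu> (iota h)"
  using assms similitude_iota Units_closed by blast
qed (use assms in auto)

text \<open>The inverse of \<open>g\<close> is a point of the group too, hence also of the form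
  \<open>iota h'\<close>. With \<open>iota_group\<close> this identifies the points over
  \<open>A\<close> with the invertible block diagonal symplectic similitudes.\<close>

lemma group_iota:
 assumes "g \<in> carrier (PEL_group D A)"
 obtains h h' \<mu> where "g = iota h" "blk h" "blk h'" "mmul A \<Lambda> \<Lambda> \<Lambda> h h' = mone A \<Lambda>" "mmul A \<Lambda> \<Lambda> \<Lambda> h' h = mone A \<Lambda>"
  "\<mu> \<in> Units A" "form h = msc A \<Lambda> \<Lambda> \<mu> Om"
proof -
 interpret G: group "PEL_group D A" by (rule PEL_group)
 have *: "\<exists>h. blk h \<and> g = iota h" if g: "g \<in> carrier (PEL_group D A)" for g
 proof -
  obtain M where M: "M \<in> mats A \<Xi> \<Xi>" "g = bc.cjm M" using bc.cjm_surj[OF PEL_group_mats[OF g]] .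
  have "mmul A \<Xi> \<Xi> \<Xi> M (stdA b) = mmul A \<Xi> \<Xi> \<Xi> (stdA b) M" if b: "b \<in> basisB D" for b
  proof -
   have "g \<bullet>\<bullet> ext (bmat D b) = ext (bmat D b) \<bullet>\<bullet> g" using g b unfolding PEL_group_iff by blast
   then show ?thesis unfolding M(2) ext_bmat[OF b] using M(1) by (simp add: bc.cjm_mult bc.cjm_inj)
  qed
  then show ?thesis using commute_st[OF M(1)] M(2) unfolding iota_def by metis
 qed
 obtain h where h: "blk h" "g = iota h" using *[OF assms] by blast
 obtain h' where h': "blk h'" "inv\<^bsub>PEL_group D A\<^esub> g = iota h'" using *[OF G.inv_closed[OF assms]] by blast
 have "iota (mmul A \<Lambda> \<Lambda> \<Lambda> h h') = iota (mone A \<Lambda>)" "iota (mmul A \<Lambda> \<Lambda> \<Lambda> h' h) = iota (mone A \<Lambda>)"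
  using h h' G.r_inv[OF assms] G.l_inv[OF assms] by (simp_all add: iota_mult iota_one)
 then have i: "mmul A \<Lambda> \<Lambda> \<Lambda> h h' = mone A \<Lambda>" "mmul A \<Lambda> \<Lambda> \<Lambda> h' h = mone A \<Lambda>"
  using h h' by (simp_all add: iota_inj)
 obtain \<mu> where mu: "\<mu> \<in> Units A" "similitude \<mu> g" using assms unfolding PEL_group_iff by blast
 then have "form h = msc A \<Lambda> \<Lambda> \<mu> Om" using similitude_iota[OF h(1) Units_closed] h(2) by auto
 then show thesis using that h h' i mu by blast
qed

end

section \<open>Torus elements and transvections\<close>

context symp_points
begin

text \<open>\<open>lam b u\<close> scales the half \<open>b\<close> by \<open>u\<close> and has
  multiplier \<open>u\<close>; \<open>uni b Y\<close> below is the transvection with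
  \<open>Y\<close> in the corner from the half \<open>\<not> b\<close> to the half
  \<open>b\<close>.\<close>

definition "lam b u = (\<lambda>(l, m) \<in> \<Lambda> \<times> \<Lambda>. if l = m then (if snd l = b then u else \<one>) else \<zero>)"
definition "uni b Y = (\<lambda>(l, m) \<in> \<Lambda> \<times> \<Lambda>. if l = m then \<one> else if snd l = b \<and> snd m = (\<not> b) then Y (fst l) (fst m) else \<zero>)"
definition "bsy Y \<longleftrightarrow> (\<forall>al\<in>TH. \<forall>be\<in>TH. Y al be \<in> carrier A \<and> Y al be = Y be al \<and> (bl al ~= bl be --> Y al be = \<zero>))"

abbreviation lmul (infixl "\<odot>" 70) where "h \<odot> h' \<equiv> mmul A \<Lambda> \<Lambda> \<Lambda> h h'"

lemma bsyD: "bsy Y ==> al \<in> TH ==> be \<in> TH ==> Y al be \<in> carrier A" "bsy Y ==> al \<in> TH ==> be \<in> TH ==> Y al be = Y be al"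
 "bsy Y ==> al \<in> TH ==> be \<in> TH ==> bl al ~= bl be ==> Y al be = \<zero>"
 unfolding bsy_def by blast+

lemma bsy_uminus: "bsy Y ==> bsy (\<lambda>al be. \<ominus> Y al be)"
 unfolding bsy_def by auto

lemma bsy_add: "bsy Y ==> bsy Z ==> bsy (\<lambda>al be. Y al be \<oplus> Z al be)"
 unfolding bsy_def by auto

lemma lam_mats [simp]: "u \<in> carrier A ==> lam b u \<in> mats A \<Lambda> \<Lambda>"
 by (rule mats_memI) (auto simp: lam_def)

lemma uni_mats [simp]: "bsy Y ==> uni b Y \<in> mats A \<Lambda> \<Lambda>"
 by (rule mats_memI) (auto simp: uni_def bsyD)

lemma lam_blk [simp]: "u \<in> carrier A ==> blk (lam b u)"
 unfolding blk_def by (intro conjI lam_mats ballI impI) (auto simp: lam_def)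

lemma uni_blk [simp]: "bsy Y ==> blk (uni b Y)"
 unfolding blk_def by (intro conjI uni_mats ballI impI) (auto simp: uni_def bsyD)

lemma lam_entry: "l \<in> \<Lambda> ==> m \<in> \<Lambda> ==> lam b u (l, m) = (if l = m then (if snd l = b then u else \<one>) else \<zero>)"
 unfolding lam_def by simp

lemma uni_entry: "l \<in> \<Lambda> ==> m \<in> \<Lambda> ==> uni b Y (l, m) = (if l = m then \<one> else if snd l = b \<and> snd m = (\<not> b) then Y (fst l) (fst m) else \<zero>)"
 unfolding uni_def by simp

lemma lam_left:
 assumes "h \<in> mats A \<Lambda> \<Lambda>" "u \<in> carrier A" "l \<in> \<Lambda>" "m \<in> \<Lambda>"
 shows "(lam b u \<odot> h) (l, m) = (if snd l = b then u \<otimes> h (l, m) else h (l, m))"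
proof -
 note c = mats_entry[OF assms(1)]
 have "(lam b u \<odot> h) (l, m) = (\<Oplus>p\<in>\<Lambda>. lam b u (l, p) \<otimes> h (p, m))" using assms(3,4) by (simp only: mmul_entry)
 also have "\<dots> = lam b u (l, l) \<otimes> h (l, m)"
  by (rule finsum_single[OF fin\<Lambda>(1) assms(3)]) (use assms c in \<open>simp_all add: lam_entry\<close>)
 finally show ?thesis using assms c[OF assms(3,4)] by (simp add: lam_entry)
qed

lemma lam_right:
 assumes "h \<in> mats A \<Lambda> \<Lambda>" "u \<in> carrier A" "l \<in> \<Lambda>" "m \<in> \<Lambda>"
 shows "(h \<odot> lam b u) (l, m) = (if snd m = b then u \<otimes> h (l, m) else h (l, m))"
proof -
 note c = mats_entry[OF assms(1)]
 have "(h \<odot> lam b u) (l, m) = (\<Oplus>p\<in>\<Lambda>. h (l, p) \<otimes> lam b u (p, m))" using assms(3,4) by (simp only: mmul_entry)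
 also have "\<dots> = h (l, m) \<otimes> lam b u (m, m)"
  by (rule finsum_single[OF fin\<Lambda>(1) assms(4)]) (use assms c in \<open>simp_all add: lam_entry\<close>)
 finally show ?thesis using assms c[OF assms(3,4)] by (simp add: lam_entry m_comm)
qed

lemma finsum_Lam:
 assumes "!!l. l \<in> \<Lambda> ==> g l \<in> carrier A"
 shows "(\<Oplus>l\<in>\<Lambda>. g l) = (\<Oplus>be\<in>TH. g (be, b)) \<oplus> (\<Oplus>be\<in>TH. g (be, \<not> b))"
proof -
 have U: "(UNIV :: bool set) = {b, \<not> b}" by (cases b) auto
 have "(\<Oplus>l\<in>\<Lambda>. g l) = (\<Oplus>be\<in>TH. \<Oplus>c\<in>UNIV. g (be, c))" using finT assms by (intro finsum_Times) auto
 also have "\<dots> = (\<Oplus>be\<in>TH. g (be, b) \<oplus> g (be, \<not> b))"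
  using assms unfolding U by (intro finsum_cong') auto
 also have "\<dots> = (\<Oplus>be\<in>TH. g (be, b)) \<oplus> (\<Oplus>be\<in>TH. g (be, \<not> b))"
  using assms by (intro finsum_addf) auto
 finally show ?thesis .
qed

text \<open>A row operation: only the rows of the half \<open>b\<close> change, by multiples of rows
  of the other half.\<close>

lemma uni_left:
 assumes h: "h \<in> mats A \<Lambda> \<Lambda>" and Y: "bsy Y" and lm: "al \<in> TH" "m \<in> \<Lambda>"
 shows "(uni b Y \<odot> h) ((al, b), m) = h ((al, b), m) \<oplus> (\<Oplus>be\<in>TH. Y al be \<otimes> h ((be, \<not> b), m))"
  and "(uni b Y \<odot> h) ((al, \<not> b), m) = h ((al, \<not> b), m)"
proof -
 note c = mats_entry[OF h]
 have l: "(al, b') \<in> \<Lambda>" for b' using lm by simp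
 have 1: "(uni b Y \<odot> h) ((al, b'), m) = (\<Oplus>be\<in>TH. uni b Y ((al, b'), (be, b)) \<otimes> h ((be, b), m)) \<oplus> (\<Oplus>be\<in>TH. uni b Y ((al, b'), (be, \<not> b)) \<otimes> h ((be, \<not> b), m))" for b'
 proof -
  have "(uni b Y \<odot> h) ((al, b'), m) = (\<Oplus>p\<in>\<Lambda>. uni b Y ((al, b'), p) \<otimes> h (p, m))" using l lm(2) by (simp only: mmul_entry)
  also have "\<dots> = (\<Oplus>be\<in>TH. uni b Y ((al, b'), (be, b)) \<otimes> h ((be, b), m)) \<oplus> (\<Oplus>be\<in>TH. uni b Y ((al, b'), (be, \<not> b)) \<otimes> h ((be, \<not> b), m))"
   by (rule finsum_Lam) (use c lm mats_entry[OF uni_mats[OF Y]] in auto)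
  finally show ?thesis .
 qed
 have "(\<Oplus>be\<in>TH. uni b Y ((al, b), (be, b)) \<otimes> h ((be, b), m)) = uni b Y ((al, b), (al, b)) \<otimes> h ((al, b), m)"
  by (rule finsum_single[OF finT lm(1)]) (use c lm in \<open>simp_all add: uni_entry\<close>)
 moreover have "(\<Oplus>be\<in>TH. uni b Y ((al, b), (be, \<not> b)) \<otimes> h ((be, \<not> b), m)) = (\<Oplus>be\<in>TH. Y al be \<otimes> h ((be, \<not> b), m))"
  by (rule finsum_cong'[OF refl]) (use c lm bsyD(1)[OF Y] in \<open>simp_all add: uni_entry\<close>)
 ultimately show "(uni b Y \<odot> h) ((al, b), m) = h ((al, b), m) \<oplus> (\<Oplus>be\<in>TH. Y al be \<otimes> h ((be, \<not> b), m))"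
  unfolding 1 using c lm by (simp add: uni_entry)
 have "(\<Oplus>be\<in>TH. uni b Y ((al, \<not> b), (be, \<not> b)) \<otimes> h ((be, \<not> b), m)) = uni b Y ((al, \<not> b), (al, \<not> b)) \<otimes> h ((al, \<not> b), m)"
  by (rule finsum_single[OF finT lm(1)]) (use c lm in \<open>simp_all add: uni_entry\<close>)
 moreover have "(\<Oplus>be\<in>TH. uni b Y ((al, \<not> b), (be, b)) \<otimes> h ((be, b), m)) = (\<Oplus>be\<in>TH. \<zero>)"
  by (rule finsum_cong'[OF refl]) (use c lm in \<open>simp_all add: uni_entry\<close>)
 ultimately show "(uni b Y \<odot> h) ((al, \<not> b), m) = h ((al, \<not> b), m)"
  unfolding 1 using c lm by (simp add: uni_entry)
qed

lemma Lam_cases: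
 assumes "l \<in> \<Lambda>"
 obtains al where "al \<in> TH" "l = (al, b)" | al where "al \<in> TH" "l = (al, \<not> b)"
 using assms by (cases l; cases "snd l = b") auto

lemma finsum_delta_right:
 assumes "!!be. be \<in> TH ==> g be \<in> carrier A" "m \<in> \<Lambda>"
 shows "(\<Oplus>be\<in>TH. g be \<otimes> (if (be, b) = m then \<one> else \<zero>)) = (if snd m = b then g (fst m) else \<zero>)"
proof (cases "snd m = b")
 case True
 then have m: "m = (fst m, b)" "fst m \<in> TH" using assms(2) by auto
 have "(\<Oplus>be\<in>TH. g be \<otimes> (if (be, b) = m then \<one> else \<zero>)) = g (fst m) \<otimes> (if (fst m, b) = m then \<one> else \<zero>)"
  by (rule finsum_single[OF finT m(2)]) (use assms m(1) in \<open>auto simp: prod_eq_iff\<close>)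
 then show ?thesis using True m assms by (simp split: if_splits)
next
 case False
 then have "(\<Oplus>be\<in>TH. g be \<otimes> (if (be, b) = m then \<one> else \<zero>)) = (\<Oplus>be\<in>TH. \<zero>)"
  using assms by (intro finsum_cong') auto
 then show ?thesis using False by simp
qed

lemma uni_add:
 assumes "bsy Y" "bsy Z"
 shows "uni b Y \<odot> uni b Z = uni b (\<lambda>al be. Y al be \<oplus> Z al be)"
proof (rule mats_eqI[of _ A \<Lambda> \<Lambda>])
 fix l m assume lm: "l \<in> \<Lambda>" "m \<in> \<Lambda>"
 then show "(uni b Y \<odot> uni b Z) (l, m) = uni b (\<lambda>al be. Y al be \<oplus> Z al be) (l, m)"
 proof (cases l rule: Lam_cases[where b = b])
  case (1 al)
  have "(\<Oplus>be\<in>TH. Y al be \<otimes> uni b Z ((be, \<not> b), m)) = (\<Oplus>be\<in>TH. Y al be \<otimes> (if (be, \<not> b) = m then \<one> else \<zero>))"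
   by (rule finsum_cong'[OF refl]) (use lm 1 bsyD(1)[OF assms(1)] in \<open>auto simp: uni_entry\<close>)
  also have "\<dots> = (if snd m = (\<not> b) then Y al (fst m) else \<zero>)"
   by (rule finsum_delta_right) (use lm 1 bsyD(1)[OF assms(1)] in auto)
  finally show ?thesis
   using lm 1 uni_left(1)[OF uni_mats[OF assms(2)] assms(1) 1(1) lm(2), of b b] bsyD(1)[OF assms(1)] bsyD(1)[OF assms(2)]
   by (cases m) (auto simp: uni_entry a_comm)
 next
  case (2 al)
  then show ?thesis
   using lm uni_left(2)[OF uni_mats[OF assms(2)] assms(1) 2(1) lm(2), of b b] by (auto simp: uni_entry)
 qed
qed (use assms bsy_add in auto)

lemma uni_zero: "uni b (\<lambda>al be. \<zero>) = mone A \<Lambda>"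
 unfolding uni_def mone_def by (rule ext) (auto simp: restrict_def)

lemma uni_inverse:
 assumes "bsy Y"
 shows "uni b Y \<odot> uni b (\<lambda>al be. \<ominus> Y al be) = mone A \<Lambda>" "uni b (\<lambda>al be. \<ominus> Y al be) \<odot> uni b Y = mone A \<Lambda>"
proof -
 have c: "uni b Z = uni b Z'" if "!!al be. al \<in> TH ==> be \<in> TH ==> Z al be = Z' al be" for Z Z'
  unfolding uni_def using that by (intro ext) (auto simp: restrict_def)
 show "uni b Y \<odot> uni b (\<lambda>al be. \<ominus> Y al be) = mone A \<Lambda>" "uni b (\<lambda>al be. \<ominus> Y al be) \<odot> uni b Y = mone A \<Lambda>"
  unfolding uni_add[OF assms bsy_uminus[OF assms]] uni_add[OF bsy_uminus[OF assms] assms] uni_zero[of b, symmetric]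
  by (rule c, use bsyD(1)[OF assms] in \<open>simp add: r_neg l_neg\<close>)+
qed

lemma Om_left:
 assumes "h \<in> mats A \<Lambda> \<Lambda>" "al \<in> TH" "m \<in> \<Lambda>"
 shows "(Om \<odot> h) ((al, b), m) = \<phi> (Omega b (\<not> b)) \<otimes> h ((al, \<not> b), m)"
proof -
 have l: "(al, b) \<in> \<Lambda>" "(al, \<not> b) \<in> \<Lambda>" using assms by auto
 have "(Om \<odot> h) ((al, b), m) = (\<Oplus>p\<in>\<Lambda>. Om ((al, b), p) \<otimes> h (p, m))" using l(1) assms(3) by (simp only: mmul_entry)
 also have "\<dots> = Om ((al, b), (al, \<not> b)) \<otimes> h ((al, \<not> b), m)"
 proof (rule finsum_single[OF fin\<Lambda>(1) l(2)])
  fix p assume "p \<in> \<Lambda>" "p ~= (al, \<not> b)"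
  then show "Om ((al, b), p) \<otimes> h (p, m) = \<zero>"
   using mats_entry[OF assms(1)] assms by (cases p) (auto simp: Om_def Omega_def)
 qed (use mats_entry[OF assms(1)] mats_entry[OF Om_mats] l assms in auto)
 finally show ?thesis using l by (simp add: Om_def)
qed

lemma form_entry:
 assumes h: "h \<in> mats A \<Lambda> \<Lambda>" "l \<in> \<Lambda>" "m \<in> \<Lambda>"
 shows "form h (l, m) = (\<Oplus>be\<in>TH. h ((be, True), l) \<otimes> h ((be, False), m)) \<ominus> (\<Oplus>be\<in>TH. h ((be, False), l) \<otimes> h ((be, True), m))"
proof -
 note c = mats_entry[OF h(1)]
 have "form h (l, m) = (\<Oplus>p\<in>\<Lambda>. h (p, l) \<otimes> (Om \<odot> h) (p, m))"
  unfolding form_def using h by (simp only: mmul_entry) (rule finsum_cong', auto simp: mtr_entry c mats_entry[OF mmul_mats[OF Om_mats]])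
 also have "\<dots> = (\<Oplus>be\<in>TH. h ((be, True), l) \<otimes> (Om \<odot> h) ((be, True), m)) \<oplus> (\<Oplus>be\<in>TH. h ((be, False), l) \<otimes> (Om \<odot> h) ((be, False), m))"
  using finsum_Lam[of "\<lambda>p. h (p, l) \<otimes> (Om \<odot> h) (p, m)" True] c h mats_entry[OF mmul_mats[OF Om_mats h(1)]] by simp
 also have "(\<Oplus>be\<in>TH. h ((be, True), l) \<otimes> (Om \<odot> h) ((be, True), m)) = (\<Oplus>be\<in>TH. h ((be, True), l) \<otimes> h ((be, False), m))"
  by (rule finsum_cong'[OF refl]) (use c h Om_left[OF h(1) _ h(3), of _ True] in \<open>auto simp: Omega_def\<close>)
 also have "(\<Oplus>be\<in>TH. h ((be, False), l) \<otimes> (Om \<odot> h) ((be, False), m)) = (\<Oplus>be\<in>TH. \<ominus> \<one> \<otimes> (h ((be, False), l) \<otimes> h ((be, True), m)))"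
 proof (rule finsum_cong'[OF refl])
  fix be assume b: "be \<in> TH"
  have "\<phi> (-1) = \<ominus> \<one>" using phi_minus[of 1] by simp
  then show "h ((be, False), l) \<otimes> (Om \<odot> h) ((be, False), m) = \<ominus> \<one> \<otimes> (h ((be, False), l) \<otimes> h ((be, True), m))"
   using Om_left[OF h(1) b h(3), of False] b c h by (simp add: Omega_def l_minus r_minus)
 qed (use c h in auto)
 also have "\<dots> = \<ominus> (\<Oplus>be\<in>TH. h ((be, False), l) \<otimes> h ((be, True), m))"
  using finT c h by (subst finsum_rdistr[symmetric]) (auto simp: l_minus intro!: finsum_closed)
 finally show ?thesis by (simp add: minus_eq)
qed

end

context symp_points
begin

text \<open>Exchanging the two halves reverses the sign of the pairing, and \<open>Omega\<close>
  absorbs it. Both kinds of transvections can then be treated at once.\<close>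

lemma form_entry':
 assumes h: "h \<in> mats A \<Lambda> \<Lambda>" "l \<in> \<Lambda>" "m \<in> \<Lambda>"
 shows "form h (l, m) = \<phi> (Omega b (\<not> b)) \<otimes> ((\<Oplus>be\<in>TH. h ((be, b), l) \<otimes> h ((be, \<not> b), m)) \<ominus> (\<Oplus>be\<in>TH. h ((be, \<not> b), l) \<otimes> h ((be, b), m)))"
proof -
 define x y where xy: "x = (\<Oplus>be\<in>TH. h ((be, True), l) \<otimes> h ((be, False), m))" "y = (\<Oplus>be\<in>TH. h ((be, False), l) \<otimes> h ((be, True), m))"
 have c: "x \<in> carrier A" "y \<in> carrier A" unfolding xy using mats_entry[OF h(1)] h(2,3) by (auto intro!: finsum_closed)
 have "x \<ominus> y = \<ominus> (y \<ominus> x)" using c by algebra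
 then show ?thesis
  unfolding form_entry[OF h] using c by (cases b) (simp_all add: Omega_def xy[symmetric] phi_minus l_minus minus_closed)
qed

text \<open>Only the pairing of two columns of the half \<open>\<not> b\<close> could change, and
  there the two contributions cancel by symmetry of \<open>Y\<close>.\<close>

lemma form_uni:
 assumes Y: "bsy Y"
 shows "form (uni b Y) = msc A \<Lambda> \<Lambda> \<one> Om"
proof (rule mats_eqI[of _ A \<Lambda> \<Lambda>])
 fix l m assume lm: "l \<in> \<Lambda>" "m \<in> \<Lambda>"
 note c = bsyD(1)[OF Y]
 have uc: "uni b Y (p, q) \<in> carrier A" if "p \<in> \<Lambda>" "q \<in> \<Lambda>" for p q using mats_entry[OF uni_mats[OF Y] that] .
 have 1: "(\<Oplus>be\<in>TH. uni b Y ((be, b), p) \<otimes> uni b Y ((be, \<not> b), q)) = (if snd q = (\<not> b) then uni b Y ((fst q, b), p) else \<zero>)"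
  if "p \<in> \<Lambda>" "q \<in> \<Lambda>" for p q
 proof -
  have "(\<Oplus>be\<in>TH. uni b Y ((be, b), p) \<otimes> uni b Y ((be, \<not> b), q)) = (\<Oplus>be\<in>TH. uni b Y ((be, b), p) \<otimes> (if (be, \<not> b) = q then \<one> else \<zero>))"
   using that by (intro finsum_cong') (auto simp: uni_entry uc c)
  also have "\<dots> = (if snd q = (\<not> b) then uni b Y ((fst q, b), p) else \<zero>)"
   by (rule finsum_delta_right) (use that uc in auto)
  finally show ?thesis .
 qed
 have 2: "(\<Oplus>be\<in>TH. uni b Y ((be, \<not> b), l) \<otimes> uni b Y ((be, b), m)) = (\<Oplus>be\<in>TH. uni b Y ((be, b), m) \<otimes> uni b Y ((be, \<not> b), l))"
  using lm uc by (intro finsum_cong') (auto simp: m_comm)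
 have e: "form (uni b Y) (l, m) = \<phi> (Omega b (\<not> b)) \<otimes> ((\<Oplus>be\<in>TH. uni b Y ((be, b), l) \<otimes> uni b Y ((be, \<not> b), m)) \<ominus> (\<Oplus>be\<in>TH. uni b Y ((be, \<not> b), l) \<otimes> uni b Y ((be, b), m)))"
  by (rule form_entry'[OF uni_mats[OF Y] lm])
 have "form (uni b Y) (l, m) = \<phi> (Omega b (\<not> b)) \<otimes> ((if snd m = (\<not> b) then uni b Y ((fst m, b), l) else \<zero>) \<ominus> (if snd l = (\<not> b) then uni b Y ((fst l, b), m) else \<zero>))"
  unfolding e 2 unfolding 1[OF lm] 1[OF lm(2,1)] by (rule refl)
 also have "\<dots> = Om (l, m)"
  using lm
 proof (cases l rule: Lam_cases[where b = b])
  case l: (1 al)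
  show ?thesis using lm(2)
  proof (cases m rule: Lam_cases[where b = b])
   case m: (1 \<gamma>)
   show ?thesis using l m by (simp add: Om_def Omega_def minus_eq)
  next
   case m: (2 \<gamma>)
   show ?thesis using l m by (auto simp: Om_def minus_eq uni_entry)
  qed
 next
  case l: (2 al)
  show ?thesis using lm(2)
  proof (cases m rule: Lam_cases[where b = b])
   case m: (1 \<gamma>)
   have "\<phi> (Omega (\<not> b) b) = \<ominus> \<phi> (Omega b (\<not> b))" by (simp add: Omega_def flip: phi_minus)
   then show ?thesis using l m by (auto simp: Om_def minus_eq uni_entry r_minus)
  next
   case m: (2 \<gamma>)
   show ?thesis using l m c bsyD(2)[OF Y l(1) m(1)] by (auto simp: Om_def Omega_def minus_eq uni_entry r_neg)
  qed
 qed
 finally show "form (uni b Y) (l, m) = msc A \<Lambda> \<Lambda> \<one> Om (l, m)"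
  using lm mats_entry[OF Om_mats] by (simp add: msc_entry)
qed (use Y in \<open>auto simp: form_def\<close>)

lemma form_lam:
 assumes u: "u \<in> carrier A"
 shows "form (lam b u) = msc A \<Lambda> \<Lambda> u Om"
proof (rule mats_eqI[of _ A \<Lambda> \<Lambda>])
 fix l m assume lm: "l \<in> \<Lambda>" "m \<in> \<Lambda>"
 have t: "mtr \<Lambda> \<Lambda> (lam b u) = lam b u"
  by (rule mats_eqI[of _ A \<Lambda> \<Lambda>]) (use u in \<open>auto simp: mtr_entry lam_entry\<close>)
 have o: "Om (l, m) \<in> carrier A" using mats_entry[OF Om_mats] lm by blast
 have z: "snd l = snd m ==> Om (l, m) = \<zero>" using lm by (simp add: Om_def Omega_def split_def)
 show "form (lam b u) (l, m) = msc A \<Lambda> \<Lambda> u Om (l, m)"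
  unfolding form_def t lam_left[OF mmul_mats[OF Om_mats lam_mats[OF u]] u lm] lam_right[OF Om_mats u lm]
  using u lm o z by (cases "snd l = b"; cases "snd m = b") (auto simp: msc_entry)
qed (use u in \<open>auto simp: form_def\<close>)

lemma lam_inverse:
 assumes "u \<in> Units A"
 shows "lam b u \<odot> lam b (inv u) = mone A \<Lambda>" "lam b (inv u) \<odot> lam b u = mone A \<Lambda>"
proof -
 have "lam b u \<odot> lam b v = mone A \<Lambda>" if c: "u \<in> carrier A" "v \<in> carrier A" "u \<otimes> v = \<one>" for u v
 proof (rule mats_eqI[of _ A \<Lambda> \<Lambda>])
  fix l m assume lm: "l \<in> \<Lambda>" "m \<in> \<Lambda>"
  show "(lam b u \<odot> lam b v) (l, m) = mone A \<Lambda> (l, m)"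
   unfolding lam_left[OF lam_mats[OF c(2)] c(1) lm] using c lm by (simp add: lam_entry mone_entry)
 qed (use c in auto)
 from this[of u "inv u"] this[of "inv u" u] show "lam b u \<odot> lam b (inv u) = mone A \<Lambda>" "lam b (inv u) \<odot> lam b u = mone A \<Lambda>"
  using assms by auto
qed

lemma uni_group: "bsy Y ==> iota (uni b Y) \<in> carrier (PEL_group D A)"
 using iota_group[OF uni_blk uni_blk, of Y "\<lambda>al be. \<ominus> Y al be" b b \<one>] uni_inverse[of Y b] bsy_uminus form_uni by simp

lemma lam_group: "u \<in> Units A ==> iota (lam b u) \<in> carrier (PEL_group D A)"
 using iota_group[OF lam_blk lam_blk, of u "inv u" b b u] lam_inverse form_lam Units_closed[of u] Units_closed[OF Units_inv_Units, of u] by simp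

text \<open>The torus acts on transvections with weight one. All weight arguments for
  \<open>f\<close> rest on this relation.\<close>

lemma lam_uni:
 assumes u: "u \<in> carrier A" and Y: "bsy Y"
 shows "lam b u \<odot> uni b Y = uni b (\<lambda>al be. u \<otimes> Y al be) \<odot> lam b u"
proof -
 have Y': "bsy (\<lambda>al be. u \<otimes> Y al be)" using Y u unfolding bsy_def by auto
 show ?thesis
 proof (rule mats_eqI[of _ A \<Lambda> \<Lambda>])
  fix l m assume lm: "l \<in> \<Lambda>" "m \<in> \<Lambda>"
  show "(lam b u \<odot> uni b Y) (l, m) = (uni b (\<lambda>al be. u \<otimes> Y al be) \<odot> lam b u) (l, m)"
   unfolding lam_left[OF uni_mats[OF Y] u lm] lam_right[OF uni_mats[OF Y'] u lm]
   using lm u bsyD(1)[OF Y] by (auto simp: uni_entry)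
 qed (use u Y Y' in auto)
qed

end

section \<open>The Weyl element and the image of the Deligne torus\<close>

context symp_points
begin

text \<open>As in SL2, the product of three transvections is antidiagonal, with corners
  \<open>Y\<close> and minus its inverse \<open>Z\<close>. Once its diagonal blocks vanish
  (\<open>same\<close>), it exchanges the two halves and so carries \<open>lam b u\<close> to
  \<open>lam (\<not> b) u\<close>.\<close>

lemma weyl:
 fixes b :: bool
 assumes u: "u \<in> carrier A" and Y: "bsy Y" and Z: "bsy Z"
  and YZ: "!!al \<gamma>. al \<in> TH ==> \<gamma> \<in> TH ==> (\<Oplus>be\<in>TH. Y al be \<otimes> Z be \<gamma>) = (if al = \<gamma> then \<one> else \<zero>)"
  and ZY: "!!al \<gamma>. al \<in> TH ==> \<gamma> \<in> TH ==> (\<Oplus>be\<in>TH. Z al be \<otimes> Y be \<gamma>) = (if al = \<gamma> then \<one> else \<zero>)"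
 defines "w \<equiv> uni b Y \<odot> (uni (\<not> b) (\<lambda>al be. \<ominus> Z al be) \<odot> uni b Y)"
 shows "lam (\<not> b) u \<odot> w = w \<odot> lam b u"
proof -
 let ?Z = "\<lambda>al be. \<ominus> Z al be" and ?h1 = "uni b Y"
 have Z': "bsy ?Z" by (rule bsy_uminus[OF Z])
 note cY = bsyD(1)[OF Y] and cZ = bsyD(1)[OF Z]
 have c1: "?h1 (p, q) \<in> carrier A" if "p \<in> \<Lambda>" "q \<in> \<Lambda>" for p q using mats_entry[OF uni_mats[OF Y] that] .
 define h2 where "h2 = uni (\<not> b) ?Z \<odot> ?h1"
 have h2m: "h2 \<in> mats A \<Lambda> \<Lambda>" unfolding h2_def using Y Z' by simp
 have wm: "w \<in> mats A \<Lambda> \<Lambda>" unfolding w_def using Y Z' by simp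
 have h2: "h2 ((al, \<not> b), m) = ?h1 ((al, \<not> b), m) \<oplus> (\<Oplus>be\<in>TH. ?Z al be \<otimes> ?h1 ((be, b), m))" "h2 ((al, b), m) = ?h1 ((al, b), m)"
  if "al \<in> TH" "m \<in> \<Lambda>" for al m
  using uni_left[OF uni_mats[OF Y] Z' that, of "\<not> b" b] unfolding h2_def by simp_all
 have w: "w ((al, b), m) = h2 ((al, b), m) \<oplus> (\<Oplus>be\<in>TH. Y al be \<otimes> h2 ((be, \<not> b), m))" "w ((al, \<not> b), m) = h2 ((al, \<not> b), m)"
  if "al \<in> TH" "m \<in> \<Lambda>" for al m
  using uni_left[OF h2m Y that] unfolding w_def h2_def by simp_all
 have neg: "(\<Oplus>be\<in>TH. \<ominus> \<one> \<otimes> g be) = \<ominus> (\<Oplus>be\<in>TH. g be)" if "!!be. be \<in> TH ==> g be \<in> carrier A" for g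
  using finT that by (subst finsum_rdistr[symmetric]) (auto simp: l_minus intro!: finsum_closed)
 have same: "w ((al, b), (\<gamma>, b)) = \<zero>" "w ((al, \<not> b), (\<gamma>, \<not> b)) = \<zero>" if ag: "al \<in> TH" "\<gamma> \<in> TH" for al \<gamma>
 proof -
  have g: "(\<gamma>, b) \<in> \<Lambda>" "(\<gamma>, \<not> b) \<in> \<Lambda>" using ag by auto
  have 1: "h2 ((be, \<not> b), (\<gamma>, b)) = \<ominus> Z be \<gamma>" if b: "be \<in> TH" for be
  proof -
   have "(\<Oplus>\<delta>\<in>TH. ?Z be \<delta> \<otimes> ?h1 ((\<delta>, b), (\<gamma>, b))) = (\<Oplus>\<delta>\<in>TH. ?Z be \<delta> \<otimes> (if (\<delta>, b) = (\<gamma>, b) then \<one> else \<zero>))"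
    using ag b cZ by (intro finsum_cong') (auto simp: uni_entry)
   also have "\<dots> = \<ominus> Z be \<gamma>"
    using finsum_delta_right[of "?Z be" "(\<gamma>, b)" b] ag b cZ by simp
   finally show ?thesis using h2(1)[OF b g(1)] ag b cZ by (simp add: uni_entry)
  qed
  have "(\<Oplus>be\<in>TH. Y al be \<otimes> h2 ((be, \<not> b), (\<gamma>, b))) = (\<Oplus>be\<in>TH. \<ominus> \<one> \<otimes> (Y al be \<otimes> Z be \<gamma>))"
   using ag cY cZ by (intro finsum_cong') (auto simp: 1 l_minus r_minus)
  also have "\<dots> = \<ominus> (if al = \<gamma> then \<one> else \<zero>)"
   using YZ[OF ag] neg[of "\<lambda>be. Y al be \<otimes> Z be \<gamma>"] ag cY cZ by simp
  finally show "w ((al, b), (\<gamma>, b)) = \<zero>"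
   using w(1)[OF ag(1) g(1)] h2(2)[OF ag(1) g(1)] ag g by (simp add: uni_entry r_neg)
  have "(\<Oplus>be\<in>TH. ?Z al be \<otimes> ?h1 ((be, b), (\<gamma>, \<not> b))) = (\<Oplus>be\<in>TH. \<ominus> \<one> \<otimes> (Z al be \<otimes> Y be \<gamma>))"
   using ag cY cZ by (intro finsum_cong') (auto simp: uni_entry l_minus)
  also have "\<dots> = \<ominus> (if al = \<gamma> then \<one> else \<zero>)"
   using ZY[OF ag] neg[of "\<lambda>be. Z al be \<otimes> Y be \<gamma>"] ag cY cZ by simp
  finally show "w ((al, \<not> b), (\<gamma>, \<not> b)) = \<zero>"
   using w(2)[OF ag(1) g(2)] h2(1)[OF ag(1) g(2)] ag g by (simp add: uni_entry r_neg)
 qed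
 show ?thesis
 proof (rule mats_eqI[of _ A \<Lambda> \<Lambda>])
  fix l m assume lm: "l \<in> \<Lambda>" "m \<in> \<Lambda>"
  have z: "w (l, m) = \<zero>" if "snd l = snd m"
   using same[of "fst l" "fst m"] that lm by (cases l; cases m; cases "snd l = b") auto
  show "(lam (\<not> b) u \<odot> w) (l, m) = (w \<odot> lam b u) (l, m)"
   unfolding lam_left[OF wm u lm] lam_right[OF wm u lm] using z u by (cases "snd l = b"; cases "snd m = b") auto
 qed (use u wm in auto)
qed

text \<open>The solution of \<open>a + c eps b = u\<close> and \<open>a - c eps b = 1\<close>: the
  point of the Deligne torus on which \<open>h\<close> acts by \<open>u\<close> on the half
  \<open>b\<close> and trivially on the other half.\<close>

abbreviation "ta u \<equiv> \<phi> (1/2) \<otimes> (u \<oplus> \<one>)"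
abbreviation "tc b u \<equiv> \<phi> (1 / (2 * eps b)) \<otimes> (u \<ominus> \<one>)"

lemma torus_entry:
 assumes u: "u \<in> carrier A"
 shows "ta u \<oplus> tc b u \<otimes> \<phi> (eps c) = (if c = b then u else \<one>)"
proof -
 define h where "h = \<phi> (1/2)"
 have h: "h \<in> carrier A" "h \<oplus> h = \<one>" unfolding h_def using phi_add[of "1/2" "1/2"] by simp_all
 have e: "tc b u \<otimes> \<phi> (eps c) = \<phi> (1 / (2 * eps b) * eps c) \<otimes> (u \<ominus> \<one>)"
  unfolding phi_mult using u by (simp add: m_ac minus_closed)
 show ?thesis
 proof (cases "c = b")
  case True
  have "ta u \<oplus> tc b u \<otimes> \<phi> (eps c) = h \<otimes> (u \<oplus> \<one>) \<oplus> h \<otimes> (u \<ominus> \<one>)"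
   unfolding e h_def using True by (simp add: eps_def)
  also have "\<dots> = (h \<oplus> h) \<otimes> u" using h(1) u by algebra
  finally show ?thesis using True h u by simp
 next
  case False
  then have "1 / (2 * eps b) * eps c = - (1/2)" by (auto simp: eps_def)
  then have "ta u \<oplus> tc b u \<otimes> \<phi> (eps c) = h \<otimes> (u \<oplus> \<one>) \<oplus> (\<ominus> h) \<otimes> (u \<ominus> \<one>)"
   unfolding e h_def using phi_minus[of "1/2"] by simp
  also have "\<dots> = (h \<oplus> h) \<otimes> \<one>" using h(1) u by algebra
  finally show ?thesis using False h u by simp
 qed
qed

text \<open>The inverse is the point belonging to \<open>inv u\<close>.\<close>

lemma torus_memb:
 assumes u: "u \<in> Units A"
 shows "(ta u, tc b u) \<in> deligne_torus A"
proof -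
 define h k v where hkv: "h = \<phi> (1/2)" "k = \<phi> (1 / (2 * eps b))" "v = inv u"
 have c: "h \<in> carrier A" "k \<in> carrier A" "u \<in> carrier A" "v \<in> carrier A" using u unfolding hkv by auto
 have uv: "u \<otimes> v = \<one>" using u unfolding hkv by simp
 have kk: "k \<otimes> k = \<ominus> (h \<otimes> h)"
  unfolding hkv by (simp add: eps_def flip: phi_mult phi_minus)
 have h4: "h \<otimes> h \<oplus> h \<otimes> h \<oplus> (h \<otimes> h \<oplus> h \<otimes> h) = \<one>"
  unfolding hkv by (simp flip: phi_mult phi_add)
 define p p' q q' where pq: "p = u \<oplus> \<one>" "p' = v \<oplus> \<one>" "q = u \<ominus> \<one>" "q' = v \<ominus> \<one>"
 have cp: "p \<in> carrier A" "p' \<in> carrier A" "q \<in> carrier A" "q' \<in> carrier A" unfolding pq using c by (auto simp: minus_closed)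
 have "p \<otimes> p' = u \<otimes> v \<oplus> u \<oplus> v \<oplus> \<one>" "q \<otimes> q' = u \<otimes> v \<ominus> u \<ominus> v \<oplus> \<one>"
  "p \<otimes> q' = u \<otimes> v \<ominus> u \<oplus> v \<ominus> \<one>" "q \<otimes> p' = u \<otimes> v \<oplus> u \<ominus> v \<ominus> \<one>"
  unfolding pq using c by algebra+
 note pp = this[unfolded uv]
 have "p \<otimes> p' \<oplus> q \<otimes> q' = (\<one> \<oplus> \<one>) \<oplus> (\<one> \<oplus> \<one>)" "p \<otimes> q' \<oplus> q \<otimes> p' = \<zero>"
  unfolding pp using c by algebra+
 note s = this
 have "h \<otimes> p \<otimes> (h \<otimes> p') \<ominus> k \<otimes> q \<otimes> (k \<otimes> q') = (h \<otimes> h) \<otimes> (p \<otimes> p') \<ominus> (k \<otimes> k) \<otimes> (q \<otimes> q')"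
  using c cp by (simp add: m_ac)
 also have "\<dots> = h \<otimes> h \<otimes> (p \<otimes> p' \<oplus> q \<otimes> q')"
  unfolding kk using c cp by (simp add: minus_eq l_minus r_distr)
 also have "\<dots> = \<one>"
  unfolding s using c h4 by (simp add: r_distr)
 finally have 1: "h \<otimes> (u \<oplus> \<one>) \<otimes> (h \<otimes> (v \<oplus> \<one>)) \<ominus> k \<otimes> (u \<ominus> \<one>) \<otimes> (k \<otimes> (v \<ominus> \<one>)) = \<one>" unfolding pq .
 have "h \<otimes> p \<otimes> (k \<otimes> q') \<oplus> k \<otimes> q \<otimes> (h \<otimes> p') = (h \<otimes> k) \<otimes> (p \<otimes> q' \<oplus> q \<otimes> p')"
  using c cp by (simp add: m_ac r_distr)
 then have 2: "h \<otimes> (u \<oplus> \<one>) \<otimes> (k \<otimes> (v \<ominus> \<one>)) \<oplus> k \<otimes> (u \<ominus> \<one>) \<otimes> (h \<otimes> (v \<oplus> \<one>)) = \<zero>"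
  unfolding s unfolding pq using c by simp
 have m: "h \<otimes> (u \<oplus> \<one>) \<in> carrier A" "k \<otimes> (u \<ominus> \<one>) \<in> carrier A" "h \<otimes> (v \<oplus> \<one>) \<in> carrier A" "k \<otimes> (v \<ominus> \<one>) \<in> carrier A"
  using c by (auto simp: minus_closed)
 show ?thesis
  unfolding deligne_torus_def hkv(1,2)[symmetric] using 1 2 m by blast
qed

definition "hmat a c = madd A I I (msc A I I a (mone A I)) (msc A I I c (mbase I I \<phi> (mbase I I of_real (hh D \<i>))))"

lemma h_point_eq:
 assumes "hh D 1 = mone real_ring I" "a \<in> carrier A" "c \<in> carrier A"
 shows "h_point D A (\<lambda>r. \<phi> (of_real r)) (a, c) = hmat a c"
 using assms unfolding h_point_def hmat_def by (auto simp: fun_eq_iff madd_def msc_def mone_def mbase_def)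

text \<open>In the new basis \<open>h(\<i>)\<close> is the diagonal matrix \<open>epsm\<close>, so
  by \<open>torus_entry\<close> the elements \<open>lam b u\<close> lie in the image of
  \<open>h\<close>, where the behaviour of a morphism of Shimura data is prescribed.\<close>

lemma hmat_lam:
 assumes u: "u \<in> carrier A"
 shows "hmat (ta u) (tc b u) = iota (lam b u)"
 unfolding iota_def
proof (rule bc.cjm_intertwine)
 let ?a = "ta u" and ?c = "tc b u" and ?J = "mbase I I \<phi> (mbase I I of_real (hh D \<i>))"
 have c: "?a \<in> carrier A" "?c \<in> carrier A" using u by (auto simp: minus_closed)
 have J: "?J \<in> mats A I I" by (simp add: cx_mats)
 have E: "mbase \<Xi> \<Xi> \<phi> (epsm \<Xi>) \<in> mats A \<Xi> \<Xi>" by (simp add: form_mats)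
 have QAm: "QA \<in> mats A I \<Xi>" by simp
 show "hmat ?a ?c \<in> mats A I I" unfolding hmat_def using c J by simp
 show "st (lam b u) \<in> mats A \<Xi> \<Xi>" using u by simp
 have JQA: "mmul A I I \<Xi> ?J QA = mmul A I \<Xi> \<Xi> QA (mbase \<Xi> \<Xi> \<phi> (epsm \<Xi>))"
  using cx.mbase_mmul[OF fin\<Lambda>(2) cx_mats Q_mats] cx.mbase_mmul[OF fin\<Xi> Q_mats form_mats(2)] JQ by metis
 have S: "st (lam b u) = madd A \<Xi> \<Xi> (msc A \<Xi> \<Xi> ?a (mone A \<Xi>)) (msc A \<Xi> \<Xi> ?c (mbase \<Xi> \<Xi> \<phi> (epsm \<Xi>)))"
 proof (rule mats_eqI[of _ A \<Xi> \<Xi>])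
  fix \<xi> \<eta> assume x: "\<xi> \<in> \<Xi>" "\<eta> \<in> \<Xi>"
  then show "st (lam b u) (\<xi>, \<eta>) = madd A \<Xi> \<Xi> (msc A \<Xi> \<Xi> ?a (mone A \<Xi>)) (msc A \<Xi> \<Xi> ?c (mbase \<Xi> \<Xi> \<phi> (epsm \<Xi>))) (\<xi>, \<eta>)"
   using torus_entry[OF u, of b "snd (snd \<xi>)"] snd_Xi[OF x(1)] snd_Xi[OF x(2)] c
   by (auto simp: st_entry lam_entry madd_entry msc_entry mone_entry mbase_entry epsm_def prod_eq_iff)
 qed (use u c E in auto)
 show "mmul A I I \<Xi> (hmat ?a ?c) QA = mmul A I \<Xi> \<Xi> QA (st (lam b u))"
  unfolding S hmat_def using c J E QAm
  by (simp add: mmul_add_left mmul_add_right mmul_msc_left mmul_msc_right JQA)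
qed

end

section \<open>Matrices as operators\<close>

text \<open>Linear operators on all functions, so that the matrices over a varying index set live in
  one type of class \<open>real_algebra\<close>, to which \<open>symmetric_rep\<close>
  applies.\<close>

typedef 'v linop = "{F :: ('v => complex) => ('v => complex). (\<forall>x y. F (\<lambda>i. x i + y i) = (\<lambda>i. F x i + F y i)) \<and> (\<forall>c x. F (\<lambda>i. c * x i) = (\<lambda>i. c * F x i))}"
 by (rule exI[of _ "\<lambda>x i. 0"]) auto

lemma Rep_add: "Rep_linop F (\<lambda>i. x i + y i) = (\<lambda>i. Rep_linop F x i + Rep_linop F y i)"
 and Rep_scale: "Rep_linop F (\<lambda>i. c * x i) = (\<lambda>i. c * Rep_linop F x i)"
 using Rep_linop[of F] by auto

instantiation linop :: (type) real_algebra
begin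

definition "0 = Abs_linop (\<lambda>x i. 0)"
definition "F + G = Abs_linop (\<lambda>x i. Rep_linop F x i + Rep_linop G x i)"
definition "F - G = Abs_linop (\<lambda>x i. Rep_linop F x i - Rep_linop G x i)"
definition "- F = Abs_linop (\<lambda>x i. - Rep_linop F x i)"
definition "F * G = Abs_linop (\<lambda>x. Rep_linop F (Rep_linop G x))"
definition "scaleR r F = Abs_linop (\<lambda>x i. of_real r * Rep_linop F x i)"

lemma Rep_ops:
 "Rep_linop 0 x i = 0" "Rep_linop (F + G) x i = Rep_linop F x i + Rep_linop G x i"
 "Rep_linop (F - G) x i = Rep_linop F x i - Rep_linop G x i" "Rep_linop (- F) x i = - Rep_linop F x i"
 "Rep_linop (F * G) x = Rep_linop F (Rep_linop G x)" "Rep_linop (scaleR r F) x i = of_real r * Rep_linop F x i"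
 unfolding zero_linop_def plus_linop_def minus_linop_def uminus_linop_def times_linop_def scaleR_linop_def
 by (subst Abs_linop_inverse; simp add: Rep_add Rep_scale algebra_simps)+

lemma linop_eqI: "(!!x i. Rep_linop F x i = Rep_linop G x i) ==> F = G"
 using Rep_linop_inject by (metis ext)

instance
proof
 fix F G H :: "'a linop" and r :: real
 have e: "Rep_linop F (Rep_linop (G + H) x) = Rep_linop F (\<lambda>i. Rep_linop G x i + Rep_linop H x i)"
  "Rep_linop F (Rep_linop (scaleR r G) x) = Rep_linop F (\<lambda>i. of_real r * Rep_linop G x i)" for x
  by (rule arg_cong[where f="Rep_linop F"], simp add: fun_eq_iff Rep_ops)+
 show "F * (G + H) = F * G + F * H" by (rule linop_eqI) (simp add: Rep_ops e Rep_add)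
 show "F * scaleR r G = scaleR r (F * G)" by (rule linop_eqI) (simp add: Rep_ops e Rep_scale)
qed (rule linop_eqI, simp add: Rep_ops algebra_simps)+

end

lemma Rep_sum: "Rep_linop (\<Sum>a\<in>S. F a) x i = (\<Sum>a\<in>S. Rep_linop (F a) x i)"
 by (induction S rule: infinite_finite_induct) (auto simp: Rep_ops)

lemma Rep_sum_arg: "Rep_linop F (\<lambda>k. \<Sum>a\<in>S. c a * u a k) i = (\<Sum>a\<in>S. c a * Rep_linop F (u a) i)"
proof (induction S arbitrary: i rule: infinite_finite_induct)
 case (insert a S)
 then show ?case
  using fun_cong[OF Rep_add[of F "\<lambda>k. c a * u a k" "\<lambda>k. \<Sum>a\<in>S. c a * u a k"], of i] fun_cong[OF Rep_scale[of F "c a" "u a"], of i]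
  by simp
qed (use fun_cong[OF Rep_scale[of F 0 "\<lambda>k. 0"]] in \<open>simp_all\<close>)

definition cscale :: "complex => 'v linop => 'v linop"
 where "cscale c F = Abs_linop (\<lambda>x i. c * Rep_linop F x i)"

lemma Rep_cscale: "Rep_linop (cscale c F) x i = c * Rep_linop F x i"
 unfolding cscale_def by (subst Abs_linop_inverse) (simp_all add: Rep_add Rep_scale algebra_simps)

lemma cscale_simps:
 "cscale c F * G = cscale c (F * G)" "F * cscale c G = cscale c (F * G)" "cscale c (F + G) = cscale c F + cscale c G"
 "cscale c (F - G) = cscale c F - cscale c G" "cscale c (cscale d F) = cscale (c * d) F" "cscale 1 F = F" "cscale (of_real r) F = scaleR r F"
proof -
 have e: "Rep_linop F (Rep_linop (cscale c G) x) = Rep_linop F (\<lambda>i. c * Rep_linop G x i)" for x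
  by (rule arg_cong[where f="Rep_linop F"], simp add: fun_eq_iff Rep_cscale)
 show "F * cscale c G = cscale c (F * G)"
  by (rule linop_eqI) (simp add: Rep_ops Rep_cscale e Rep_scale)
qed (rule linop_eqI, simp add: Rep_ops Rep_cscale algebra_simps)+

text \<open>Matrices are extended by zero outside the index set. The identity matrix therefore
  becomes an idempotent of the operator algebra, in general not its unit.\<close>

definition emb :: "'v set => ('v \<times> 'v => complex) => 'v linop"
 where "emb I M = Abs_linop (\<lambda>x i. if i \<in> I then \<Sum>j\<in>I. M (i, j) * x j else 0)"

lemma Rep_emb: "Rep_linop (emb I M) x i = (if i \<in> I then \<Sum>j\<in>I. M (i, j) * x j else 0)"
 unfolding emb_def by (subst Abs_linop_inverse) (auto simp: fun_eq_iff algebra_simps sum.distrib sum_distrib_left)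

abbreviation unitv :: "'v => 'v => complex"
 where "unitv a \<equiv> (\<lambda>k. if k = a then 1 else 0)"

lemma emb_entry: "finite I ==> i \<in> I ==> j \<in> I ==> Rep_linop (emb I M) (unitv j) i = M (i, j)"
 by (simp add: Rep_emb if_distrib[of "\<lambda>x. _ * x"] cong: if_cong)

lemma emb_mult: "finite I ==> emb I M * emb I N = emb I (mmul CR I I I M N)"
proof (rule linop_eqI)
 fix x i assume I: "finite I"
 have "(\<Sum>j\<in>I. M (i, j) * (\<Sum>k\<in>I. N (j, k) * x k)) = (\<Sum>k\<in>I. (\<Sum>j\<in>I. M (i, j) * N (j, k)) * x k)"
  unfolding sum_distrib_left sum_distrib_right by (subst sum.swap) (simp add: mult.assoc)
 then show "Rep_linop (emb I M * emb I N) x i = Rep_linop (emb I (mmul CR I I I M N)) x i"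
  using I by (simp add: Rep_ops Rep_emb mmul_entry)
qed

lemma emb_add: "emb I (madd CR I I M N) = emb I M + emb I N"
 by (rule linop_eqI) (simp add: Rep_ops Rep_emb madd_entry sum.distrib distrib_right)

lemma emb_msc: "emb I (msc CR I I c M) = cscale c (emb I M)"
 by (rule linop_eqI) (simp add: Rep_cscale Rep_emb msc_entry sum_distrib_left mult.assoc)

lemma emb_inj: "finite I ==> M \<in> mats CR I I ==> N \<in> mats CR I I ==> emb I M = emb I N ==> M = N"
 by (rule mats_eqI[of _ CR I I]) (metis emb_entry)+

lemma emb_one:
 assumes "finite I" "M \<in> mats CR I I"
 shows "emb I (mone CR I) * emb I M = emb I M" "emb I M * emb I (mone CR I) = emb I M"
proof -
 interpret C: base_ring CR by (rule base_ring_type)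
 show "emb I (mone CR I) * emb I M = emb I M" "emb I M * emb I (mone CR I) = emb I M"
  using assms by (simp_all add: emb_mult)
qed

lemma Rep_emb_left:
 "i \<in> I ==> (\<Sum>j\<in>I. M (i, j) * Rep_linop F x j) = Rep_linop (emb I M * F) x i"
 by (simp add: Rep_ops Rep_emb)

lemma Rep_emb_right:
 assumes "finite I" "i \<in> I"
 shows "(\<Sum>j\<in>I. Rep_linop F (unitv j) a * M (j, i)) = Rep_linop (F * emb I M) (unitv i) a"
proof -
 have "Rep_linop (emb I M) (unitv i) = (\<lambda>k. \<Sum>j\<in>I. M (j, i) * unitv j k)"
 proof
  fix k
  have "(\<Sum>j\<in>I. M (j, i) * unitv j k) = (\<Sum>j\<in>I. if j = k then M (k, i) else 0)" by (rule sum.cong) auto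
  then show "Rep_linop (emb I M) (unitv i) k = (\<Sum>j\<in>I. M (j, i) * unitv j k)"
   using assms emb_entry[OF assms(1) _ assms(2), of k M] by (cases "k \<in> I") (simp_all add: Rep_emb)
 qed
 then show ?thesis by (simp add: Rep_ops Rep_sum_arg mult.commute)
qed

lemma Rep_product:
 assumes "finite I" "emb I (mone CR I) * G = G"
 shows "Rep_linop (F * G) x i = (\<Sum>a\<in>I. Rep_linop F (unitv a) i * Rep_linop G x a)"
proof -
 have "Rep_linop G x = (\<lambda>k. \<Sum>a\<in>I. Rep_linop G x a * unitv a k)"
 proof
  fix k
  have "Rep_linop G x k = Rep_linop (emb I (mone CR I) * G) x k" using assms(2) by simp
  also have "\<dots> = (if k \<in> I then \<Sum>j\<in>I. (if k = j then Rep_linop G x j else 0) else 0)"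
   by (auto simp: Rep_ops Rep_emb mone_entry intro!: sum.cong)
  also have "\<dots> = (\<Sum>a\<in>I. Rep_linop G x a * unitv a k)"
  proof -
   have "(\<Sum>a\<in>I. Rep_linop G x a * unitv a k) = (\<Sum>a\<in>I. if k = a then Rep_linop G x a else 0)" by (rule sum.cong) auto
   then show ?thesis using assms(1) by simp
  qed
  finally show "Rep_linop G x k = (\<Sum>a\<in>I. Rep_linop G x a * unitv a k)" .
 qed
 then have "Rep_linop F (Rep_linop G x) i = Rep_linop F (\<lambda>k. \<Sum>a\<in>I. Rep_linop G x a * unitv a k) i" by simp
 then show ?thesis by (simp add: Rep_ops Rep_sum_arg mult.commute)
qed

section \<open>Generation of the symplectic group of a local ring\<close>

context symp_points
begin

definition "sp h \<longleftrightarrow> blk h \<and> form h = msc A \<Lambda> \<Lambda> \<one> Om"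
definition "coldelta h m \<longleftrightarrow> (\<forall>l\<in>\<Lambda>. h (l, m) = (if l = m then \<one> else \<zero>))"

lemma spD: "sp h ==> blk h" "sp h ==> h \<in> mats A \<Lambda> \<Lambda>" "sp h ==> l \<in> \<Lambda> ==> m \<in> \<Lambda> ==> h (l, m) \<in> carrier A"
 "sp h ==> l \<in> \<Lambda> ==> m \<in> \<Lambda> ==> form h (l, m) = Om (l, m)"
 unfolding sp_def using mats_entry[OF blk_mats, of h l m] mats_entry[OF Om_mats, of l m] by (auto simp: msc_entry)

lemma sp_uni: "sp h ==> bsy Y ==> sp (uni b Y \<odot> h)"
 unfolding sp_def using form_mult[of "uni b Y" h \<one> \<one>] form_uni[of Y b] by (simp add: mmul_blk)

text \<open>With \<open>v\<close> the inverse of the pivot and \<open>s\<close> the product of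
  \<open>y\<close> and \<open>x\<close>, the matrix
  \<open>v (y e_i^t + e_i y^t) - v^2 s e_i e_i^t\<close> is symmetric and maps \<open>x\<close> to
  \<open>y\<close>. The last conclusion, on vanishing columns, is what keeps columns that are
  already reduced intact.\<close>

lemma solve:
 assumes i: "i \<in> TH" "x i \<in> Units A" and x: "!!al. al \<in> TH ==> x al \<in> carrier A"
  and y: "!!al. al \<in> TH ==> y al \<in> carrier A" "!!al. al \<in> TH ==> bl al ~= bl i ==> y al = \<zero>"
 obtains Y where "bsy Y" "!!al. al \<in> TH ==> (\<Oplus>be\<in>TH. Y al be \<otimes> x be) = y al"
  "!!al be. al \<in> TH ==> be \<in> TH ==> be ~= i ==> y be = \<zero> ==> Y al be = \<zero>"
proof -
 define v where "v = inv (x i)"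
 define s where "s = (\<Oplus>be\<in>TH. y be \<otimes> x be)"
 have v: "v \<in> carrier A" "v \<otimes> x i = \<one>" and s: "s \<in> carrier A" and xi: "x i \<in> carrier A"
  unfolding v_def s_def using i x y by (auto intro!: finsum_closed)
 \<comment> \<open>The last summand corrects the entry at the pivot, where the other two
   overlap.\<close>
 define Y where "Y al be = (if be = i then v \<otimes> y al else \<zero>) \<oplus> ((if al = i then v \<otimes> y be else \<zero>) \<oplus> (if al = i \<and> be = i then \<ominus> (v \<otimes> (v \<otimes> s)) else \<zero>))" for al be
 have "bsy Y"
  unfolding bsy_def
 proof (intro ballI conjI impI)
  fix al be assume ab: "al \<in> TH" "be \<in> TH"
  show "Y al be \<in> carrier A" "Y al be = Y be al" unfolding Y_def using ab v s y(1) by (auto simp: a_ac)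
  assume n: "bl al ~= bl be"
  have "be = i ==> y al = \<zero>" "al = i ==> y be = \<zero>" using y(2)[OF ab(1)] y(2)[OF ab(2)] n by auto
  then have "be = i ==> v \<otimes> y al = \<zero>" "al = i ==> v \<otimes> y be = \<zero>"
   using v(1) by simp_all
  moreover have "\<not> (al = i \<and> be = i)" using n by auto
  ultimately show "Y al be = \<zero>" unfolding Y_def by auto
 qed
 moreover have "(\<Oplus>be\<in>TH. Y al be \<otimes> x be) = y al" if a: "al \<in> TH" for al
 proof -
  have "(\<Oplus>be\<in>TH. Y al be \<otimes> x be) = (\<Oplus>be\<in>TH. (if be = i then v \<otimes> y al \<otimes> x i else \<zero>) \<oplus> ((if al = i then v else \<zero>) \<otimes> (y be \<otimes> x be)
    \<oplus> (if be = i then (if al = i then \<ominus> (v \<otimes> (v \<otimes> s)) else \<zero>) \<otimes> x i else \<zero>)))"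
   unfolding Y_def using a v s x y(1) i by (intro finsum_cong') (auto simp: l_distr m_assoc)
  also have "\<dots> = v \<otimes> y al \<otimes> x i \<oplus> ((if al = i then v else \<zero>) \<otimes> s \<oplus> (if al = i then \<ominus> (v \<otimes> (v \<otimes> s)) else \<zero>) \<otimes> x i)"
  proof -
   have "(\<Oplus>be\<in>TH. (if al = i then v else \<zero>) \<otimes> (y be \<otimes> x be)) = (if al = i then v else \<zero>) \<otimes> s"
    unfolding s_def using finT v x y(1) by (subst finsum_rdistr) auto
   then show ?thesis using a v s x y(1) i xi finT by (subst finsum_addf, auto)+ (auto simp: finsum_delta)
  qed
  also have "v \<otimes> y al \<otimes> x i = y al" using v y(1)[OF a] xi by (simp add: m_ac flip: m_assoc)
  also have "(if al = i then v else \<zero>) \<otimes> s \<oplus> (if al = i then \<ominus> (v \<otimes> (v \<otimes> s)) else \<zero>) \<otimes> x i = \<zero>"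
  proof -
   have "v \<otimes> (v \<otimes> s) \<otimes> x i = (v \<otimes> x i) \<otimes> (v \<otimes> s)" using v(1) s xi by (simp add: m_ac)
   then have "v \<otimes> (v \<otimes> s) \<otimes> x i = v \<otimes> s" using v s by simp
   then show ?thesis using v(1) s xi by (simp add: l_minus r_neg)
  qed
  finally show ?thesis using y(1)[OF a] by simp
 qed
 moreover have "Y al be = \<zero>" if "al \<in> TH" "be \<in> TH" "be ~= i" "y be = \<zero>" for al be
  unfolding Y_def using that v by simp
 ultimately show thesis by (rule that)
qed

text \<open>A pivot in the half \<open>\<not> b\<close> of column \<open>m\<close> allows one
  transvection to give the half \<open>b\<close> of this column any prescribed value
  \<open>y\<close>. Reduced columns of the half \<open>b\<close> always survive; those of the half
  \<open>\<not> b\<close> survive if their index is not the pivot and the entry there is not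
  changed.\<close>

lemma step:
 assumes h: "sp h" and m: "m \<in> \<Lambda>" and i: "i \<in> TH" "h ((i, \<not> b), m) \<in> Units A" "bl i = bl (fst m)"
  and y: "!!al. al \<in> TH ==> y al \<in> carrier A" "!!al. al \<in> TH ==> bl al ~= bl i ==> y al = \<zero>"
 obtains Y where "bsy Y" "sp (uni b Y \<odot> h)" "!!al. al \<in> TH ==> (uni b Y \<odot> h) ((al, b), m) = y al"
  "!!al. al \<in> TH ==> (uni b Y \<odot> h) ((al, \<not> b), m) = h ((al, \<not> b), m)"
  "!!\<theta>. \<theta> \<in> TH ==> coldelta h (\<theta>, b) ==> coldelta (uni b Y \<odot> h) (\<theta>, b)"
  "!!\<theta>. \<theta> \<in> TH ==> \<theta> ~= i ==> y \<theta> = h ((\<theta>, b), m) ==> coldelta h (\<theta>, \<not> b) ==> coldelta (uni b Y \<odot> h) (\<theta>, \<not> b)"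
proof -
 have c: "h ((al, b'), p) \<in> carrier A" if "al \<in> TH" "p \<in> \<Lambda>" for al b' p using spD(3)[OF h, of "(al, b')"] that by simp
 let ?y = "\<lambda>al. y al \<ominus> h ((al, b), m)"
 have y': "?y al \<in> carrier A" "bl al ~= bl i ==> ?y al = \<zero>" if a: "al \<in> TH" for al
  using y[OF a] c[OF a m] blk_zero[OF spD(1)[OF h], of "(al, b)" m] a m i(3) by (auto simp: minus_closed minus_eq)
 obtain Y where Y: "bsy Y" "!!al. al \<in> TH ==> (\<Oplus>be\<in>TH. Y al be \<otimes> h ((be, \<not> b), m)) = ?y al"
  "!!al be. al \<in> TH ==> be \<in> TH ==> be ~= i ==> ?y be = \<zero> ==> Y al be = \<zero>"
  using solve[of i "\<lambda>al. h ((al, \<not> b), m)" ?y] i c m y' by blast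
 note u = uni_left[OF spD(2)[OF h] Y(1)]
 have cd: "coldelta (uni b Y \<odot> h) (\<theta>, b')"
  if t: "\<theta> \<in> TH" "coldelta h (\<theta>, b')" and z: "!!al. al \<in> TH ==> b' = (\<not> b) ==> Y al \<theta> = \<zero>" for \<theta> b'
  unfolding coldelta_def
 proof
  fix l assume "l \<in> \<Lambda>"
  then show "(uni b Y \<odot> h) (l, (\<theta>, b')) = (if l = (\<theta>, b') then \<one> else \<zero>)"
  proof (cases l rule: Lam_cases[where b = b])
   case (1 al)
   have "(\<Oplus>be\<in>TH. Y al be \<otimes> h ((be, \<not> b), (\<theta>, b'))) = (\<Oplus>be\<in>TH. \<zero>)"
   proof (rule finsum_cong'[OF refl])
    fix be assume b: "be \<in> TH"
    show "Y al be \<otimes> h ((be, \<not> b), (\<theta>, b')) = \<zero>"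
     using t z[OF 1(1)] b bsyD(1)[OF Y(1) 1(1) b] unfolding coldelta_def by auto
   qed auto
   then show ?thesis using u(1)[OF 1(1), of "(\<theta>, b')" b] t 1 unfolding coldelta_def by auto
  next
   case (2 al)
   then show ?thesis using u(2)[OF 2(1), of "(\<theta>, b')" b] t unfolding coldelta_def by auto
  qed
 qed
 show thesis
 proof (rule that[OF Y(1) sp_uni[OF h Y(1)]])
  fix al assume a: "al \<in> TH"
  have "h ((al, b), m) \<oplus> (y al \<ominus> h ((al, b), m)) = y al" using c[OF a m] y(1)[OF a] by algebra
  then show "(uni b Y \<odot> h) ((al, b), m) = y al" using u(1)[OF a m] Y(2)[OF a] by simp
  show "(uni b Y \<odot> h) ((al, \<not> b), m) = h ((al, \<not> b), m)" using u(2)[OF a m] .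
 next
  fix \<theta> assume t: "\<theta> \<in> TH"
  show "coldelta h (\<theta>, b) ==> coldelta (uni b Y \<odot> h) (\<theta>, b)" by (rule cd[OF t]) auto
  assume a: "\<theta> ~= i" "y \<theta> = h ((\<theta>, b), m)" "coldelta h (\<theta>, \<not> b)"
  have "?y \<theta> = \<zero>" using a(2) c[OF t m] by (simp add: r_neg minus_eq)
  then show "coldelta (uni b Y \<odot> h) (\<theta>, \<not> b)" using Y(3)[OF _ t a(1)] by (intro cd[OF t a(3)]) blast
 qed
qed

text \<open>Pairing the unit column \<open>(\<theta>, b)\<close> with column \<open>m\<close>
  returns one entry of that column, and the preserved form prescribes the value of the
  pairing.\<close>

lemma form_coldelta:
 assumes h: "sp h" and t: "\<theta> \<in> TH" "coldelta h (\<theta>, b)" and m: "m \<in> \<Lambda>"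
 shows "h ((\<theta>, \<not> b), m) = (if m = (\<theta>, \<not> b) then \<one> else \<zero>)"
proof -
 have c: "h ((al, b'), p) \<in> carrier A" if "al \<in> TH" "p \<in> \<Lambda>" for al b' p using spD(3)[OF h, of "(al, b')"] that by simp
 have l: "(\<theta>, b) \<in> \<Lambda>" using t by simp
 have cd: "h ((be, b'), (\<theta>, b)) = (if be = \<theta> \<and> b' = b then \<one> else \<zero>)" if "be \<in> TH" for be b'
  using t(2) that unfolding coldelta_def by auto
 have s: "(\<Oplus>be\<in>TH. h ((be, b), (\<theta>, b)) \<otimes> h ((be, \<not> b), m)) = h ((\<theta>, b), (\<theta>, b)) \<otimes> h ((\<theta>, \<not> b), m)"
  by (rule finsum_single[OF finT t(1)]) (use cd c m l in auto)
 have s': "(\<Oplus>be\<in>TH. h ((be, \<not> b), (\<theta>, b)) \<otimes> h ((be, b), m)) = (\<Oplus>be\<in>TH. \<zero>)"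
  by (rule finsum_cong'[OF refl]) (use cd c m in auto)
 have "Om ((\<theta>, b), m) = \<phi> (Omega b (\<not> b)) \<otimes> (h ((\<theta>, b), (\<theta>, b)) \<otimes> h ((\<theta>, \<not> b), m) \<ominus> (\<Oplus>be\<in>TH. \<zero>))"
  using form_entry'[OF spD(2)[OF h] l m, of b] spD(4)[OF h l m] unfolding s s' by simp
 then have e: "Om ((\<theta>, b), m) = \<phi> (Omega b (\<not> b)) \<otimes> h ((\<theta>, \<not> b), m)"
  using cd[OF t(1)] c[OF t(1) m] by (simp add: minus_eq)
 have "\<phi> (Omega b (\<not> b)) \<otimes> \<phi> (Omega b (\<not> b)) = \<one>" by (simp add: Omega_def flip: phi_mult)
 then have "h ((\<theta>, \<not> b), m) = \<phi> (Omega b (\<not> b)) \<otimes> Om ((\<theta>, b), m)"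
  unfolding e using c[OF t(1) m] by (simp flip: m_assoc)
 also have "\<dots> = (if m = (\<theta>, \<not> b) then \<one> else \<zero>)"
 proof (cases m)
  case (Pair \<gamma> b')
  then show ?thesis using m t(1) by (cases b; cases b') (auto simp: Om_def Omega_def simp flip: phi_mult)
 qed
 finally show ?thesis .
qed

text \<open>Generation as an induction principle: \<open>good\<close> is any property that holds for
  the identity and passes from a row operation applied to \<open>h\<close> back to \<open>h\<close>.
  Reducing \<open>h\<close> to the identity by row operations then proves it. \<open>M\<close> is
  the maximal ideal of the local ring.\<close>

context
 fixes M and good :: "(('t \<times> bool) \<times> ('t \<times> bool) => 'u) => bool"
 assumes M: "ideal M A" "\<one> \<notin> M" "!!x. x \<in> carrier A ==> x \<notin> M ==> x \<in> Units A"
  and good_one: "good (mone A \<Lambda>)" and good_uni: "!!b Y h. bsy Y ==> sp h ==> good (uni b Y \<odot> h) ==> good h"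
begin

abbreviation "fixing T h \<equiv> \<forall>\<theta>\<in>T. \<forall>b. coldelta h (\<theta>, b)"

lemma M_zero: "\<zero> \<in> M" using M(1) by (simp add: additive_subgroup.zero_closed ideal_def)

lemma fixing_row:
 assumes "sp h" "T \<subseteq> TH" "fixing T h" "\<theta> \<in> T" "m \<in> \<Lambda>" "fst m \<notin> T"
 shows "h ((\<theta>, b), m) = \<zero>"
 using form_coldelta[of h \<theta> "\<not> b" m] assms by auto

text \<open>Outside the fixed columns the entries in the fixed rows are zero by
  \<open>fixing_row\<close>. Prescribing zero there leaves them unchanged, so the fixed columns stay
  fixed.\<close>

lemma step':
 assumes h: "sp h" "T \<subseteq> TH" "fixing T h" and m: "m \<in> \<Lambda>" "fst m \<notin> T" and i: "i \<in> TH" "i \<notin> T" "h ((i, \<not> b), m) \<in> Units A" "bl i = bl (fst m)"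
  and y: "!!al. al \<in> TH ==> y al \<in> carrier A" "!!al. al \<in> TH ==> bl al ~= bl i ==> y al = \<zero>" "!!al. al \<in> T ==> y al = \<zero>"
 obtains h2 where "sp h2" "fixing T h2" "good h2 ==> good h" "!!al. al \<in> TH ==> h2 ((al, b), m) = y al"
  "!!al. al \<in> TH ==> h2 ((al, \<not> b), m) = h ((al, \<not> b), m)"
  "!!\<theta>. \<theta> \<in> TH ==> coldelta h (\<theta>, b) ==> coldelta h2 (\<theta>, b)"
  "!!\<theta>. \<theta> \<in> TH ==> \<theta> ~= i ==> y \<theta> = h ((\<theta>, b), m) ==> coldelta h (\<theta>, \<not> b) ==> coldelta h2 (\<theta>, \<not> b)"
proof -
 obtain Y where Y: "bsy Y" "sp (uni b Y \<odot> h)" "!!al. al \<in> TH ==> (uni b Y \<odot> h) ((al, b), m) = y al"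
  "!!al. al \<in> TH ==> (uni b Y \<odot> h) ((al, \<not> b), m) = h ((al, \<not> b), m)"
  "!!\<theta>. \<theta> \<in> TH ==> coldelta h (\<theta>, b) ==> coldelta (uni b Y \<odot> h) (\<theta>, b)"
  "!!\<theta>. \<theta> \<in> TH ==> \<theta> ~= i ==> y \<theta> = h ((\<theta>, b), m) ==> coldelta h (\<theta>, \<not> b) ==> coldelta (uni b Y \<odot> h) (\<theta>, \<not> b)"
  using step[OF h(1) m(1) i(1,3,4), of y] y(1,2) by blast
 have "fixing T (uni b Y \<odot> h)"
 proof (intro ballI allI)
  fix \<theta> b' assume t: "\<theta> \<in> T"
  have "y \<theta> = h ((\<theta>, b), m)" using fixing_row[OF h t m] y(3)[OF t] by simp
  then have "coldelta (uni b Y \<odot> h) (\<theta>, b)" "coldelta (uni b Y \<odot> h) (\<theta>, \<not> b)"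
   using Y(5)[of \<theta>] Y(6)[of \<theta>] t h(2,3) i(2) by auto
  then show "coldelta (uni b Y \<odot> h) (\<theta>, b')" by (cases "b' = b") auto
 qed
 then show thesis using that[OF Y(2)] good_uni[OF Y(1) h(1)] Y(3-6) by blast
qed

text \<open>Both columns of one further symplectic pair are turned into unit vectors. The first
  requires a pivot, which locality supplies; for the second, the form supplies an entry 1, and the
  first column must not be spoiled.\<close>

lemma fix_pair:
 assumes h: "sp h" "T \<subseteq> TH" "fixing T h" and t: "\<theta> \<in> TH" "\<theta> \<notin> T"
 shows "\<exists>h2. sp h2 \<and> fixing (insert \<theta> T) h2 \<and> (good h2 --> good h)"
proof -
 let ?m = "(\<theta>, True)" and ?m' = "(\<theta>, False)" and ?d = "\<lambda>\<eta> al. if al = \<eta> then \<one> else \<zero>"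
 have m: "?m \<in> \<Lambda>" "fst ?m \<notin> T" "?m' \<in> \<Lambda>" "fst ?m' \<notin> T" using t by auto
 have d: "?d \<eta> al \<in> carrier A" for \<eta> al :: 't by simp
 have one: "\<one> \<in> Units A" by simp
 have supp: "al \<notin> T \<and> bl al = bl \<theta>" if "sp h'" "fixing T h'" "al \<in> TH" "h' ((al, b), (\<theta>, b')) ~= \<zero>" for h' al b b'
  using fixing_row[OF that(1) h(2) that(2), of al "(\<theta>, b')" b] blk_zero[OF spD(1)[OF that(1)], of "(al, b)" "(\<theta>, b')"] that t by auto
 \<comment> \<open>If all entries of the column lay in \<open>M\<close>, so would its pairing with
   the partner column, which is 1.\<close>
 have "\<exists>p\<in>\<Lambda>. h (p, ?m) \<notin> M"
 proof (rule ccontr)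
  assume "\<not> (\<exists>p\<in>\<Lambda>. h (p, ?m) \<notin> M)"
  then have all: "h (p, ?m) \<in> M" if "p \<in> \<Lambda>" for p using that by blast
  interpret M: ideal M A by (rule M(1))
  have in1: "h ((be, True), ?m) \<otimes> h ((be, False), ?m') \<in> M" "h ((be, False), ?m) \<otimes> h ((be, True), ?m') \<in> M" if "be \<in> TH" for be
   using all[of "(be, True)"] all[of "(be, False)"] that m spD(3)[OF h(1)] by (auto intro!: M.I_r_closed)
  have sum: "(\<Oplus>be\<in>S. g be) \<in> M" if "finite S" "!!be. be \<in> S ==> g be \<in> M" for S :: "'t set" and g
   using that by (induction S rule: finite_induct) (auto simp: M_zero M.Icarr Pi_iff)
  have "Om (?m, ?m') = (\<Oplus>be\<in>TH. h ((be, True), ?m) \<otimes> h ((be, False), ?m')) \<ominus> (\<Oplus>be\<in>TH. h ((be, False), ?m) \<otimes> h ((be, True), ?m'))"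
   using form_entry[OF spD(2)[OF h(1)] m(1,3)] spD(4)[OF h(1) m(1,3)] by simp
  also have "\<dots> \<in> M" unfolding minus_eq
   by (intro M.a_closed M.a_inv_closed sum finT in1)
  finally show False using M(2) t by (simp add: Om_def Omega_def)
 qed
 then obtain p where p: "p \<in> \<Lambda>" "h (p, ?m) \<notin> M" by blast
 have pc: "h (p, ?m) \<in> carrier A" using spD(3)[OF h(1) p(1) m(1)] .
 have pu: "h (p, ?m) \<in> Units A" using M(3)[OF pc p(2)] .
 have pn: "h (p, ?m) ~= \<zero>" using p(2) M_zero by metis
 \<comment> \<open>A pivot is wanted in the half \<open>False\<close>. If it is in the half
   \<open>True\<close>, one operation places a 1 at \<open>(\<theta>, False)\<close>.\<close>
 obtain h1 i where h1: "sp h1" "fixing T h1" "good h1 ==> good h" and i: "i \<in> TH" "i \<notin> T" "h1 ((i, False), ?m) \<in> Units A" "bl i = bl \<theta>"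
 proof (cases "snd p")
  case False
  then have e: "p = (fst p, False)" "fst p \<in> TH" using p(1) by (auto simp: prod_eq_iff)
  show ?thesis using that[OF h(1,3), of "fst p"] supp[OF h(1,3) e(2), of False True] e pu pn by metis
 next
  case True
  then have e: "p = (fst p, True)" "fst p \<in> TH" using p(1) by (auto simp: prod_eq_iff)
  have s: "fst p \<notin> T" "bl (fst p) = bl \<theta>" using supp[OF h(1,3) e(2), of True True] e pn by metis+
  have pu': "h ((fst p, \<not> False), ?m) \<in> Units A" using e(1) pu by simp
  have bp: "bl (fst p) = bl (fst ?m)" using s by simp
  show ?thesis
  proof (rule step'[OF h m(1,2) e(2) s(1) pu' bp, of "?d \<theta>"])
   fix h2 assume a: "sp h2" "fixing T h2" "good h2 ==> good h" "!!al. al \<in> TH ==> h2 ((al, False), ?m) = ?d \<theta> al"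
   have "h2 ((\<theta>, False), ?m) \<in> Units A" using a(4)[OF t(1)] one by simp
   then show thesis using that[OF a(1,2) _ t] a(3) by blast
  qed (use s t in auto)
 qed
 have i': "h1 ((i, \<not> True), ?m) \<in> Units A" "bl i = bl (fst ?m)" using i by simp_all
 \<comment> \<open>The half \<open>True\<close> of the first column is set to the unit vector at
   \<open>\<theta>\<close>, which gives a pivot 1 at \<open>(\<theta>, True)\<close>.\<close>
 obtain h2 where h2: "sp h2" "fixing T h2" "good h2 ==> good h1" "!!al. al \<in> TH ==> h2 ((al, True), ?m) = ?d \<theta> al"
 proof (rule step'[OF h1(1) h(2) h1(2) m(1,2) i(1,2) i', of "?d \<theta>"])
  fix h2 assume a: "sp h2" "fixing T h2" "good h2 ==> good h1" "!!al. al \<in> TH ==> h2 ((al, True), ?m) = ?d \<theta> al"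
  show thesis by (rule that[OF a(1,2)]) (use a(3,4) in auto)
 qed (use t i in auto)
 have u2: "h2 ((\<theta>, \<not> False), ?m) \<in> Units A" "bl \<theta> = bl (fst ?m)" using h2(4)[OF t(1)] one by simp_all
 \<comment> \<open>That pivot clears the half \<open>False\<close>, and the first column is
   reduced.\<close>
 obtain h3 where h3: "sp h3" "fixing T h3" "good h3 ==> good h2" "!!al. al \<in> TH ==> h3 ((al, False), ?m) = \<zero>" "!!al. al \<in> TH ==> h3 ((al, True), ?m) = ?d \<theta> al"
 proof (rule step'[OF h2(1) h(2) h2(2) m(1,2) t u2, of "\<lambda>al. \<zero>"])
  fix h3 assume a: "sp h3" "fixing T h3" "good h3 ==> good h2" "!!al. al \<in> TH ==> h3 ((al, False), ?m) = \<zero>"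
   "!!al. al \<in> TH ==> h3 ((al, \<not> False), ?m) = h2 ((al, \<not> False), ?m)"
  show thesis by (rule that[OF a(1,2)]) (use a(3-5) h2(4) in auto)
 qed auto
 have c3: "coldelta h3 ?m" unfolding coldelta_def
 proof
  fix l assume "l \<in> \<Lambda>"
  then show "h3 (l, ?m) = (if l = ?m then \<one> else \<zero>)" using h3(4,5) by (cases l; cases "snd l") auto
 qed
 have f3: "h3 ((\<theta>, False), ?m') = \<one>" using form_coldelta[OF h3(1) t(1) c3 m(3)] by simp
 \<comment> \<open>Operating on the half \<open>False\<close> with pivot \<open>\<theta>\<close>
   would spoil the first column. If an entry at some \<open>\<eta>\<close> is wrong, it is nonzero
   and \<open>\<eta>\<close> differs from \<open>\<theta>\<close>; a 1 is first put at
   \<open>(\<eta>, True)\<close> using the entry 1 at \<open>(\<theta>, False)\<close>, and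
   \<open>\<eta>\<close> then serves as pivot. The entry at \<open>\<theta>\<close> keeps its value
   1, as preservation of the first column demands.\<close>
 obtain h4 where h4: "sp h4" "fixing T h4" "good h4 ==> good h3" "!!al. al \<in> TH ==> h4 ((al, False), ?m') = ?d \<theta> al" "coldelta h4 ?m"
 proof (cases "\<forall>al\<in>TH. h3 ((al, False), ?m') = ?d \<theta> al")
  case True
  then show ?thesis using that[of h3] h3 c3 by blast
 next
  case False
  then obtain \<eta> where e: "\<eta> \<in> TH" "h3 ((\<eta>, False), ?m') ~= ?d \<theta> \<eta>" by blast
  have et1: "\<eta> ~= \<theta>" using e(2) f3 by auto
  have et: "\<eta> ~= \<theta>" "h3 ((\<eta>, False), ?m') ~= \<zero>" using e(2) et1 by auto
  have es: "\<eta> \<notin> T" "bl \<eta> = bl \<theta>" using supp[OF h3(1,2) e(1) et(2)] by auto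
  have u3: "h3 ((\<theta>, \<not> True), ?m') \<in> Units A" "bl \<theta> = bl (fst ?m')" using f3 one by simp_all
  obtain h3a where h3a: "sp h3a" "fixing T h3a" "good h3a ==> good h3" "!!al. al \<in> TH ==> h3a ((al, True), ?m') = ?d \<eta> al"
   "h3a ((\<theta>, False), ?m') = \<one>" "coldelta h3a ?m"
  proof (rule step'[OF h3(1) h(2) h3(2) m(3,4) t u3, of "?d \<eta>"])
   fix h2 assume a: "sp h2" "fixing T h2" "good h2 ==> good h3" "!!al. al \<in> TH ==> h2 ((al, True), ?m') = ?d \<eta> al"
    "!!al. al \<in> TH ==> h2 ((al, \<not> True), ?m') = h3 ((al, \<not> True), ?m')"
    "!!\<theta>. \<theta> \<in> TH ==> coldelta h3 (\<theta>, True) ==> coldelta h2 (\<theta>, True)"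
   show thesis by (rule that[OF a(1,2)]) (use a(3-6) t f3 c3 in auto)
  qed (use es e in auto)
  have u3a: "h3a ((\<eta>, \<not> False), ?m') \<in> Units A" "bl \<eta> = bl (fst ?m')" using h3a(4)[OF e(1)] one es by simp_all
  show ?thesis
  proof (rule step'[OF h3a(1) h(2) h3a(2) m(3,4) e(1) es(1) u3a, of "?d \<theta>"])
   fix h2 assume a: "sp h2" "fixing T h2" "good h2 ==> good h3a" "!!al. al \<in> TH ==> h2 ((al, False), ?m') = ?d \<theta> al"
    "!!\<theta>'. \<theta>' \<in> TH ==> \<theta>' ~= \<eta> ==> ?d \<theta> \<theta>' = h3a ((\<theta>', False), ?m') ==> coldelta h3a (\<theta>', \<not> False) ==> coldelta h2 (\<theta>', \<not> False)"
   have "coldelta h2 ?m" using a(5)[OF t(1)] et h3a(5,6) by simp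
   then show thesis using that[OF a(1,2)] a(3,4) h3a(3) by blast
  qed (use es t in auto)
 qed
 have u4: "h4 ((\<theta>, \<not> True), ?m') \<in> Units A" "bl \<theta> = bl (fst ?m')" using h4(4)[OF t(1)] one by simp_all
 \<comment> \<open>Clearing the half \<open>True\<close> of the second column leaves the first one
   unchanged, because that column belongs to the half being altered.\<close>
 obtain h5 where h5: "sp h5" "fixing T h5" "good h5 ==> good h4" "coldelta h5 ?m'" "coldelta h5 ?m"
 proof (rule step'[OF h4(1) h(2) h4(2) m(3,4) t u4, of "\<lambda>al. \<zero>"])
  fix h2 assume a: "sp h2" "fixing T h2" "good h2 ==> good h4" "!!al. al \<in> TH ==> h2 ((al, True), ?m') = \<zero>"
   "!!al. al \<in> TH ==> h2 ((al, \<not> True), ?m') = h4 ((al, \<not> True), ?m')"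
   "!!\<theta>. \<theta> \<in> TH ==> coldelta h4 (\<theta>, True) ==> coldelta h2 (\<theta>, True)"
  have "coldelta h2 ?m'" unfolding coldelta_def
  proof
   fix l assume "l \<in> \<Lambda>"
   then show "h2 (l, ?m') = (if l = ?m' then \<one> else \<zero>)"
    using a(4,5) h4(4) by (cases l; cases "snd l") auto
  qed
  then show thesis using that[OF a(1-3)] a(6)[OF t(1) h4(5)] by blast
 qed auto
 have "fixing (insert \<theta> T) h5"
 proof (intro ballI allI)
  fix \<theta>' b assume "\<theta>' \<in> insert \<theta> T"
  then show "coldelta h5 (\<theta>', b)" using h5(2,4,5) by (cases b) auto
 qed
 then show ?thesis using h5(1,3) h4(3) h3(3) h2(3) h1(3) by blast
qed

text \<open>Induction on the number of indices whose pair of columns is not yet reduced; when none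
  is left, the matrix is the identity.\<close>

lemma symplectic_generation:
 assumes "sp h"
 shows "good h"
proof -
 have "good h" if "T \<subseteq> TH" "sp h" "fixing T h" for T h
  using that
 proof (induction "card (TH - T)" arbitrary: T h rule: less_induct)
  case less
  show ?case
  proof (cases "T = TH")
   case True
   have "h = mone A \<Lambda>"
   proof (rule mats_eqI[of _ A \<Lambda> \<Lambda>])
    fix l m assume lm: "l \<in> \<Lambda>" "m \<in> \<Lambda>"
    have "coldelta h m" using less.prems(3) True lm(2) by (cases m) auto
    then have "h (l, m) = (if l = m then \<one> else \<zero>)" using lm(1) unfolding coldelta_def by blast
    then show "h (l, m) = mone A \<Lambda> (l, m)" using lm by (simp only: mone_entry)
   qed (use spD(2)[OF less.prems(2)] in auto)
   then show ?thesis using good_one by simp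
  next
   case False
   then obtain \<theta> where t: "\<theta> \<in> TH" "\<theta> \<notin> T" using less.prems by blast
   obtain h2 where h2: "sp h2" "fixing (insert \<theta> T) h2" "good h2 --> good h"
    using fix_pair[OF less.prems(2,1,3) t] by blast
   have "card (TH - insert \<theta> T) < card (TH - T)" using t finT by (intro psubset_card_mono) auto
   then show ?thesis using less.hyps[of "insert \<theta> T" h2] h2 t less.prems(1) by blast
  qed
 qed
 from this[of "{}"] show ?thesis using assms by blast
qed

end

end

section \<open>Homomorphisms on symplectic transvections\<close>

lemma Units_hom:
 assumes "base_ring_hom R S \<psi>" "\<mu> \<in> Units R"
 shows "\<psi> \<mu> \<in> Units S"
proof -
 interpret base_ring_hom R S \<psi> by (rule assms(1))
 have "\<psi> \<mu> \<otimes>\<^bsub>S\<^esub> \<psi> (inv\<^bsub>R\<^esub> \<mu>) = \<one>\<^bsub>S\<^esub>" "\<psi> (inv\<^bsub>R\<^esub> \<mu>) \<otimes>\<^bsub>S\<^esub> \<psi> \<mu> = \<one>\<^bsub>S\<^esub>"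
  using assms(2) hom_mult[of \<mu> "inv\<^bsub>R\<^esub> \<mu>"] hom_mult[of "inv\<^bsub>R\<^esub> \<mu>" \<mu>] by auto
 then show ?thesis unfolding Units_def using assms(2) by auto
qed

lemma mbase_group:
 fixes D :: "('b::ring, 'v::ab_group_add) pel"
 assumes R: "rat_algebra R" "rat_algebra S" "\<psi> \<in> Ring.ring_hom R S" and fin: "finite (basisV D)" "finite (basisB D)"
  and g: "g \<in> carrier (PEL_group D R)"
 shows "mbase (basisV D) (basisV D) \<psi> g \<in> carrier (PEL_group D S)"
proof -
 let ?I = "basisV D"
 interpret R: pel_alg R D using R(1) fin by (simp add: pel_alg_def pel_alg_axioms_def rat_alg_iff)
 interpret S: pel_alg S D using R(2) fin by (simp add: pel_alg_def pel_alg_axioms_def rat_alg_iff)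
 interpret h: base_ring_hom R S \<psi> using R(3) R.is_cring S.is_cring by (intro base_ring_homI)
 have e: "S.ext M = mbase ?I ?I \<psi> (R.ext M)" if "M \<in> mats rat_ring ?I ?I" for M
  unfolding mbase_mbase by (rule mbase_cong[OF that]) (use rat_algebra_hom(2)[OF R(1) S.is_cring R(3)] in simp)
 obtain g' \<mu> where w: "g \<in> mats R ?I ?I" "\<forall>k\<in>basisB D. mmul R ?I ?I ?I g (R.ext (bmat D k)) = mmul R ?I ?I ?I (R.ext (bmat D k)) g"
  "g' \<in> mats R ?I ?I" "mmul R ?I ?I ?I g g' = mone R ?I" "mmul R ?I ?I ?I g' g = mone R ?I" "\<mu> \<in> Units R" "R.similitude \<mu> g"
  using g unfolding R.PEL_group_iff by blast
 note m = h.mbase_mmul[OF fin(1)]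
 have G: "R.ext (gram D) \<in> mats R ?I ?I" by simp
 have sim: "S.similitude (\<psi> \<mu>) (mbase ?I ?I \<psi> g)"
  using arg_cong[OF w(7)[unfolded R.similitude_def], of "mbase ?I ?I \<psi>"] w(1) w(6) G
  unfolding S.similitude_def e[OF gram_mats] by (simp add: m mbase_mtr h.mbase_msc R.Units_closed)
 show ?thesis
  unfolding S.PEL_group_iff
 proof (intro conjI ballI)
  fix k assume k: "k \<in> basisB D"
  have b: "R.ext (bmat D k) \<in> mats R ?I ?I" by simp
  show "mmul S ?I ?I ?I (mbase ?I ?I \<psi> g) (S.ext (bmat D k)) = mmul S ?I ?I ?I (S.ext (bmat D k)) (mbase ?I ?I \<psi> g)"
   unfolding e[OF bmat_mats] using arg_cong[OF bspec[OF w(2) k], of "mbase ?I ?I \<psi>"] w(1) b by (simp add: m)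
 next
  show "\<exists>g'\<in>mats S ?I ?I. mmul S ?I ?I ?I (mbase ?I ?I \<psi> g) g' = mone S ?I \<and> mmul S ?I ?I ?I g' (mbase ?I ?I \<psi> g) = mone S ?I"
   using w(1,3-5) by (intro bexI[of _ "mbase ?I ?I \<psi> g'"]) (auto simp: m[symmetric] h.mbase_mone)
 next
  show "\<exists>\<mu>\<in>Units S. S.similitude \<mu> (mbase ?I ?I \<psi> g)"
   using sim Units_hom[OF h.base_ring_hom_axioms w(6)] by blast
 qed (use w in simp)
qed

locale points_hom = Z: symp_points D TH bl n cf Q P Z \<phi>Z + A: symp_points D TH bl n cf Q P A \<phi>A
 for D :: "('b::ring, 'v::ab_group_add) pel" and TH :: "'t set" and bl n cf Q P and Z :: "'u ring" and \<phi>Z and A :: "'w ring" and \<phi>A +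
 fixes \<psi> assumes psi: "\<psi> \<in> Ring.ring_hom Z A" "!!c. \<psi> (\<phi>Z c) = \<phi>A c"
begin

sublocale h: base_ring_hom Z A \<psi>
 using psi(1) Z.is_cring A.is_cring by (intro base_ring_homI)

lemma iota_base:
 assumes h: "h \<in> mats Z Z.\<Lambda> Z.\<Lambda>"
 shows "mbase Z.I Z.I \<psi> (Z.iota h) = A.iota (mbase Z.\<Lambda> Z.\<Lambda> \<psi> h)"
proof -
 have QA: "mbase Z.I Z.\<Xi> \<psi> Z.QA = A.QA" "mbase Z.\<Xi> Z.I \<psi> Z.PA = A.PA"
  unfolding mbase_mbase by (simp_all add: comp_def psi(2))
 have st: "mbase Z.\<Xi> Z.\<Xi> \<psi> (Z.st h) = A.st (mbase Z.\<Lambda> Z.\<Lambda> \<psi> h)"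
 proof (rule mats_eqI[of _ A Z.\<Xi> Z.\<Xi>])
  fix \<xi> \<eta> assume x: "\<xi> \<in> Z.\<Xi>" "\<eta> \<in> Z.\<Xi>"
  then show "mbase Z.\<Xi> Z.\<Xi> \<psi> (Z.st h) (\<xi>, \<eta>) = A.st (mbase Z.\<Lambda> Z.\<Lambda> \<psi> h) (\<xi>, \<eta>)"
   using Z.snd_Xi[OF x(1)] Z.snd_Xi[OF x(2)] by (simp add: mbase_entry Z.st_entry A.st_entry)
 qed (use h in simp_all)
 have m: "Z.QA \<in> mats Z Z.I Z.\<Xi>" "Z.PA \<in> mats Z Z.\<Xi> Z.I" "Z.st h \<in> mats Z Z.\<Xi> Z.\<Xi>" using h by simp_all
 have "mbase Z.I Z.I \<psi> (Z.iota h) = mmul A Z.I Z.\<Xi> Z.I (mbase Z.I Z.\<Xi> \<psi> Z.QA) (mmul A Z.\<Xi> Z.\<Xi> Z.I (mbase Z.\<Xi> Z.\<Xi> \<psi> (Z.st h)) (mbase Z.\<Xi> Z.I \<psi> Z.PA))"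
  unfolding Z.iota_def Z.bc.cjm_def using m by (simp add: h.mbase_mmul)
 then show ?thesis unfolding QA st A.iota_def A.bc.cjm_def .
qed

lemma uni_base: "mbase Z.\<Lambda> Z.\<Lambda> \<psi> (Z.uni b Y) = A.uni b (\<lambda>al be. \<psi> (Y al be))"
 by (auto simp: mbase_def Z.uni_def A.uni_def fun_eq_iff)

end

text \<open>Conjugation by \<open>2 P + P'\<close> acts on the four corners of \<open>e\<close> by
  1, 2, 1/2 and 1. A weight 2 leaves only the corner from \<open>P'\<close> to \<open>P\<close>, and
  a larger weight leaves nothing.\<close>

lemma weight:
 fixes e :: "'e::real_algebra"
 assumes P: "P * P = P" "P' * P' = P'" "P * P' = 0" "P' * P = 0" "(P + P') * e = e" "e * (P + P') = e"
  and c: "(2 *\<^sub>R P + P') * e = c *\<^sub>R (e * (2 *\<^sub>R P + P'))"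
 shows "c = 2 ==> P * e = e \<and> e * P' = e" "c > 2 ==> e = 0"
proof -
 have "P * ((2 *\<^sub>R P + P') * e) = 2 *\<^sub>R (P * e)" "P' * ((2 *\<^sub>R P + P') * e) = P' * e"
  using P by (simp_all add: distrib_left distrib_right flip: mult.assoc)
 then have 1: "2 *\<^sub>R (P * e) = c *\<^sub>R (2 *\<^sub>R (P * e * P) + P * e * P')" "P' * e = c *\<^sub>R (2 *\<^sub>R (P' * e * P) + P' * e * P')"
  unfolding c by (simp_all add: distrib_left mult.assoc)
 have pe: "P * e = P * e * P + P * e * P'" "P' * e = P' * e * P + P' * e * P'"
  using P(6) by (simp_all add: mult.assoc flip: distrib_left)
 have r: "x * P * P = x * P" "x * P * P' = 0" "x * P' * P = 0" "x * P' * P' = x * P'" for x using P by (simp_all add: mult.assoc)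
 define a b a' b' where ab: "a = P * e * P" "b = P * e * P'" "a' = P' * e * P" "b' = P' * e * P'"
 have "2 *\<^sub>R (P * e) * P = (c *\<^sub>R (2 *\<^sub>R (P * e * P) + P * e * P')) * P" "2 *\<^sub>R (P * e) * P' = (c *\<^sub>R (2 *\<^sub>R (P * e * P) + P * e * P')) * P'"
  "P' * e * P = (c *\<^sub>R (2 *\<^sub>R (P' * e * P) + P' * e * P')) * P" "P' * e * P' = (c *\<^sub>R (2 *\<^sub>R (P' * e * P) + P' * e * P')) * P'"
  by (simp_all only: 1(1) flip: 1(2))
 then have "2 *\<^sub>R a = (2 * c) *\<^sub>R a" "2 *\<^sub>R b = c *\<^sub>R b" "1 *\<^sub>R a' = (2 * c) *\<^sub>R a'" "1 *\<^sub>R b' = c *\<^sub>R b'"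
  unfolding ab by (simp_all add: distrib_right r mult.commute)
 then have z: "(2 - 2 * c) *\<^sub>R a = 0" "(2 - c) *\<^sub>R b = 0" "(1 - 2 * c) *\<^sub>R a' = 0" "(1 - c) *\<^sub>R b' = 0"
  by (simp_all only: scaleR_left_diff_distrib right_minus_eq)
 have es: "e = a + b + (a' + b')" using P(5) pe unfolding ab by (simp add: distrib_right)
 show "e = 0" if "c > 2" using z that es by simp
 show "P * e = e \<and> e * P' = e" if "c = 2"
 proof -
  have "e = b" using z that es by simp
  then show ?thesis unfolding ab using P(1,2) by (metis mult.assoc)
 qed
qed

text \<open>The corner of the product at \<open>P\<close> is \<open>P - x * z\<close>. The relation
  with the torus says that this corner equals its double, so it vanishes.\<close>

lemma weyl_relation:
 fixes x z :: "'e::real_algebra"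
 assumes P: "P * P = P" "P' * P' = P'" "P * P' = 0" "P' * P = 0"
  and x: "P * x = x" "x * P' = x" and z: "P' * z = z" "z * P = z"
  and w: "(2 *\<^sub>R P' + P) * ((P + P' + x) * ((P + P' - z) * (P + P' + x))) = (P + P' + x) * ((P + P' - z) * (P + P' + x)) * (2 *\<^sub>R P + P')"
 shows "x * z = P"
proof -
 have r: "x * P = 0" "P' * x = 0" "z * P' = 0" "P * z = 0" "x * x = 0"
  using P x z by (metis mult.assoc mult_zero_right mult_zero_left)+
 have t: "P * (P * u) = P * u" "P' * (P' * u) = P' * u" "P * (P' * u) = 0" "P' * (P * u) = 0" "P * (x * u) = x * u" "x * (P' * u) = x * u"
  "P' * (z * u) = z * u" "z * (P * u) = z * u" "x * (P * u) = 0" "P' * (x * u) = 0" "z * (P' * u) = 0" "P * (z * u) = 0" "x * (x * u) = 0" for u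
  using P x z r by (simp_all flip: mult.assoc)
 define W where "W = (P + P' + x) * ((P + P' - z) * (P + P' + x))"
 have "P * (W * P) = P - x * z"
  unfolding W_def by (simp add: distrib_left distrib_right left_diff_distrib right_diff_distrib mult.assoc P x z r t)
 moreover have "P * ((2 *\<^sub>R P' + P) * W) * P = P * (W * (2 *\<^sub>R P + P')) * P" using w unfolding W_def by simp
 then have "P * (W * P) = 2 *\<^sub>R (P * (W * P))"
  by (simp add: distrib_left distrib_right mult.assoc P t)
 then have "P * (W * P) = 0" by (simp add: scaleR_2)
 ultimately show ?thesis by simp
qed

text \<open>A fixed copy of \<open>\<complex>[s]\<close> among the test rings, with mutually inverse
  isomorphisms \<open>pin\<close> and \<open>pout\<close>.\<close>

definition polyring_data :: "complex ring \<times> (complex poly => complex) \<times> (complex => complex poly)"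
 where "polyring_data = (SOME (A, al, be). cring A \<and> al \<in> Ring.ring_hom poly_ring A \<and> be \<in> Ring.ring_hom A poly_ring \<and>
  (\<forall>x. be (al x) = x) \<and> (\<forall>x\<in>carrier A. al (be x) = x))"

definition "pol = fst polyring_data"
definition "pin = fst (snd polyring_data)"
definition "pout = snd (snd polyring_data)"

lemma pol: "cring pol" "pin \<in> Ring.ring_hom poly_ring pol" "pout \<in> Ring.ring_hom pol poly_ring" "pout (pin p) = p"
proof -
 let ?S = "\<lambda>(A :: complex ring, al, be). cring A \<and> al \<in> Ring.ring_hom poly_ring A \<and> be \<in> Ring.ring_hom A poly_ring \<and>
  (\<forall>x. be (al x) = x) \<and> (\<forall>x\<in>carrier A. al (be x) = x)"
 have "\<exists>t. ?S t"
 proof (rule small_ring_iso[OF cring_from_type_algebra small_poly])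
  fix A :: "complex ring" and al be
  assume "cring A" "al \<in> Ring.ring_hom poly_ring A" "be \<in> Ring.ring_hom A poly_ring"
   "!!x. x \<in> carrier poly_ring ==> be (al x) = x" "!!x. x \<in> carrier A ==> al (be x) = x"
  then have "?S (A, al, be)" by simp
  then show ?thesis by (rule exI[of ?S "(A, al, be)"])
 qed
 then have *: "?S polyring_data" unfolding polyring_data_def by (rule someI_ex)
 obtain A al be where e: "polyring_data = (A, al, be)" by (rule prod_cases3)
 show "cring pol" "pin \<in> Ring.ring_hom poly_ring pol" "pout \<in> Ring.ring_hom pol poly_ring" "pout (pin p) = p"
  using * unfolding e pol_def pin_def pout_def split_conv fst_conv snd_conv by blast+
qed

lemma type_uminus [simp]: "a_inv (ring_of_type_algebra :: 'a::comm_ring_1 ring) x = - x"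
proof -
 interpret base_ring "ring_of_type_algebra :: 'a ring" by (rule base_ring_type)
 show ?thesis using minus_equality[of "- x" x] by simp
qed

lemma type_minus [simp]: "a_minus (ring_of_type_algebra :: 'a::comm_ring_1 ring) x y = x - y"
 by (simp add: a_minus_def)

lemma pol_algebra: "complex_algebra pol (\<lambda>c. pin [:c:])"
proof -
 have "(\<lambda>c. [:c:]) \<in> Ring.ring_hom CR poly_ring"
  by (rule type_ring_homI) (auto simp: one_pCons)
 from ring_hom_trans[OF this pol(2)] have "(\<lambda>c. pin [:c:]) \<in> Ring.ring_hom CR pol" by (simp only: comp_def)
 then show ?thesis
  unfolding complex_algebra_def complex_algebra_axioms_def base_ring_def using pol(1) by (intro conjI)
qed

text \<open>As a constant, the identity can serve as a structure map without making the simplifier loop on \<open>0\<close> and \<open>1\<close>.\<close>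

definition cid :: "complex => complex"
 where cid: "cid c = c"

lemma cid_real [simp]: "cid (of_real r) = of_real r" by (rule cid)

lemma complex_self: "complex_algebra CR cid"
 unfolding complex_algebra_def complex_algebra_axioms_def by (intro conjI base_ring_type type_ring_homI) (simp_all add: cid)

lemma pev_complex: "pev CR cid a p = poly p a"
proof -
 interpret complex_algebra CR cid by (rule complex_self)
 show ?thesis
 proof (induction p)
  case (pCons c p)
  have "pev CR cid a (pCons c p) = cid c + a * pev CR cid a p" by (subst pev_pCons) simp_all
  then show ?case unfolding pCons(2) cid by simp
 qed (simp add: pev_def)
qed

section \<open>The morphism on the image of the Deligne torus\<close>

locale symp_functor = normal_form D' TH bl n cf Q P
 for D' :: "('b1::ring, 'v1::ab_group_add) pel" and TH :: "'t set" and bl n cf Q P and D :: "('b2::ring, 'v2::ab_group_add) pel" +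
 fixes f :: "complex ring => ('v1 \<times> 'v1 => complex) => ('v2 \<times> 'v2 => complex)"
 assumes datum: "PEL_datum D'" "PEL_datum D" and morph: "shimura_morphism D' D f"
begin

abbreviation "I2 \<equiv> basisV D"
abbreviation "I1 \<equiv> basisV D'"

lemma fin2: "finite I2" "finite (basisB D)" using PEL_datum.fin_IV[OF datum(2)] PEL_datum.fin_IB[OF datum(2)] by auto

lemma f_hom: "rat_algebra R ==> f R \<in> hom (PEL_group D' R) (PEL_group D R)"
 and f_nat: "\<psi> \<in> Ring.ring_hom R S ==> rat_algebra R ==> rat_algebra S ==> g \<in> carrier (PEL_group D' R) ==>
  f S (mbase I1 I1 \<psi> g) = mbase I2 I2 \<psi> (f R g)"
 using morph unfolding shimura_morphism_def group_scheme_hom_def by blast+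

lemma pel_alg1: "rat_algebra R ==> pel_alg R D'" and pel_alg2: "rat_algebra R ==> pel_alg R D"
 using fin2 finV finB by (simp_all add: pel_alg_def pel_alg_axioms_def rat_alg_iff)

lemma f_group: "rat_algebra R ==> g \<in> carrier (PEL_group D' R) ==> f R g \<in> carrier (PEL_group D R)"
 using f_hom unfolding hom_def by blast

lemma f_mats: "rat_algebra R ==> g \<in> carrier (PEL_group D' R) ==> f R g \<in> mats R I2 I2"
 using f_group pel_alg.PEL_group_mats[OF pel_alg2] by blast

lemma f_mult: "rat_algebra R ==> g \<in> carrier (PEL_group D' R) ==> h \<in> carrier (PEL_group D' R) ==>
  f R (mmul R I1 I1 I1 g h) = mmul R I2 I2 I2 (f R g) (f R h)"
proof -
 assume a: "rat_algebra R" "g \<in> carrier (PEL_group D' R)" "h \<in> carrier (PEL_group D' R)"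
 have "f R (g \<otimes>\<^bsub>PEL_group D' R\<^esub> h) = f R g \<otimes>\<^bsub>PEL_group D R\<^esub> f R h"
  using f_hom[OF a(1)] a(2,3) unfolding hom_def by blast
 then show ?thesis
  unfolding pel_alg.PEL_group_mult[OF pel_alg1[OF a(1)]] pel_alg.PEL_group_mult[OF pel_alg2[OF a(1)]] .
qed

lemma f_one: "rat_algebra R ==> f R (mone R I1) = mone R I2"
proof -
 assume R: "rat_algebra R"
 interpret group_hom "PEL_group D' R" "PEL_group D R" "f R"
  by (intro group_hom.intro group_hom_axioms.intro pel_alg.PEL_group[OF pel_alg1[OF R]] pel_alg.PEL_group[OF pel_alg2[OF R]] f_hom[OF R])
 show ?thesis using hom_one unfolding pel_alg.PEL_group_one[OF pel_alg1[OF R]] pel_alg.PEL_group_one[OF pel_alg2[OF R]] .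
qed

lemma gamma_exists: "\<exists>g \<in> carrier (PEL_group D real_ring). \<forall>A \<phi>. real_algebra A \<phi> -->
  (\<forall>z \<in> deligne_torus A. f A (h_conj D' (mone real_ring I1) A \<phi> z) = h_conj D g A \<phi> z)"
proof -
 interpret R: pel_alg real_ring D' by (rule pel_alg1[OF rat_algebra_type])
 interpret RG: group "PEL_group D' real_ring" by (rule R.PEL_group)
 have "mone real_ring I1 \<in> carrier (PEL_group D' real_ring)" using RG.one_closed by simp
 then show ?thesis using morph unfolding shimura_morphism_def by blast
qed

text \<open>The definition of a morphism of Shimura data, applied to the trivial conjugate of the
  first \<open>h\<close>, gives one \<open>\<gamma>\<close> with which \<open>f\<close> carries that
  \<open>h\<close> to the conjugate by \<open>\<gamma>\<close> of the \<open>h\<close> on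
  \<open>V\<close>.\<close>

definition "\<gamma> = (SOME g. g \<in> carrier (PEL_group D real_ring) \<and> (\<forall>A \<phi>. real_algebra A \<phi> -->
  (\<forall>z \<in> deligne_torus A. f A (h_conj D' (mone real_ring I1) A \<phi> z) = h_conj D g A \<phi> z)))"

lemma gamma: "\<gamma> \<in> carrier (PEL_group D real_ring)" "real_algebra A \<phi> ==> z \<in> deligne_torus A ==>
  f A (h_conj D' (mone real_ring I1) A \<phi> z) = h_conj D \<gamma> A \<phi> z"
 using someI_ex[of "\<lambda>g. g \<in> carrier (PEL_group D real_ring) \<and> (\<forall>A \<phi>. real_algebra A \<phi> -->
  (\<forall>z \<in> deligne_torus A. f A (h_conj D' (mone real_ring I1) A \<phi> z) = h_conj D g A \<phi> z))"] gamma_exists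
 unfolding \<gamma>_def by blast+

definition "\<gamma>' = inv\<^bsub>PEL_group D real_ring\<^esub> \<gamma>"
text \<open>The complex structure of \<open>V\<close> belonging to that conjugate; \<open>JV\<close>
  below is its complexification. Its eigenspaces are the two halves on which \<open>f\<close> is
  studied.\<close>

definition "JR = mmul real_ring I2 I2 I2 \<gamma> (mmul real_ring I2 I2 I2 (hh D \<i>) \<gamma>')"
definition "JV = mbase I2 I2 complex_of_real JR"

lemma hh_mats: "hh D z \<in> mats real_ring I2 I2" using PEL_datum.h_End[OF datum(2), of z] unfolding BR_End_def by blast

lemma gamma': "\<gamma>' \<in> mats real_ring I2 I2" "\<gamma> \<in> mats real_ring I2 I2" "mmul real_ring I2 I2 I2 \<gamma> \<gamma>' = mone real_ring I2" "mmul real_ring I2 I2 I2 \<gamma>' \<gamma> = mone real_ring I2"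
 "\<gamma>' \<in> carrier (PEL_group D real_ring)"
proof -
 interpret R: pel_alg real_ring D by (rule pel_alg2[OF rat_algebra_type])
 interpret RG: group "PEL_group D real_ring" by (rule R.PEL_group)
 show "\<gamma>' \<in> carrier (PEL_group D real_ring)" unfolding \<gamma>'_def using gamma(1) by simp
 then show "\<gamma>' \<in> mats real_ring I2 I2" "\<gamma> \<in> mats real_ring I2 I2" by (rule R.PEL_group_mats) (rule R.PEL_group_mats[OF gamma(1)])
 show "mmul real_ring I2 I2 I2 \<gamma> \<gamma>' = mone real_ring I2" "mmul real_ring I2 I2 I2 \<gamma>' \<gamma> = mone real_ring I2"
  unfolding \<gamma>'_def using RG.r_inv[OF gamma(1)] RG.l_inv[OF gamma(1)] unfolding R.PEL_group_mult R.PEL_group_one .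
qed

lemma JR: "JR \<in> mats real_ring I2 I2" "mmul real_ring I2 I2 I2 JR JR = msc real_ring I2 I2 (-1) (mone real_ring I2)"
proof -
 interpret R: base_ring real_ring by (rule base_ring_type)
 note m = hh_mats gamma'(1,2) fin2(1)
 show "JR \<in> mats real_ring I2 I2" unfolding JR_def using m by simp
 have c: "mmul real_ring I2 I2 I2 \<gamma>' (mmul real_ring I2 I2 I2 \<gamma> N) = N" if "N \<in> mats real_ring I2 I2" for N
  using R.mmul_assoc[OF fin2(1) fin2(1) gamma'(1,2) that] gamma'(4) that fin2(1) by simp
 have "hh D (complex_of_real (-1) * 1) = (\<lambda>p \<in> I2 \<times> I2. -1 * hh D 1 p)" by (rule PEL_datum.h_scale[OF datum(2)])
 then have h: "mmul real_ring I2 I2 I2 (hh D \<i>) (hh D \<i>) = msc real_ring I2 I2 (-1) (mone real_ring I2)"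
  using PEL_datum.h_mult[OF datum(2), of \<i> \<i>] unfolding PEL_datum.h_unit[OF datum(2)] msc_def by (simp add: split_def)
 have h2: "mmul real_ring I2 I2 I2 (hh D \<i>) (mmul real_ring I2 I2 I2 (hh D \<i>) N) = msc real_ring I2 I2 (-1) N" if "N \<in> mats real_ring I2 I2" for N
  using R.mmul_assoc[OF fin2(1) fin2(1) hh_mats[of \<i>] hh_mats[of \<i>] that] h that fin2(1) by (simp add: R.mmul_msc_left)
 have "mmul real_ring I2 I2 I2 JR JR = mmul real_ring I2 I2 I2 \<gamma> (msc real_ring I2 I2 (-1) \<gamma>')"
  unfolding JR_def using m by (simp add: R.mmul_assoc c h2)
 then show "mmul real_ring I2 I2 I2 JR JR = msc real_ring I2 I2 (-1) (mone real_ring I2)"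
  using m gamma'(3) by (simp add: R.mmul_msc_right)
qed

lemma JV: "JV \<in> mats CR I2 I2" "mmul CR I2 I2 I2 JV JV = msc CR I2 I2 (-1) (mone CR I2)"
proof -
 interpret h: base_ring_hom real_ring CR complex_of_real
  by (intro base_ring_homI cring_from_type_algebra type_ring_homI) auto
 show "JV \<in> mats CR I2 I2" unfolding JV_def using JR(1) by simp
 have "mmul CR I2 I2 I2 JV JV = mbase I2 I2 complex_of_real (mmul real_ring I2 I2 I2 JR JR)"
  unfolding JV_def using JR(1) fin2(1) by (simp add: h.mbase_mmul)
 also have "\<dots> = msc CR I2 I2 (-1) (mone CR I2)"
  unfolding JR(2) by (simp add: h.mbase_msc[OF h.RB.mone_mats] h.mbase_mone)
 finally show "mmul CR I2 I2 I2 JV JV = msc CR I2 I2 (-1) (mone CR I2)" .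
qed

end

locale functor_points = symp_functor D' TH bl n cf Q P D f + A: symp_points D' TH bl n cf Q P A \<phi>
 for D' :: "('b1::ring, 'v1::ab_group_add) pel" and TH :: "'t set" and bl n cf Q P and D :: "('b2::ring, 'v2::ab_group_add) pel" and f
  and A :: "complex ring" and \<phi>
begin

text \<open>By \<open>hmat_lam\<close> the argument is a point of the image of the first
  \<open>h\<close>, so \<open>f\<close> sends it to the same torus point acting through
  \<open>JV\<close>.\<close>

lemma f_lam:
 assumes u: "u \<in> Units A"
 shows "f A (A.iota (A.lam b u)) = madd A I2 I2 (msc A I2 I2 (A.ta u) (mone A I2)) (msc A I2 I2 (A.tc b u) (mbase I2 I2 \<phi> JV))"
proof -
 let ?r = "\<lambda>r. \<phi> (complex_of_real r)" and ?a = "A.ta u" and ?c = "A.tc b u"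
 have uc: "u \<in> carrier A" using u by (rule A.Units_closed)
 have ac: "?a \<in> carrier A" "?c \<in> carrier A" using uc by (auto simp: A.minus_closed)
 have rh: "?r \<in> Ring.ring_hom real_ring A"
  by (rule type_ring_homI) (auto simp: A.phi_mult A.phi_add)
 have ra: "real_algebra A ?r" unfolding real_algebra_def using rh A.is_cring by blast
 interpret r: base_ring_hom real_ring A ?r
  using rh A.is_cring cring_from_type_algebra[where 'a=real] by (intro base_ring_homI)
 interpret G: pel_alg A D by (rule pel_alg2[OF A.rat_algebra])
 interpret GG: group "PEL_group D A" by (rule G.PEL_group)
 interpret GG1: group "PEL_group D' A" by (rule A.PEL_group)
 have one1: "mone A I1 \<in> carrier (PEL_group D' A)" using GG1.one_closed by simp
 have inv1: "inv\<^bsub>PEL_group D' A\<^esub> (mone A I1) = mone A I1" using GG1.inv_one by simp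
 have lg: "A.iota (A.lam b u) \<in> mats A I1 I1" using uc by simp
 have hp1: "h_point D' A ?r (?a, ?c) = A.iota (A.lam b u)"
  using A.h_point_eq[OF PEL_datum.h_unit[OF datum(1)] ac] A.hmat_lam[OF uc] by simp
 have "h_conj D' (mone real_ring I1) A ?r (?a, ?c) = A.iota (A.lam b u)"
  unfolding h_conj_def r.mbase_mone inv1 hp1 using lg finV by simp
 then have "f A (A.iota (A.lam b u)) = h_conj D \<gamma> A ?r (?a, ?c)"
  using gamma(2)[OF ra A.torus_memb[OF u]] by metis
 also have "\<dots> = madd A I2 I2 (msc A I2 I2 ?a (mone A I2)) (msc A I2 I2 ?c (mbase I2 I2 \<phi> JV))"
 proof -
  let ?g = "mbase I2 I2 ?r \<gamma>" and ?g' = "mbase I2 I2 ?r \<gamma>'" and ?h = "mbase I2 I2 ?r (hh D \<i>)"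
  have gg: "?g \<in> carrier (PEL_group D A)"
   by (rule mbase_group[OF rat_algebra_type A.rat_algebra rh fin2 gamma(1)])
  have m: "?g \<in> mats A I2 I2" "?g' \<in> mats A I2 I2" "?h \<in> mats A I2 I2" using gamma' hh_mats by simp_all
  have gi: "mmul A I2 I2 I2 ?g ?g' = mone A I2" "mmul A I2 I2 I2 ?g' ?g = mone A I2"
   using r.mbase_mmul[OF fin2(1) gamma'(2,1)] r.mbase_mmul[OF fin2(1) gamma'(1,2)] gamma'(3,4) by (simp_all add: r.mbase_mone)
  have gin: "inv\<^bsub>PEL_group D A\<^esub> ?g = ?g'" by (rule G.PEL_group_inv[OF gg m(2) gi(2)])
  have hp: "h_point D A ?r (?a, ?c) = madd A I2 I2 (msc A I2 I2 ?a (mone A I2)) (msc A I2 I2 ?c ?h)"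
   unfolding h_point_def PEL_datum.h_unit[OF datum(2)] using ac by (auto simp: fun_eq_iff madd_def msc_def mone_def mbase_def)
  have J: "mbase I2 I2 \<phi> JV = mmul A I2 I2 I2 ?g (mmul A I2 I2 I2 ?h ?g')"
  proof -
   have "mbase I2 I2 \<phi> JV = mbase I2 I2 ?r JR" unfolding JV_def mbase_mbase by (simp add: comp_def)
   then show ?thesis unfolding JR_def using gamma' hh_mats fin2(1) by (simp add: r.mbase_mmul)
  qed
  show ?thesis
   unfolding h_conj_def G.PEL_group_mult gin hp J
   using m ac fin2(1) gi by (simp add: A.mmul_add_left A.mmul_add_right A.mmul_msc_left A.mmul_msc_right A.mmul_assoc)
 qed
 finally show ?thesis .
qed

end

lemma (in functor_points) bsy_real:
 assumes "bsym TH bl Y" "a \<in> carrier A"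
 shows "A.bsy (\<lambda>al be. a \<otimes>\<^bsub>A\<^esub> \<phi> (of_real (Y al be)))"
proof -
 have "Y al be = Y be al" "bl al ~= bl be ==> Y al be = 0" for al be using assms(1) unfolding bsym_def by metis+
 note y = this
 show ?thesis
  unfolding A.bsy_def
 proof (intro ballI conjI impI)
  fix al be
  show "a \<otimes>\<^bsub>A\<^esub> \<phi> (of_real (Y al be)) \<in> carrier A" using assms(2) by simp
  show "a \<otimes>\<^bsub>A\<^esub> \<phi> (of_real (Y al be)) = a \<otimes>\<^bsub>A\<^esub> \<phi> (of_real (Y be al))" using y(1)[of al be] by simp
  show "a \<otimes>\<^bsub>A\<^esub> \<phi> (of_real (Y al be)) = \<zero>\<^bsub>A\<^esub>" if "bl al ~= bl be" using y(2)[OF that] assms(2) by simp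
 qed
qed

section \<open>Transvections with an indeterminate parameter\<close>

context symp_functor
begin

lemma points: "complex_algebra A \<phi> ==> functor_points D' TH bl n cf Q P D f A \<phi>"
 unfolding functor_points_def symp_points_def using symp_functor_axioms normal_form_axioms by blast

interpretation Z: functor_points D' TH bl n cf Q P D f pol "\<lambda>c. pin [:c:]" by (rule points[OF pol_algebra])

text \<open>The transvection with parameter \<open>s\<close> over \<open>\<complex>[s]\<close>. The
  entries \<open>pp\<close> of its image are polynomials in \<open>s\<close>, and \<open>qm\<close>
  collects their linear coefficients. \<open>Pe b\<close> is the projection onto the eigenspace of
  \<open>JV\<close> with eigenvalue \<open>eps b\<close>.\<close>

definition "sX b Y = Z.A.uni b (\<lambda>al be. pin [:0, 1:] \<otimes>\<^bsub>pol\<^esub> pin [:complex_of_real (Y al be):])"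
definition "pp b Y p = pout (f pol (Z.A.iota (sX b Y)) p)"
definition "qm b Y = (\<lambda>(i, j) \<in> I2 \<times> I2. coeff (pp b Y (i, j)) 1)"
definition "eone = emb I2 (mone CR I2)"
definition "jj = emb I2 JV"
definition "Pe b = (1/2 :: real) *\<^sub>R (eone - cscale (eps b) jj)"
definition "qe b Y = emb I2 (qm b Y)"

end

context functor_points
begin

text \<open>Naturality of \<open>f\<close> along the evaluation of \<open>\<complex>[s]\<close> at
  \<open>a\<close>: one polynomial matrix governs all complex algebras at once.\<close>

lemma f_uni_pev:
 assumes Y: "bsym TH bl Y" and a: "a \<in> carrier A" and ij: "i \<in> I2" "j \<in> I2"
 shows "f A (A.iota (A.uni b (\<lambda>al be. a \<otimes>\<^bsub>A\<^esub> \<phi> (of_real (Y al be))))) (i, j) = pev A \<phi> a (pp b Y (i, j))"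
proof -
 interpret Z: functor_points D' TH bl n cf Q P D f pol "\<lambda>c. pin [:c:]" by (rule points[OF pol_algebra])
 let ?psi = "\<lambda>x. pev A \<phi> a (pout x)"
 have ps: "?psi \<in> Ring.ring_hom pol A" using ring_hom_trans[OF pol(3) A.pev_hom[OF a]] by (simp only: comp_def)
 have pc: "?psi (pin [:c:]) = \<phi> c" for c unfolding pol(4) using a by simp
 interpret H: points_hom D' TH bl n cf Q P pol "\<lambda>c. pin [:c:]" A \<phi> ?psi
  by (intro points_hom.intro points_hom_axioms.intro Z.A.symp_points_axioms A.symp_points_axioms ps pc)
 have s: "pin p \<in> carrier pol" for p using ring_hom_closed[OF pol(2)] by simp
 have u: "sX b Y \<in> mats pol Z.A.\<Lambda> Z.A.\<Lambda>"
  unfolding sX_def by (rule Z.A.uni_mats[OF Z.bsy_real[OF Y s]])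
 have g: "Z.A.iota (sX b Y) \<in> carrier (PEL_group D' pol)"
  unfolding sX_def by (rule Z.A.uni_group[OF Z.bsy_real[OF Y s]])
 have e: "?psi (pin [:0, 1:] \<otimes>\<^bsub>pol\<^esub> pin [:c:]) = a \<otimes>\<^bsub>A\<^esub> \<phi> c" for c
  using H.h.hom_mult[OF s s, of "[:0, 1:]" "[:c:]"] pc[of c] pol(4)[of "[:0, 1:]"] a by simp
 have "mbase I1 I1 ?psi (Z.A.iota (sX b Y)) = A.iota (A.uni b (\<lambda>al be. a \<otimes>\<^bsub>A\<^esub> \<phi> (of_real (Y al be))))"
  unfolding H.iota_base[OF u] unfolding sX_def H.uni_base e ..
 then have "f A (A.iota (A.uni b (\<lambda>al be. a \<otimes>\<^bsub>A\<^esub> \<phi> (of_real (Y al be))))) = mbase I2 I2 ?psi (f pol (Z.A.iota (sX b Y)))"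
  using f_nat[OF ps Z.A.rat_algebra A.rat_algebra g] by simp
 then show ?thesis using ij by (simp add: mbase_entry pp_def)
qed

end

section \<open>Linearity in the parameter and the Weyl relation\<close>

context symp_functor
begin

interpretation C: functor_points D' TH bl n cf Q P D f CR cid by (rule points[OF complex_self])

abbreviation "UC b Y \<equiv> C.A.uni b (\<lambda>al be. complex_of_real (Y al be))"
abbreviation "cmul \<equiv> mmul CR I2 I2 I2"

lemma eps_eps: "eps b * eps b = -1" "eps (\<not> b) = - eps b" "1 / (2 * eps b) = of_real (-1/2) * eps b"
 unfolding eps_def by (auto simp: divide_simps)

lemma bsyC: "bsym TH bl Y ==> C.A.bsy (\<lambda>al be. a * complex_of_real (Y al be))" "bsym TH bl Y ==> C.A.bsy (\<lambda>al be. complex_of_real (Y al be))"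
 using C.bsy_real[of Y a] C.bsy_real[of Y 1] by simp_all

lemma eone: "eone * eone = eone" "eone * jj = jj" "jj * eone = jj" "jj * jj = - eone"
proof -
 show "eone * eone = eone" "eone * jj = jj" "jj * eone = jj" unfolding eone_def jj_def using emb_one[OF fin2(1)] JV(1) C.A.mone_mats by blast+
 have "jj * jj = cscale (of_real (-1)) eone" unfolding jj_def eone_def emb_mult[OF fin2(1)] JV(2) emb_msc by simp
 then show "jj * jj = - eone" unfolding cscale_simps by simp
qed

lemma Jb: "cscale (eps b) jj * cscale (eps b) jj = eone" "cscale (eps (\<not> b)) jj = - cscale (eps b) jj" "eone * cscale (eps b) jj = cscale (eps b) jj" "cscale (eps b) jj * eone = cscale (eps b) jj"
proof -
 have m: "cscale (-1) F = - F" for F :: "'v2 linop" using cscale_simps(7)[of "-1" F] by simp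
 show "cscale (eps b) jj * cscale (eps b) jj = eone"
  unfolding cscale_simps eone eps_eps by (simp add: m)
 have "cscale (- eps b) jj = cscale (-1) (cscale (eps b) jj)" unfolding cscale_simps by simp
 then show "cscale (eps (\<not> b)) jj = - cscale (eps b) jj" unfolding eps_eps m .
 show "eone * cscale (eps b) jj = cscale (eps b) jj" "cscale (eps b) jj * eone = cscale (eps b) jj" unfolding cscale_simps eone by simp_all
qed

lemma Pe: "Pe b * Pe b = Pe b" "Pe b * Pe (\<not> b) = 0" "Pe b + Pe (\<not> b) = eone" "Pe (\<not> b) * Pe b = 0"
proof -
 let ?J = "cscale (eps b) jj"
 have 1: "Pe b = (1/2) *\<^sub>R (eone - ?J)" "Pe (\<not> b) = (1/2) *\<^sub>R (eone + ?J)" unfolding Pe_def Jb(2) by simp_all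
 have "(eone - ?J) * (eone - ?J) = 2 *\<^sub>R (eone - ?J)" by (simp add: left_diff_distrib right_diff_distrib Jb eone scaleR_2)
 then show "Pe b * Pe b = Pe b" unfolding 1 by simp
 have "(eone - ?J) * (eone + ?J) = 0" "(eone + ?J) * (eone - ?J) = 0" by (simp_all add: left_diff_distrib right_diff_distrib distrib_left distrib_right Jb eone)
 then show "Pe b * Pe (\<not> b) = 0" "Pe (\<not> b) * Pe b = 0" unfolding 1 by simp_all
 have "Pe b + Pe (\<not> b) = (1/2) *\<^sub>R (eone + eone)" unfolding 1 by (simp flip: scaleR_add_right)
 then show "Pe b + Pe (\<not> b) = eone" by (simp flip: scaleR_2)
qed

lemma PP2: "Pe b + Pe (\<not> b) = eone" "Pe True + Pe False = eone" using Pe(3)[of b] Pe(3)[of True] by simp_all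

text \<open>A single torus element is enough for all weights, since the powers of 2 are
  distinct.\<close>

abbreviation "M2 b \<equiv> f CR (C.A.iota (C.A.lam b 2))"

lemma two_unit: "(2::complex) \<in> Units CR"
 unfolding Units_def by (auto intro!: exI[of _ "1/2"])

lemma M2_mats: "M2 b \<in> mats CR I2 I2"
 by (rule f_mats[OF C.A.rat_algebra C.A.lam_group[OF two_unit]])

lemma emb_M2: "emb I2 (M2 b) = 2 *\<^sub>R Pe b + Pe (\<not> b)"
proof -
 let ?J = "cscale (eps b) jj"
 have id: "mbase I2 I2 cid JV = JV" by (rule mbase_id[OF JV(1)]) (rule cid)
 have 3: "(1/2) * (2 + 1) = complex_of_real (3/2)" by simp
 have "emb I2 (M2 b) = cscale ((1/2) * (2 + 1)) eone + cscale (1 / (2 * eps b)) jj"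
  unfolding C.f_lam[OF two_unit] id by (simp only: emb_add emb_msc eone_def jj_def type_ring_simps type_minus cid) simp
 also have "\<dots> = (3/2) *\<^sub>R eone - (1/2) *\<^sub>R ?J"
  unfolding 3 cscale_simps(7) eps_eps(3) cscale_simps(5)[symmetric] by simp
 finally have e: "emb I2 (M2 b) = (3/2) *\<^sub>R eone - (1/2) *\<^sub>R ?J" .
 have "2 *\<^sub>R Pe b + Pe (\<not> b) = (eone - ?J) + (1/2) *\<^sub>R (eone + ?J)" unfolding Pe_def Jb(2) by simp
 also have "\<dots> = (1 *\<^sub>R eone + (1/2) *\<^sub>R eone) - (1 *\<^sub>R ?J - (1/2) *\<^sub>R ?J)" by (simp add: scaleR_add_right)
 also have "\<dots> = (3/2) *\<^sub>R eone - (1/2) *\<^sub>R ?J" unfolding scaleR_add_left[symmetric] scaleR_left_diff_distrib[symmetric] by simp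
 finally show ?thesis using e by simp
qed

context
 fixes Y and b :: bool assumes Y: "bsym TH bl Y"
begin

text \<open>The relation \<open>lam_uni\<close> with \<open>u = 2\<close> holds for every complex
  value of the parameter, hence as an identity of polynomials; comparing coefficients of degree
  \<open>m\<close> produces the factor \<open>2 ^ m\<close>.\<close>

lemma poly_relation:
 assumes i: "i \<in> I2" "k \<in> I2"
 shows "(\<Sum>j\<in>I2. M2 b (i, j) * coeff (pp b Y (j, k)) m) = 2 ^ m * (\<Sum>j\<in>I2. coeff (pp b Y (i, j)) m * M2 b (j, k))"
proof -
 have "poly (\<Sum>j\<in>I2. smult (M2 b (i, j)) (pp b Y (j, k))) a = poly (\<Sum>j\<in>I2. smult (M2 b (j, k)) (pcompose (pp b Y (i, j)) [:0, 2:])) a" for a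
 proof -
  let ?W = "\<lambda>a. C.A.uni b (\<lambda>al be. a * complex_of_real (Y al be))"
  have W: "f CR (C.A.iota (?W a)) (i, j) = poly (pp b Y (i, j)) a" if "i \<in> I2" "j \<in> I2" for a i j
   using C.f_uni_pev[OF Y _ that, of a b] by (simp add: pev_complex)
  have "C.A.lmul (C.A.lam b 2) (?W a) = C.A.lmul (C.A.uni b (\<lambda>al be. 2 * (a * complex_of_real (Y al be)))) (C.A.lam b 2)"
   using C.A.lam_uni[of 2 "\<lambda>al be. a * complex_of_real (Y al be)" b] bsyC(1)[OF Y] by simp
  then have l: "C.A.lmul (C.A.lam b 2) (?W a) = C.A.lmul (?W (2 * a)) (C.A.lam b 2)" by (simp add: mult.assoc)
  have g: "C.A.iota (C.A.lam b 2) \<in> carrier (PEL_group D' CR)" "C.A.iota (?W a) \<in> carrier (PEL_group D' CR)"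
   "C.A.iota (?W (2 * a)) \<in> carrier (PEL_group D' CR)"
   using C.A.lam_group[OF two_unit] C.A.uni_group[OF bsyC(1)[OF Y]] by blast+
  have mm: "?W a \<in> mats CR C.A.\<Lambda> C.A.\<Lambda>" "C.A.lam b 2 \<in> mats CR C.A.\<Lambda> C.A.\<Lambda>" "C.A.blk (?W (2 * a))" "C.A.blk (C.A.lam b 2)"
   using C.A.uni_mats[OF bsyC(1)[OF Y]] C.A.uni_blk[OF bsyC(1)[OF Y]] by simp_all
  have "cmul (M2 b) (f CR (C.A.iota (?W a))) = cmul (f CR (C.A.iota (?W (2 * a)))) (M2 b)"
   using arg_cong[OF l, of "\<lambda>h. f CR (C.A.iota h)"]
   unfolding C.A.iota_mult[OF mm(4,1)] C.A.iota_mult[OF mm(3,2)] f_mult[OF C.A.rat_algebra g(1,2)] f_mult[OF C.A.rat_algebra g(3,1)] .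
  from fun_cong[OF this, of "(i, k)"] have "(\<Sum>j\<in>I2. M2 b (i, j) * poly (pp b Y (j, k)) a) = (\<Sum>j\<in>I2. poly (pp b Y (i, j)) (2 * a) * M2 b (j, k))"
   using i fin2(1) by (simp add: mmul_entry W)
  then show ?thesis by (simp add: poly_sum poly_pcompose mult.commute)
 qed
 then have "(\<Sum>j\<in>I2. smult (M2 b (i, j)) (pp b Y (j, k))) = (\<Sum>j\<in>I2. smult (M2 b (j, k)) (pcompose (pp b Y (i, j)) [:0, 2:]))"
  by (intro poly_eq_poly_eq_iff[THEN iffD1] ext)
 from arg_cong[OF this, of "\<lambda>p. coeff p m"]
 show ?thesis by (simp add: coeff_sum coeff_pcompose_linear sum_distrib_left mult_ac)
qed

lemma emb_relation:
 fixes m defines "U \<equiv> (\<lambda>(i, j) \<in> I2 \<times> I2. coeff (pp b Y (i, j)) m)"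
 shows "U \<in> mats CR I2 I2" "(2 *\<^sub>R Pe b + Pe (\<not> b)) * emb I2 U = (2 ^ m) *\<^sub>R (emb I2 U * (2 *\<^sub>R Pe b + Pe (\<not> b)))"
proof -
 show um: "U \<in> mats CR I2 I2" unfolding U_def by (rule mats_memI) auto
 have "cmul (M2 b) U = msc CR I2 I2 (of_real (2 ^ m)) (cmul U (M2 b))"
 proof (rule mats_eqI[of _ CR I2 I2])
  fix i k assume ik: "i \<in> I2" "k \<in> I2"
  then show "cmul (M2 b) U (i, k) = msc CR I2 I2 (of_real (2 ^ m)) (cmul U (M2 b)) (i, k)"
   using poly_relation[OF ik, of m] fin2(1) by (simp add: mmul_entry msc_entry U_def)
 qed (use M2_mats um in simp_all)
 then have "emb I2 (M2 b) * emb I2 U = cscale (of_real (2 ^ m)) (emb I2 U * emb I2 (M2 b))"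
  unfolding emb_mult[OF fin2(1)] by (simp only: emb_msc)
 then show "(2 *\<^sub>R Pe b + Pe (\<not> b)) * emb I2 U = (2 ^ m) *\<^sub>R (emb I2 U * (2 *\<^sub>R Pe b + Pe (\<not> b)))"
  unfolding emb_M2 cscale_simps(7) .
qed

lemma qm_mats: "qm b Y \<in> mats CR I2 I2"
 unfolding qm_def by (rule mats_memI) auto

lemma eone_emb: "U \<in> mats CR I2 I2 ==> (Pe b + Pe (\<not> b)) * emb I2 U = emb I2 U" "U \<in> mats CR I2 I2 ==> emb I2 U * (Pe b + Pe (\<not> b)) = emb I2 U"
 unfolding PP2 eone_def using emb_one[OF fin2(1)] by blast+

text \<open>The linear coefficient has weight 2, so only the corner from
  \<open>Pe (\<not> b)\<close> to \<open>Pe b\<close> remains.\<close>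

lemma Pqe: "Pe b * qe b Y = qe b Y" "qe b Y * Pe (\<not> b) = qe b Y"
proof -
 have e: "qe b Y = emb I2 (\<lambda>(i, j) \<in> I2 \<times> I2. coeff (pp b Y (i, j)) 1)" unfolding qe_def qm_def ..
 have "Pe (\<not> b) * Pe (\<not> b) = Pe (\<not> b)" by (rule Pe(1))
 from weight(1)[OF Pe(1) this Pe(2) Pe(4) eone_emb[OF emb_relation(1)[of 1]] emb_relation(2)[of 1]]
 show "Pe b * qe b Y = qe b Y" "qe b Y * Pe (\<not> b) = qe b Y" unfolding e by simp_all
qed

text \<open>The constant term is \<open>f\<close> of the identity. The eigenvalues of
  \<open>M2 b\<close> are 2 and 1, so no coefficient of weight \<open>2 ^ m\<close> with
  \<open>m > 1\<close> can be nonzero.\<close>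

lemma pp_linear:
 assumes i: "i \<in> I2" "j \<in> I2"
 shows "pp b Y (i, j) = [:if i = j then 1 else 0, qm b Y (i, j):]"
proof (rule poly_eqI)
 fix m :: nat
 consider "m = 0" | "m = 1" | "m > 1" by linarith
 then show "coeff (pp b Y (i, j)) m = coeff [:if i = j then 1 else 0, qm b Y (i, j):] m"
 proof cases
  case 1
  have "C.A.uni b (\<lambda>al be. 0 * complex_of_real (Y al be)) = mone CR C.A.\<Lambda>" using C.A.uni_zero[of b] by simp
  then have "f CR (C.A.iota (C.A.uni b (\<lambda>al be. 0 * complex_of_real (Y al be)))) = mone CR I2"
   using C.A.iota_one f_one[OF C.A.rat_algebra] by simp
  then have "poly (pp b Y (i, j)) 0 = (if i = j then 1 else 0)"
   using C.f_uni_pev[OF Y _ i, of 0 b] i by (cases "i = j") (simp_all add: pev_complex mone_entry)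
  then show ?thesis using 1 by (simp add: poly_0_coeff_0)
 next
  case 2
  then show ?thesis using i by (simp add: qm_def)
 next
  case 3
  \<comment> \<open>Brings the weight into the range of the second part of
    \<open>weight\<close>.\<close>
  have "(2::real) ^ 1 < 2 ^ m" by (rule power_strict_increasing) (use 3 in simp_all)
  then have c: "(2::real) < 2 ^ m" by simp
  have "Pe (\<not> b) * Pe (\<not> b) = Pe (\<not> b)" by (rule Pe(1))
  from weight(2)[OF Pe(1) this Pe(2) Pe(4) eone_emb[OF emb_relation(1)[of m]] emb_relation(2)[of m] c]
  have "Rep_linop (emb I2 (\<lambda>(i, j) \<in> I2 \<times> I2. coeff (pp b Y (i, j)) m)) (unitv j) i = 0" by (simp add: Rep_ops)
  then have "coeff (pp b Y (i, j)) m = 0" unfolding emb_entry[OF fin2(1) i] using i by simp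
  then show ?thesis using 3 by (simp add: coeff_pCons split: nat.splits)
 qed
qed

lemma UC_q: "emb I2 (f CR (C.A.iota (C.A.uni b (\<lambda>al be. a * complex_of_real (Y al be))))) = eone + cscale a (qe b Y)"
proof -
 have "f CR (C.A.iota (C.A.uni b (\<lambda>al be. a * complex_of_real (Y al be)))) = madd CR I2 I2 (mone CR I2) (msc CR I2 I2 a (qm b Y))"
 proof (rule mats_eqI[of _ CR I2 I2])
  fix i j assume i: "i \<in> I2" "j \<in> I2"
  then show "f CR (C.A.iota (C.A.uni b (\<lambda>al be. a * complex_of_real (Y al be)))) (i, j) = madd CR I2 I2 (mone CR I2) (msc CR I2 I2 a (qm b Y)) (i, j)"
   using C.f_uni_pev[OF Y _ i, of a b] pp_linear[OF i] by (simp add: pev_complex madd_entry mone_entry msc_entry)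
 next
  show "f CR (C.A.iota (C.A.uni b (\<lambda>al be. a * complex_of_real (Y al be)))) \<in> mats CR I2 I2"
   by (rule f_mats[OF C.A.rat_algebra C.A.uni_group[OF bsyC(1)[OF Y]]])
 qed (use qm_mats C.A.mone_mats in simp)
 then show ?thesis unfolding eone_def qe_def by (simp add: emb_add emb_msc)
qed

end

lemma UC_q1: "bsym TH bl Y ==> emb I2 (f CR (C.A.iota (UC b Y))) = eone + qe b Y"
 using UC_q[of Y b 1] by (simp add: cscale_simps)

lemma UC_mult:
 assumes "C.A.blk h" "C.A.blk h'" "C.A.iota h \<in> carrier (PEL_group D' CR)" "C.A.iota h' \<in> carrier (PEL_group D' CR)"
 shows "emb I2 (f CR (C.A.iota (C.A.lmul h h'))) = emb I2 (f CR (C.A.iota h)) * emb I2 (f CR (C.A.iota h'))"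
 unfolding C.A.iota_mult[OF assms(1) C.A.blk_mats[OF assms(2)]] f_mult[OF C.A.rat_algebra assms(3,4)] emb_mult[OF fin2(1)] ..

lemma UC_good: "bsym TH bl Y ==> C.A.blk (UC b Y)" "bsym TH bl Y ==> C.A.iota (UC b Y) \<in> carrier (PEL_group D' CR)"
 using C.A.uni_blk C.A.uni_group bsyC(2) by blast+

text \<open>The product passes through \<open>Pe (\<not> b) * Pe b = 0\<close>.\<close>

lemma Pe_zero: "bsym TH bl Y ==> bsym TH bl Z ==> qe b Y * qe b Z = 0"
 using Pqe[of Y b] Pqe[of Z b] Pe(4)[of b] by (metis mult.assoc mult_zero_left mult_zero_right)

lemma eone_qe: "bsym TH bl Y ==> eone * qe b Y = qe b Y" "bsym TH bl Y ==> qe b Y * eone = qe b Y"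
 unfolding eone_def qe_def using emb_one[OF fin2(1) qm_mats] by blast+

text \<open>Additivity comes from the product of two transvections of the same kind, whose mixed
  term vanishes by \<open>Pe_zero\<close>; compatibility with inversion comes from applying
  \<open>f\<close> to the Weyl element.\<close>

lemma symmetric_rep_qe: "symmetric_rep TH bl qe Pe"
proof
 show "finite TH" by (rule finT)
 fix Y Z :: "'t => 't => real" and b :: bool and c :: real
 show "Pe b * Pe b = Pe b" "Pe b * Pe (\<not> b) = 0" by (rule Pe)+
 assume Y: "bsym TH bl Y"
 show "Pe b * qe b Y = qe b Y" "qe b Y * Pe (\<not> b) = qe b Y" by (rule Pqe[OF Y])+
 have sc: "bsym TH bl (\<lambda>\<theta> \<eta>. c * Y \<theta> \<eta>)" if "bsym TH bl Y" for c :: real and Y using that unfolding bsym_def by auto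
 have scale: "qe b (\<lambda>\<theta> \<eta>. c * Y \<theta> \<eta>) = c *\<^sub>R qe b Y" if "bsym TH bl Y" for c :: real and Y and b
  using UC_q[OF that, of b "of_real c"] UC_q1[OF sc[OF that], of b c] by (simp add: cscale_simps)
 show "qe b (\<lambda>\<theta> \<eta>. c * Y \<theta> \<eta>) = c *\<^sub>R qe b Y" by (rule scale[OF Y])
 assume Z: "bsym TH bl Z"
 have add: "bsym TH bl (\<lambda>\<theta> \<eta>. Y \<theta> \<eta> + Z \<theta> \<eta>)"
  using Y Z unfolding bsym_def by (metis add.right_neutral)
 \<comment> \<open>Transvections of the same kind multiply by adding their parameters.\<close>
 have u: "C.A.lmul (UC b Y) (UC b Z) = UC b (\<lambda>\<theta> \<eta>. Y \<theta> \<eta> + Z \<theta> \<eta>)"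
  using C.A.uni_add[OF bsyC(2)[OF Y] bsyC(2)[OF Z], of b] by simp
 have "eone + qe b (\<lambda>\<theta> \<eta>. Y \<theta> \<eta> + Z \<theta> \<eta>) = (eone + qe b Y) * (eone + qe b Z)"
  using UC_q1[OF add, of b] UC_mult[OF UC_good(1)[OF Y] UC_good(1)[OF Z] UC_good(2)[OF Y] UC_good(2)[OF Z], of b b]
  unfolding u UC_q1[OF Y] UC_q1[OF Z] by simp
 also have "\<dots> = eone + (qe b Y + qe b Z)"
  by (simp add: distrib_left distrib_right eone(1) eone_qe[OF Y] eone_qe[OF Z] Pe_zero[OF Y Z] add_ac)
 finally show "qe b (\<lambda>\<theta> \<eta>. Y \<theta> \<eta> + Z \<theta> \<eta>) = qe b Y + qe b Z" by simp
 assume YZ: "!!\<theta> \<zeta>. \<theta> \<in> TH ==> \<zeta> \<in> TH ==> (\<Sum>\<eta>\<in>TH. Y \<theta> \<eta> * Z \<eta> \<zeta>) = of_bool (\<theta> = \<zeta>)"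
 have ss: "Y al be = Y be al" "Z al be = Z be al" for al be using Y Z unfolding bsym_def by metis+
 have ZY: "(\<Sum>\<eta>\<in>TH. Z \<theta> \<eta> * Y \<eta> \<zeta>) = of_bool (\<theta> = \<zeta>)" if "\<theta> \<in> TH" "\<zeta> \<in> TH" for \<theta> \<zeta>
 proof -
  have "(\<Sum>\<eta>\<in>TH. Z \<theta> \<eta> * Y \<eta> \<zeta>) = (\<Sum>\<eta>\<in>TH. Y \<zeta> \<eta> * Z \<eta> \<theta>)"
   by (rule sum.cong[OF refl]) (metis ss mult.commute)
  then show ?thesis using YZ[OF that(2,1)] by (auto simp: of_bool_def)
 qed
 have cs: "(\<Sum>\<eta>\<in>TH. complex_of_real (g \<eta>) * complex_of_real (h \<eta>)) = complex_of_real (\<Sum>\<eta>\<in>TH. g \<eta> * h \<eta>)" for g h by simp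
 define Z' where "Z' = (\<lambda>\<theta> \<eta>. (-1) * Z \<theta> \<eta>)"
 have Z': "bsym TH bl Z'" unfolding Z'_def by (rule sc[OF Z])
 have z': "(\<lambda>al be. - complex_of_real (Z al be)) = (\<lambda>al be. complex_of_real (Z' al be))" unfolding Z'_def by simp
 let ?w = "C.A.lmul (UC b Y) (C.A.lmul (UC (\<not> b) Z') (UC b Y))"
 \<comment> \<open>The torus relation of the Weyl element built from \<open>Y\<close> and its
   inverse \<open>Z\<close>, for the torus value 2.\<close>
 have "C.A.lmul (C.A.lam (\<not> b) 2) (C.A.lmul (UC b Y) (C.A.lmul (C.A.uni (\<not> b) (\<lambda>al be. \<ominus>\<^bsub>CR\<^esub> complex_of_real (Z al be))) (UC b Y))) =
   C.A.lmul (C.A.lmul (UC b Y) (C.A.lmul (C.A.uni (\<not> b) (\<lambda>al be. \<ominus>\<^bsub>CR\<^esub> complex_of_real (Z al be))) (UC b Y))) (C.A.lam b 2)"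
  by (rule C.A.weyl[OF _ bsyC(2)[OF Y] bsyC(2)[OF Z]]) (use finT YZ ZY in \<open>auto simp: cs simp del: of_real_sum\<close>)
 then have w: "C.A.lmul (C.A.lam (\<not> b) 2) ?w = C.A.lmul ?w (C.A.lam b 2)"
  unfolding type_uminus z' .
 have lg: "C.A.blk (C.A.lam b' 2)" "C.A.iota (C.A.lam b' 2) \<in> carrier (PEL_group D' CR)" for b'
  using C.A.lam_group[OF two_unit] by simp_all
 interpret G: group "PEL_group D' CR" by (rule pel_alg.PEL_group[OF pel_alg1[OF C.A.rat_algebra]])
 have clo: "C.A.blk (C.A.lmul h h') \<and> C.A.iota (C.A.lmul h h') \<in> carrier (PEL_group D' CR)"
  if "C.A.blk h" "C.A.blk h'" "C.A.iota h \<in> carrier (PEL_group D' CR)" "C.A.iota h' \<in> carrier (PEL_group D' CR)" for h h'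
  using that G.m_closed[OF that(3,4)] C.A.mmul_blk[OF that(1,2)] C.A.iota_mult[OF that(1) C.A.blk_mats[OF that(2)]] by simp
 note gY = UC_good[OF Y, of b] and gZ = UC_good[OF Z', of "\<not> b"]
 note c1 = clo[OF gZ(1) gY(1) gZ(2) gY(2)]
 note c2 = clo[OF gY(1) conjunct1[OF c1] gY(2) conjunct2[OF c1]]
 have z: "qe (\<not> b) Z' = - qe (\<not> b) Z" unfolding Z'_def scale[OF Z] by simp
 have W: "emb I2 (f CR (C.A.iota ?w)) = (eone + qe b Y) * ((eone - qe (\<not> b) Z) * (eone + qe b Y))"
  unfolding UC_mult[OF gY(1) conjunct1[OF c1] gY(2) conjunct2[OF c1]] UC_mult[OF gZ(1) gY(1) gZ(2) gY(2)] UC_q1[OF Y] UC_q1[OF Z'] z by simp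
 have "emb I2 (M2 (\<not> b)) * emb I2 (f CR (C.A.iota ?w)) = emb I2 (f CR (C.A.iota ?w)) * emb I2 (M2 b)"
  using arg_cong[OF w, of "\<lambda>h. emb I2 (f CR (C.A.iota h))"]
  unfolding UC_mult[OF lg(1) conjunct1[OF c2] lg(2) conjunct2[OF c2]] UC_mult[OF conjunct1[OF c2] lg(1) conjunct2[OF c2] lg(2)] .
 then have rel: "(2 *\<^sub>R Pe (\<not> b) + Pe b) * ((Pe b + Pe (\<not> b) + qe b Y) * ((Pe b + Pe (\<not> b) - qe (\<not> b) Z) * (Pe b + Pe (\<not> b) + qe b Y))) =
  (Pe b + Pe (\<not> b) + qe b Y) * ((Pe b + Pe (\<not> b) - qe (\<not> b) Z) * (Pe b + Pe (\<not> b) + qe b Y)) * (2 *\<^sub>R Pe b + Pe (\<not> b))"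
  unfolding W emb_M2 PP2 not_not .
 have nn: "Pe (\<not> b) * qe (\<not> b) Z = qe (\<not> b) Z" "qe (\<not> b) Z * Pe b = qe (\<not> b) Z" using Pqe[OF Z, of "\<not> b"] by simp_all
 show "qe b Y * qe (\<not> b) Z = Pe b"
  by (rule weyl_relation[OF Pe(1) Pe(1) Pe(2) Pe(4) Pqe[OF Y] nn rel])
qed

end

section \<open>Rational intertwiners\<close>

lemma (in base_ring) finsum_fst:
 assumes "finite I" "k < (m::nat)" "!!j. j \<in> I ==> g j \<in> carrier R"
 shows "(\<Oplus>p\<in>{..<m} \<times> I. if k = fst p then g (snd p) else \<zero>) = (\<Oplus>j\<in>I. g j)"
proof -
 have "(\<Oplus>p\<in>{..<m} \<times> I. if k = fst p then g (snd p) else \<zero>) = (\<Oplus>l\<in>{..<m}. \<Oplus>j\<in>I. if k = l then g j else \<zero>)"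
  using assms by (subst finsum_Times) (auto cong: if_cong)
 also have "\<dots> = (\<Oplus>j\<in>I. if k = k then g j else \<zero>)"
  by (rule finsum_single[where f="\<lambda>l. \<Oplus>j\<in>I. if k = l then g j else \<zero>"]) (use assms in \<open>auto intro!: finsum_closed\<close>)
 finally show ?thesis by simp
qed

text \<open>Stacking the \<open>T k\<close> into a column and the \<open>S k\<close> into a row
  gives \<open>S T = 1\<close>. Hence \<open>T S\<close> is an equivariant idempotent of the power
  of \<open>V'\<close>, and \<open>T\<close> is a bijection onto its image with inverse
  \<open>S\<close>.\<close>

lemma admissible_pairs:
 fixes D' :: "('b1::ring, 'v1::ab_group_add) pel" and D :: "('b2::ring, 'v2::ab_group_add) pel" and m :: nat
 assumes fin: "finite (basisV D')" "finite (basisB D')" "finite (basisV D)"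
  and S: "!!k. k < m ==> S k \<in> mats rat_ring (basisV D) (basisV D')" and T: "!!k. k < m ==> T k \<in> mats rat_ring (basisV D') (basisV D)"
  and fm: "!!R g. rat_algebra R ==> g \<in> carrier (PEL_group D' R) ==> f R g \<in> mats R (basisV D) (basisV D)"
  and fS: "!!R g k i j. rat_algebra R ==> g \<in> carrier (PEL_group D' R) ==> k < m ==> i \<in> basisV D ==> j \<in> basisV D' ==>
   finsum R (\<lambda>l. f R g (i, l) \<otimes>\<^bsub>R\<^esub> of_rat_alg R (S k (l, j))) (basisV D) = finsum R (\<lambda>l. of_rat_alg R (S k (i, l)) \<otimes>\<^bsub>R\<^esub> g (l, j)) (basisV D')"
  and fT: "!!R g k i j. rat_algebra R ==> g \<in> carrier (PEL_group D' R) ==> k < m ==> i \<in> basisV D' ==> j \<in> basisV D ==>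
   finsum R (\<lambda>l. of_rat_alg R (T k (i, l)) \<otimes>\<^bsub>R\<^esub> f R g (l, j)) (basisV D) = finsum R (\<lambda>l. g (i, l) \<otimes>\<^bsub>R\<^esub> of_rat_alg R (T k (l, j))) (basisV D')"
  and ST: "!!i j. i \<in> basisV D ==> j \<in> basisV D ==> (\<Sum>k<m. \<Sum>l\<in>basisV D'. S k (i, l) * T k (l, j)) = (if i = j then 1 else 0)"
 shows "admissible D' D f"
proof -
 let ?I = "basisV D" and ?I' = "basisV D'"
 define J where "J = {..<m} \<times> ?I'"
 have J: "std_power_basis D' m = J" "finite J" unfolding J_def std_power_basis_def using fin by auto
 interpret Q: base_ring rat_ring by (rule base_ring_type)
 define TT where "TT = (\<lambda>(p, i) \<in> J \<times> ?I. T (fst p) (snd p, i))"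
 define SS where "SS = (\<lambda>(i, p) \<in> ?I \<times> J. S (fst p) (i, snd p))"
 have Tm: "TT \<in> mats rat_ring J ?I" and Sm: "SS \<in> mats rat_ring ?I J"
  by (rule mats_memI; simp add: TT_def SS_def)+
 have STo: "mmul rat_ring ?I J ?I SS TT = mone rat_ring ?I"
 proof (rule mats_eqI[of _ rat_ring ?I ?I])
  fix i j assume ij: "i \<in> ?I" "j \<in> ?I"
  have "mmul rat_ring ?I J ?I SS TT (i, j) = (\<Sum>p\<in>J. S (fst p) (i, snd p) * T (fst p) (snd p, j))"
   using ij J by (simp add: mmul_entry TT_def SS_def)
  also have "\<dots> = (\<Sum>k<m. \<Sum>l\<in>?I'. S k (i, l) * T k (l, j))"
   unfolding J_def using fin by (simp add: sum_pair)
  finally show "mmul rat_ring ?I J ?I SS TT (i, j) = mone rat_ring ?I (i, j)"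
   using ST[OF ij] ij by (simp add: mone_entry)
 qed (use Tm Sm in auto)
 define e where "e = mmul rat_ring J ?I J TT SS"
 have em: "e \<in> mats rat_ring J J" unfolding e_def using Tm Sm by simp
 have ee: "mmul rat_ring J J J e e = e"
 proof -
  have "mmul rat_ring J J J e e = mmul rat_ring J ?I J TT (mmul rat_ring ?I ?I J (mmul rat_ring ?I J ?I SS TT) SS)"
   unfolding e_def using Tm Sm J fin by (simp add: Q.mmul_assoc)
  then show ?thesis unfolding STo e_def using Sm fin by simp
 qed
 have eq: "mmul R J ?I ?I (mbase J ?I (of_rat_alg R) TT) (f R g) = mmul R J J ?I (std_power D' m R g) (mbase J ?I (of_rat_alg R) TT)"
  "mmul R ?I ?I J (f R g) (mbase ?I J (of_rat_alg R) SS) = mmul R ?I J J (mbase ?I J (of_rat_alg R) SS) (std_power D' m R g)"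
  "std_power D' m R g \<in> mats R J J"
  if R: "rat_algebra R" "g \<in> carrier (PEL_group D' R)" for R g
 proof -
  interpret R: pel_alg R D' using R(1) fin by (simp add: pel_alg_def pel_alg_axioms_def rat_alg_iff)
  have gm: "g \<in> mats R ?I' ?I'" by (rule R.PEL_group_mats[OF R(2)])
  note gc = mats_entry[OF gm] and fc = mats_entry[OF fm[OF R]]
  have sp: "std_power D' m R g (p, q) = (if fst p = fst q then g (snd p, snd q) else \<zero>\<^bsub>R\<^esub>)" if "p \<in> J" "q \<in> J" for p q
   using that unfolding std_power_def J(1) by (simp add: split_def)
  have snd: "fst p < m" "snd p \<in> ?I'" if "p \<in> J" for p using that unfolding J_def by auto
  show spm: "std_power D' m R g \<in> mats R J J"
  proof (rule mats_memI)
   fix p q assume "p \<in> J" "q \<in> J"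
   then show "std_power D' m R g (p, q) \<in> carrier R" using sp snd gc by auto
  next
   fix x assume "x \<notin> J \<times> J"
   then show "std_power D' m R g x = undefined" unfolding std_power_def J(1) by auto
  qed
  show "mmul R J ?I ?I (mbase J ?I (of_rat_alg R) TT) (f R g) = mmul R J J ?I (std_power D' m R g) (mbase J ?I (of_rat_alg R) TT)"
  proof (rule mats_eqI[of _ R J ?I])
   fix p i assume p: "p \<in> J" "i \<in> ?I"
   have "mmul R J ?I ?I (mbase J ?I (of_rat_alg R) TT) (f R g) (p, i) = finsum R (\<lambda>l. of_rat_alg R (T (fst p) (snd p, l)) \<otimes>\<^bsub>R\<^esub> f R g (l, i)) ?I"
    using p by (simp only: mmul_entry) (rule R.finsum_cong', auto simp: mbase_entry TT_def fc)
   also have "\<dots> = finsum R (\<lambda>l. g (snd p, l) \<otimes>\<^bsub>R\<^esub> of_rat_alg R (T (fst p) (l, i))) ?I'"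
    by (rule fT[OF R snd(1)[OF p(1)] snd(2)[OF p(1)] p(2)])
   also have "\<dots> = finsum R (\<lambda>q. if fst p = fst q then g (snd p, snd q) \<otimes>\<^bsub>R\<^esub> of_rat_alg R (T (fst p) (snd q, i)) else \<zero>\<^bsub>R\<^esub>) J"
    unfolding J_def using snd[OF p(1)] fin gc by (intro R.finsum_fst[symmetric]) auto
   also have "\<dots> = mmul R J J ?I (std_power D' m R g) (mbase J ?I (of_rat_alg R) TT) (p, i)"
    using p by (simp only: mmul_entry) (rule R.finsum_cong', auto simp: mbase_entry TT_def sp gc snd)
   finally show "mmul R J ?I ?I (mbase J ?I (of_rat_alg R) TT) (f R g) (p, i) = mmul R J J ?I (std_power D' m R g) (mbase J ?I (of_rat_alg R) TT) (p, i)" .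
  qed (use Tm fm[OF R] spm in auto)
  show "mmul R ?I ?I J (f R g) (mbase ?I J (of_rat_alg R) SS) = mmul R ?I J J (mbase ?I J (of_rat_alg R) SS) (std_power D' m R g)"
  proof (rule mats_eqI[of _ R ?I J])
   fix i p assume p: "i \<in> ?I" "p \<in> J"
   have "mmul R ?I ?I J (f R g) (mbase ?I J (of_rat_alg R) SS) (i, p) = finsum R (\<lambda>l. f R g (i, l) \<otimes>\<^bsub>R\<^esub> of_rat_alg R (S (fst p) (l, snd p))) ?I"
    using p by (simp only: mmul_entry) (rule R.finsum_cong', auto simp: mbase_entry SS_def fc)
   also have "\<dots> = finsum R (\<lambda>l. of_rat_alg R (S (fst p) (i, l)) \<otimes>\<^bsub>R\<^esub> g (l, snd p)) ?I'"
    by (rule fS[OF R snd(1)[OF p(2)] p(1) snd(2)[OF p(2)]])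
   also have "\<dots> = finsum R (\<lambda>q. if fst p = fst q then of_rat_alg R (S (fst p) (i, snd q)) \<otimes>\<^bsub>R\<^esub> g (snd q, snd p) else \<zero>\<^bsub>R\<^esub>) J"
    unfolding J_def using snd[OF p(2)] fin gc by (intro R.finsum_fst[symmetric]) auto
   also have "\<dots> = mmul R ?I J J (mbase ?I J (of_rat_alg R) SS) (std_power D' m R g) (i, p)"
    using p by (simp only: mmul_entry) (rule R.finsum_cong', auto simp: mbase_entry SS_def sp gc snd)
   finally show "mmul R ?I ?I J (f R g) (mbase ?I J (of_rat_alg R) SS) (i, p) = mmul R ?I J J (mbase ?I J (of_rat_alg R) SS) (std_power D' m R g) (i, p)" .
  qed (use Sm fm[OF R] spm in auto)
 qed
 have T_hom: "TT \<in> rep_hom D' ?I f J (std_power D' m)"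
  unfolding rep_hom_def using Tm eq(1) by blast
 have e_hom: "e \<in> rep_hom D' J (std_power D' m) J (std_power D' m)"
  unfolding rep_hom_def mem_Collect_eq
 proof (intro conjI em allI impI ballI)
  fix R :: "complex ring" and g assume R: "rat_algebra R" "g \<in> carrier (PEL_group D' R)"
  interpret R: rat_alg R using R(1) by (simp add: rat_alg_iff)
  let ?T = "mbase J ?I (of_rat_alg R) TT" and ?S = "mbase ?I J (of_rat_alg R) SS" and ?s = "std_power D' m R g"
  have m: "?T \<in> mats R J ?I" "?S \<in> mats R ?I J" "?s \<in> mats R J J" "f R g \<in> mats R ?I ?I" using Tm Sm eq(3)[OF R] fm[OF R] by auto
  have "mmul R J J J (mbase J J (of_rat_alg R) e) ?s = mmul R J ?I J ?T (mmul R ?I J J ?S ?s)"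
   unfolding e_def R.rat.mbase_mmul[OF fin(3) Tm Sm] using m J fin by (simp add: R.mmul_assoc)
  also have "\<dots> = mmul R J ?I J (mmul R J ?I ?I ?T (f R g)) ?S"
   unfolding eq(2)[OF R, symmetric] using m J fin by (simp add: R.mmul_assoc)
  also have "\<dots> = mmul R J J J ?s (mbase J J (of_rat_alg R) e)"
   unfolding eq(1)[OF R] e_def R.rat.mbase_mmul[OF fin(3) Tm Sm] using m J fin by (simp add: R.mmul_assoc)
  finally show "mmul R J J J (mbase J J (of_rat_alg R) e) ?s = mmul R J J J ?s (mbase J J (of_rat_alg R) e)" .
 qed
 have bij: "bij_betw (mapply rat_ring J ?I TT) (vecs rat_ring ?I) (mapply rat_ring J J e ` vecs rat_ring J)"
 proof (rule bij_betw_imageI)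
  have inv: "mapply rat_ring ?I J SS (mapply rat_ring J ?I TT v) = v" if "v \<in> vecs rat_ring ?I" for v
   using Q.mapply_mmul[OF J(2) fin(3) Sm Tm that] Q.mapply_one[OF fin(3) that] unfolding STo by simp
  then show "inj_on (mapply rat_ring J ?I TT) (vecs rat_ring ?I)" by (intro inj_on_inverseI[of _ "mapply rat_ring ?I J SS"]) blast
  have ev: "mapply rat_ring J J e w = mapply rat_ring J ?I TT (mapply rat_ring ?I J SS w)" if "w \<in> vecs rat_ring J" for w
   unfolding e_def using Q.mapply_mmul[OF fin(3) J(2) Tm Sm that] .
  show "mapply rat_ring J ?I TT ` vecs rat_ring ?I = mapply rat_ring J J e ` vecs rat_ring J"
  proof (intro equalityI subsetI)
   fix x assume "x \<in> mapply rat_ring J ?I TT ` vecs rat_ring ?I"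
   then obtain v where v: "v \<in> vecs rat_ring ?I" "x = mapply rat_ring J ?I TT v" by blast
   have w: "mapply rat_ring J ?I TT v \<in> vecs rat_ring J" by (rule Q.mapply_vecs[OF Tm v(1)])
   have "x = mapply rat_ring J J e (mapply rat_ring J ?I TT v)" unfolding ev[OF w] inv[OF v(1)] v(2) ..
   then show "x \<in> mapply rat_ring J J e ` vecs rat_ring J" using w by blast
  next
   fix x assume "x \<in> mapply rat_ring J J e ` vecs rat_ring J"
   then obtain w where w: "w \<in> vecs rat_ring J" "x = mapply rat_ring J J e w" by blast
   show "x \<in> mapply rat_ring J ?I TT ` vecs rat_ring ?I"
    unfolding w(2) ev[OF w(1)] using Q.mapply_vecs[OF Sm w(1)] by blast
  qed
 qed
 show ?thesis
  unfolding admissible_def Let_def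
 proof (rule exI[of _ m], unfold J(1), intro bexI[of _ e] conjI bexI[of _ TT])
 qed (rule ee bij T_hom e_hom)+
qed

text \<open>A basis of \<open>\<complex>\<close> over \<open>\<rat>\<close> is chosen.
  \<open>B\<close> contains the finitely many basis elements occurring in \<open>Z\<close>, the
  \<open>\<psi> h\<close> are coordinate functionals, and \<open>\<psi>0\<close> is a rescaled
  coordinate that is nonzero on 1.\<close>

lemma rational_coordinates:
 assumes "finite Z"
 obtains B :: "complex set" and \<psi> :: "complex => complex => rat" and \<psi>0 :: "complex => rat" where "finite B"
  "!!h c d. \<psi> h (c + d) = \<psi> h c + \<psi> h d" "!!z. z \<in> Z ==> (\<Sum>h\<in>B. of_rat (\<psi> h z) * h) = z"
  "!!c d. \<psi>0 (c + d) = \<psi>0 c + \<psi>0 d" "!!q c. \<psi>0 (of_rat q * c) = q * \<psi>0 c" "\<psi>0 1 = 1"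
proof -
 interpret V: vector_space "\<lambda>q :: rat. \<lambda>z :: complex. of_rat q * z"
  by unfold_locales (simp_all add: of_rat_add of_rat_mult distrib_left distrib_right)
 define B0 where "B0 = V.extend_basis {}"
 have B0: "V.independent B0" "V.span B0 = UNIV"
  unfolding B0_def using V.independent_extend_basis[OF V.independent_empty] V.span_extend_basis[OF V.independent_empty] by auto
 define r where "r = V.representation B0"
 have r_add: "r (c + d) h = r c h + r d h" for c d h unfolding r_def using V.representation_add[OF B0(1)] B0(2) by simp
 have r_scale: "r (of_rat q * c) h = q * r c h" for q c h unfolding r_def using V.representation_scale[OF B0(1)] B0(2) by simp
 have r_fin: "finite {h. r z h ~= 0}" for z unfolding r_def by (rule V.finite_representation)
 have r_sum: "(\<Sum>h | r z h ~= 0. of_rat (r z h) * h) = z" for z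
  unfolding r_def using V.sum_nonzero_representation_eq[OF B0(1)] B0(2) by simp
 define B where "B = (\<Union>z\<in>Z. {h. r z h ~= 0})"
 have fB: "finite B" unfolding B_def using assms r_fin by blast
 have zB: "(\<Sum>h\<in>B. of_rat (r z h) * h) = z" if "z \<in> Z" for z
 proof -
  have "(\<Sum>h\<in>B. of_rat (r z h) * h) = (\<Sum>h | r z h ~= 0. of_rat (r z h) * h)"
   by (rule sum.mono_neutral_right[OF fB]) (use that in \<open>auto simp: B_def\<close>)
  then show ?thesis unfolding r_sum .
 qed
 \<comment> \<open>A coordinate in which 1 does not vanish; dividing by its value at 1 normalizes
   \<open>\<psi>0\<close>.\<close>
 have "\<exists>h0. r 1 h0 ~= 0"
 proof (rule ccontr)
  assume "\<not> (\<exists>h0. r 1 h0 ~= 0)"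
  then have "{h. r 1 h ~= 0} = {}" by blast
  then show False using r_sum[of 1] by simp
 qed
 then obtain h0 where h0: "r 1 h0 ~= 0" by blast
 show thesis
 proof (rule that[of B "\<lambda>h z. r z h" "\<lambda>z. r z h0 / r 1 h0"])
 qed (use fB zB h0 in \<open>auto simp: r_add r_scale add_divide_distrib\<close>)
qed

section \<open>Equivariant matrices\<close>

context symp_functor
begin

interpretation C: functor_points D' TH bl n cf Q P D f CR cid by (rule points[OF complex_self])
interpretation R: symmetric_rep TH bl qe Pe by (rule symmetric_rep_qe)

abbreviation "Lm \<equiv> TH \<times> (UNIV :: bool set)"
text \<open>The operators \<open>xx t l\<close> are applied to one basis vector \<open>a\<close>, so
  that \<open>l\<close> becomes a column index. Equivariance of the columns \<open>xx\<close> turns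
  into equivariance of a matrix from the standard representation to \<open>V\<close>. Dually,
  \<open>TT\<close> reads off the component \<open>a\<close> of the \<open>yy t l\<close>.\<close>

definition "SS t a = (\<lambda>(i, l) \<in> I2 \<times> Lm. Rep_linop (R.xx t l) (unitv a) i)"
definition "TT t a = (\<lambda>(l, i) \<in> Lm \<times> I2. Rep_linop (R.yy t l) (unitv i) a)"
text \<open>The nilpotent part of the transvection with parameter \<open>ymat al be\<close> in the
  standard representation; \<open>Em\<close> below is the matrix of \<open>h(\<i>)\<close>
  there.\<close>

definition "Nm b al be = (\<lambda>(l, m) \<in> Lm \<times> Lm. if snd l = b \<and> snd m = (\<not> b) then complex_of_real (ymat al be (fst l) (fst m)) else 0)"
definition "Em = (\<lambda>(l, m) \<in> Lm \<times> Lm. if l = m then eps (snd l) else 0)"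

lemma ST_mats: "SS t a \<in> mats CR I2 Lm" "TT t a \<in> mats CR Lm I2" "Nm b al be \<in> mats CR Lm Lm" "Em \<in> mats CR Lm Lm"
 by (rule mats_memI; simp add: SS_def TT_def Nm_def Em_def)+

lemma finL: "finite Lm" using finT by simp

lemma sum_Lm: "(\<Sum>m\<in>Lm. g m) = (\<Sum>\<theta>\<in>TH. g (\<theta>, b) + g (\<theta>, \<not> b))" for g :: "'t \<times> bool => complex"
proof -
 have "(\<Sum>m\<in>Lm. g m) = (\<Sum>\<theta>\<in>TH. \<Sum>c\<in>UNIV. g (\<theta>, c))" by (simp add: sum.cartesian_product split_def)
 also have "\<dots> = (\<Sum>\<theta>\<in>TH. g (\<theta>, b) + g (\<theta>, \<not> b))" by (rule sum.cong[OF refl]) (cases b; simp add: UNIV_bool add.commute)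
 finally show ?thesis .
qed

lemma ymat_sum:
 assumes "al \<in> TH" "be \<in> TH"
 shows "(\<Sum>\<theta>\<in>TH. u \<theta> * complex_of_real (ymat al be \<theta> \<zeta>)) = (if \<zeta> = be then u al else 0) + (if \<zeta> = al then u be else 0)"
proof -
 have "(\<Sum>\<theta>\<in>TH. u \<theta> * complex_of_real (ymat al be \<theta> \<zeta>)) =
  (\<Sum>\<theta>\<in>TH. (if \<theta> = al then if \<zeta> = be then u al else 0 else 0) + (if \<theta> = be then if \<zeta> = al then u be else 0 else 0))"
  by (rule sum.cong[OF refl]) (simp add: ymat_def distrib_left)
 then show ?thesis using assms finT by (simp add: sum.distrib)
qed

context
 fixes t al be :: 't and b :: bool assumes t: "t \<in> TH" and ab: "al \<in> TH" "be \<in> TH" "bl al = bl be"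
begin

text \<open>The transformation rule of \<open>xx\<close> in \<open>bimodule_maps\<close>, read entry
  by entry. The two cases distinguish columns killed by \<open>q b\<close> from columns moved to the
  opposite half.\<close>

lemma q_SS: "mmul CR I2 I2 Lm (qm b (ymat al be)) (SS t a) = mmul CR I2 Lm Lm (SS t a) (Nm b al be)"
proof (rule mats_eqI[of _ CR I2 Lm])
 fix i l assume i: "i \<in> I2" "l \<in> Lm"
 have "mmul CR I2 I2 Lm (qm b (ymat al be)) (SS t a) (i, l) = (\<Sum>j\<in>I2. qm b (ymat al be) (i, j) * Rep_linop (R.xx t l) (unitv a) j)"
  using i fin2(1) by (simp add: mmul_entry SS_def)
 then have L: "mmul CR I2 I2 Lm (qm b (ymat al be)) (SS t a) (i, l) = Rep_linop (qe b (ymat al be) * R.xx t l) (unitv a) i"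
  unfolding Rep_emb_left[OF i(1)] qe_def .
 have Rr: "mmul CR I2 Lm Lm (SS t a) (Nm b al be) (i, l) = (\<Sum>m\<in>Lm. SS t a (i, m) * Nm b al be (m, l))"
  using i finL by (simp only: mmul_entry finsum_type type_ring_simps if_True)
 show "mmul CR I2 I2 Lm (qm b (ymat al be)) (SS t a) (i, l) = mmul CR I2 Lm Lm (SS t a) (Nm b al be) (i, l)"
  using i(2)
 proof (cases l rule: C.A.Lam_cases[where b = b])
  case (1 \<zeta>)
  have "(\<Sum>m\<in>Lm. SS t a (i, m) * Nm b al be (m, l)) = 0"
   by (rule sum.neutral) (use 1 in \<open>auto simp: Nm_def\<close>)
  then show ?thesis unfolding L Rr using R.bimodule_maps(2)[OF t ab 1(1), of b] 1(2) by (simp add: Rep_ops)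
 next
  case (2 \<zeta>)
  let ?X = "\<lambda>\<theta>. Rep_linop (R.xx t (\<theta>, b)) (unitv a) i"
  have "(\<Sum>m\<in>Lm. SS t a (i, m) * Nm b al be (m, l)) = (\<Sum>\<theta>\<in>TH. ?X \<theta> * complex_of_real (ymat al be \<theta> \<zeta>))"
   unfolding sum_Lm[of _ b] by (rule sum.cong[OF refl]) (use 2 i in \<open>simp add: Nm_def SS_def\<close>)
  then have "mmul CR I2 Lm Lm (SS t a) (Nm b al be) (i, l) = (if \<zeta> = be then ?X al else 0) + (if \<zeta> = al then ?X be else 0)"
   unfolding Rr ymat_sum[OF ab(1,2)] .
  then show ?thesis unfolding L unfolding 2(2) R.bimodule_maps(1)[OF t ab 2(1)]
   by (cases "\<zeta> = be"; cases "\<zeta> = al") (simp_all add: Rep_ops)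
 qed
qed (intro C.A.mmul_mats qm_mats[OF R.bs_ymat[OF ab]] ST_mats)+

lemma TT_q: "mmul CR Lm I2 I2 (TT t a) (qm b (ymat al be)) = mmul CR Lm Lm I2 (Nm b al be) (TT t a)"
proof (rule mats_eqI[of _ CR Lm I2])
 fix l i assume i: "l \<in> Lm" "i \<in> I2"
 have "mmul CR Lm I2 I2 (TT t a) (qm b (ymat al be)) (l, i) = (\<Sum>j\<in>I2. Rep_linop (R.yy t l) (unitv j) a * qm b (ymat al be) (j, i))"
  using i fin2(1) by (simp add: mmul_entry TT_def)
 then have L: "mmul CR Lm I2 I2 (TT t a) (qm b (ymat al be)) (l, i) = Rep_linop (R.yy t l * qe b (ymat al be)) (unitv i) a"
  unfolding Rep_emb_right[OF fin2(1) i(2)] qe_def .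
 have Rr: "mmul CR Lm Lm I2 (Nm b al be) (TT t a) (l, i) = (\<Sum>m\<in>Lm. Nm b al be (l, m) * TT t a (m, i))"
  using i finL by (simp only: mmul_entry finsum_type type_ring_simps if_True)
 show "mmul CR Lm I2 I2 (TT t a) (qm b (ymat al be)) (l, i) = mmul CR Lm Lm I2 (Nm b al be) (TT t a) (l, i)"
  using i(1)
 proof (cases l rule: C.A.Lam_cases[where b = b])
  case (2 \<zeta>)
  have "(\<Sum>m\<in>Lm. Nm b al be (l, m) * TT t a (m, i)) = 0"
   by (rule sum.neutral) (use 2 in \<open>auto simp: Nm_def\<close>)
  then show ?thesis unfolding L Rr using R.bimodule_maps(4)[OF t ab 2(1), of b] 2(2) by (simp add: Rep_ops)
 next
  case (1 \<zeta>)
  let ?X = "\<lambda>\<theta>. Rep_linop (R.yy t (\<theta>, \<not> b)) (unitv i) a"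
  have "(\<Sum>m\<in>Lm. Nm b al be (l, m) * TT t a (m, i)) = (\<Sum>\<theta>\<in>TH. ?X \<theta> * complex_of_real (ymat al be \<theta> \<zeta>))"
   unfolding sum_Lm[of _ b] by (rule sum.cong[OF refl]) (use 1 i ymat_commute[of al be \<zeta>] in \<open>simp add: Nm_def TT_def mult.commute\<close>)
  then have "mmul CR Lm Lm I2 (Nm b al be) (TT t a) (l, i) = (if \<zeta> = be then ?X al else 0) + (if \<zeta> = al then ?X be else 0)"
   unfolding Rr ymat_sum[OF ab(1,2)] .
  then show ?thesis unfolding L unfolding 1(2) R.bimodule_maps(3)[OF t ab 1(1)]
   by (cases "\<zeta> = be"; cases "\<zeta> = al") (simp_all add: Rep_ops)
 qed
qed (intro C.A.mmul_mats qm_mats[OF R.bs_ymat[OF ab]] ST_mats)+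

end

text \<open>Being fixed by \<open>Pe c\<close> means that \<open>F\<close> is half of
  \<open>F\<close> minus \<open>eps c\<close> times its image under \<open>jj\<close>; solving for
  that image uses that \<open>eps c\<close> has square -1.\<close>

lemma jj_act: "Pe c * F = F ==> jj * F = cscale (eps c) F" "F * Pe c = F ==> F * jj = cscale (eps c) F"
proof -
 have m: "cscale (-1) G = - G" for G :: "'v2 linop" using cscale_simps(7)[of "-1" G] by simp
 have key: "H = cscale (eps c) F" if "F = (1/2 :: real) *\<^sub>R (F - cscale (eps c) H)" for H F :: "'v2 linop"
 proof -
  have "2 *\<^sub>R F = F - cscale (eps c) H" using that by (metis scaleR_scaleR scaleR_one mult.commute times_divide_eq_left mult_1 divide_self_if zero_neq_numeral)
  then have "cscale (eps c) H + F = 0" by (simp add: scaleR_2 algebra_simps)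
  then have "cscale (eps c) H = - F" by (simp only: eq_neg_iff_add_eq_0)
  then have "cscale (eps c) (cscale (eps c) H) = cscale (eps c) (cscale (-1) F)" unfolding m by simp
  then have "cscale (-1) H = cscale (-1) (cscale (eps c) F)" unfolding cscale_simps eps_eps by (simp only: mult.commute)
  then show ?thesis unfolding m by simp
 qed
 have e: "eone * Pe c = Pe c" "Pe c * eone = Pe c" unfolding PP2(1)[of c, symmetric] by (simp_all add: distrib_left distrib_right Pe(1,2,4))
 show "jj * F = cscale (eps c) F" if F: "Pe c * F = F"
 proof (rule key)
  have "eone * F = F" using e(1) F by (metis mult.assoc)
  then show "F = (1/2 :: real) *\<^sub>R (F - cscale (eps c) (jj * F))" using F unfolding Pe_def by (simp add: left_diff_distrib cscale_simps)
 qed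
 show "F * jj = cscale (eps c) F" if F: "F * Pe c = F"
 proof (rule key)
  have "F * eone = F" using e(2) F by (metis mult.assoc)
  then show "F = (1/2 :: real) *\<^sub>R (F - cscale (eps c) (F * jj))" using F unfolding Pe_def by (simp add: right_diff_distrib cscale_simps)
 qed
qed

lemma JV_SS:
 assumes t: "t \<in> TH"
 shows "mmul CR I2 I2 Lm JV (SS t a) = mmul CR I2 Lm Lm (SS t a) Em" "mmul CR Lm I2 I2 (TT t a) JV = mmul CR Lm Lm I2 Em (TT t a)"
proof -
 have x: "jj * R.xx t l = cscale (eps (snd l)) (R.xx t l)" "R.yy t l * jj = cscale (eps (snd l)) (R.yy t l)" if "l \<in> Lm" for l
  using jj_act(1)[OF R.bimodule_maps(5)[OF t _ _ refl, of "fst l" "fst l" "snd l"]] jj_act(2)[OF R.bimodule_maps(6)[OF t _ _ refl, of "fst l" "fst l" "snd l"]] that by auto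
 show "mmul CR I2 I2 Lm JV (SS t a) = mmul CR I2 Lm Lm (SS t a) Em"
 proof (rule mats_eqI[of _ CR I2 Lm])
  fix i l assume i: "i \<in> I2" "l \<in> Lm"
  have "mmul CR I2 I2 Lm JV (SS t a) (i, l) = (\<Sum>j\<in>I2. JV (i, j) * Rep_linop (R.xx t l) (unitv a) j)"
   using i fin2(1) by (simp add: mmul_entry SS_def)
  also have "\<dots> = eps (snd l) * SS t a (i, l)"
   unfolding Rep_emb_left[OF i(1)] jj_def[symmetric] x(1)[OF i(2)] Rep_cscale using i by (simp add: SS_def)
  also have "\<dots> = (\<Sum>m\<in>Lm. if m = l then eps (snd l) * SS t a (i, l) else 0)" using i finL by simp
  also have "\<dots> = (\<Sum>m\<in>Lm. SS t a (i, m) * Em (m, l))" by (rule sum.cong[OF refl]) (use i in \<open>auto simp: Em_def\<close>)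
  also have "\<dots> = mmul CR I2 Lm Lm (SS t a) Em (i, l)" using i finL by (simp only: mmul_entry finsum_type type_ring_simps if_True)
  finally show "mmul CR I2 I2 Lm JV (SS t a) (i, l) = mmul CR I2 Lm Lm (SS t a) Em (i, l)" .
 qed (use JV(1) C.A.mmul_mats ST_mats in blast)+
 show "mmul CR Lm I2 I2 (TT t a) JV = mmul CR Lm Lm I2 Em (TT t a)"
 proof (rule mats_eqI[of _ CR Lm I2])
  fix l i assume i: "l \<in> Lm" "i \<in> I2"
  have "mmul CR Lm I2 I2 (TT t a) JV (l, i) = (\<Sum>j\<in>I2. Rep_linop (R.yy t l) (unitv j) a * JV (j, i))"
   using i fin2(1) by (simp add: mmul_entry TT_def)
  also have "\<dots> = eps (snd l) * TT t a (l, i)"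
   unfolding Rep_emb_right[OF fin2(1) i(2)] jj_def[symmetric] x(2)[OF i(1)] Rep_cscale using i by (simp add: TT_def)
  also have "\<dots> = (\<Sum>m\<in>Lm. if m = l then eps (snd l) * TT t a (l, i) else 0)" using i finL by simp
  also have "\<dots> = (\<Sum>m\<in>Lm. Em (l, m) * TT t a (m, i))" by (rule sum.cong[OF refl]) (use i in \<open>auto simp: Em_def\<close>)
  also have "\<dots> = mmul CR Lm Lm I2 Em (TT t a) (l, i)" using i finL by (simp only: mmul_entry finsum_type type_ring_simps if_True)
  finally show "mmul CR Lm I2 I2 (TT t a) JV (l, i) = mmul CR Lm Lm I2 Em (TT t a) (l, i)" .
 qed (use JV(1) C.A.mmul_mats ST_mats in blast)+
qed

text \<open>Summing over \<open>a\<close> recomposes the operator products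
  \<open>xx t l * yy t l\<close>, whose total is the identity by
  \<open>sum_bimodule_maps\<close>.\<close>

lemma SS_TT:
 assumes i: "i \<in> I2" "j \<in> I2"
 shows "(\<Sum>t\<in>TH. \<Sum>a\<in>I2. \<Sum>l\<in>Lm. SS t a (i, l) * TT t a (l, j)) = (if i = j then 1 else 0)"
proof -
 have e: "emb I2 (mone CR I2) * R.yy t l = R.yy t l" if t: "t \<in> TH" "l \<in> Lm" for t l
 proof -
  have "Pe True * R.yy t l = R.yy t l"
   using R.bimodule_maps(7)[OF t(1) _ _ refl, of "fst l" "fst l" "snd l"] t(2) by auto
  moreover have "eone * Pe True = Pe True" unfolding PP2(1)[of True, symmetric] by (simp add: distrib_right Pe(1) Pe(4)[of True, simplified])
  ultimately show ?thesis unfolding eone_def by (metis mult.assoc)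
 qed
 have "(\<Sum>t\<in>TH. \<Sum>a\<in>I2. \<Sum>l\<in>Lm. SS t a (i, l) * TT t a (l, j)) =
  (\<Sum>t\<in>TH. \<Sum>l\<in>Lm. \<Sum>a\<in>I2. Rep_linop (R.xx t l) (unitv a) i * Rep_linop (R.yy t l) (unitv j) a)"
  by (rule sum.cong[OF refl], subst sum.swap) (use i in \<open>auto simp: SS_def TT_def intro!: sum.cong\<close>)
 also have "\<dots> = (\<Sum>t\<in>TH. \<Sum>l\<in>Lm. Rep_linop (R.xx t l * R.yy t l) (unitv j) i)"
  by (intro sum.cong refl) (simp add: Rep_product[OF fin2(1) e])
 also have "\<dots> = Rep_linop (\<Sum>t\<in>TH. \<Sum>l\<in>Lm. R.xx t l * R.yy t l) (unitv j) i" by (simp only: Rep_sum)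
 also have "\<dots> = (if i = j then 1 else 0)"
  unfolding R.sum_bimodule_maps PP2(2) eone_def emb_entry[OF fin2(1) i] using i by (simp add: mone_entry)
 finally show ?thesis .
qed

text \<open>The coordinates with first index 0, present in every block, select one copy of each
  standard representation inside \<open>V'\<close>. Composing with \<open>P0\<close> and
  \<open>Q0\<close> turns maps between \<open>V\<close> and the standard representation into maps
  between \<open>V\<close> and \<open>V'\<close>.\<close>

definition "P0 = (\<lambda>(l, j) \<in> Lm \<times> I1. P ((0, l), j))"
definition "Q0 = (\<lambda>(i, l) \<in> I1 \<times> Lm. Q (i, (0, l)))"
definition "S1 t a = mmul CR I2 Lm I1 (SS t a) P0"
definition "T1 t a = mmul CR I1 Lm I2 Q0 (TT t a)"

lemma PQ0_mats: "P0 \<in> mats CR Lm I1" "Q0 \<in> mats CR I1 Lm" "S1 t a \<in> mats CR I2 I1" "T1 t a \<in> mats CR I1 I2"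
proof -
 show p: "P0 \<in> mats CR Lm I1" "Q0 \<in> mats CR I1 Lm" by (rule mats_memI; simp add: P0_def Q0_def)+
 show "S1 t a \<in> mats CR I2 I1" "T1 t a \<in> mats CR I1 I2"
  unfolding S1_def T1_def using p ST_mats C.A.mmul_mats by blast+
qed

lemma P0_Q0: "mmul CR Lm I1 Lm P0 Q0 = mone CR Lm"
proof (rule mats_eqI[of _ CR Lm Lm])
 fix l m assume lm: "l \<in> Lm" "m \<in> Lm"
 have "mmul CR Lm I1 Lm P0 Q0 (l, m) = mmul CR (Xi TH bl n) I1 (Xi TH bl n) P Q ((0, l), (0, m))"
  using lm C.A.Xi_zero[OF lm(1)] C.A.Xi_zero[OF lm(2)] finV by (simp only: mmul_entry finsum_type type_ring_simps if_True) (simp add: P0_def Q0_def)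
 then show "mmul CR Lm I1 Lm P0 Q0 (l, m) = mone CR Lm (l, m)"
  unfolding PQ using lm C.A.Xi_zero[OF lm(1)] C.A.Xi_zero[OF lm(2)] by (simp add: mone_entry)
qed (use PQ0_mats C.A.mmul_mats C.A.mone_mats in blast)+

lemma S1_T1:
 assumes i: "i \<in> I2" "j \<in> I2"
 shows "(\<Sum>t\<in>TH. \<Sum>a\<in>I2. \<Sum>l\<in>I1. S1 t a (i, l) * T1 t a (l, j)) = (if i = j then 1 else 0)"
proof -
 have "mmul CR I2 I1 I2 (S1 t a) (T1 t a) = mmul CR I2 Lm I2 (SS t a) (mmul CR Lm Lm I2 (mmul CR Lm I1 Lm P0 Q0) (TT t a))" for t a
  unfolding S1_def T1_def using finL finV ST_mats(1,2) PQ0_mats(1,2) by (simp add: C.A.mmul_assoc)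
 then have e: "mmul CR I2 I1 I2 (S1 t a) (T1 t a) = mmul CR I2 Lm I2 (SS t a) (TT t a)" for t a
  unfolding P0_Q0 C.A.mmul_one_left[OF finL ST_mats(2)] .
 have "(\<Sum>l\<in>I1. S1 t a (i, l) * T1 t a (l, j)) = (\<Sum>l\<in>Lm. SS t a (i, l) * TT t a (l, j))" for t a
  using fun_cong[OF e[of t a], of "(i, j)"] i finV finL by (simp only: mmul_entry finsum_type type_ring_simps if_True)
 then show ?thesis using SS_TT[OF i] by simp
qed

end

section \<open>Equivariance over complex local algebras\<close>

context functor_points
begin

abbreviation "SA t a \<equiv> mbase I2 Lm \<phi> (SS t a)"
abbreviation "TA t a \<equiv> mbase Lm I2 \<phi> (TT t a)"
abbreviation "G1 \<equiv> carrier (PEL_group D' A)"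

text \<open>The elements on which both families of matrices intertwine \<open>f\<close> with the
  standard representation; this is the property fed into
  \<open>symplectic_generation\<close>.\<close>

definition "good h \<longleftrightarrow> A.blk h \<and> A.iota h \<in> G1 \<and> (\<forall>t\<in>TH. \<forall>a\<in>I2.
 mmul A I2 I2 Lm (f A (A.iota h)) (SA t a) = mmul A I2 Lm Lm (SA t a) h \<and>
 mmul A Lm I2 I2 (TA t a) (f A (A.iota h)) = mmul A Lm Lm I2 h (TA t a))"

lemma STA_mats: "SA t a \<in> mats A I2 Lm" "TA t a \<in> mats A Lm I2"
 using ST_mats by simp_all

lemma fA_mats: "g \<in> G1 ==> f A g \<in> mats A I2 I2"
 by (rule f_mats[OF A.rat_algebra])

lemma goodD: "good h ==> h \<in> mats A Lm Lm" "good h ==> A.iota h \<in> G1" "good h ==> A.blk h" "good h ==> f A (A.iota h) \<in> mats A I2 I2"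
 "good h ==> t \<in> TH ==> a \<in> I2 ==> mmul A I2 I2 Lm (f A (A.iota h)) (SA t a) = mmul A I2 Lm Lm (SA t a) h"
 "good h ==> t \<in> TH ==> a \<in> I2 ==> mmul A Lm I2 I2 (TA t a) (f A (A.iota h)) = mmul A Lm Lm I2 h (TA t a)"
 unfolding good_def using fA_mats A.blk_mats by blast+

text \<open>Torus elements and elementary transvections are both affine in one fixed complex matrix,
  on the side of \<open>V\<close> as on the standard side. Equivariance over \<open>A\<close> thus
  reduces to an intertwining relation over \<open>\<complex>\<close>, used for the pair
  \<open>JV\<close>, \<open>Em\<close> and for the pair \<open>qm\<close>,
  \<open>Nm\<close>.\<close>

lemma good_lin:
 assumes h: "A.blk h" "A.iota h \<in> G1" "c1 \<in> carrier A" "c2 \<in> carrier A" and MN: "M \<in> mats CR I2 I2" "N \<in> mats CR Lm Lm"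
  and e: "f A (A.iota h) = madd A I2 I2 (msc A I2 I2 c1 (mone A I2)) (msc A I2 I2 c2 (mbase I2 I2 \<phi> M))"
   "h = madd A Lm Lm (msc A Lm Lm c1 (mone A Lm)) (msc A Lm Lm c2 (mbase Lm Lm \<phi> N))"
  and r: "!!t a. t \<in> TH ==> mmul CR I2 I2 Lm M (SS t a) = mmul CR I2 Lm Lm (SS t a) N"
   "!!t a. t \<in> TH ==> mmul CR Lm I2 I2 (TT t a) M = mmul CR Lm Lm I2 N (TT t a)"
 shows "good h"
 unfolding good_def
proof (intro conjI ballI h(1,2))
 fix t a assume t: "t \<in> TH"
 let ?M = "mbase I2 I2 \<phi> M" and ?N = "mbase Lm Lm \<phi> N"
 have m: "?M \<in> mats A I2 I2" "?N \<in> mats A Lm Lm" using MN by simp_all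
 have r1: "mmul A I2 I2 Lm ?M (SA t a) = mmul A I2 Lm Lm (SA t a) ?N"
  using r(1)[OF t, of a] A.cx.mbase_mmul[OF fin2(1) MN(1) ST_mats(1)] A.cx.mbase_mmul[OF finL ST_mats(1) MN(2)] by metis
 have r2: "mmul A Lm I2 I2 (TA t a) ?M = mmul A Lm Lm I2 ?N (TA t a)"
  using r(2)[OF t, of a] A.cx.mbase_mmul[OF fin2(1) ST_mats(2) MN(1)] A.cx.mbase_mmul[OF finL MN(2) ST_mats(2)] by metis
 note s = STA_mats m h(3,4) fin2(1) finL
 show "mmul A I2 I2 Lm (f A (A.iota h)) (SA t a) = mmul A I2 Lm Lm (SA t a) h"
  unfolding e(1) by (subst e(2)) (use s in \<open>simp add: A.mmul_add_left A.mmul_add_right A.mmul_msc_left A.mmul_msc_right r1\<close>)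
 show "mmul A Lm I2 I2 (TA t a) (f A (A.iota h)) = mmul A Lm Lm I2 h (TA t a)"
  unfolding e(1) by (subst e(2)) (use s in \<open>simp add: A.mmul_add_left A.mmul_add_right A.mmul_msc_left A.mmul_msc_right r2\<close>)
qed

lemma good_lam:
 assumes u: "u \<in> Units A"
 shows "good (A.lam b u)"
proof (rule good_lin[OF _ A.lam_group[OF u] _ _ JV(1) ST_mats(4) f_lam[OF u]])
 have uc: "u \<in> carrier A" using u by (rule A.Units_closed)
 show "A.blk (A.lam b u)" using uc by simp
 show c: "A.ta u \<in> carrier A" "A.tc b u \<in> carrier A" using uc by (auto simp: A.minus_closed)
 show "A.lam b u = madd A Lm Lm (msc A Lm Lm (A.ta u) (mone A Lm)) (msc A Lm Lm (A.tc b u) (mbase Lm Lm \<phi> Em))"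
 proof (rule mats_eqI[of _ A Lm Lm])
  fix l m assume lm: "l \<in> Lm" "m \<in> Lm"
  show "A.lam b u (l, m) = madd A Lm Lm (msc A Lm Lm (A.ta u) (mone A Lm)) (msc A Lm Lm (A.tc b u) (mbase Lm Lm \<phi> Em)) (l, m)"
   using A.torus_entry[OF uc, of b "snd l"] lm c
   by (cases "l = m") (simp_all add: A.lam_entry madd_entry msc_entry mone_entry mbase_entry Em_def split_def)
 qed (use uc c ST_mats(4) in auto)
qed (use JV_SS in auto)

text \<open>By \<open>pp_linear\<close> the image under \<open>f\<close> is affine in
  \<open>a\<close>, as is the transvection itself.\<close>

lemma good_elem:
 assumes a: "a \<in> carrier A" and ab: "al \<in> TH" "be \<in> TH" "bl al = bl be"
 shows "good (A.uni b (\<lambda>x y. a \<otimes>\<^bsub>A\<^esub> \<phi> (of_real (ymat al be x y))))"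
proof -
 let ?u = "A.uni b (\<lambda>x y. a \<otimes>\<^bsub>A\<^esub> \<phi> (of_real (ymat al be x y)))"
 interpret R: symmetric_rep TH bl qe Pe by (rule symmetric_rep_qe)
 have Y: "bsym TH bl (ymat al be)" using ab by (rule R.bs_ymat)
 note bs = bsy_real[OF Y a]
 have g: "A.iota ?u \<in> G1" by (rule A.uni_group[OF bs])
 have one: "\<one>\<^bsub>A\<^esub> \<in> carrier A" by simp
 show ?thesis
 proof (rule good_lin[OF A.uni_blk[OF bs] g one a qm_mats[OF Y] ST_mats(3)])
  show "f A (A.iota ?u) = madd A I2 I2 (msc A I2 I2 \<one>\<^bsub>A\<^esub> (mone A I2)) (msc A I2 I2 a (mbase I2 I2 \<phi> (qm b (ymat al be))))"
  proof (rule mats_eqI[of _ A I2 I2])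
   fix i j assume i: "i \<in> I2" "j \<in> I2"
   show "f A (A.iota ?u) (i, j) = madd A I2 I2 (msc A I2 I2 \<one>\<^bsub>A\<^esub> (mone A I2)) (msc A I2 I2 a (mbase I2 I2 \<phi> (qm b (ymat al be)))) (i, j)"
    unfolding f_uni_pev[OF Y a i] pp_linear[OF Y i] using i a
    by (cases "i = j") (simp_all add: A.pev_pCons madd_entry msc_entry mone_entry mbase_entry)
  qed (use fA_mats[OF g] a qm_mats[OF Y] in auto)
  show "?u = madd A Lm Lm (msc A Lm Lm \<one>\<^bsub>A\<^esub> (mone A Lm)) (msc A Lm Lm a (mbase Lm Lm \<phi> (Nm b al be)))"
  proof (rule mats_eqI[of _ A Lm Lm])
   fix l m assume lm: "l \<in> Lm" "m \<in> Lm"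
   show "?u (l, m) = madd A Lm Lm (msc A Lm Lm \<one>\<^bsub>A\<^esub> (mone A Lm)) (msc A Lm Lm a (mbase Lm Lm \<phi> (Nm b al be))) (l, m)"
    unfolding A.uni_entry[OF lm] madd_entry[OF lm] msc_entry[OF lm] mone_entry[OF lm] mbase_entry[OF lm]
    using lm a by (cases "l = m"; cases "snd l = b"; cases "snd m = (\<not> b)") (simp_all add: Nm_def split_def)
  qed (use a ST_mats(3) A.uni_mats[OF bs] in auto)
 qed (use q_SS TT_q ab in auto)
qed

lemma good_one: "good (mone A Lm)"
proof -
 interpret G: group "PEL_group D' A" by (rule A.PEL_group)
 have "mone A I1 \<in> G1" using G.one_closed by simp
 then show ?thesis unfolding good_def A.iota_one f_one[OF A.rat_algebra] using A.mone_blk STA_mats fin2(1) finL by simp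
qed

lemma good_mult:
 assumes "good h" "good h'"
 shows "good (A.lmul h h')"
 unfolding good_def
proof (intro conjI ballI)
 interpret G: group "PEL_group D' A" by (rule A.PEL_group)
 note h = goodD(1-4)[OF assms(1)] and h' = goodD(1-4)[OF assms(2)]
 have i: "A.iota (A.lmul h h') = mmul A I1 I1 I1 (A.iota h) (A.iota h')" by (rule A.iota_mult[OF h(3) h'(1)])
 show "A.blk (A.lmul h h')" by (rule A.mmul_blk[OF h(3) h'(3)])
 show "A.iota (A.lmul h h') \<in> G1" unfolding i using G.m_closed[OF h(2) h'(2)] by simp
 have F: "f A (A.iota (A.lmul h h')) = mmul A I2 I2 I2 (f A (A.iota h)) (f A (A.iota h'))"
  unfolding i by (rule f_mult[OF A.rat_algebra h(2) h'(2)])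
 fix t a assume t: "t \<in> TH" "a \<in> I2"
 note s = STA_mats[of t a] h(1,4) h'(1,4) fin2(1) finL
 have "mmul A I2 I2 Lm (f A (A.iota (A.lmul h h'))) (SA t a) = mmul A I2 Lm Lm (mmul A I2 I2 Lm (f A (A.iota h)) (SA t a)) h'"
  unfolding F using s by (simp add: A.mmul_assoc goodD(5)[OF assms(2) t])
 then show "mmul A I2 I2 Lm (f A (A.iota (A.lmul h h'))) (SA t a) = mmul A I2 Lm Lm (SA t a) (A.lmul h h')"
  unfolding goodD(5)[OF assms(1) t] using s by (simp add: A.mmul_assoc)
 have "mmul A Lm I2 I2 (TA t a) (f A (A.iota (A.lmul h h'))) = mmul A Lm I2 I2 (mmul A Lm I2 I2 (TA t a) (f A (A.iota h))) (f A (A.iota h'))"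
  unfolding F using s by (simp add: A.mmul_assoc)
 also have "\<dots> = mmul A Lm Lm I2 h (mmul A Lm I2 I2 (TA t a) (f A (A.iota h')))"
  unfolding goodD(6)[OF assms(1) t] using s by (simp add: A.mmul_assoc)
 finally show "mmul A Lm I2 I2 (TA t a) (f A (A.iota (A.lmul h h'))) = mmul A Lm Lm I2 (A.lmul h h') (TA t a)"
  unfolding goodD(6)[OF assms(2) t] using s by (simp add: A.mmul_assoc)
qed

text \<open>A symmetric matrix over \<open>A\<close> is a sum of multiples of \<open>ymat\<close>,
  and transvections turn sums into products. Real coefficients alone would not suffice, which is why
  \<open>good_elem\<close> allows any scalar from \<open>A\<close>.\<close>

lemma good_uni:
 assumes Y: "A.bsy Y"
 shows "good (A.uni b Y)"
proof -
 \<comment> \<open>The factor one half accounts for summing over ordered pairs: off the diagonal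
   each entry occurs twice, and on the diagonal \<open>ymat\<close> is twice the unit.\<close>
 define h where "h = \<phi> (1/2)"
 have h: "h \<in> carrier A" "h \<oplus>\<^bsub>A\<^esub> h = \<one>\<^bsub>A\<^esub>" unfolding h_def using A.phi_add[of "1/2" "1/2"] by simp_all
 define PS where "PS = {p \<in> TH \<times> TH. bl (fst p) = bl (snd p)}"
 have finP: "finite PS" unfolding PS_def using finT by simp
 define el where "el p x y = (h \<otimes>\<^bsub>A\<^esub> Y (fst p) (snd p)) \<otimes>\<^bsub>A\<^esub> \<phi> (of_real (ymat (fst p) (snd p) x y))" for p x y
 have Yc: "Y al be \<in> carrier A" if "al \<in> TH" "be \<in> TH" for al be using A.bsyD(1)[OF Y that] .
 have elc: "el p x y \<in> carrier A" if "p \<in> PS" for p x y using that Yc h(1) unfolding el_def PS_def by auto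
 interpret R: symmetric_rep TH bl qe Pe by (rule symmetric_rep_qe)
 have elg: "A.bsy (el p) \<and> good (A.uni b (el p))" if "p \<in> PS" for p
 proof -
  have p: "fst p \<in> TH" "snd p \<in> TH" "bl (fst p) = bl (snd p)" using that unfolding PS_def by auto
  have c: "h \<otimes>\<^bsub>A\<^esub> Y (fst p) (snd p) \<in> carrier A" using h Yc p by simp
  show ?thesis using bsy_real[OF R.bs_ymat[OF p] c] good_elem[OF c p] unfolding el_def by blast
 qed
 have "A.bsy (\<lambda>x y. finsum A (\<lambda>p. el p x y) F) \<and> good (A.uni b (\<lambda>x y. finsum A (\<lambda>p. el p x y) F))" if "finite F" "F \<subseteq> PS" for F
  using that
 proof (induction F rule: finite_induct)
  case empty
  have "A.bsy (\<lambda>x y. \<zero>\<^bsub>A\<^esub>)" unfolding A.bsy_def by simp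
  then show ?case using A.uni_zero good_one by simp
 next
  case (insert p F)
  have e: "(\<lambda>x y. finsum A (\<lambda>p. el p x y) (insert p F)) = (\<lambda>x y. el p x y \<oplus>\<^bsub>A\<^esub> finsum A (\<lambda>p. el p x y) F)"
   using insert.hyps insert.prems elc by (intro ext A.finsum_insert) auto
  have IH: "A.bsy (\<lambda>x y. finsum A (\<lambda>p. el p x y) F)" "good (A.uni b (\<lambda>x y. finsum A (\<lambda>p. el p x y) F))" using insert by auto
  have ep: "A.bsy (el p)" "good (A.uni b (el p))" using elg[of p] insert.prems by auto
  show ?case unfolding e using A.bsy_add[OF ep(1) IH(1)] good_mult[OF ep(2) IH(2)] unfolding A.uni_add[OF ep(1) IH(1)] by blast
 qed
 then have g: "good (A.uni b (\<lambda>x y. finsum A (\<lambda>p. el p x y) PS))" using finP by blast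
 have val: "finsum A (\<lambda>p. el p x y) PS = Y x y" if xy: "x \<in> TH" "y \<in> TH" for x y
 proof -
  let ?z = "h \<otimes>\<^bsub>A\<^esub> Y x y"
  have z: "?z \<in> carrier A" using h Yc xy by simp
  \<comment> \<open>For \<open>x\<close> and \<open>y\<close> in different blocks the pair is
    missing from \<open>PS\<close>, but then \<open>Y x y\<close> is zero.\<close>
  have d: "finsum A (\<lambda>p. if p = q then ?z else \<zero>\<^bsub>A\<^esub>) PS = ?z" if q: "q = (x, y) | q = (y, x)" for q
  proof (cases "bl x = bl y")
   case True
   then have "q \<in> PS" using q xy unfolding PS_def by auto
   then show ?thesis by (rule A.finsum_delta(2)[OF finP _ z])
  next
   case False
   then have z0: "?z = \<zero>\<^bsub>A\<^esub>" using A.bsyD(3)[OF Y xy] h by simp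
   show ?thesis unfolding z0 if_cancel by (rule A.finsum_zero)
  qed
  have sy: "Y y x = Y x y" using A.bsyD(2)[OF Y xy(2,1)] .
  have "finsum A (\<lambda>p. el p x y) PS = finsum A (\<lambda>p. (if p = (x, y) then ?z else \<zero>\<^bsub>A\<^esub>) \<oplus>\<^bsub>A\<^esub> (if p = (y, x) then ?z else \<zero>\<^bsub>A\<^esub>)) PS"
  proof (rule A.finsum_cong'[OF refl])
   fix p assume p: "p \<in> PS"
   then have pc: "fst p \<in> TH" "snd p \<in> TH" unfolding PS_def by auto
   have w: "h \<otimes>\<^bsub>A\<^esub> Y (fst p) (snd p) \<in> carrier A" using h Yc pc by simp
   have a1: "(x = fst p \<and> y = snd p) = (p = (x, y))" and a2: "(x = snd p \<and> y = fst p) = (p = (y, x))"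
    by (metis prod.collapse prod.inject)+
   let ?w = "h \<otimes>\<^bsub>A\<^esub> Y (fst p) (snd p)"
   have ym: "ymat (fst p) (snd p) x y = of_bool (p = (x, y)) + of_bool (p = (y, x))" by (simp only: ymat_def a1 a2)
   have two: "\<phi> 2 = \<one>\<^bsub>A\<^esub> \<oplus>\<^bsub>A\<^esub> \<one>\<^bsub>A\<^esub>" using A.phi_add[of 1 1] by simp
   have t: "\<phi> (of_real (of_bool c1 + of_bool c2)) = (if c1 then \<one>\<^bsub>A\<^esub> else \<zero>\<^bsub>A\<^esub>) \<oplus>\<^bsub>A\<^esub> (if c2 then \<one>\<^bsub>A\<^esub> else \<zero>\<^bsub>A\<^esub>)" for c1 c2 :: bool
    by (cases c1; cases c2) (simp_all add: two)
   have m: "?w \<otimes>\<^bsub>A\<^esub> (if p = q then \<one>\<^bsub>A\<^esub> else \<zero>\<^bsub>A\<^esub>) = (if p = q then ?z else \<zero>\<^bsub>A\<^esub>)" if q: "q = (x, y) | q = (y, x)" for q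
   proof (cases "p = q")
    case True
    have "?w = ?z"
     using q
    proof
     assume "q = (x, y)"
     then show ?thesis unfolding True by (simp only: fst_conv snd_conv)
    next
     assume "q = (y, x)"
     then show ?thesis unfolding True by (simp only: fst_conv snd_conv sy)
    qed
    then show ?thesis using True A.r_one[OF w] by simp
   next
    case False
    then show ?thesis using A.r_null[OF w] by (simp only: if_False)
   qed
   have o: "(if c then \<one>\<^bsub>A\<^esub> else \<zero>\<^bsub>A\<^esub>) \<in> carrier A" for c by (cases c) simp_all
   show "el p x y = (if p = (x, y) then ?z else \<zero>\<^bsub>A\<^esub>) \<oplus>\<^bsub>A\<^esub> (if p = (y, x) then ?z else \<zero>\<^bsub>A\<^esub>)"
    unfolding el_def ym t A.r_distr[OF o o w] m[OF disjI1[OF refl]] m[OF disjI2[OF refl]] by (rule refl)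
  next
   show "(\<lambda>p. (if p = (x, y) then ?z else \<zero>\<^bsub>A\<^esub>) \<oplus>\<^bsub>A\<^esub> (if p = (y, x) then ?z else \<zero>\<^bsub>A\<^esub>)) \<in> PS \<rightarrow> carrier A"
    by (rule Pi_I) (simp add: z)
  qed
  also have "\<dots> = finsum A (\<lambda>p. if p = (x, y) then ?z else \<zero>\<^bsub>A\<^esub>) PS \<oplus>\<^bsub>A\<^esub> finsum A (\<lambda>p. if p = (y, x) then ?z else \<zero>\<^bsub>A\<^esub>) PS"
   by (rule A.finsum_addf; rule Pi_I; simp add: z)
  also have "\<dots> = ?z \<oplus>\<^bsub>A\<^esub> ?z" unfolding d[OF disjI1[OF refl]] d[OF disjI2[OF refl]] by (rule refl)
  also have "\<dots> = Y x y"
   unfolding A.l_distr[OF h(1) h(1) Yc[OF xy], symmetric] h(2) by (rule A.l_one[OF Yc[OF xy]])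
  finally show ?thesis .
 qed
 have "A.uni b (\<lambda>x y. finsum A (\<lambda>p. el p x y) PS) = A.uni b Y"
  unfolding A.uni_def by (rule ext) (auto simp: val restrict_def)
 then show ?thesis using g by simp
qed

text \<open>Multiplying by a torus element with the inverse multiplier makes the point symplectic;
  both factors are good, by \<open>good_lam\<close> and by generation.\<close>

lemma good_all:
 assumes M: "ideal M A" "\<one>\<^bsub>A\<^esub> \<notin> M" "!!x. x \<in> carrier A ==> x \<notin> M ==> x \<in> Units A" and g: "g \<in> G1"
 obtains h where "g = A.iota h" "good h"
proof -
 have gs: "good h" if "A.sp h" for h
 proof (rule A.symplectic_generation[where good = good, OF M good_one _ that])
  fix b Y h assume a: "A.bsy Y" "A.sp h" "good (A.lmul (A.uni b Y) h)"
  note m = A.spD(2)[OF a(2)] A.uni_mats[OF a(1)] A.uni_mats[OF A.bsy_uminus[OF a(1)]]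
  have "A.lmul (A.uni b (\<lambda>al be. \<ominus>\<^bsub>A\<^esub> Y al be)) (A.lmul (A.uni b Y) h) = h"
   unfolding A.mmul_assoc[OF finL finL m(3,2,1), symmetric] A.uni_inverse(2)[OF a(1)] by (rule A.mmul_one_left[OF finL m(1)])
  then show "good h" using good_mult[OF good_uni[OF A.bsy_uminus[OF a(1)]] a(3)] by metis
 qed auto
 obtain h h' \<mu> where h: "g = A.iota h" "A.blk h" "\<mu> \<in> Units A" "A.form h = msc A Lm Lm \<mu> A.Om" using A.group_iota[OF g] by metis
 have i: "inv\<^bsub>A\<^esub> \<mu> \<in> carrier A" "\<mu> \<in> carrier A" "inv\<^bsub>A\<^esub> \<mu> \<otimes>\<^bsub>A\<^esub> \<mu> = \<one>\<^bsub>A\<^esub>" using h(3) A.Units_closed by simp_all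
 \<comment> \<open>This product has multiplier 1.\<close>
 let ?h = "A.lmul (A.lam True (inv\<^bsub>A\<^esub> \<mu>)) h"
 note hm = A.blk_mats[OF h(2)]
 have "A.sp ?h"
  unfolding A.sp_def using A.form_mult[OF A.lam_mats[OF i(1), of True] hm i(1,2) A.form_lam[OF i(1)] h(4)] A.mmul_blk[OF A.lam_blk[OF i(1)] h(2)] i(3) by simp
 then have "good (A.lmul (A.lam True \<mu>) ?h)" using good_mult[OF good_lam[OF h(3)] gs] by blast
 moreover have "A.lmul (A.lam True \<mu>) ?h = h"
  unfolding A.mmul_assoc[OF finL finL A.lam_mats[OF i(2)] A.lam_mats[OF i(1)] hm, symmetric] A.lam_inverse(1)[OF h(3)] by (rule A.mmul_one_left[OF finL hm])
 ultimately show thesis using that h(1) by simp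
qed

text \<open>A point of the group acts on \<open>V'\<close> as \<open>1 \<otimes> h\<close>, so it
  preserves the part with first index 0 and acts there by \<open>h\<close>. The intertwining
  property of \<open>good\<close> passes through \<open>P0\<close> and \<open>Q0\<close>.\<close>

lemma equivariant_local:
 assumes M: "ideal M A" "\<one>\<^bsub>A\<^esub> \<notin> M" "!!x. x \<in> carrier A ==> x \<notin> M ==> x \<in> Units A" and g: "g \<in> G1" and t: "t \<in> TH" "a \<in> I2"
 shows "mmul A I2 I2 I1 (f A g) (mbase I2 I1 \<phi> (S1 t a)) = mmul A I2 I1 I1 (mbase I2 I1 \<phi> (S1 t a)) g"
  and "mmul A I1 I2 I2 (mbase I1 I2 \<phi> (T1 t a)) (f A g) = mmul A I1 I1 I2 g (mbase I1 I2 \<phi> (T1 t a))"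
proof -
 obtain h where h: "g = A.iota h" "good h" using good_all[OF M g] .
 let ?P = "mbase Lm I1 \<phi> P0" and ?Q = "mbase I1 Lm \<phi> Q0"
 have PQm: "?P \<in> mats A Lm I1" "?Q \<in> mats A I1 Lm" using PQ0_mats by simp_all
 have gm: "g \<in> mats A I1 I1" by (rule A.PEL_group_mats[OF g])
 note hm = goodD(1)[OF h(2)] and Fm = goodD(4)[OF h(2), folded h(1)]
 have sm: "A.st h \<in> mats A A.\<Xi> A.\<Xi>" "A.PA \<in> mats A A.\<Xi> I1" "A.QA \<in> mats A I1 A.\<Xi>" using hm by simp_all
 \<comment> \<open>In the adapted coordinates the point acts by \<open>st h\<close>; the truncation
   to first index 0 follows below.\<close>
 have Pg: "mmul A A.\<Xi> I1 I1 A.PA g = mmul A A.\<Xi> A.\<Xi> I1 (A.st h) A.PA"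
  unfolding h(1) A.iota_def A.bc.cjm_def using sm by simp
 have gQ: "mmul A I1 I1 A.\<Xi> g A.QA = mmul A I1 A.\<Xi> A.\<Xi> A.QA (A.st h)"
  unfolding h(1) A.iota_def A.bc.cjm_def using sm finV by (simp add: A.mmul_assoc A.bc.PQ)
 have z: "(0, l) \<in> A.\<Xi>" if "l \<in> Lm" for l using A.Xi_zero[OF that] .
 have P: "mmul A Lm I1 I1 ?P g = mmul A Lm Lm I1 h ?P"
 proof (rule mats_eqI[of _ A Lm I1])
  fix l j assume l: "l \<in> Lm" "j \<in> I1"
  have "mmul A Lm I1 I1 ?P g (l, j) = mmul A A.\<Xi> I1 I1 A.PA g ((0, l), j)"
   using l z[OF l(1)] by (simp only: mmul_entry) (rule A.finsum_cong', auto simp: mbase_entry P0_def mats_entry[OF gm])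
  also have "\<dots> = finsum A (\<lambda>\<eta>. if 0 = fst \<eta> then h (l, snd \<eta>) \<otimes>\<^bsub>A\<^esub> ?P (snd \<eta>, j) else \<zero>\<^bsub>A\<^esub>) A.\<Xi>"
   unfolding Pg using l z[OF l(1)]
  proof (simp only: mmul_entry, intro A.finsum_cong'[OF refl])
   fix \<eta> assume e: "\<eta> \<in> A.\<Xi>"
   note s = A.snd_Xi[OF e]
   show "A.st h ((0, l), \<eta>) \<otimes>\<^bsub>A\<^esub> A.PA (\<eta>, j) = (if 0 = fst \<eta> then h (l, snd \<eta>) \<otimes>\<^bsub>A\<^esub> ?P (snd \<eta>, j) else \<zero>\<^bsub>A\<^esub>)"
    unfolding A.st_entry[OF z[OF l(1)] e] mbase_entry[OF e l(2)] mbase_entry[OF s l(2)] using s l by (cases \<eta>) (simp add: P0_def)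
  qed (use l hm in \<open>auto intro!: A.m_closed simp: mats_entry[OF hm] mats_entry[OF PQm(1)] A.snd_Xi\<close>)
  also have "\<dots> = finsum A (\<lambda>m. h (l, m) \<otimes>\<^bsub>A\<^esub> ?P (m, j)) Lm"
   by (rule A.finsum_Xi[where \<xi> = "(0, l)"]) (use z l in \<open>simp_all add: mats_entry[OF hm] mats_entry[OF PQm(1)]\<close>)
  also have "\<dots> = mmul A Lm Lm I1 h ?P (l, j)" using l by (simp only: mmul_entry)
  finally show "mmul A Lm I1 I1 ?P g (l, j) = mmul A Lm Lm I1 h ?P (l, j)" .
 qed (use PQm gm hm in simp_all)
 have Q: "mmul A I1 I1 Lm g ?Q = mmul A I1 Lm Lm ?Q h"
 proof (rule mats_eqI[of _ A I1 Lm])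
  fix i l assume l: "i \<in> I1" "l \<in> Lm"
  have "mmul A I1 I1 Lm g ?Q (i, l) = mmul A I1 I1 A.\<Xi> g A.QA (i, (0, l))"
   using l z[OF l(2)] by (simp only: mmul_entry) (rule A.finsum_cong', auto simp: mbase_entry Q0_def mats_entry[OF gm])
  also have "\<dots> = finsum A (\<lambda>\<eta>. if 0 = fst \<eta> then ?Q (i, snd \<eta>) \<otimes>\<^bsub>A\<^esub> h (snd \<eta>, l) else \<zero>\<^bsub>A\<^esub>) A.\<Xi>"
   unfolding gQ using l z[OF l(2)]
  proof (simp only: mmul_entry, intro A.finsum_cong'[OF refl])
   fix \<eta> assume e: "\<eta> \<in> A.\<Xi>"
   note s = A.snd_Xi[OF e]
   show "A.QA (i, \<eta>) \<otimes>\<^bsub>A\<^esub> A.st h (\<eta>, (0, l)) = (if 0 = fst \<eta> then ?Q (i, snd \<eta>) \<otimes>\<^bsub>A\<^esub> h (snd \<eta>, l) else \<zero>\<^bsub>A\<^esub>)"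
    unfolding A.st_entry[OF e z[OF l(2)]] mbase_entry[OF l(1) e] mbase_entry[OF l(1) s] using s l by (cases \<eta>) (simp add: Q0_def)
  qed (use l hm in \<open>auto intro!: A.m_closed simp: mats_entry[OF hm] mats_entry[OF PQm(2)] A.snd_Xi\<close>)
  also have "\<dots> = finsum A (\<lambda>m. ?Q (i, m) \<otimes>\<^bsub>A\<^esub> h (m, l)) Lm"
   by (rule A.finsum_Xi[where \<xi> = "(0, l)"]) (use z l in \<open>simp_all add: mats_entry[OF hm] mats_entry[OF PQm(2)]\<close>)
  also have "\<dots> = mmul A I1 Lm Lm ?Q h (i, l)" using l by (simp only: mmul_entry)
  finally show "mmul A I1 I1 Lm g ?Q (i, l) = mmul A I1 Lm Lm ?Q h (i, l)" .
 qed (use PQm gm hm in simp_all)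
 note s = STA_mats[of t a] PQm gm hm Fm fin2(1) finL finV
 have S: "mbase I2 I1 \<phi> (S1 t a) = mmul A I2 Lm I1 (SA t a) ?P" and T: "mbase I1 I2 \<phi> (T1 t a) = mmul A I1 Lm I2 ?Q (TA t a)"
  unfolding S1_def T1_def by (rule A.cx.mbase_mmul[OF finL ST_mats(1) PQ0_mats(1)] A.cx.mbase_mmul[OF finL PQ0_mats(2) ST_mats(2)])+
 have "mmul A I2 I2 I1 (f A g) (mmul A I2 Lm I1 (SA t a) ?P) = mmul A I2 Lm I1 (mmul A I2 I2 Lm (f A g) (SA t a)) ?P"
  using s by (simp add: A.mmul_assoc)
 then show "mmul A I2 I2 I1 (f A g) (mbase I2 I1 \<phi> (S1 t a)) = mmul A I2 I1 I1 (mbase I2 I1 \<phi> (S1 t a)) g"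
  unfolding S goodD(5)[OF h(2) t, folded h(1)] using s by (simp add: A.mmul_assoc P)
 have "mmul A I1 I1 I2 g (mmul A I1 Lm I2 ?Q (TA t a)) = mmul A I1 Lm I2 (mmul A I1 I1 Lm g ?Q) (TA t a)"
  using s by (simp add: A.mmul_assoc)
 then show "mmul A I1 I2 I2 (mbase I1 I2 \<phi> (T1 t a)) (f A g) = mmul A I1 I1 I2 g (mbase I1 I2 \<phi> (T1 t a))"
  unfolding T Q using s by (simp add: A.mmul_assoc goodD(6)[OF h(2) t, folded h(1)])
qed

end

section \<open>Descent to the rational numbers\<close>

text \<open>If two entries differed, \<open>local_ring_extension\<close> would provide a local ring
  in which their difference is still nonzero.\<close>

lemma local_eqI:
 fixes A :: "complex ring"
 assumes A: "cring A" "U \<in> mats A I J" "W \<in> mats A I J"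
  and eq: "!!(L :: complex ring) be M. cring L ==> be \<in> Ring.ring_hom A L ==> ideal M L ==> \<one>\<^bsub>L\<^esub> \<notin> M ==>
   (!!x. x \<in> carrier L ==> x \<notin> M ==> x \<in> Units L) ==> mbase I J be U = mbase I J be W"
 shows "U = W"
proof (rule mats_eqI[OF A(2,3)])
 fix i j assume ij: "i \<in> I" "j \<in> J"
 interpret A: cring A by (rule A(1))
 note c = mats_entry[OF A(2) ij] mats_entry[OF A(3) ij]
 show "U (i, j) = W (i, j)"
 proof (rule ccontr)
  assume n: "U (i, j) ~= W (i, j)"
  let ?d = "U (i, j) \<ominus>\<^bsub>A\<^esub> W (i, j)"
  have d: "?d \<in> carrier A" "?d ~= \<zero>\<^bsub>A\<^esub>" using c n by (auto simp: A.minus_closed)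
  show False
  proof (rule local_ring_extension[OF A(1) d])
   fix L :: "complex ring" and be M
   assume L: "cring L" "be \<in> Ring.ring_hom A L" "be ?d ~= \<zero>\<^bsub>L\<^esub>" "ideal M L" "\<one>\<^bsub>L\<^esub> \<notin> M" "!!x. x \<in> carrier L ==> x \<notin> M ==> x \<in> Units L"
   interpret h: base_ring_hom A L be by (rule base_ring_homI[OF A(1) L(1,2)])
   have "be (U (i, j)) = be (W (i, j))"
    using fun_cong[OF eq[OF L(1,2,4,5,6)], of "(i, j)"] unfolding mbase_entry[OF ij] .
   then have "be ?d = \<zero>\<^bsub>L\<^esub>" unfolding A.minus_eq using c by (simp add: h.S.r_neg)
   then show False using L(3) by simp
  qed
 qed
qed

context symp_functor
begin

text \<open>Naturality of \<open>f\<close> moves both sides to the local rings over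
  \<open>K\<close>, where \<open>equivariant_local\<close> applies.\<close>

lemma equivariant_complex:
 assumes K: "complex_algebra K \<phi>" and g: "g \<in> carrier (PEL_group D' K)" and t: "t \<in> TH" "a \<in> I2"
 shows "mmul K I2 I2 I1 (f K g) (mbase I2 I1 \<phi> (S1 t a)) = mmul K I2 I1 I1 (mbase I2 I1 \<phi> (S1 t a)) g"
  and "mmul K I1 I2 I2 (mbase I1 I2 \<phi> (T1 t a)) (f K g) = mmul K I1 I1 I2 g (mbase I1 I2 \<phi> (T1 t a))"
proof -
 interpret K: functor_points D' TH bl n cf Q P D f K \<phi> by (rule points[OF K])
 have gm: "g \<in> mats K I1 I1" by (rule K.A.PEL_group_mats[OF g])
 have fm: "f K g \<in> mats K I2 I2" by (rule K.fA_mats[OF g])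
 have STm: "mbase I2 I1 \<phi> (S1 t a) \<in> mats K I2 I1" "mbase I1 I2 \<phi> (T1 t a) \<in> mats K I1 I2" using PQ0_mats(3,4) by simp_all
 have loc: "mbase I2 I1 be (mmul K I2 I2 I1 (f K g) (mbase I2 I1 \<phi> (S1 t a))) = mbase I2 I1 be (mmul K I2 I1 I1 (mbase I2 I1 \<phi> (S1 t a)) g) \<and>
   mbase I1 I2 be (mmul K I1 I2 I2 (mbase I1 I2 \<phi> (T1 t a)) (f K g)) = mbase I1 I2 be (mmul K I1 I1 I2 g (mbase I1 I2 \<phi> (T1 t a)))"
  if L: "cring L" "be \<in> Ring.ring_hom K L" "ideal M L" "\<one>\<^bsub>L\<^esub> \<notin> M" "!!x. x \<in> carrier L ==> x \<notin> M ==> x \<in> Units L"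
  for L :: "complex ring" and be M
 proof -
  have "(\<lambda>c. be (\<phi> c)) \<in> Ring.ring_hom CR L" using ring_hom_trans[OF K.A.phi_hom L(2)] by (simp only: comp_def)
  then have LL: "complex_algebra L (\<lambda>c. be (\<phi> c))" using L(1) by (simp only: complex_algebra_def complex_algebra_axioms_def base_ring_def)
  interpret L: functor_points D' TH bl n cf Q P D f L "\<lambda>c. be (\<phi> c)" by (rule points[OF LL])
  interpret h: base_ring_hom K L be by (rule base_ring_homI[OF K.A.is_cring L(1,2)])
  have g': "mbase I1 I1 be g \<in> carrier (PEL_group D' L)"
   by (rule mbase_group[OF K.A.rat_algebra L.A.rat_algebra L(2) finV finB g])
  have fg: "f L (mbase I1 I1 be g) = mbase I2 I2 be (f K g)" by (rule f_nat[OF L(2) K.A.rat_algebra L.A.rat_algebra g])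
  show ?thesis
   unfolding h.mbase_mmul[OF fin2(1) fm STm(1)] h.mbase_mmul[OF finV STm(1) gm] h.mbase_mmul[OF fin2(1) STm(2) fm] h.mbase_mmul[OF finV gm STm(2)] mbase_mbase comp_def
   using L.equivariant_local[OF L(3,4,5) g' t] unfolding fg by blast
 qed
 show "mmul K I2 I2 I1 (f K g) (mbase I2 I1 \<phi> (S1 t a)) = mmul K I2 I1 I1 (mbase I2 I1 \<phi> (S1 t a)) g"
  by (rule local_eqI[OF K.A.is_cring K.A.mmul_mats[OF fm STm(1)] K.A.mmul_mats[OF STm(1) gm]]) (rule conjunct1[OF loc])
 show "mmul K I1 I2 I2 (mbase I1 I2 \<phi> (T1 t a)) (f K g) = mmul K I1 I1 I2 g (mbase I1 I2 \<phi> (T1 t a))"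
  by (rule local_eqI[OF K.A.is_cring K.A.mmul_mats[OF STm(2) fm] K.A.mmul_mats[OF gm STm(2)]]) (rule conjunct2[OF loc])
qed

text \<open>The point is mapped to \<open>R \<otimes> \<complex>\<close>, where the complex matrices
  are equivariant. Each side is a sum of simple tensors of an element of \<open>R\<close> and an
  entry of the matrix, so \<open>id \<otimes> \<psi>\<close> replaces the entries by their values
  under \<open>\<psi>\<close>.\<close>

lemma equivariant_rational:
 fixes \<psi> :: "complex => rat"
 assumes R: "rat_algebra R" and g: "g \<in> carrier (PEL_group D' R)" and t: "t \<in> TH" "a \<in> I2" and psi: "!!c d. \<psi> (c + d) = \<psi> c + \<psi> d"
 shows "i \<in> I2 ==> j \<in> I1 ==> finsum R (\<lambda>l. f R g (i, l) \<otimes>\<^bsub>R\<^esub> of_rat_alg R (\<psi> (S1 t a (l, j)))) I2 = finsum R (\<lambda>l. of_rat_alg R (\<psi> (S1 t a (i, l))) \<otimes>\<^bsub>R\<^esub> g (l, j)) I1"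
  and "i' \<in> I1 ==> j' \<in> I2 ==> finsum R (\<lambda>l. of_rat_alg R (\<psi> (T1 t a (i', l))) \<otimes>\<^bsub>R\<^esub> f R g (l, j')) I2 = finsum R (\<lambda>l. g (i', l) \<otimes>\<^bsub>R\<^esub> of_rat_alg R (\<psi> (T1 t a (l, j')))) I1"
proof -
 obtain K :: "complex ring" and al \<phi> \<theta> where K: "cring K" "al \<in> Ring.ring_hom R K" "\<phi> \<in> Ring.ring_hom CR K"
  and th: "\<theta> \<in> carrier K \<rightarrow> carrier R" "!!x y. x \<in> carrier K ==> y \<in> carrier K ==> \<theta> (x \<oplus>\<^bsub>K\<^esub> y) = \<theta> x \<oplus>\<^bsub>R\<^esub> \<theta> y"
   "!!r c. r \<in> carrier R ==> \<theta> (al r \<otimes>\<^bsub>K\<^esub> \<phi> c) = r \<otimes>\<^bsub>R\<^esub> of_rat_alg R (\<psi> c)"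
 proof (rule complexification_exists[OF R])
  fix K :: "complex ring" and al \<phi>
  assume K: "cring K" "al \<in> Ring.ring_hom R K" "\<phi> \<in> Ring.ring_hom CR K"
   "!!\<psi> :: complex => rat. (!!c d. \<psi> (c + d) = \<psi> c + \<psi> d) ==> \<exists>\<theta>. \<theta> \<in> carrier K \<rightarrow> carrier R \<and>
   (\<forall>x \<in> carrier K. \<forall>y \<in> carrier K. \<theta> (x \<oplus>\<^bsub>K\<^esub> y) = \<theta> x \<oplus>\<^bsub>R\<^esub> \<theta> y) \<and>
   (\<forall>r \<in> carrier R. \<forall>c. \<theta> (al r \<otimes>\<^bsub>K\<^esub> \<phi> c) = r \<otimes>\<^bsub>R\<^esub> of_rat_alg R (\<psi> c))"
  obtain \<theta> where "\<theta> \<in> carrier K \<rightarrow> carrier R" "\<forall>x \<in> carrier K. \<forall>y \<in> carrier K. \<theta> (x \<oplus>\<^bsub>K\<^esub> y) = \<theta> x \<oplus>\<^bsub>R\<^esub> \<theta> y"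
   "\<forall>r \<in> carrier R. \<forall>c. \<theta> (al r \<otimes>\<^bsub>K\<^esub> \<phi> c) = r \<otimes>\<^bsub>R\<^esub> of_rat_alg R (\<psi> c)" using K(4)[of \<psi>] psi by blast
  then show thesis by (intro that[OF K(1-3)]) blast+
 qed
 have KK: "complex_algebra K \<phi>" using K(1,3) by (simp only: complex_algebra_def complex_algebra_axioms_def base_ring_def)
 interpret K: functor_points D' TH bl n cf Q P D f K \<phi> by (rule points[OF KK])
 interpret R: pel_alg R D' by (rule pel_alg1[OF R])
 interpret h: base_ring_hom R K al by (rule base_ring_homI[OF R.is_cring K(1,2)])
 have gm: "g \<in> mats R I1 I1" by (rule R.PEL_group_mats[OF g])
 have fm: "f R g \<in> mats R I2 I2" by (rule f_mats[OF R g])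
 have gK: "mbase I1 I1 al g \<in> carrier (PEL_group D' K)" by (rule mbase_group[OF R K.A.rat_algebra K(2) finV finB g])
 have fK: "f K (mbase I1 I1 al g) = mbase I2 I2 al (f R g)" by (rule f_nat[OF K(2) R K.A.rat_algebra g])
 have tc: "\<theta> x \<in> carrier R" if "x \<in> carrier K" for x using th(1) that by auto
 have t0: "\<theta> \<zero>\<^bsub>K\<^esub> = \<zero>\<^bsub>R\<^esub>"
 proof -
  have "\<theta> \<zero>\<^bsub>K\<^esub> = \<theta> \<zero>\<^bsub>K\<^esub> \<oplus>\<^bsub>R\<^esub> \<theta> \<zero>\<^bsub>K\<^esub>" using th(2)[of "\<zero>\<^bsub>K\<^esub>" "\<zero>\<^bsub>K\<^esub>"] by simp
  then show ?thesis using tc[of "\<zero>\<^bsub>K\<^esub>"] R.add.r_cancel_one'[of "\<theta> \<zero>\<^bsub>K\<^esub>" "\<theta> \<zero>\<^bsub>K\<^esub>"] by simp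
 qed
 have ts: "\<theta> (finsum K x S) = finsum R (\<lambda>l. \<theta> (x l)) S" if "finite S" "!!l. l \<in> S ==> x l \<in> carrier K" for S :: "'v2 set" and x
  using that
 proof (induction S rule: finite_induct)
  case (insert l S)
  then have "x \<in> S \<rightarrow> carrier K" "x l \<in> carrier K" "(\<lambda>l. \<theta> (x l)) \<in> S \<rightarrow> carrier R" "\<theta> (x l) \<in> carrier R" using tc by auto
  then show ?case using insert by (simp add: th(2) K.A.finsum_closed)
 qed (simp add: t0)
 have ts1: "\<theta> (finsum K x S) = finsum R (\<lambda>l. \<theta> (x l)) S" if "finite S" "!!l. l \<in> S ==> x l \<in> carrier K" for S :: "'v1 set" and x
  using that
 proof (induction S rule: finite_induct)
  case (insert l S)
  then have "x \<in> S \<rightarrow> carrier K" "x l \<in> carrier K" "(\<lambda>l. \<theta> (x l)) \<in> S \<rightarrow> carrier R" "\<theta> (x l) \<in> carrier R" using tc by auto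
  then show ?case using insert by (simp add: th(2) K.A.finsum_closed)
 qed (simp add: t0)
 have th': "\<theta> (\<phi> c \<otimes>\<^bsub>K\<^esub> al r) = of_rat_alg R (\<psi> c) \<otimes>\<^bsub>R\<^esub> r" if "r \<in> carrier R" for r c
  using th(3)[OF that, of c] that by (simp add: K.A.m_comm R.m_comm)
 note gc = mats_entry[OF gm] and fc = mats_entry[OF fm]
 note ec = equivariant_complex[OF KK gK t, unfolded fK]
 show "finsum R (\<lambda>l. f R g (i, l) \<otimes>\<^bsub>R\<^esub> of_rat_alg R (\<psi> (S1 t a (l, j)))) I2 = finsum R (\<lambda>l. of_rat_alg R (\<psi> (S1 t a (i, l))) \<otimes>\<^bsub>R\<^esub> g (l, j)) I1"
  if ij: "i \<in> I2" "j \<in> I1"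
 proof -
  have "finsum K (\<lambda>l. al (f R g (i, l)) \<otimes>\<^bsub>K\<^esub> \<phi> (S1 t a (l, j))) I2 = mmul K I2 I2 I1 (mbase I2 I2 al (f R g)) (mbase I2 I1 \<phi> (S1 t a)) (i, j)"
   using ij by (simp only: mmul_entry) (rule K.A.finsum_cong', auto simp: mbase_entry fc)
  also have "\<dots> = finsum K (\<lambda>l. \<phi> (S1 t a (i, l)) \<otimes>\<^bsub>K\<^esub> al (g (l, j))) I1"
   unfolding ec(1) using ij by (simp only: mmul_entry) (rule K.A.finsum_cong', auto simp: mbase_entry gc)
  finally have "\<theta> (finsum K (\<lambda>l. al (f R g (i, l)) \<otimes>\<^bsub>K\<^esub> \<phi> (S1 t a (l, j))) I2) = \<theta> (finsum K (\<lambda>l. \<phi> (S1 t a (i, l)) \<otimes>\<^bsub>K\<^esub> al (g (l, j))) I1)" by simp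
  moreover have "\<theta> (finsum K (\<lambda>l. al (f R g (i, l)) \<otimes>\<^bsub>K\<^esub> \<phi> (S1 t a (l, j))) I2) = finsum R (\<lambda>l. f R g (i, l) \<otimes>\<^bsub>R\<^esub> of_rat_alg R (\<psi> (S1 t a (l, j)))) I2"
   using ij fc fin2(1) by (subst ts) (auto simp: th(3) intro!: R.finsum_cong')
  moreover have "\<theta> (finsum K (\<lambda>l. \<phi> (S1 t a (i, l)) \<otimes>\<^bsub>K\<^esub> al (g (l, j))) I1) = finsum R (\<lambda>l. of_rat_alg R (\<psi> (S1 t a (i, l))) \<otimes>\<^bsub>R\<^esub> g (l, j)) I1"
   using ij gc by (subst ts1) (auto simp: th' intro!: R.finsum_cong')
  ultimately show ?thesis by simp
 qed
 show "finsum R (\<lambda>l. of_rat_alg R (\<psi> (T1 t a (i', l))) \<otimes>\<^bsub>R\<^esub> f R g (l, j')) I2 = finsum R (\<lambda>l. g (i', l) \<otimes>\<^bsub>R\<^esub> of_rat_alg R (\<psi> (T1 t a (l, j')))) I1"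
  if ij: "i' \<in> I1" "j' \<in> I2"
 proof -
  have "finsum K (\<lambda>l. \<phi> (T1 t a (i', l)) \<otimes>\<^bsub>K\<^esub> al (f R g (l, j'))) I2 = mmul K I1 I2 I2 (mbase I1 I2 \<phi> (T1 t a)) (mbase I2 I2 al (f R g)) (i', j')"
   using ij by (simp only: mmul_entry) (rule K.A.finsum_cong', auto simp: mbase_entry fc)
  also have "\<dots> = finsum K (\<lambda>l. al (g (i', l)) \<otimes>\<^bsub>K\<^esub> \<phi> (T1 t a (l, j'))) I1"
   unfolding ec(2) using ij by (simp only: mmul_entry) (rule K.A.finsum_cong', auto simp: mbase_entry gc)
  finally have "\<theta> (finsum K (\<lambda>l. \<phi> (T1 t a (i', l)) \<otimes>\<^bsub>K\<^esub> al (f R g (l, j'))) I2) = \<theta> (finsum K (\<lambda>l. al (g (i', l)) \<otimes>\<^bsub>K\<^esub> \<phi> (T1 t a (l, j'))) I1)" by simp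
  moreover have "\<theta> (finsum K (\<lambda>l. \<phi> (T1 t a (i', l)) \<otimes>\<^bsub>K\<^esub> al (f R g (l, j'))) I2) = finsum R (\<lambda>l. of_rat_alg R (\<psi> (T1 t a (i', l))) \<otimes>\<^bsub>R\<^esub> f R g (l, j')) I2"
   using ij fc fin2(1) by (subst ts) (auto simp: th' intro!: R.finsum_cong')
  moreover have "\<theta> (finsum K (\<lambda>l. al (g (i', l)) \<otimes>\<^bsub>K\<^esub> \<phi> (T1 t a (l, j'))) I1) = finsum R (\<lambda>l. g (i', l) \<otimes>\<^bsub>R\<^esub> of_rat_alg R (\<psi> (T1 t a (l, j')))) I1"
   using ij gc by (subst ts1) (auto simp: th(3) intro!: R.finsum_cong')
  ultimately show ?thesis by simp
 qed
qed

text \<open>Rational intertwiners are taken from \<open>S1\<close> and \<open>T1\<close> by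
  functionals chosen so that the products still add up to the identity; a basis element
  \<open>h\<close> of \<open>\<complex>\<close> becomes an additional summation index.\<close>

lemma admissible_f: "admissible D' D f"
proof -
 \<comment> \<open>All entries of all the matrices \<open>S1 t a\<close>; finitely many, so finitely
   many basis elements express them.\<close>
 define Z where "Z = (\<lambda>(t, a, p). S1 t a p) ` (TH \<times> I2 \<times> (I2 \<times> I1))"
 have "finite Z" unfolding Z_def using finT fin2(1) finV by simp
 then obtain B :: "complex set" and \<psi> :: "complex => complex => rat" and \<psi>0 :: "complex => rat" where B: "finite B"
  and psi: "!!h c d. \<psi> h (c + d) = \<psi> h c + \<psi> h d" "!!z. z \<in> Z ==> (\<Sum>h\<in>B. of_rat (\<psi> h z) * h) = z"
  and psi0: "!!c d. \<psi>0 (c + d) = \<psi>0 c + \<psi>0 d" "!!q c. \<psi>0 (of_rat q * c) = q * \<psi>0 c" "\<psi>0 1 = 1"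
  by (rule rational_coordinates) blast
 have z0: "\<psi>0 0 = 0" using psi0(2)[of 0 0] by simp
 have s1: "\<psi>0 (\<Sum>x\<in>S. g x) = (\<Sum>x\<in>S. \<psi>0 (g x))" for g and S :: "'t set"
  by (induction S rule: infinite_finite_induct) (simp_all add: z0 psi0(1))
 have s2: "\<psi>0 (\<Sum>x\<in>S. g x) = (\<Sum>x\<in>S. \<psi>0 (g x))" for g and S :: "'v2 set"
  by (induction S rule: infinite_finite_induct) (simp_all add: z0 psi0(1))
 have s3: "\<psi>0 (\<Sum>x\<in>S. g x) = (\<Sum>x\<in>S. \<psi>0 (g x))" for g and S :: "'v1 set"
  by (induction S rule: infinite_finite_induct) (simp_all add: z0 psi0(1))
 have s4: "\<psi>0 (\<Sum>x\<in>S. g x) = (\<Sum>x\<in>S. \<psi>0 (g x))" for g and S :: "complex set"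
  by (induction S rule: infinite_finite_induct) (simp_all add: z0 psi0(1))
 let ?K = "TH \<times> I2 \<times> B"
 have "finite ?K" using finT fin2(1) B by simp
 then obtain e where e: "bij_betw e {..<card ?K} ?K"
  using ex_bij_betw_nat_finite[of ?K] by (auto simp: lessThan_atLeast0)
 have em: "fst (e k) \<in> TH" "fst (snd (e k)) \<in> I2" if "k < card ?K" for k
  using bij_betw_apply[OF e, of k] that by auto
 \<comment> \<open>An index \<open>k\<close> encodes a triple \<open>(t, a, h)\<close>. Only the
   coordinate at \<open>h\<close> of \<open>S1\<close> is kept, and \<open>h\<close> itself is moved
   into \<open>T\<close> before \<open>\<psi>0\<close> is applied.\<close>
 define S where "S k = (\<lambda>p \<in> I2 \<times> I1. \<psi> (snd (snd (e k))) (S1 (fst (e k)) (fst (snd (e k))) p))" for k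
 define T where "T k = (\<lambda>p \<in> I1 \<times> I2. \<psi>0 (snd (snd (e k)) * T1 (fst (e k)) (fst (snd (e k))) p))" for k
 show ?thesis
 proof (rule admissible_pairs[OF finV finB fin2(1)])
  fix k assume "k < card ?K"
  show "S k \<in> mats rat_ring I2 I1" "T k \<in> mats rat_ring I1 I2" by (rule mats_memI; simp add: S_def T_def)+
 next
  fix R :: "complex ring" and g assume R: "rat_algebra R" "g \<in> carrier (PEL_group D' R)"
  show "f R g \<in> mats R I2 I2" by (rule f_mats[OF R])
  interpret R: pel_alg R D' by (rule pel_alg1[OF R(1)])
  note gc = mats_entry[OF R.PEL_group_mats[OF R(2)]] and fc = mats_entry[OF f_mats[OF R]]
  fix k assume k: "k < card ?K"
  have p0: "\<psi>0 (snd (snd (e k)) * (c + d)) = \<psi>0 (snd (snd (e k)) * c) + \<psi>0 (snd (snd (e k)) * d)" for c d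
   by (simp add: distrib_left psi0(1))
  show "finsum R (\<lambda>l. f R g (i, l) \<otimes>\<^bsub>R\<^esub> of_rat_alg R (S k (l, j))) I2 = finsum R (\<lambda>l. of_rat_alg R (S k (i, l)) \<otimes>\<^bsub>R\<^esub> g (l, j)) I1"
   if ij: "i \<in> I2" "j \<in> I1" for i j
  proof -
   have "finsum R (\<lambda>l. f R g (i, l) \<otimes>\<^bsub>R\<^esub> of_rat_alg R (S k (l, j))) I2 = finsum R (\<lambda>l. f R g (i, l) \<otimes>\<^bsub>R\<^esub> of_rat_alg R (\<psi> (snd (snd (e k))) (S1 (fst (e k)) (fst (snd (e k))) (l, j)))) I2"
    using ij fc by (intro R.finsum_cong') (auto simp: S_def)
   also have "\<dots> = finsum R (\<lambda>l. of_rat_alg R (\<psi> (snd (snd (e k))) (S1 (fst (e k)) (fst (snd (e k))) (i, l))) \<otimes>\<^bsub>R\<^esub> g (l, j)) I1"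
    by (rule equivariant_rational(1)[OF R em[OF k] psi(1) ij])
   also have "\<dots> = finsum R (\<lambda>l. of_rat_alg R (S k (i, l)) \<otimes>\<^bsub>R\<^esub> g (l, j)) I1"
    using ij gc by (intro R.finsum_cong') (auto simp: S_def)
   finally show ?thesis .
  qed
  show "finsum R (\<lambda>l. of_rat_alg R (T k (i, l)) \<otimes>\<^bsub>R\<^esub> f R g (l, j)) I2 = finsum R (\<lambda>l. g (i, l) \<otimes>\<^bsub>R\<^esub> of_rat_alg R (T k (l, j))) I1"
   if ij: "i \<in> I1" "j \<in> I2" for i j
  proof -
   have "finsum R (\<lambda>l. of_rat_alg R (T k (i, l)) \<otimes>\<^bsub>R\<^esub> f R g (l, j)) I2 = finsum R (\<lambda>l. of_rat_alg R (\<psi>0 (snd (snd (e k)) * T1 (fst (e k)) (fst (snd (e k))) (i, l))) \<otimes>\<^bsub>R\<^esub> f R g (l, j)) I2"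
    using ij fc by (intro R.finsum_cong') (auto simp: T_def)
   also have "\<dots> = finsum R (\<lambda>l. g (i, l) \<otimes>\<^bsub>R\<^esub> of_rat_alg R (\<psi>0 (snd (snd (e k)) * T1 (fst (e k)) (fst (snd (e k))) (l, j)))) I1"
    by (rule equivariant_rational(2)[OF R em[OF k] p0 ij])
   also have "\<dots> = finsum R (\<lambda>l. g (i, l) \<otimes>\<^bsub>R\<^esub> of_rat_alg R (T k (l, j))) I1"
    using ij gc by (intro R.finsum_cong') (auto simp: T_def)
   finally show ?thesis .
  qed
 next
  fix i j assume ij: "i \<in> I2" "j \<in> I2"
  have gen: "(\<Sum>(t, a, h)\<in>?K. G t a h) = (\<Sum>t\<in>TH. \<Sum>a\<in>I2. \<Sum>h\<in>B. G t a h)" for G :: "'t => 'v2 => complex => rat"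
   by (simp add: sum.cartesian_product split_def)
  have "(\<Sum>k<card ?K. \<Sum>l\<in>I1. S k (i, l) * T k (l, j)) =
   (\<Sum>k<card ?K. (\<lambda>(t, a, h). \<Sum>l\<in>I1. \<psi> h (S1 t a (i, l)) * \<psi>0 (h * T1 t a (l, j))) (e k))"
   by (intro sum.cong refl) (use ij in \<open>simp add: S_def T_def split_def\<close>)
  also have "\<dots> = (\<Sum>(t, a, h)\<in>?K. \<Sum>l\<in>I1. \<psi> h (S1 t a (i, l)) * \<psi>0 (h * T1 t a (l, j)))"
   by (rule sum.reindex_bij_betw[OF e])
  also have "\<dots> = (\<Sum>t\<in>TH. \<Sum>a\<in>I2. \<Sum>h\<in>B. \<Sum>l\<in>I1. \<psi> h (S1 t a (i, l)) * \<psi>0 (h * T1 t a (l, j)))"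
   by (rule gen)
  also have "\<dots> = (\<Sum>t\<in>TH. \<Sum>a\<in>I2. \<Sum>l\<in>I1. \<psi>0 (S1 t a (i, l) * T1 t a (l, j)))"
  proof (intro sum.cong refl)
   fix t a assume ta: "t \<in> TH" "a \<in> I2"
   have "(\<Sum>h\<in>B. \<Sum>l\<in>I1. \<psi> h (S1 t a (i, l)) * \<psi>0 (h * T1 t a (l, j))) = (\<Sum>l\<in>I1. \<Sum>h\<in>B. \<psi> h (S1 t a (i, l)) * \<psi>0 (h * T1 t a (l, j)))"
    by (rule sum.swap)
   also have "\<dots> = (\<Sum>l\<in>I1. \<psi>0 (S1 t a (i, l) * T1 t a (l, j)))"
   proof (rule sum.cong[OF refl])
    fix l assume l: "l \<in> I1"
    have "S1 t a (i, l) \<in> Z" unfolding Z_def using ta ij l by (intro image_eqI[of _ _ "(t, a, (i, l))"]) auto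
    note z = psi(2)[OF this]
    \<comment> \<open>Rational linearity lets \<open>\<psi>0\<close> absorb the coordinates, and the
      sum over \<open>h\<close> reassembles the entry of \<open>S1\<close>; the product relation
      over \<open>\<complex>\<close> thereby becomes one over \<open>\<rat>\<close>.\<close>
    have "(\<Sum>h\<in>B. \<psi> h (S1 t a (i, l)) * \<psi>0 (h * T1 t a (l, j))) = \<psi>0 (\<Sum>h\<in>B. of_rat (\<psi> h (S1 t a (i, l))) * (h * T1 t a (l, j)))"
     by (simp add: s4 psi0(2))
    also have "(\<Sum>h\<in>B. of_rat (\<psi> h (S1 t a (i, l))) * (h * T1 t a (l, j))) = (\<Sum>h\<in>B. of_rat (\<psi> h (S1 t a (i, l))) * h) * T1 t a (l, j)"
     by (simp add: sum_distrib_right mult.assoc)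
    finally show "(\<Sum>h\<in>B. \<psi> h (S1 t a (i, l)) * \<psi>0 (h * T1 t a (l, j))) = \<psi>0 (S1 t a (i, l) * T1 t a (l, j))" unfolding z .
   qed
   finally show "(\<Sum>h\<in>B. \<Sum>l\<in>I1. \<psi> h (S1 t a (i, l)) * \<psi>0 (h * T1 t a (l, j))) = (\<Sum>l\<in>I1. \<psi>0 (S1 t a (i, l) * T1 t a (l, j)))" .
  qed
  also have "\<dots> = \<psi>0 (\<Sum>t\<in>TH. \<Sum>a\<in>I2. \<Sum>l\<in>I1. S1 t a (i, l) * T1 t a (l, j))" by (simp add: s1 s2 s3)
  also have "\<dots> = (if i = j then 1 else 0)" unfolding S1_T1[OF ij] by (simp add: z0 psi0(3))
  finally show "(\<Sum>k<card ?K. \<Sum>l\<in>I1. S k (i, l) * T k (l, j)) = (if i = j then 1 else 0)" .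
 qed
qed

end

theorem corollary11p3:
  fixes D' :: "('b1::ring, 'v1::ab_group_add) pel"
    and D :: "('b2::ring, 'v2::ab_group_add) pel"
    and f :: "complex ring \<Rightarrow> ('v1 \<times> 'v1 \<Rightarrow> complex) \<Rightarrow> ('v2 \<times> 'v2 \<Rightarrow> complex)"
  assumes "PEL_datum D'" and "symplectic_type D'"
    and "PEL_datum D"
    and "shimura_morphism D' D f"
  shows "admissible D' D f"
proof -
  obtain \<Theta> :: "('v1 \<Rightarrow> real) set" and bl n cf Q P where "normal_form D' \<Theta> bl n cf Q P"
    using symplectic_normal_form[OF assms(1,2)] .
  then have "symp_functor D' \<Theta> bl n cf Q P D f"
    using assms by (intro symp_functor.intro symp_functor_axioms.intro)
  then show ?thesis by (rule symp_functor.admissible_f)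
qed

end
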